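(* Let $\vec\Phi\in\mathcal E(D^2,\mathbb R^3)$ be a weak conformal immersion, $\lambda=\log|\partial_{x_1}\vec\Phi|=\log|\partial_{x_2}\vec\Phi|$ its conformal factor and $\vec e=(\vec e_1,\vec e_2)=e^{-\lambda}(\partial_{x_1}\vec\Phi,\partial_{x_2}\vec\Phi)$ the associated orthonormal frame. Then, for any smooth perturbation $\vec w\in C^\infty_c(\mathbb R^3,\mathbb R^3)$ with $\vec w|_{\vec\Phi(\partial D^2)}=0$, letting $\vec\Phi_t(x):=\vec\Phi(x)+t\,\vec w(\vec\Phi(x))\in\mathcal E(D^2,\mathbb R^3)$ be the perturbed weak immersion, with unit normal $\vec n_t$ and induced metric $g_t=\vec\Phi_t^*g_{\mathbb R^3}$, and $\vec e_t=(\vec e_{1,t},\vec e_{2,t})$ the associated moving frame $$\vec e_{1,t}:=\vec e_2\times\vec n_t=\vec e_1+t\,e^{-\lambda}(\partial_{x_1}\vec w,\vec n)\,\vec n+o(t),\qquad \vec e_{2,t}:=-\vec e_{1,t}\times\vec n_t=\vec e_2+t\,e^{-\lambda}(\partial_{x_2}\vec w,\vec n)\,\vec n+o(t),$$ one has $$\frac{d}{dt}\mathcal F_T(\vec\Phi_t,\vec e_t)(0):=\frac{d}{dt}\left[\frac12\int_{D^2}|\vec e_{2,t}\cdot d\vec e_{1,t}|_{g_t}^2\,dvol_{g_t}\right](0)$$ $$=\int_{D^2}\Big(\vec w,\ d\big[\vec{\mathbb I}\llcorner_g(\vec e_2,d\vec e_1)\big]+d\ast_g\Big[\big[(\vec e_2,d\vec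 e_1)\otimes(\vec e_2,d\vec e_1)-2^{-1}|\vec e_2\cdot d\vec e_1|_g^2\,g\big]\llcorner_g d\vec\Phi\Big]\Big)$$ $$=\int_{D^2}\Big(\vec w,\ \operatorname{div}\Big[-\vec{\mathbb I}\llcorner_g(\vec e_2,\nabla^\perp\vec e_1)-(\vec e_2,\nabla^\perp\vec e_1)\,\big\langle(\vec e_2,\nabla\vec e_1),\nabla\vec\Phi\big\rangle_g+\tfrac12\,|(\vec e_2,\nabla\vec e_1)|_g^2\,\nabla^\perp\vec\Phi\Big]\Big)\,dx .$$
   Context: $D^2$ is the unit disc with coordinates $(x_1,x_2)$. $\mathcal E(D^2,\mathbb R^3)$ is the space of weak immersions: maps $\vec\Phi\in W^{1,\infty}(D^2,\mathbb R^3)$ whose pullback metric $g=\vec\Phi^*g_{\mathbb R^3}$ is equivalent to a smooth reference metric (two-sided bound as quadratic forms) and whose unit normal $\vec n=\frac{\partial_{x_1}\vec\Phi\times\partial_{x_2}\vec\Phi}{|\partial_{x_1}\vec\Phi\times\partial_{x_2}\vec\Phi|}$ lies in $W^{1,2}$. Weak conformal means in addition that $|\partial_{x_1}\vec\Phi|=|\partial_{x_2}\vec\Phi|=e^\lambda$ and $\partial_{x_1}\vec\Phi\cdot\partial_{x_2}\vec\Phi=0$ a.e., so $g=e^{2\lambda}(dx_1^2+dx_2^2)$. The tangential frame energy of a frame $\vec e$ along $\vec\Phi$ is $\mathcal F_T(\vec\Phi,\vec e)=\frac12\int|\vec e_1\cdot d\vec e_2|_g^2\,dvol_g$. Notation: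 $(\cdot,\cdot)$ and $\cdot$ both denote the Euclidean scalar product in $\mathbb R^3$; $\vec w$ and its derivatives $\partial_{x_i}\vec w$ are taken along $\vec\Phi$. $\vec{\mathbb I}_{ij}=\pi_{\vec n}(\partial^2_{x_ix_j}\vec\Phi)$ is the second fundamental form, with $\pi_{\vec n}$ the orthogonal projection on the normal line. $\llcorner_g$ denotes contraction with respect to $g$: for a one-form $\beta$ (with components $\beta_i$, identified with a vector field), $(\vec{\mathbb I}\llcorner_g\beta)_j=e^{-2\lambda}\sum_i\vec{\mathbb I}_{ji}\beta_i$, and for a 2-tensor $T$, $(T\llcorner_g d\vec\Phi)_j=e^{-2\lambda}\sum_iT_{ji}\partial_{x_i}\vec\Phi$. $\langle\cdot,\cdot\rangle_g$ and $|\cdot|_g$ are the scalar product and norm in $(D^2,g)$, so $\langle(\vec e_2,\nabla\vec e_1),\nabla\vec\Phi\rangle_g=e^{-2\lambda}\sum_i(\vec e_2,\partial_{x_i}\vec e_1)\,\partial_{x_i}\vec\Phi$ and $|(\vec e_2,\nabla\vec e_1)|_g^2=|\vec e_2\cdot d\vec e_1|_g^2=e^{-2\lambda}\sum_i(\vec e_2,\partial_{x_i}\vec e_1)^2$. $d$ is the Cartan differential, $\ast_g$ the Hodge duality with respect to $g$, $\operatorname{div}$ and $\nabla$ are the divergence and gradient in $\mathbb R^2$ with the Euclidean metric, and $\nabla^\perp=(-\partial_{x_2},\partial_{x_1})$.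
   Formalization: The last line is false as printed (sphere patch); its bracket is replaced by the divergence form of the line above: −(II⌞ω)^⊥ + ω⟨ω,∇Φ⟩ − ½|ω|²∇Φ, ω=(e_2,∇e_1). The frame energy F_T(Φ,e) is assumed finite, so that its derivative has a meaning; Φ_t is an immersion for small |t|. *)

theory Defs
  imports "HOL-Analysis.Analysis"
begin

section \<open>Smooth functions\<close>

primrec C_k :: "nat \<Rightarrow> ('a::euclidean_space \<Rightarrow> 'b::real_normed_vector) \<Rightarrow> bool" where
  "C_k 0 f \<longleftrightarrow> continuous_on UNIV f"
| "C_k (Suc k) f \<longleftrightarrow>
     (\<forall>x. f differentiable (at x)) \<and> (\<forall>v. C_k k (\<lambda>x. frechet_derivative f (at x) v))"

definition smooth :: "('a::euclidean_space \<Rightarrow> 'b::real_normed_vector) \<Rightarrow> bool" where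
  "smooth f \<longleftrightarrow> (\<forall>k. C_k k f)"

definition fun_support :: "('a::topological_space \<Rightarrow> 'b::zero) \<Rightarrow> 'a set" where
  "fun_support f = closure {x. f x \<noteq> 0}"


section \<open>Sobolev functions on the unit disc\<close>

abbreviation disc :: "(real^2) set" where
  "disc \<equiv> ball 0 1"

abbreviation disc_measure :: "(real^2) measure" where
  "disc_measure \<equiv> lebesgue_on disc"

definition test_function :: "(real^2 \<Rightarrow> 'b::real_normed_vector) \<Rightarrow> bool" where
  "test_function \<phi> \<longleftrightarrow> smooth \<phi> \<and> compact (fun_support \<phi>) \<and> fun_support \<phi> \<subseteq> disc"

definition cpd :: "2 \<Rightarrow> (real^2 \<Rightarrow> 'b::real_normed_vector) \<Rightarrow> real^2 \<Rightarrow> 'b" where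
  "cpd i \<phi> x = frechet_derivative \<phi> (at x) (axis i 1)"

definition locally_integrable :: "(real^2 \<Rightarrow> 'b::euclidean_space) \<Rightarrow> bool" where
  "locally_integrable u \<longleftrightarrow> (\<forall>K. compact K \<and> K \<subseteq> disc \<longrightarrow> u absolutely_integrable_on K)"

definition weak_partial ::
  "2 \<Rightarrow> (real^2 \<Rightarrow> 'b::euclidean_space) \<Rightarrow> (real^2 \<Rightarrow> 'b) \<Rightarrow> bool" where
  "weak_partial i u v \<longleftrightarrow> locally_integrable u \<and> locally_integrable v \<and>
     (\<forall>\<phi> :: real^2 \<Rightarrow> real. test_function \<phi> \<longrightarrow>
        (LINT x|disc_measure. cpd i \<phi> x *\<^sub>R u x)
          = - (LINT x|disc_measure. \<phi> x *\<^sub>R v x))"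

definition weakly_differentiable :: "(real^2 \<Rightarrow> 'b::euclidean_space) \<Rightarrow> bool" where
  "weakly_differentiable u \<longleftrightarrow> (\<forall>i. \<exists>v. weak_partial i u v)"

text \<open>A representative of the weak derivative, which is unique up to null sets; it is
  unspecified if \<open>u\<close> has no weak derivative in the given direction.\<close>

definition pd :: "2 \<Rightarrow> (real^2 \<Rightarrow> 'b::euclidean_space) \<Rightarrow> real^2 \<Rightarrow> 'b" where
  "pd i u = (SOME v. weak_partial i u v)"

definition L_inf :: "(real^2 \<Rightarrow> 'b::euclidean_space) \<Rightarrow> bool" where
  "L_inf u \<longleftrightarrow> u \<in> borel_measurable disc_measure \<and> (\<exists>C. AE x in disc_measure. norm (u x) \<le> C)"

definition L_two :: "(real^2 \<Rightarrow> 'b::euclidean_space) \<Rightarrow> bool" where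
  "L_two u \<longleftrightarrow> u \<in> borel_measurable disc_measure \<and> integrable disc_measure (\<lambda>x. (norm (u x))\<^sup>2)"

definition W_1_inf :: "(real^2 \<Rightarrow> 'b::euclidean_space) \<Rightarrow> bool" where
  "W_1_inf u \<longleftrightarrow> L_inf u \<and> (\<forall>i. \<exists>v. weak_partial i u v \<and> L_inf v)"

definition W_1_2 :: "(real^2 \<Rightarrow> 'b::euclidean_space) \<Rightarrow> bool" where
  "W_1_2 u \<longleftrightarrow> L_two u \<and> (\<forall>i. \<exists>v. weak_partial i u v \<and> L_two v)"


section \<open>Weak immersions of the disc\<close>

definition pullback_metric :: "(real^2 \<Rightarrow> real^3) \<Rightarrow> real^2 \<Rightarrow> real^2^2" where
  "pullback_metric \<Phi> x = (\<chi> i j. pd i \<Phi> x \<bullet> pd j \<Phi> x)"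

definition unit_normal :: "(real^2 \<Rightarrow> real^3) \<Rightarrow> real^2 \<Rightarrow> real^3" where
  "unit_normal \<Phi> x =
     (let N = cross3 (pd 1 \<Phi> x) (pd 2 \<Phi> x) in (1 / norm N) *\<^sub>R N)"

text \<open>The smooth reference metric is the flat one; any other metric that is smooth up to the
  boundary gives the same class. A map in \<open>W\<^sup>1\<^sup>,\<^sup>\<infinity>\<close> of the disc has a representative that is
  continuous up to the boundary; that representative is used, since the values of
  \<open>\<Phi>\<close> on the boundary circle are needed.\<close>

definition weak_immersion :: "(real^2 \<Rightarrow> real^3) \<Rightarrow> bool" where
  "weak_immersion \<Phi> \<longleftrightarrow>
     continuous_on (cball 0 1) \<Phi> \<and> W_1_inf \<Phi> \<and>
     (\<exists>C>0. AE x in disc_measure. \<forall>v.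
        (1 / C) * (v \<bullet> v) \<le> v \<bullet> (pullback_metric \<Phi> x *v v) \<and>
        v \<bullet> (pullback_metric \<Phi> x *v v) \<le> C * (v \<bullet> v)) \<and>
     W_1_2 (unit_normal \<Phi>)"

definition weak_conformal_immersion :: "(real^2 \<Rightarrow> real^3) \<Rightarrow> bool" where
  "weak_conformal_immersion \<Phi> \<longleftrightarrow>
     weak_immersion \<Phi> \<and>
     (AE x in disc_measure. norm (pd 1 \<Phi> x) = norm (pd 2 \<Phi> x) \<and> pd 1 \<Phi> x \<bullet> pd 2 \<Phi> x = 0)"

definition conformal_factor :: "(real^2 \<Rightarrow> real^3) \<Rightarrow> real^2 \<Rightarrow> real" where
  "conformal_factor \<Phi> x = ln (norm (pd 1 \<Phi> x))"

definition coord_frame :: "2 \<Rightarrow> (real^2 \<Rightarrow> real^3) \<Rightarrow> real^2 \<Rightarrow> real^3" where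
  "coord_frame i \<Phi> x = exp (- conformal_factor \<Phi> x) *\<^sub>R pd i \<Phi> x"


section \<open>One-forms and the tangential frame energy\<close>

text \<open>A one-form is represented pointwise by the vector of its two components, of type
  \<open>real^2\<close> for scalar forms and \<open>real^3^2\<close> for forms with values in \<open>\<real>\<^sup>3\<close>.
  The gradient of a map and its differential have the same components.\<close>

definition grad :: "(real^2 \<Rightarrow> real^3) \<Rightarrow> real^2 \<Rightarrow> real^3^2" where
  "grad u x = (\<chi> i. pd i u x)"

text \<open>The form \<open>a \<cdot> db\<close>.\<close>

definition dot_d :: "(real^2 \<Rightarrow> real^3) \<Rightarrow> (real^2 \<Rightarrow> real^3) \<Rightarrow> real^2 \<Rightarrow> real^2" where
  "dot_d a b x = (\<chi> i. a x \<bullet> pd i b x)"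

definition form_norm_sq :: "real^2^2 \<Rightarrow> real^2 \<Rightarrow> real" where
  "form_norm_sq G \<alpha> = \<alpha> \<bullet> (matrix_inv G *v \<alpha>)"

text \<open>The density of \<open>|a \<cdot> db|\<^sup>2 dvol\<close> for the metric induced by \<open>\<Phi>\<close>, relative to \<open>dx\<close>.\<close>

definition connection_density ::
  "(real^2 \<Rightarrow> real^3) \<Rightarrow> (real^2 \<Rightarrow> real^3) \<Rightarrow> (real^2 \<Rightarrow> real^3) \<Rightarrow> real^2 \<Rightarrow> real" where
  "connection_density \<Phi> a b x =
     form_norm_sq (pullback_metric \<Phi> x) (dot_d a b x) * sqrt (det (pullback_metric \<Phi> x))"

definition connection_energy ::
  "(real^2 \<Rightarrow> real^3) \<Rightarrow> (real^2 \<Rightarrow> real^3) \<Rightarrow> (real^2 \<Rightarrow> real^3) \<Rightarrow> real" where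
  "connection_energy \<Phi> a b = 1/2 * (LINT x|disc_measure. connection_density \<Phi> a b x)"

definition tangential_frame_energy ::
  "(real^2 \<Rightarrow> real^3) \<Rightarrow> (real^2 \<Rightarrow> real^3) \<Rightarrow> (real^2 \<Rightarrow> real^3) \<Rightarrow> real" where
  "tangential_frame_energy \<Phi> e1 e2 = connection_energy \<Phi> e1 e2"

text \<open>The Bochner integral is \<open>0\<close> for functions that are not integrable, so that finiteness of
  the energy has to be expressed separately.\<close>

definition finite_frame_energy ::
  "(real^2 \<Rightarrow> real^3) \<Rightarrow> (real^2 \<Rightarrow> real^3) \<Rightarrow> (real^2 \<Rightarrow> real^3) \<Rightarrow> bool" where
  "finite_frame_energy \<Phi> e1 e2 \<longleftrightarrow>
     weakly_differentiable e1 \<and> weakly_differentiable e2 \<and>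
     integrable disc_measure (connection_density \<Phi> e1 e2)"


section \<open>Perturbations\<close>

definition perturbed ::
  "(real^2 \<Rightarrow> real^3) \<Rightarrow> (real^3 \<Rightarrow> real^3) \<Rightarrow> real \<Rightarrow> real^2 \<Rightarrow> real^3" where
  "perturbed \<Phi> w t x = \<Phi> x + t *\<^sub>R w (\<Phi> x)"

definition perturbed_frame_1 ::
  "(real^2 \<Rightarrow> real^3) \<Rightarrow> (real^3 \<Rightarrow> real^3) \<Rightarrow> real \<Rightarrow> real^2 \<Rightarrow> real^3" where
  "perturbed_frame_1 \<Phi> w t x = cross3 (coord_frame 2 \<Phi> x) (unit_normal (perturbed \<Phi> w t) x)"

definition perturbed_frame_2 ::
  "(real^2 \<Rightarrow> real^3) \<Rightarrow> (real^3 \<Rightarrow> real^3) \<Rightarrow> real \<Rightarrow> real^2 \<Rightarrow> real^3" where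
  "perturbed_frame_2 \<Phi> w t x =
     - cross3 (perturbed_frame_1 \<Phi> w t x) (unit_normal (perturbed \<Phi> w t) x)"

definition perturbed_frame ::
  "2 \<Rightarrow> (real^2 \<Rightarrow> real^3) \<Rightarrow> (real^3 \<Rightarrow> real^3) \<Rightarrow> real \<Rightarrow> real^2 \<Rightarrow> real^3" where
  "perturbed_frame i \<Phi> w t =
     (if i = 1 then perturbed_frame_1 \<Phi> w t else perturbed_frame_2 \<Phi> w t)"


section \<open>Contractions, Hodge star, divergence and exterior derivative\<close>

definition second_form :: "(real^2 \<Rightarrow> real^3) \<Rightarrow> real^2 \<Rightarrow> 2 \<Rightarrow> 2 \<Rightarrow> real^3" where
  "second_form \<Phi> x i j =
     (unit_normal \<Phi> x \<bullet> pd i (pd j \<Phi>) x) *\<^sub>R unit_normal \<Phi> x"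

definition contract_second_form ::
  "(real^2 \<Rightarrow> real^3) \<Rightarrow> real^2 \<Rightarrow> real^2 \<Rightarrow> real^3^2" where
  "contract_second_form \<Phi> x \<beta> =
     (\<chi> j. exp (- 2 * conformal_factor \<Phi> x) *\<^sub>R (\<Sum>i\<in>UNIV. \<beta> $ i *\<^sub>R second_form \<Phi> x j i))"

definition contract_d :: "(real^2 \<Rightarrow> real^3) \<Rightarrow> real^2 \<Rightarrow> real^2^2 \<Rightarrow> real^3^2" where
  "contract_d \<Phi> x T =
     (\<chi> j. exp (- 2 * conformal_factor \<Phi> x) *\<^sub>R (\<Sum>i\<in>UNIV. T $ j $ i *\<^sub>R pd i \<Phi> x))"

text \<open>The scalar product \<open>\<langle>\<beta>, \<nabla>\<Phi>\<rangle>\<close> in the conformal metric.\<close>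

definition inner_grad :: "(real^2 \<Rightarrow> real^3) \<Rightarrow> real^2 \<Rightarrow> real^2 \<Rightarrow> real^3" where
  "inner_grad \<Phi> x \<beta> =
     exp (- 2 * conformal_factor \<Phi> x) *\<^sub>R (\<Sum>i\<in>UNIV. \<beta> $ i *\<^sub>R pd i \<Phi> x)"

definition stress_tensor :: "real^2^2 \<Rightarrow> real^2 \<Rightarrow> real^2^2" where
  "stress_tensor G \<alpha> = (\<chi> i j. \<alpha> $ i * \<alpha> $ j - 1/2 * form_norm_sq G \<alpha> * G $ i $ j)"

text \<open>Rotation of the components, so that \<open>\<nabla>\<^sup>\<bottom> u = perp (\<nabla>u) = (- \<partial>\<^sub>2 u, \<partial>\<^sub>1 u)\<close>.\<close>

definition perp :: "real^3^2 \<Rightarrow> real^3^2" where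
  "perp \<beta> = vector [- (\<beta> $ 2), \<beta> $ 1]"

text \<open>For a metric \<open>G\<close> and the orientation \<open>dx\<^sub>1 \<and> dx\<^sub>2\<close>, the Hodge star of \<open>\<beta>\<close> is the contraction
  of the volume form \<open>sqrt (det G) dx\<^sub>1 \<and> dx\<^sub>2\<close> with the vector field dual to \<open>\<beta>\<close>. In particular
  \<open>* dx\<^sub>1 = dx\<^sub>2\<close> and \<open>* dx\<^sub>2 = - dx\<^sub>1\<close> if \<open>G\<close> is conformal.\<close>

definition hodge_star :: "real^2^2 \<Rightarrow> real^3^2 \<Rightarrow> real^3^2" where
  "hodge_star G \<beta> =
     sqrt (det G) *\<^sub>R perp (\<chi> i. \<Sum>k\<in>UNIV. matrix_inv G $ i $ k *\<^sub>R \<beta> $ k)"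

definition L_one :: "(real^2 \<Rightarrow> real^3^2) \<Rightarrow> bool" where
  "L_one X \<longleftrightarrow> integrable disc_measure X"

text \<open>The distributions \<open>div X\<close> and \<open>d \<beta> = (\<partial>\<^sub>1 \<beta>\<^sub>2 - \<partial>\<^sub>2 \<beta>\<^sub>1) dx\<^sub>1 \<and> dx\<^sub>2\<close>, for integrable
  \<open>X\<close> and \<open>\<beta>\<close>.\<close>

definition distr_div :: "(real^2 \<Rightarrow> real^3^2) \<Rightarrow> (real^2 \<Rightarrow> real^3) \<Rightarrow> real" where
  "distr_div X \<phi> = - (LINT x|disc_measure. (\<Sum>i\<in>UNIV. cpd i \<phi> x \<bullet> X x $ i))"

definition distr_d :: "(real^2 \<Rightarrow> real^3^2) \<Rightarrow> (real^2 \<Rightarrow> real^3) \<Rightarrow> real" where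
  "distr_d \<beta> \<phi> = - (LINT x|disc_measure. (cpd 1 \<phi> x \<bullet> \<beta> x $ 2 - cpd 2 \<phi> x \<bullet> \<beta> x $ 1))"

definition approximates :: "(nat \<Rightarrow> real^2 \<Rightarrow> real^3) \<Rightarrow> (real^2 \<Rightarrow> real^3) \<Rightarrow> bool" where
  "approximates \<phi> f \<longleftrightarrow>
     (\<forall>k. test_function (\<phi> k)) \<and>
     uniform_limit disc \<phi> f sequentially \<and>
     (\<exists>C. \<forall>k i x. norm (cpd i (\<phi> k) x) \<le> C) \<and>
     (\<forall>i. AE x in disc_measure. (\<lambda>k. cpd i (\<phi> k) x) \<longlonglongrightarrow> pd i f x)"

text \<open>The pairing of a distribution \<open>T\<close>, such as the divergence of an integrable field, with a
  function \<open>f \<in> W\<^sup>1\<^sup>,\<^sup>\<infinity>\<close> vanishing on the boundary circle, written formally as the integral of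
  \<open>(f, T)\<close>. Such \<open>f\<close> are limits of test functions in the sense of \<open>approximates\<close>.\<close>

definition pairing :: "(real^2 \<Rightarrow> real^3) \<Rightarrow> ((real^2 \<Rightarrow> real^3) \<Rightarrow> real) \<Rightarrow> real" where
  "pairing f T = (THE L. \<forall>\<phi>. approximates \<phi> f \<longrightarrow> (\<lambda>k. T (\<phi> k)) \<longlonglongrightarrow> L)"


section \<open>The two forms of the first variation\<close>

definition variation_form :: "(real^2 \<Rightarrow> real^3) \<Rightarrow> real^2 \<Rightarrow> real^3^2" where
  "variation_form \<Phi> x =
     (let G = pullback_metric \<Phi> x;
          \<omega> = dot_d (coord_frame 2 \<Phi>) (coord_frame 1 \<Phi>) x
      in contract_second_form \<Phi> x \<omega> + hodge_star G (contract_d \<Phi> x (stress_tensor G \<omega>)))"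

text \<open>With \<open>\<tau>\<close> the contracted stress tensor, the field below is \<open>- perp (II \<omega>) + \<tau>\<close>, as
  dictated by \<open>d \<beta> = - div (perp \<beta>)\<close> and \<open>d * \<tau> = div \<tau>\<close>: the rotation acts on the free index of
  the second fundamental form, and the last two terms are not rotated.\<close>

definition variation_field :: "(real^2 \<Rightarrow> real^3) \<Rightarrow> real^2 \<Rightarrow> real^3^2" where
  "variation_field \<Phi> x =
     (let G = pullback_metric \<Phi> x;
          \<omega> = dot_d (coord_frame 2 \<Phi>) (coord_frame 1 \<Phi>) x
      in - perp (contract_second_form \<Phi> x \<omega>) + (\<chi> j. \<omega> $ j *\<^sub>R inner_grad \<Phi> x \<omega>)
         - (1/2 * form_norm_sq G \<omega>) *\<^sub>R grad \<Phi> x)"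

end

theory Submission
  imports Defs "HOL-Real_Asymp.Real_Asymp"
begin

text \<open>Write \<open>c\<^sub>i = Dw(e\<^sub>i)\<close>. The cross product of the derivatives of \<open>\<Phi>\<^sub>t\<close>, divided by \<open>e\<^sup>2\<^sup>\<lambda>\<close>, is a polynomial
  \<open>n + t b\<^sub>1 + t\<^sup>2 b\<^sub>2\<close> in \<open>t\<close> whose coefficients are bounded and have square integrable derivatives.
  Normalising it gives \<open>n\<^sub>t\<close> and the perturbed frame. The energy density is conformally invariant;
  it is therefore an expression in \<open>e\<^sub>i\<close>, \<open>c\<^sub>i\<close>, \<open>n\<close> and the derivatives of \<open>e\<^sub>i\<close>, \<open>n\<close>, \<open>b\<^sub>i\<close>, and quadratic in
  the latter. Its first order expansion in \<open>t\<close> thus has an integrable remainder, and the energy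
  can be differentiated under the integral sign.

  To identify the derivative with \<open>- \<integral> \<partial>\<^sub>i w \<cdot> X\<^sub>i\<close> for the field \<open>X\<close> of the statement one needs the symmetry
  of the second fundamental form. It is not available pointwise, since \<open>\<Phi>\<close> has no second
  derivatives a priori. Testing the commutation of the weak derivatives of \<open>\<Phi>\<close> with \<open>\<phi> e\<^sub>k\<close>, however,
  shows that \<open>e\<^sup>\<lambda>\<close> is weakly differentiable; hence so are \<open>\<partial>\<^sub>i \<Phi> = e\<^sup>\<lambda> e\<^sub>i\<close>, and their derivatives commute.
  Finally, \<open>w \<circ> \<Phi>\<close> is Lipschitz and
  vanishes on the boundary circle, so that cutting it off near the circle and mollifying gives
  the test functions in which the pairing is computed.\<close>

section \<open>Calculus of smooth functions\<close>

text \<open>The derivative of the frame is controlled by two separate inputs. Its component along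
  the normal is given by the derivative of \<open>n\<close>, which is in L^2 by hypothesis; its
  tangential component is the connection form, which is in L^2 because the frame energy is assumed
  finite. Products of several such objects occur, so each factor carries a degree counting
  derivatives, and degree two is the most that integration permits. All dependence on t is built
  from bilinear operations and one inverse square root; the expansion therefore follows from closure
  rules with a remainder of order t^2. The o(t) expansion of the frame is the case of degree zero,
  where the remainder is uniform almost everywhere. The derivative of \<open>b1\<close>, and with it
  the derivatives of the coefficients c_i, disappears at first order because the function
  multiplying it vanishes at t = 0; only the connection form and the second fundamental form
  survive.\<close>

lemma C_k_SucI:
  assumes "\<And>x. (f has_derivative f' x) (at x)" and "\<And>v. C_k k (\<lambda>x. f' x v)"
  shows "C_k (Suc k) f"
proof -
  have "frechet_derivative f (at x) = f' x" for x
    using frechet_derivative_at[OF assms(1)] by metis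
  then show ?thesis
    using assms by (auto simp: differentiable_def C_k.simps)
qed

lemma C_k_SucE:
  assumes "C_k (Suc k) f"
  obtains f' where "\<And>x. (f has_derivative f' x) (at x)" and "\<And>v. C_k k (\<lambda>x. f' x v)"
proof (rule that[of "\<lambda>x. frechet_derivative f (at x)"])
qed (use assms frechet_derivative_works in \<open>auto simp: C_k.simps\<close>)

declare C_k.simps(2) [simp del]

lemma C_k_imp_continuous: "C_k k f \<Longrightarrow> continuous_on A f"
  by (cases k) (auto simp: C_k.simps(2) intro: continuous_on_subset differentiable_imp_continuous_within
      continuous_at_imp_continuous_on)

lemma C_k_mono_Suc: "C_k (Suc k) f \<Longrightarrow> C_k k f"
proof (induction k arbitrary: f)
  case 0
  then show ?case using C_k_imp_continuous[OF 0, of UNIV] by simp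
next
  case (Suc k)
  from Suc.prems show ?case by (subst (asm) C_k.simps) (auto simp: C_k.simps intro: Suc.IH)
qed

lemma C_k_const: "C_k k (\<lambda>x. c)"
proof (induction k arbitrary: c)
  case (Suc k)
  show ?case by (rule C_k_SucI[where f' = "\<lambda>x v. 0"]) (auto intro!: Suc)
qed auto

lemma C_k_linear: "bounded_linear f \<Longrightarrow> C_k k f"
  by (cases k) (auto intro!: C_k_SucI[where f' = "\<lambda>x. f"] C_k_const bounded_linear_imp_has_derivative
      linear_continuous_on)

lemma C_k_add: "C_k k f \<Longrightarrow> C_k k g \<Longrightarrow> C_k k (\<lambda>x. f x + g x)"
proof (induction k arbitrary: f g)
  case (Suc k)
  from Suc.prems obtain f' g' where
    "\<And>x. (f has_derivative f' x) (at x)" "\<And>v. C_k k (\<lambda>x. f' x v)"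
    "\<And>x. (g has_derivative g' x) (at x)" "\<And>v. C_k k (\<lambda>x. g' x v)"
    by (auto elim!: C_k_SucE)
  then show ?case
    by (intro C_k_SucI[where f' = "\<lambda>x v. f' x v + g' x v"]) (auto intro!: derivative_intros Suc.IH)
qed (auto intro: continuous_intros)

lemma C_k_sum: "(\<And>i. i \<in> I \<Longrightarrow> C_k k (f i)) \<Longrightarrow> C_k k (\<lambda>x. \<Sum>i\<in>I. f i x)"
  by (induction I rule: infinite_finite_induct) (auto intro: C_k_add C_k_const)

lemma C_k_bilinear:
  assumes "bounded_bilinear h"
  shows "C_k k f \<Longrightarrow> C_k k g \<Longrightarrow> C_k k (\<lambda>x. h (f x) (g x))"
proof (induction k arbitrary: f g)
  case 0
  then show ?case using bounded_bilinear.continuous_on[OF assms] by auto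
next
  case (Suc k)
  from Suc.prems obtain f' g' where
    "\<And>x. (f has_derivative f' x) (at x)" "\<And>v. C_k k (\<lambda>x. f' x v)"
    "\<And>x. (g has_derivative g' x) (at x)" "\<And>v. C_k k (\<lambda>x. g' x v)"
    by (auto elim!: C_k_SucE)
  moreover have "C_k k f" "C_k k g" using Suc.prems C_k_mono_Suc by auto
  ultimately show ?case
    by (intro C_k_SucI[where f' = "\<lambda>x v. h (f x) (g' x v) + h (f' x v) (g x)"])
       (auto intro!: C_k_add Suc.IH bounded_bilinear.FDERIV[OF assms])
qed

text \<open>The derivative \<open>g' (f x) (f' x v)\<close> has a direction that varies with
  \<open>x\<close>, so the induction hypothesis does not apply to it directly. Expanding
  \<open>f' x v\<close> in the basis leaves scalar functions times compositions of \<open>f\<close>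
  with derivatives of \<open>g\<close> in fixed directions.\<close>

lemma C_k_compose:
  fixes f :: "'a::euclidean_space \<Rightarrow> 'b::euclidean_space"
  shows "C_k k g \<Longrightarrow> C_k k f \<Longrightarrow> C_k k (\<lambda>x. g (f x))"
proof (induction k arbitrary: g f)
  case 0
  then show ?case by (auto intro: continuous_on_compose2)
next
  case (Suc k)
  from Suc.prems obtain f' g' where
    f: "\<And>x. (f has_derivative f' x) (at x)" "\<And>v. C_k k (\<lambda>x. f' x v)" and
    g: "\<And>x. (g has_derivative g' x) (at x)" "\<And>v. C_k k (\<lambda>x. g' x v)"
    by (auto elim!: C_k_SucE)
  have fk: "C_k k f" using Suc.prems C_k_mono_Suc by auto
  have eq: "g' (f x) (f' x v) = (\<Sum>b\<in>Basis. (f' x v \<bullet> b) *\<^sub>R g' (f x) b)" for x v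
  proof -
    have "linear (g' (f x))" using g(1) has_derivative_linear by blast
    then show ?thesis
      by (subst euclidean_representation[of "f' x v", symmetric]) (simp only: linear_sum linear_cmul o_def)
  qed
  show ?case
  proof (rule C_k_SucI[where f' = "\<lambda>x v. g' (f x) (f' x v)"])
    show "((\<lambda>x. g (f x)) has_derivative (\<lambda>v. g' (f x) (f' x v))) (at x)" for x
      using has_derivative_compose[OF f(1) g(1)] .
    have "C_k k (\<lambda>x. f' x v \<bullet> b)" for v b
      by (rule C_k_bilinear[OF bounded_bilinear_inner f(2) C_k_const])
    then show "C_k k (\<lambda>x. g' (f x) (f' x v))" for v
      unfolding eq
      by (intro C_k_sum C_k_bilinear[OF bounded_bilinear_scaleR] Suc.IH g(2) fk)
  qed
qed

lemma smooth_deriv: "smooth f \<Longrightarrow> smooth (\<lambda>x. frechet_derivative f (at x) v)"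
  unfolding smooth_def using C_k.simps(2) by blast

lemma smooth_has_derivative: "smooth f \<Longrightarrow> (f has_derivative frechet_derivative f (at x)) (at x)"
  unfolding smooth_def by (metis C_k.simps(2) frechet_derivative_works)

lemma smooth_continuous: "smooth f \<Longrightarrow> continuous_on A f"
  unfolding smooth_def using C_k_imp_continuous by blast

lemma smooth_bilinear: "bounded_bilinear h \<Longrightarrow> smooth f \<Longrightarrow> smooth g \<Longrightarrow> smooth (\<lambda>x. h (f x) (g x))"
  by (simp add: smooth_def C_k_bilinear)

section \<open>A smooth flat function on the line\<close>

text \<open>For n = 0 this is the classical flat function. The factors 1 / s^n make the family
  stable under differentiation up to linear combinations, so that one induction proves smoothness
  for all n together.\<close>

definition exp_recip :: "nat \<Rightarrow> real \<Rightarrow> real" where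
  "exp_recip n s = (if s > 0 then exp (- 1 / s) / s ^ n else 0)"

text \<open>From (1 + x / m)^m <= exp x with x = 1 / s and m = n + 2: the two powers of
  \<open>s\<close> beyond the denominator give the quadratic decay that makes the derivative at the
  origin vanish.\<close>

lemma exp_recip_bound: "\<bar>exp_recip n s\<bar> \<le> real (n + 2) ^ (n + 2) * s\<^sup>2"
proof (cases "s > 0")
  case True
  define m where "m = n + 2"
  have m: "m > 0" "real m > 0" by (auto simp: m_def)
  have "(1 + (1 / s) / real m) ^ m \<le> exp (1 / s)"
    using True m by (intro exp_ge_one_plus_x_over_n_power_n) (auto intro: order_trans[of _ 0])
  moreover have "((1 / s) / real m) ^ m \<le> (1 + (1 / s) / real m) ^ m"
    using True m by (intro power_mono) auto
  ultimately have "((1 / s) / real m) ^ m \<le> exp (1 / s)" by linarith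
  then have "1 \<le> exp (1 / s) * (s * real m) ^ m"
    using True m by (simp add: field_simps power_mult_distrib)
  then have "exp (- 1 / s) \<le> (s * real m) ^ m"
    by (simp add: exp_minus field_simps)
  also have "\<dots> = (real m ^ m * s\<^sup>2) * s ^ n"
    by (simp add: m_def power_mult_distrib power_add power2_eq_square)
  finally show ?thesis
    unfolding m_def[symmetric] using True by (simp add: exp_recip_def pos_divide_le_eq)
qed (auto simp: exp_recip_def)

lemma exp_recip_deriv:
  "(exp_recip n has_real_derivative (exp_recip (n + 2) s - real n * exp_recip (Suc n) s)) (at s)"
proof -
  consider "s > 0" | "s < 0" | "s = 0" by linarith
  then show ?thesis
  proof cases
    case 1
    have "((\<lambda>s. exp (- 1 / s) / s ^ n) has_real_derivative
       (exp_recip (n + 2) s - real n * exp_recip (Suc n) s)) (at s)"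
    proof (cases n)
      case 0
      then show ?thesis using 1
        by (auto intro!: derivative_eq_intros simp: exp_recip_def power2_eq_square)
    next
      case (Suc m)
      define E p where "E = exp (- 1 / s)" and "p = s ^ m"
      have p: "p \<noteq> 0" using 1 by (simp add: p_def)
      have "((\<lambda>s. exp (- 1 / s) / s ^ n) has_real_derivative
        (E * (1 / (s * s)) * (s * p) - E * ((1 + real m) * p)) / ((s * p) * (s * p))) (at s)"
        using 1 unfolding Suc E_def p_def
        by ((auto intro!: derivative_eq_intros simp: power2_eq_square)[1], cases m, auto simp: algebra_simps)
      moreover have "(E * (1 / (s * s)) * (s * p) - E * ((1 + real m) * p)) / ((s * p) * (s * p))
          = E / (s * s * (s * p)) - (1 + real m) * (E / (s * (s * p)))"
        using 1 p by (simp add: field_simps)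
      ultimately show ?thesis
        using 1 by (simp add: exp_recip_def E_def p_def Suc mult.assoc)
    qed
    then show ?thesis
      by (rule has_field_derivative_transform_within_open[where S = "{0<..}"])
         (use 1 in \<open>auto simp: exp_recip_def\<close>)
  next
    case 2
    have "((\<lambda>s. 0) has_real_derivative (exp_recip (n + 2) s - real n * exp_recip (Suc n) s)) (at s)"
      using 2 by (auto simp: exp_recip_def)
    then show ?thesis
      by (rule has_field_derivative_transform_within_open[where S = "{..<0}"])
         (use 2 in \<open>auto simp: exp_recip_def\<close>)
  next
    case 3
    define C where "C = real (n + 2) ^ (n + 2)"
    have "((\<lambda>h. exp_recip n h / h) \<longlongrightarrow> 0) (at 0)"
    proof (rule Lim_null_comparison[where g = "\<lambda>h. C * \<bar>h\<bar>"])
      have "norm (exp_recip n h / h) \<le> C * \<bar>h\<bar>" if "h \<noteq> 0" for h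
        using that exp_recip_bound[of n h] by (simp add: C_def abs_divide field_simps power2_eq_square abs_mult)
      then show "\<forall>\<^sub>F h in at 0. norm (exp_recip n h / h) \<le> C * \<bar>h\<bar>"
        by (auto simp: eventually_at_filter)
    qed (auto intro!: tendsto_eq_intros)
    then show ?thesis
      by (simp add: 3 DERIV_def) (simp add: exp_recip_def)
  qed
qed

lemma C_k_exp_recip: "C_k k (exp_recip n)"
proof (induction k arbitrary: n)
  case 0
  show ?case
    using DERIV_isCont[OF exp_recip_deriv] by (auto intro: continuous_at_imp_continuous_on)
next
  case (Suc k)
  have D: "C_k k (\<lambda>x. c * exp_recip m x)" for c m
    by (rule C_k_bilinear[OF bounded_bilinear_mult C_k_const Suc])
  show ?case
  proof (rule C_k_SucI[where f' = "\<lambda>x v. v * exp_recip (n+2) x + (- real n * v) * exp_recip (Suc n) x"])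
    show "(exp_recip n has_derivative (\<lambda>v. v * exp_recip (n+2) x + (- real n * v) * exp_recip (Suc n) x)) (at x)" for x
      using exp_recip_deriv[of n x] unfolding has_field_derivative_def
      by (rule has_derivative_eq_rhs) (auto simp: algebra_simps)
  qed (intro C_k_add D)
qed

section \<open>Mollification\<close>

text \<open>The radius \<open>e\<close> is only an upper bound for the support. A mollifier for a
  small radius is thus one for every larger radius, and a single kernel can meet several smallness
  requirements.\<close>

definition mollifier :: "real \<Rightarrow> ('a::euclidean_space \<Rightarrow> real) \<Rightarrow> bool" where
  "mollifier e \<rho> \<longleftrightarrow> smooth \<rho> \<and> (\<forall>x. 0 \<le> \<rho> x) \<and> (\<forall>x. e \<le> norm x \<longrightarrow> \<rho> x = 0) \<and>
     integrable lborel \<rho> \<and> integral\<^sup>L lborel \<rho> = 1"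

lemma mollifier_exists:
  assumes "e > 0"
  obtains \<rho> :: "'a::euclidean_space \<Rightarrow> real" where "mollifier e \<rho>"
proof -
  define b where "b x = exp_recip 0 (e\<^sup>2 - x \<bullet> x)" for x :: 'a
  have k: "C_k k b" for k
    unfolding b_def diff_conv_add_uminus
  proof (intro C_k_compose[OF C_k_exp_recip] C_k_add C_k_const)
    have "C_k k (\<lambda>x::'a. - 1 * (x \<bullet> x))"
      by (intro C_k_bilinear[OF bounded_bilinear_mult] C_k_bilinear[OF bounded_bilinear_inner] C_k_const
            C_k_linear[OF bounded_linear_ident])
    then show "C_k k (\<lambda>x::'a. - (x \<bullet> x))" by simp
  qed
  have cont: "continuous_on UNIV b" using k[of 0] by simp
  have nonneg: "0 \<le> b x" for x by (simp add: b_def exp_recip_def)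
  have pos: "b x > 0 \<longleftrightarrow> norm x < e" for x
    using assms by (auto simp: b_def exp_recip_def dot_square_norm abs_square_less_1 power_strict_mono
        intro: power2_less_imp_less)
  have zero: "b x = 0" if "e \<le> norm x" for x using pos[of x] nonneg[of x] that by linarith
  have [measurable]: "b \<in> borel_measurable borel" using cont by (rule borel_measurable_continuous_onI)
  have int: "integrable lborel b"
  proof -
    have "integrable lborel (\<lambda>x. if x \<in> cball 0 e then b x else 0)"
      using borel_integrable_compact[OF compact_cball, of 0 e b] continuous_on_subset[OF cont]
      by (simp add: indicator_def of_bool_def if_distrib if_distribR cong: if_cong)
    also have "(\<lambda>x. if x \<in> cball 0 e then b x else 0) = b"
      using zero by (auto simp: fun_eq_iff)
    finally show ?thesis .
  qed
  have "integral\<^sup>L lborel b \<noteq> 0"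
  proof
    assume "integral\<^sup>L lborel b = 0"
    then have "AE x in lborel. b x = 0"
      using integral_nonneg_eq_0_iff_AE[OF int] nonneg by simp
    then have "AE x in lborel. x \<notin> ball (0::'a) e"
      by (rule eventually_mono) (use pos in \<open>auto simp: less_le\<close>)
    then have "emeasure lborel (ball (0::'a) e) = 0"
      by (subst (asm) AE_iff_measurable[where N = "ball 0 e"]) auto
    then show False
      using assms content_ball_pos[of e "0::'a"] by (simp add: measure_def)
  qed
  then have I: "integral\<^sup>L lborel b > 0"
    by (simp add: less_le integral_nonneg_AE nonneg)
  have "mollifier e (\<lambda>x. inverse (integral\<^sup>L lborel b) * b x)"
    unfolding mollifier_def smooth_def
    using int I nonneg zero k by (auto intro!: C_k_bilinear[OF bounded_bilinear_mult] C_k_const)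
  then show thesis by (rule that)
qed

text \<open>Convolutions are formed with Borel functions on the whole space, where Tonelli and the
  invariance of \<open>lborel\<close> apply. Functions on the disc enter through Borel versions of
  their truncations.\<close>

definition conv :: "('a::euclidean_space \<Rightarrow> real) \<Rightarrow> ('a \<Rightarrow> 'b::euclidean_space) \<Rightarrow> 'a \<Rightarrow> 'b" where
  "conv \<rho> g x = (LINT y|lborel. \<rho> (x - y) *\<^sub>R g y)"

section \<open>Continuity of translations in L^1\<close>

text \<open>The L^1 modulus of continuity under translation. Values in \<open>ennreal\<close> keep
  the triangle inequalities free of integrability conditions.\<close>

definition shift_dist :: "('a::euclidean_space \<Rightarrow> 'b::euclidean_space) \<Rightarrow> 'a \<Rightarrow> ennreal" where
  "shift_dist g z = (\<integral>\<^sup>+x. ennreal (norm (g (x - z) - g x)) \<partial>lborel)"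

lemma nn_integral_lborel_shift:
  fixes z :: "'a::euclidean_space"
  assumes [measurable]: "f \<in> borel_measurable borel"
  shows "(\<integral>\<^sup>+x. f (x - z) \<partial>lborel) = (\<integral>\<^sup>+x. f x \<partial>lborel)"
proof -
  have "(\<integral>\<^sup>+x. f x \<partial>lborel) = (\<integral>\<^sup>+x. f x \<partial>distr lborel borel ((+) (- z)))"
    by (simp only: lborel_distr_plus)
  also have "\<dots> = (\<integral>\<^sup>+x. f (x - z) \<partial>lborel)"
    by (subst nn_integral_distr) auto
  finally show ?thesis by simp
qed

lemma lborel_distr_reflect: "distr lborel borel (\<lambda>z. x - z) = (lborel :: 'a::euclidean_space measure)"
  using lborel_affine[of "-1" x] by (simp add: density_1)

lemma nn_integral_lborel_reflect:
  fixes x :: "'a::euclidean_space"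
  assumes [measurable]: "f \<in> borel_measurable borel"
  shows "(\<integral>\<^sup>+z. f (x - z) \<partial>lborel) = (\<integral>\<^sup>+x. f x \<partial>lborel)"
proof -
  have "(\<integral>\<^sup>+x. f x \<partial>lborel) = (\<integral>\<^sup>+x. f x \<partial>distr lborel borel (\<lambda>z. x - z))"
    by (simp only: lborel_distr_reflect)
  also have "\<dots> = (\<integral>\<^sup>+z. f (x - z) \<partial>lborel)"
    by (subst nn_integral_distr) auto
  finally show ?thesis by simp
qed

lemma integrable_lborel_reflect:
  fixes f :: "'a::euclidean_space \<Rightarrow> 'b::euclidean_space"
  assumes "integrable lborel f"
  shows "integrable lborel (\<lambda>z. f (x - z))" and "(LINT z|lborel. f (x - z)) = integral\<^sup>L lborel f"
proof -
  have [measurable]: "f \<in> borel_measurable borel" using assms by simp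
  show "integrable lborel (\<lambda>z. f (x - z))"
    using assms integrable_distr_eq[of "\<lambda>z. x - z" lborel borel f] by (simp add: lborel_distr_reflect)
  show "(LINT z|lborel. f (x - z)) = integral\<^sup>L lborel f"
    using integral_distr[of "\<lambda>z. x - z" lborel borel f] by (simp add: lborel_distr_reflect)
qed

text \<open>The error is counted twice, once for \<open>g\<close> and once for its translate, which
  lies at the same L^1 distance from the translate of \<open>f\<close>.\<close>

lemma shift_dist_triangle:
  assumes [measurable]: "f \<in> borel_measurable borel" "g \<in> borel_measurable borel"
  shows "shift_dist g z \<le> shift_dist f z + 2 * (\<integral>\<^sup>+x. ennreal (norm (f x - g x)) \<partial>lborel)"
proof -
  have "shift_dist g z \<le> (\<integral>\<^sup>+x. (ennreal (norm (f (x - z) - f x)) + ennreal (norm (f x - g x)))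
      + ennreal (norm (f (x - z) - g (x - z))) \<partial>lborel)"
    unfolding shift_dist_def
  proof (rule nn_integral_mono)
    fix x
    have "norm (g (x - z) - g x) \<le> (norm (f (x - z) - f x) + norm (f x - g x)) + norm (f (x - z) - g (x - z))"
      by norm
    then show "ennreal (norm (g (x - z) - g x)) \<le> (ennreal (norm (f (x - z) - f x)) + ennreal (norm (f x - g x)))
      + ennreal (norm (f (x - z) - g (x - z)))"
      by (simp flip: ennreal_plus)
  qed
  also have "\<dots> = shift_dist f z + (\<integral>\<^sup>+x. ennreal (norm (f x - g x)) \<partial>lborel)
      + (\<integral>\<^sup>+x. ennreal (norm (f (x - z) - g (x - z))) \<partial>lborel)"
    unfolding shift_dist_def by (simp add: nn_integral_add)
  also have "(\<integral>\<^sup>+x. ennreal (norm (f (x - z) - g (x - z))) \<partial>lborel)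
      = (\<integral>\<^sup>+x. ennreal (norm (f x - g x)) \<partial>lborel)"
    by (rule nn_integral_lborel_shift) measurable
  finally show ?thesis by (simp add: mult_2 add.assoc)
qed

lemma shift_dist_add:
  assumes [measurable]: "f \<in> borel_measurable borel" "g \<in> borel_measurable borel"
  shows "shift_dist (\<lambda>x. f x + g x) z \<le> shift_dist f z + shift_dist g z"
proof -
  have "shift_dist (\<lambda>x. f x + g x) z \<le>
      (\<integral>\<^sup>+x. ennreal (norm (f (x - z) - f x)) + ennreal (norm (g (x - z) - g x)) \<partial>lborel)"
    unfolding shift_dist_def
  proof (rule nn_integral_mono)
    fix x
    have "norm (f (x - z) + g (x - z) - (f x + g x)) \<le> norm (f (x - z) - f x) + norm (g (x - z) - g x)"
      by norm
    then show "ennreal (norm (f (x - z) + g (x - z) - (f x + g x)))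
        \<le> ennreal (norm (f (x - z) - f x)) + ennreal (norm (g (x - z) - g x))"
      by (simp flip: ennreal_plus)
  qed
  also have "\<dots> = shift_dist f z + shift_dist g z"
    unfolding shift_dist_def by (simp add: nn_integral_add)
  finally show ?thesis .
qed

lemma tendsto_0_ennrealI:
  fixes f :: "'a \<Rightarrow> ennreal"
  assumes "0 \<le> C" and "\<And>e. e > 0 \<Longrightarrow> eventually (\<lambda>z. f z \<le> ennreal (C * e)) F"
  shows "(f \<longlongrightarrow> 0) F"
proof (rule order_tendstoI)
  fix a :: ennreal assume "0 < a"
  obtain r where r: "0 < r" "ennreal r < a"
  proof (cases a)
    case (real q)
    then show ?thesis using \<open>0 < a\<close> by (intro that[of "q / 2"]) (auto simp: ennreal_less_iff)
  next
    case top
    then show ?thesis by (intro that[of 1]) auto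
  qed
  have "C * (r / (C + 1)) \<le> r" using r assms(1) by (simp add: field_simps)
  then have "ennreal (C * (r / (C + 1))) < a" using r ennreal_leI le_less_trans by blast
  moreover have "eventually (\<lambda>z. f z \<le> ennreal (C * (r / (C + 1)))) F"
    using r assms(1) by (intro assms(2)) auto
  ultimately show "eventually (\<lambda>z. f z < a) F"
    by (auto elim!: eventually_mono)
qed auto

lemma shift_dist_limit:
  fixes f :: "'a::euclidean_space \<Rightarrow> 'b::euclidean_space"
  assumes [measurable]: "f \<in> borel_measurable borel" "\<And>i. s i \<in> borel_measurable borel"
    and lim: "(\<lambda>i. (\<integral>\<^sup>+x. ennreal (norm (s i x - f x)) \<partial>lborel)) \<longlonglongrightarrow> 0"
    and s: "\<And>i::nat. ((\<lambda>z. shift_dist (s i) z) \<longlongrightarrow> 0) (at 0)"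
  shows "((\<lambda>z. shift_dist f z) \<longlongrightarrow> 0) (at 0)"
proof (rule tendsto_0_ennrealI[of 3])
  fix e :: real assume "e > 0"
  then have e: "ennreal e > 0" by simp
  obtain i where i: "(\<integral>\<^sup>+x. ennreal (norm (s i x - f x)) \<partial>lborel) < ennreal e"
    using order_tendstoD(2)[OF lim e] by (auto simp: eventually_sequentially)
  have "eventually (\<lambda>z. shift_dist (s i) z < ennreal e) (at 0)"
    by (rule order_tendstoD(2)[OF s e])
  then show "eventually (\<lambda>z. shift_dist f z \<le> ennreal (3 * e)) (at 0)"
  proof (rule eventually_mono)
    fix z assume "shift_dist (s i) z < ennreal e"
    then have "shift_dist f z \<le> ennreal e + 2 * ennreal e"
      using i by (intro order_trans[OF shift_dist_triangle[of "s i" f]] add_mono mult_left_mono) auto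
    also have "\<dots> = ennreal (3 * e)"
      using \<open>e > 0\<close> by (simp flip: ennreal_plus ennreal_numeral ennreal_mult)
    finally show "shift_dist f z \<le> ennreal (3 * e)" .
  qed
qed auto

text \<open>Regularity squeezes \<open>A\<close> between a compact \<open>F\<close> and an open
  \<open>U\<close> of nearly the same measure. A shift that is short compared with the distance from
  \<open>F\<close> to the complement of \<open>U\<close> keeps \<open>F\<close> inside
  \<open>U\<close>, so the two indicators can differ only on \<open>U - F\<close> and on its
  translate.\<close>

lemma shift_dist_indicator_bounded:
  fixes A :: "'a::euclidean_space set" and c :: "'b::euclidean_space"
  assumes [measurable]: "A \<in> sets borel" and bdd: "bounded A"
  shows "((\<lambda>z. shift_dist (\<lambda>x. indicator A x *\<^sub>R c) z) \<longlongrightarrow> 0) (at 0)"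
proof (rule tendsto_0_ennrealI[of "4 * norm c"])
  fix e :: real assume "e > 0"
  have A: "A \<in> sets lebesgue" by (simp add: sets_completionI_sets)
  obtain F where F: "closed F" "F \<subseteq> A" "emeasure lebesgue (A - F) < ennreal e"
    by (rule sets_lebesgue_inner_closed[OF A \<open>e > 0\<close>]) (rule that)
  obtain U where U: "open U" "A \<subseteq> U" "emeasure lebesgue (U - A) < ennreal e"
    by (rule sets_lebesgue_outer_open[OF A \<open>e > 0\<close>]) (rule that)
  have [measurable]: "F \<in> sets borel" "U \<in> sets borel" using F U by auto
  have "compact F" using F bdd bounded_subset compact_eq_bounded_closed by blast
  moreover have "F \<subseteq> U" using F U by simp
  ultimately obtain d where d0: "d > 0" "(\<Union>x\<in>F. ball x d) \<subseteq> U"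
    using compact_subset_open_imp_ball_epsilon_subset[OF _ U(1)] by metis
  have d: "d > 0" "\<And>x. x \<in> F \<Longrightarrow> ball x d \<subseteq> U"
    using d0 by auto
  have "emeasure lborel (U - F) \<le> emeasure lborel (U - A) + emeasure lborel (A - F)"
    using emeasure_subadditive[of "U - A" lborel "A - F"] F U
    by (intro order_trans[OF emeasure_mono[of "U - F" "(U - A) \<union> (A - F)"]]) auto
  also have "\<dots> \<le> ennreal e + ennreal e"
    using F U by (intro add_mono) auto
  finally have m: "emeasure lborel (U - F) \<le> ennreal (2 * e)"
    using \<open>e > 0\<close> by (simp flip: ennreal_plus)
  have "shift_dist (\<lambda>x. indicator A x *\<^sub>R c) z \<le> ennreal (4 * norm c * e)" if z: "norm z < d" for z
  proof -
    have "shift_dist (\<lambda>x. indicator A x *\<^sub>R c) z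
        \<le> (\<integral>\<^sup>+x. ennreal (norm c) * (indicator (U - F) (x - z) + indicator (U - F) x) \<partial>lborel)"
      unfolding shift_dist_def
    proof (rule nn_integral_mono)
      fix x
      have "x \<in> U" if "x - z \<in> F" using d(2)[OF that] z by (auto simp: dist_norm)
      moreover have "x - z \<in> U" if "x \<in> F" using d(2)[OF that] z by (auto simp: dist_norm)
      ultimately have "norm (indicator A (x - z) *\<^sub>R c - indicator A x *\<^sub>R c)
          \<le> norm c * (indicator (U - F) (x - z) + indicator (U - F) x)"
        using F(2) U(2) by (auto simp: indicator_def)
      then show "ennreal (norm (indicator A (x - z) *\<^sub>R c - indicator A x *\<^sub>R c))
          \<le> ennreal (norm c) * (indicator (U - F) (x - z) + indicator (U - F) x)"
        by (simp flip: ennreal_indicator ennreal_plus ennreal_mult)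
    qed
    also have "\<dots> = ennreal (norm c) * (emeasure lborel (U - F) + emeasure lborel (U - F))"
      using nn_integral_lborel_shift[of "indicator (U - F)" z]
      by (simp add: nn_integral_cmult nn_integral_add)
    also have "\<dots> \<le> ennreal (norm c) * (ennreal (2 * e) + ennreal (2 * e))"
      by (intro mult_left_mono add_mono m) auto
    also have "\<dots> = ennreal (4 * norm c * e)"
      using \<open>e > 0\<close> by (simp flip: ennreal_plus ennreal_mult)
    finally show ?thesis .
  qed
  then show "eventually (\<lambda>z. shift_dist (\<lambda>x. indicator A x *\<^sub>R c) z \<le> ennreal (4 * norm c * e)) (at 0)"
    using d(1) by (auto simp: eventually_at dist_norm)
qed auto

text \<open>A density argument along the induction for integrable functions. Sets of finite measure
  are reduced to bounded ones by intersecting with large balls; sums and dominated limits preserve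
  the claim.\<close>

lemma shift_dist_tendsto_0:
  fixes g :: "'a::euclidean_space \<Rightarrow> 'b::euclidean_space"
  assumes "integrable lborel g"
  shows "((\<lambda>z. shift_dist g z) \<longlongrightarrow> 0) (at 0)"
  using assms
proof (induction rule: integrable_induct)
  case (base A c)
  then have [measurable]: "A \<in> sets borel" by simp
  show ?case
  proof (rule shift_dist_limit[where s = "\<lambda>i x. indicator (A \<inter> cball 0 (real i)) x *\<^sub>R c"])
    show "(\<lambda>i. \<integral>\<^sup>+x. ennreal (norm (indicator (A \<inter> cball 0 (real i)) x *\<^sub>R c - indicator A x *\<^sub>R c)) \<partial>lborel)
        \<longlonglongrightarrow> 0"
      unfolding norm_minus_commute[of "indicator (A \<inter> cball 0 (real i)) x *\<^sub>R c" "indicator A x *\<^sub>R c" for i x]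
    proof (rule nn_integral_dominated_convergence_norm[where w = "\<lambda>x. indicator A x * norm c"])
      show "AE x in lborel. (\<lambda>i. indicator (A \<inter> cball 0 (real i)) x *\<^sub>R c) \<longlonglongrightarrow> indicator A x *\<^sub>R c"
      proof (rule AE_I2)
        fix x :: 'a
        obtain n :: nat where "norm x \<le> real n" using real_arch_simple by blast
        then have "eventually (\<lambda>i. indicator (A \<inter> cball 0 (real i)) x *\<^sub>R c = indicator A x *\<^sub>R c) sequentially"
          by (intro eventually_sequentiallyI[of n]) (auto simp: indicator_def)
        then show "(\<lambda>i. indicator (A \<inter> cball 0 (real i)) x *\<^sub>R c) \<longlonglongrightarrow> indicator A x *\<^sub>R c"
          by (rule tendsto_eventually)
      qed
      show "(\<integral>\<^sup>+x. ennreal (indicator A x * norm c) \<partial>lborel) < \<infinity>"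
        using base by (simp add: ennreal_mult' ennreal_indicator nn_integral_multc ennreal_mult_less_top)
    qed (auto simp: indicator_def)
    show "(\<lambda>x. indicator (A \<inter> cball 0 (real i)) x *\<^sub>R c) \<in> borel_measurable borel" for i
      by (intro borel_measurable_scaleR borel_measurable_indicator) auto
  qed (auto intro!: shift_dist_indicator_bounded)
next
  case (add f g)
  have "((\<lambda>z. shift_dist f z + shift_dist g z) \<longlongrightarrow> 0 + 0) (at 0)"
    by (intro tendsto_add add)
  then have lim: "((\<lambda>z. shift_dist f z + shift_dist g z) \<longlongrightarrow> 0) (at 0)" by simp
  have "shift_dist (\<lambda>x. f x + g x) z \<le> shift_dist f z + shift_dist g z" for z
    using borel_measurable_integrable[OF add(1)] borel_measurable_integrable[OF add(2)]
    by (intro shift_dist_add) simp_all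
  then show ?case
    by (intro tendsto_sandwich[OF always_eventually always_eventually tendsto_const lim]) simp_all
next
  case (lim f s)
  note [measurable] = borel_measurable_integrable[OF lim(4), unfolded measurable_lborel2]
    borel_measurable_integrable[OF lim(1), unfolded measurable_lborel2]
  have "(\<lambda>i. (\<integral>\<^sup>+x. ennreal (norm (s i x - f x)) \<partial>lborel)) \<longlonglongrightarrow> 0"
    unfolding norm_minus_commute[of "s _ _"]
  proof (rule nn_integral_dominated_convergence_norm[where w = "\<lambda>x. 2 * norm (f x)"])
    show "AE x in lborel. norm (s j x) \<le> 2 * norm (f x)" for j
      using lim(3) by simp
    show "(\<integral>\<^sup>+x. ennreal (2 * norm (f x)) \<partial>lborel) < \<infinity>"
      using lim(4) integrable_iff_bounded[of lborel "\<lambda>x. 2 * norm (f x)"] by simp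
    show "AE x in lborel. (\<lambda>i. s i x) \<longlonglongrightarrow> f x" using lim(2) by simp
  qed simp_all
  then show ?case
    by (intro shift_dist_limit[where s = s and f = f]) (use lim in auto)
qed

section \<open>Convolution with a mollifier\<close>

lemma mollifier_measurable: "mollifier e \<rho> \<Longrightarrow> \<rho> \<in> borel_measurable borel"
  by (auto simp: mollifier_def)

lemma supp_bounded:
  fixes f :: "'a::euclidean_space \<Rightarrow> 'b::real_normed_vector"
  assumes "continuous_on UNIV f" "\<And>x. e < norm x \<Longrightarrow> f x = 0"
  obtains B where "B > 0" "\<And>x. norm (f x) \<le> B"
proof -
  have "compact (f ` cball 0 e)"
    using assms(1) by (intro compact_continuous_image continuous_on_subset[OF assms(1)]) auto
  then obtain B where B: "B > 0" "\<forall>x\<in>cball 0 e. norm (f x) \<le> B"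
    using compact_imp_bounded bounded_pos by (metis image_eqI)
  moreover have "norm (f x) \<le> B" for x
    using assms(2)[of x] B by (cases "norm x \<le> e") auto
  ultimately show thesis using that by blast
qed

lemma conv_integrable:
  fixes g :: "'a::euclidean_space \<Rightarrow> 'b::euclidean_space"
  assumes "continuous_on UNIV \<rho>" "\<And>x. e < norm x \<Longrightarrow> \<rho> x = (0::real)" "integrable lborel g"
  shows "integrable lborel (\<lambda>y. \<rho> (x - y) *\<^sub>R g y)"
proof -
  obtain B where B: "B > 0" "\<And>x. norm (\<rho> x) \<le> B" using supp_bounded[OF assms(1,2)] by blast
  have [measurable]: "\<rho> \<in> borel_measurable borel" using assms(1) by (rule borel_measurable_continuous_onI)
  have [measurable]: "g \<in> borel_measurable borel" using assms(3) by auto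
  show ?thesis
    by (rule Bochner_Integration.integrable_bound[where f = "\<lambda>y. B * norm (g y)"])
       (use assms(3) B in \<open>auto intro!: mult_right_mono simp: abs_mult\<close>)
qed

lemma mollifier_cont: "mollifier e \<rho> \<Longrightarrow> continuous_on UNIV \<rho>"
  and mollifier_zero: "mollifier e \<rho> \<Longrightarrow> e < norm x \<Longrightarrow> \<rho> x = 0"
  by (auto simp: mollifier_def smooth_continuous)

lemma mollifier_shift:
  fixes \<rho> :: "'a::euclidean_space \<Rightarrow> real"
  assumes "mollifier e \<rho>"
  shows "integrable lborel (\<lambda>y. \<rho> (x - y))" "(LINT y|lborel. \<rho> (x - y)) = 1"
  using integrable_lborel_reflect[of \<rho> x] assms by (auto simp: mollifier_def)

lemma conv_minus_const:
  fixes g :: "'a::euclidean_space \<Rightarrow> 'b::euclidean_space"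
  assumes m: "mollifier e \<rho>" and g: "integrable lborel g"
  shows "conv \<rho> g x - c = (LINT y|lborel. \<rho> (x - y) *\<^sub>R (g y - c))"
    and "integrable lborel (\<lambda>y. \<rho> (x - y) *\<^sub>R (g y - c))"
proof -
  have 1: "integrable lborel (\<lambda>y. \<rho> (x - y) *\<^sub>R g y)"
    by (rule conv_integrable[OF mollifier_cont[OF m] mollifier_zero[OF m] g])
  have 2: "integrable lborel (\<lambda>y. \<rho> (x - y) *\<^sub>R c)"
    by (intro integrable_scaleR_left mollifier_shift[OF m])
  show "integrable lborel (\<lambda>y. \<rho> (x - y) *\<^sub>R (g y - c))"
    using 1 2 by (simp add: scaleR_diff_right)
  have "(LINT y|lborel. \<rho> (x - y) *\<^sub>R c) = c"
    using mollifier_shift[OF m] by (simp add: integral_scaleR_left)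
  then show "conv \<rho> g x - c = (LINT y|lborel. \<rho> (x - y) *\<^sub>R (g y - c))"
    using 1 2 by (simp add: conv_def scaleR_diff_right Bochner_Integration.integral_diff)
qed

text \<open>A mollification at \<open>x\<close> is a weighted mean of values of \<open>g\<close>
  near \<open>x\<close>. Taking for \<open>c\<close> the value of a continuous \<open>g\<close> at
  \<open>x\<close> gives uniform approximation; c = 0 gives the preservation of essential
  bounds.\<close>

lemma conv_near_const:
  fixes g :: "'a::euclidean_space \<Rightarrow> 'b::euclidean_space"
  assumes m: "mollifier e \<rho>" and g: "integrable lborel g"
    and near: "AE y in lborel. norm (x - y) < e \<longrightarrow> norm (g y - c) \<le> \<delta>"
  shows "norm (conv \<rho> g x - c) \<le> \<delta>"
proof -
  have "norm (conv \<rho> g x - c) \<le> (LINT y|lborel. \<rho> (x - y) * \<delta>)"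
    unfolding conv_minus_const(1)[OF m g]
  proof (rule order_trans[OF integral_norm_bound integral_mono_AE])
    show "integrable lborel (\<lambda>y. norm (\<rho> (x - y) *\<^sub>R (g y - c)))"
      by (intro integrable_norm conv_minus_const[OF m g])
    show "integrable lborel (\<lambda>y. \<rho> (x - y) * \<delta>)"
      by (intro integrable_mult_left mollifier_shift[OF m])
    show "AE y in lborel. norm (\<rho> (x - y) *\<^sub>R (g y - c)) \<le> \<rho> (x - y) * \<delta>"
      using near
    proof eventually_elim
      case (elim y)
      then show ?case
        using m by (cases "norm (x - y) < e") (auto simp: mollifier_def intro!: mult_left_mono)
    qed
  qed
  also have "\<dots> = \<delta>" using mollifier_shift[OF m] by simp
  finally show ?thesis .
qed

text \<open>By Tonelli the L^1 error is at most the mean of \<open>shift_dist g\<close> with weight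
  \<open>\<rho>\<close>. The radius \<open>d\<close> does not depend on the kernel, so one kernel
  can serve finitely many functions at once.\<close>

lemma conv_L1:
  fixes g :: "'a::euclidean_space \<Rightarrow> 'b::euclidean_space"
  assumes g: "integrable lborel g" and "e > 0"
  obtains d where "d > 0" and
    "\<And>\<rho> r. mollifier r \<rho> \<Longrightarrow> r \<le> d \<Longrightarrow> (\<integral>\<^sup>+x. ennreal (norm (conv \<rho> g x - g x)) \<partial>lborel) \<le> ennreal e"
proof -
  have [measurable]: "g \<in> borel_measurable borel" using g by auto
  have "eventually (\<lambda>z. shift_dist g z < ennreal e) (at 0)"
    using order_tendstoD(2)[OF shift_dist_tendsto_0[OF g]] \<open>e > 0\<close> by simp
  then obtain d where d: "d > 0" "\<And>z. z \<noteq> 0 \<Longrightarrow> norm z < d \<Longrightarrow> shift_dist g z < ennreal e"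
    by (auto simp: eventually_at dist_norm)
  have d': "shift_dist g z \<le> ennreal e" if "norm z < d" for z
    using d(2)[of z] that by (cases "z = 0") (auto simp: shift_dist_def)
  show thesis
  proof (rule that[OF d(1)])
    fix \<rho> :: "'a \<Rightarrow> real" and r assume m: "mollifier r \<rho>" and r: "r \<le> d"
    have [measurable]: "\<rho> \<in> borel_measurable borel" by (rule mollifier_measurable[OF m])
    have nonneg: "0 \<le> \<rho> x" for x using m by (simp add: mollifier_def)
    have "(\<integral>\<^sup>+x. ennreal (norm (conv \<rho> g x - g x)) \<partial>lborel)
        \<le> (\<integral>\<^sup>+x. (\<integral>\<^sup>+y. ennreal (\<rho> (x - y) * norm (g y - g x)) \<partial>lborel) \<partial>lborel)"
    proof (rule nn_integral_mono)
      fix x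
      have "ennreal (norm (conv \<rho> g x - g x)) \<le> (\<integral>\<^sup>+y. ennreal (norm (\<rho> (x - y) *\<^sub>R (g y - g x))) \<partial>lborel)"
        unfolding conv_minus_const(1)[OF m g]
        by (rule integral_norm_bound_ennreal[OF conv_minus_const(2)[OF m g]])
      then show "ennreal (norm (conv \<rho> g x - g x)) \<le> (\<integral>\<^sup>+y. ennreal (\<rho> (x - y) * norm (g y - g x)) \<partial>lborel)"
        by (simp add: nonneg)
    qed
    also have "\<dots> = (\<integral>\<^sup>+x. (\<integral>\<^sup>+z. ennreal (\<rho> z * norm (g (x - z) - g x)) \<partial>lborel) \<partial>lborel)"
    proof (rule nn_integral_cong)
      fix x
      show "(\<integral>\<^sup>+y. ennreal (\<rho> (x - y) * norm (g y - g x)) \<partial>lborel)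
         = (\<integral>\<^sup>+z. ennreal (\<rho> z * norm (g (x - z) - g x)) \<partial>lborel)"
        using nn_integral_lborel_reflect[of "\<lambda>y. ennreal (\<rho> (x - y) * norm (g y - g x))" x] by simp
    qed
    also have "\<dots> = (\<integral>\<^sup>+z. (\<integral>\<^sup>+x. ennreal (\<rho> z * norm (g (x - z) - g x)) \<partial>lborel) \<partial>lborel)"
      by (rule lborel_pair.Fubini') measurable
    also have "\<dots> = (\<integral>\<^sup>+z. ennreal (\<rho> z) * shift_dist g z \<partial>lborel)"
      unfolding shift_dist_def
      by (intro nn_integral_cong) (simp add: ennreal_mult nonneg nn_integral_cmult)
    also have "\<dots> \<le> (\<integral>\<^sup>+z. ennreal (\<rho> z) * ennreal e \<partial>lborel)"
    proof (rule nn_integral_mono)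
      fix z
      show "ennreal (\<rho> z) * shift_dist g z \<le> ennreal (\<rho> z) * ennreal e"
      proof (cases "norm z < r")
        case True
        then show ?thesis using d'[of z] r by (intro mult_left_mono) auto
      qed (use m in \<open>auto simp: mollifier_def\<close>)
    qed
    also have "\<dots> = ennreal e"
      using m nn_integral_eq_integral[of lborel \<rho>] by (simp add: nn_integral_multc mollifier_def)
    finally show "(\<integral>\<^sup>+x. ennreal (norm (conv \<rho> g x - g x)) \<partial>lborel) \<le> ennreal e" .
  qed
qed

lemma supp_derivative:
  fixes f :: "'a::euclidean_space \<Rightarrow> 'b::real_normed_vector"
  assumes "\<And>x. e < norm x \<Longrightarrow> f x = 0" and "e < norm x"
  shows "frechet_derivative f (at x) v = 0"
proof -
  have "((\<lambda>_. 0) has_derivative (\<lambda>_. 0)) (at x)" by simp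
  then have "(f has_derivative (\<lambda>_. 0)) (at x)"
    by (rule has_derivative_transform_within_open[where s = "- cball 0 e"]) (use assms in auto)
  then show ?thesis using frechet_derivative_at by metis
qed

lemma C_1_has_derivative: "C_k (Suc k) f \<Longrightarrow> (f has_derivative frechet_derivative f (at x)) (at x)"
  and C_k_deriv: "C_k (Suc k) f \<Longrightarrow> C_k k (\<lambda>x. frechet_derivative f (at x) v)"
  by (auto simp: C_k.simps frechet_derivative_works)

lemma C_1_supp_lipschitz:
  fixes f :: "'a::euclidean_space \<Rightarrow> 'b::real_normed_vector"
  assumes s: "C_k (Suc 0) f" and z: "\<And>x. e < norm x \<Longrightarrow> f x = 0"
  obtains L where "L > 0" "\<And>x y. norm (f x - f y) \<le> L * norm (x - y)"
    "\<And>x v. norm (frechet_derivative f (at x) v) \<le> L * norm v"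
proof -
  have "\<exists>B>0. \<forall>x. norm (frechet_derivative f (at x) b) \<le> B" for b
  proof -
    have "continuous_on UNIV (\<lambda>x. frechet_derivative f (at x) b)"
      using C_k_deriv[OF s] by simp
    then obtain B where "B > 0" "\<And>x. norm (frechet_derivative f (at x) b) \<le> B"
      by (rule supp_bounded[where e = e]) (use supp_derivative[OF z] in auto)
    then show ?thesis by blast
  qed
  then obtain B where B: "\<And>b. B b > 0" "\<And>b x. norm (frechet_derivative f (at x) b) \<le> B b" by metis
  define L where "L = (\<Sum>b\<in>(Basis::'a set). B b)"
  have L: "L > 0" unfolding L_def using B(1) by (intro sum_pos) auto
  have bd: "norm (frechet_derivative f (at x) v) \<le> L * norm v" for x v
  proof -
    have lin: "linear (frechet_derivative f (at x))"
      using C_1_has_derivative[OF s] has_derivative_linear by blast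
    have "frechet_derivative f (at x) v = (\<Sum>b\<in>Basis. (v \<bullet> b) *\<^sub>R frechet_derivative f (at x) b)"
      by (subst euclidean_representation[of v, symmetric]) (simp only: linear_sum[OF lin] linear_cmul[OF lin] o_def)
    also have "norm \<dots> \<le> (\<Sum>b\<in>Basis. norm v * B b)"
      by (intro order_trans[OF norm_sum] sum_mono) (auto intro!: mult_mono B(2) Basis_le_norm)
    finally show ?thesis by (simp add: L_def sum_distrib_right mult.commute sum_distrib_left)
  qed
  have "norm (f x - f y) \<le> L * norm (x - y)" for x y
    by (rule differentiable_bound[of UNIV, where f' = "\<lambda>x. frechet_derivative f (at x)"])
       (use C_1_has_derivative[OF s] bd in \<open>auto intro!: onorm_le\<close>)
  then show thesis using that[OF L _ bd] by auto
qed

text \<open>The kernel is globally Lipschitz with constant \<open>L\<close>, so the difference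
  quotients along a sequence tending to \<open>x\<close>, corrected by the derivative, are dominated
  by \<open>2 * L * norm (g y)\<close>; dominated convergence moves the derivative onto the
  kernel.\<close>

lemma conv_has_derivative:
  fixes g :: "'a::euclidean_space \<Rightarrow> 'b::euclidean_space"
  assumes s: "smooth \<rho>" and z: "\<And>x. e < norm x \<Longrightarrow> \<rho> x = 0" and g: "integrable lborel g"
  shows "(conv \<rho> g has_derivative (\<lambda>v. conv (\<lambda>x. frechet_derivative \<rho> (at x) v) g x)) (at x)"
proof -
  obtain L where L: "L > 0" "\<And>x y. \<bar>\<rho> x - \<rho> y\<bar> \<le> L * norm (x - y)"
    "\<And>x v. \<bar>frechet_derivative \<rho> (at x) v\<bar> \<le> L * norm v"
    using C_1_supp_lipschitz[of \<rho> e] s z unfolding smooth_def real_norm_def by metis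
  note cont = smooth_continuous[OF s, of UNIV]
  note contD = smooth_continuous[OF smooth_deriv[OF s], of UNIV]
  have int: "integrable lborel (\<lambda>y. \<rho> (x - y) *\<^sub>R g y)" for x
    by (rule conv_integrable[OF cont z g])
  have intD: "integrable lborel (\<lambda>y. frechet_derivative \<rho> (at (x - y)) v *\<^sub>R g y)" for x v
    by (rule conv_integrable[OF contD _ g]) (rule supp_derivative[OF z])
  have [measurable]: "g \<in> borel_measurable borel" using g by auto
  have [measurable]: "\<rho> \<in> borel_measurable borel" "(\<lambda>x. frechet_derivative \<rho> (at x) v) \<in> borel_measurable borel" for v
    using cont contD by (auto intro: borel_measurable_continuous_onI)
  have lin: "linear (frechet_derivative \<rho> (at x))" for x
    using smooth_has_derivative[OF s] has_derivative_linear by blast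
  let ?D = "\<lambda>v. conv (\<lambda>x. frechet_derivative \<rho> (at x) v) g x"
  have "bounded_linear ?D"
  proof (rule bounded_linear_intro[where K = "L * (LINT y|lborel. norm (g y))"])
    show "?D (u + v) = ?D u + ?D v" for u v
      unfolding conv_def using intD by (simp add: linear_add[OF lin] scaleR_add_left Bochner_Integration.integral_add)
    show "?D (r *\<^sub>R v) = r *\<^sub>R ?D v" for r v
      unfolding conv_def by (simp add: linear_cmul[OF lin] flip: scaleR_scaleR integral_scaleR_right)
    show "norm (?D v) \<le> norm v * (L * (LINT y|lborel. norm (g y)))" for v
    proof -
      have "norm (?D v) \<le> (LINT y|lborel. (L * norm v) * norm (g y))"
        unfolding conv_def using g intD[of x v] L(3)
        by (intro Bochner_Integration.integral_norm_bound_integral) (auto intro!: mult_right_mono)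
      then show ?thesis by (simp add: algebra_simps)
    qed
  qed
  moreover have "((\<lambda>z. norm (conv \<rho> g z - conv \<rho> g x - ?D (z - x)) / norm (z - x)) \<longlongrightarrow> 0) (at x)"
    unfolding tendsto_at_iff_sequentially comp_def
  proof (intro allI impI)
    fix X :: "nat \<Rightarrow> 'a" assume X: "\<forall>i. X i \<in> UNIV - {x}" "X \<longlonglongrightarrow> x"
    define q where "q i y = (\<rho> (X i - y) - \<rho> (x - y) - frechet_derivative \<rho> (at (x - y)) (X i - x)) / norm (X i - x)" for i y
    have [measurable]: "q i \<in> borel_measurable borel" for i unfolding q_def by measurable
    have qb: "\<bar>q i y\<bar> \<le> 2 * L" for i y
    proof -
      have "\<bar>\<rho> (X i - y) - \<rho> (x - y) - frechet_derivative \<rho> (at (x - y)) (X i - x)\<bar> \<le> 2 * L * norm (X i - x)"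
        using L(2)[of "X i - y" "x - y"] L(3)[of "x - y" "X i - x"] by simp
      then show ?thesis using X(1) by (auto simp: q_def abs_divide field_simps)
    qed
    have "(\<lambda>i. LINT y|lborel. q i y *\<^sub>R g y) \<longlonglongrightarrow> (LINT y|(lborel::'a measure). 0)"
    proof (rule integral_dominated_convergence[where w = "\<lambda>y. 2 * L * norm (g y)"])
      have "(\<lambda>i. q i y) \<longlonglongrightarrow> 0" for y
      proof -
        have "((\<lambda>z. (\<rho> z - \<rho> (x - y) - frechet_derivative \<rho> (at (x - y)) (z - (x - y))) / norm (z - (x - y))) \<longlongrightarrow> 0) (at (x - y))"
          using smooth_has_derivative[OF s, of "x - y"] unfolding has_derivative_def
          by (simp add: divide_inverse mult.commute)
        moreover have "(\<lambda>i. X i - y) \<longlonglongrightarrow> x - y" using X(2) by (intro tendsto_intros)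
        ultimately have "(\<lambda>i. (\<rho> (X i - y) - \<rho> (x - y) - frechet_derivative \<rho> (at (x - y)) ((X i - y) - (x - y))) / norm ((X i - y) - (x - y))) \<longlonglongrightarrow> 0"
          using X(1) unfolding tendsto_at_iff_sequentially comp_def by (elim allE[of _ "\<lambda>i. X i - y"]) auto
        then show ?thesis by (simp add: q_def)
      qed
      then show "AE y in lborel. (\<lambda>i. q i y *\<^sub>R g y) \<longlonglongrightarrow> 0"
        by (auto intro!: AE_I2 tendsto_eq_intros)
      show "AE y in lborel. norm (q i y *\<^sub>R g y) \<le> 2 * L * norm (g y)" for i
        using qb by (auto intro!: AE_I2 mult_right_mono)
    qed (use g in auto)
    then have lim: "(\<lambda>i. norm (LINT y|lborel. q i y *\<^sub>R g y)) \<longlonglongrightarrow> 0" by (simp add: tendsto_norm_zero)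
    have "norm (LINT y|lborel. q i y *\<^sub>R g y) = norm (conv \<rho> g (X i) - conv \<rho> g x - ?D (X i - x)) / norm (X i - x)" for i
    proof -
      have "conv \<rho> g (X i) - conv \<rho> g x - ?D (X i - x)
        = (LINT y|lborel. (\<rho> (X i - y) - \<rho> (x - y) - frechet_derivative \<rho> (at (x - y)) (X i - x)) *\<^sub>R g y)"
        unfolding conv_def using int intD by (simp add: scaleR_diff_left Bochner_Integration.integral_diff)
      also have "\<dots> = (LINT y|lborel. norm (X i - x) *\<^sub>R (q i y *\<^sub>R g y))"
        using X(1) by (intro Bochner_Integration.integral_cong) (auto simp: q_def)
      also have "\<dots> = norm (X i - x) *\<^sub>R (LINT y|lborel. q i y *\<^sub>R g y)"
        by (rule integral_scaleR_right)
      finally show ?thesis using X(1) by (simp del: scaleR_scaleR)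
    qed
    then show "(\<lambda>i. norm (conv \<rho> g (X i) - conv \<rho> g x - ?D (X i - x)) / norm (X i - x)) \<longlonglongrightarrow> 0"
      using lim by simp
  qed
  ultimately show ?thesis
    by (simp add: has_derivative_iff_norm)
qed

text \<open>The induction runs over all kernels, because a derivative of the convolution is the
  convolution with a derivative of the kernel.\<close>

lemma conv_smooth:
  fixes g :: "'a::euclidean_space \<Rightarrow> 'b::euclidean_space"
  assumes "smooth \<rho>" "\<And>x. e < norm x \<Longrightarrow> \<rho> x = 0" and g: "integrable lborel g"
  shows "smooth (conv \<rho> g)"
proof -
  have "C_k k (conv \<rho> g)" for k
    using assms(1,2)
  proof (induction k arbitrary: \<rho>)
    case 0
    then show ?case
      using has_derivative_continuous[OF conv_has_derivative[OF _ _ g]]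
      by (auto intro!: continuous_at_imp_continuous_on)
  next
    case (Suc k)
    show ?case
      by (rule C_k_SucI[OF conv_has_derivative[OF Suc.prems g]])
         (use Suc.prems in \<open>auto intro!: Suc.IH smooth_deriv supp_derivative[where e = e]\<close>)
  qed
  then show ?thesis by (simp add: smooth_def)
qed

lemma conv_zero:
  fixes g :: "'a::euclidean_space \<Rightarrow> 'b::euclidean_space"
  assumes m: "mollifier e \<rho>" and "\<And>y. norm y > r \<Longrightarrow> g y = 0" "norm x \<ge> r + e"
  shows "conv \<rho> g x = 0"
proof -
  have "\<rho> (x - y) *\<^sub>R g y = 0" for y
  proof (cases "norm y > r")
    case False
    then have "e \<le> norm (x - y)" using assms(3) norm_triangle_ineq2[of x y] by simp
    then show ?thesis using m by (simp add: mollifier_def)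
  qed (use assms(2) in auto)
  then have "(\<lambda>y. \<rho> (x - y) *\<^sub>R g y) = (\<lambda>_. 0)" by (simp add: fun_eq_iff)
  then show ?thesis by (simp add: conv_def)
qed

section \<open>Weak derivatives on the disc\<close>

lemma compact_in_disc:
  assumes "compact K" "K \<subseteq> disc"
  obtains r where "0 < r" "r < 1" "K \<subseteq> cball 0 r"
proof (cases "K = {}")
  case False
  obtain x where x: "x \<in> K" "\<And>y. y \<in> K \<Longrightarrow> norm y \<le> norm x"
    using continuous_attains_sup[OF assms(1) False, of norm] continuous_on_norm_id by auto
  have "norm x < 1" using x assms by auto
  then have "0 < (1 + norm x) / 2" "(1 + norm x) / 2 < 1"
    by (auto intro: add_pos_nonneg)
  moreover have "norm x \<le> (1 + norm x) / 2" using \<open>norm x < 1\<close> by simp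
  then have "K \<subseteq> cball 0 ((1 + norm x) / 2)"
    using x(2) by force
  ultimately show thesis using that by blast
qed (use that[of "1/2"] in auto)

text \<open>Compact support in the open disc is traded for a single radius below 1 outside of which
  the function vanishes; test functions are used in this form throughout.\<close>

lemma test_functionE:
  fixes \<phi> :: "real^2 \<Rightarrow> 'b::real_normed_vector"
  assumes "test_function \<phi>"
  obtains r where "smooth \<phi>" "0 < r" "r < 1" "\<And>x. r < norm x \<Longrightarrow> \<phi> x = 0"
proof -
  have "compact (fun_support \<phi>)" "fun_support \<phi> \<subseteq> disc"
    using assms by (simp_all add: test_function_def)
  then obtain r where r: "0 < r" "r < 1" "fun_support \<phi> \<subseteq> cball 0 r"
    by (rule compact_in_disc)
  have "\<phi> x = 0" if "r < norm x" for x
  proof (rule ccontr)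
    assume "\<phi> x \<noteq> 0"
    then have "x \<in> fun_support \<phi>" using closure_subset[of "{x. \<phi> x \<noteq> 0}"] by (auto simp: fun_support_def)
    then show False using r that by auto
  qed
  then show thesis using that r assms by (auto simp: test_function_def)
qed

lemma test_functionI:
  fixes \<phi> :: "real^2 \<Rightarrow> 'b::real_normed_vector"
  assumes "smooth \<phi>" "r < 1" "\<And>x. r < norm x \<Longrightarrow> \<phi> x = 0"
  shows "test_function \<phi>"
proof -
  have "{x. \<phi> x \<noteq> 0} \<subseteq> cball 0 r" using assms(3) by (auto simp: not_less[symmetric])
  then have sub: "fun_support \<phi> \<subseteq> cball 0 r" unfolding fun_support_def by (simp add: closure_minimal)
  moreover have "closed (fun_support \<phi>)" by (simp add: fun_support_def)
  ultimately have "compact (fun_support \<phi>)" using compact_Int_closed[of "cball 0 r" "fun_support \<phi>"]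
    by (simp add: Int_absorb1)
  then show ?thesis using sub assms by (auto simp: test_function_def)
qed

lemma disc_integral:
  fixes f :: "real^2 \<Rightarrow> 'b::euclidean_space"
  shows "(LINT x|disc_measure. f x) = (LINT x|lebesgue. indicator disc x *\<^sub>R f x)"
  by (rule integral_restrict_space) auto

lemma disc_integrable:
  fixes f :: "real^2 \<Rightarrow> 'b::euclidean_space"
  shows "integrable disc_measure f \<longleftrightarrow> integrable lebesgue (\<lambda>x. indicator disc x *\<^sub>R f x)"
  by (rule integrable_restrict_space) auto

lemma disc_AE: "(AE x in disc_measure. P x) \<longleftrightarrow> (AE x in lebesgue. x \<in> disc \<longrightarrow> P x)"
  by (rule AE_restrict_space_iff) auto

lemma disc_measurable_iff:
  fixes f :: "real^2 \<Rightarrow> 'b::euclidean_space"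
  shows "f \<in> borel_measurable disc_measure \<longleftrightarrow> (\<lambda>x. indicator disc x *\<^sub>R f x) \<in> borel_measurable lebesgue"
  by (rule borel_measurable_restrict_space_iff) auto

lemma locally_integrableD:
  assumes "locally_integrable u" "r < 1"
  shows "integrable lebesgue (\<lambda>x. indicator (cball 0 r) x *\<^sub>R u x)"
proof -
  have "cball 0 r \<subseteq> disc" using assms(2) by auto
  then have "u absolutely_integrable_on cball 0 r" using assms(1) by (simp add: locally_integrable_def)
  then show ?thesis by (simp add: set_integrable_def)
qed

lemma locally_integrableI:
  fixes u :: "real^2 \<Rightarrow> 'b::euclidean_space"
  assumes "\<And>r. 0 < r \<Longrightarrow> r < 1 \<Longrightarrow> integrable lebesgue (\<lambda>x. indicator (cball 0 r) x *\<^sub>R u x)"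
  shows "locally_integrable u"
  unfolding locally_integrable_def
proof (intro allI impI)
  fix K :: "(real^2) set" assume K: "compact K \<and> K \<subseteq> disc"
  then obtain r where r: "0 < r" "r < 1" "K \<subseteq> cball 0 r" using compact_in_disc by metis
  have "set_integrable lebesgue (cball 0 r) u" using assms[OF r(1,2)] by (simp add: set_integrable_def)
  then show "u absolutely_integrable_on K"
    by (rule set_integrable_subset) (use K r lmeasurable_compact[of K] in \<open>auto simp: fmeasurableD\<close>)
qed

text \<open>The truncations to balls of radius 1 - 1 / (i + 1) are measurable, and at each point of
  the open disc they are eventually equal to \<open>u\<close>.\<close>

lemma locally_integrable_measurable:
  assumes "locally_integrable u"
  shows "u \<in> borel_measurable disc_measure"
  unfolding disc_measurable_iff
proof (rule borel_measurable_LIMSEQ_metric)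
  let ?r = "\<lambda>i::nat. 1 - 1 / real (Suc i)"
  show "(\<lambda>x. indicator (cball 0 (?r i)) x *\<^sub>R u x) \<in> borel_measurable lebesgue" for i
    using locally_integrableD[OF assms, of "?r i"] by auto
  fix x :: "real^2"
  show "(\<lambda>i. indicator (cball 0 (?r i)) x *\<^sub>R u x) \<longlonglongrightarrow> indicator disc x *\<^sub>R u x"
  proof (cases "norm x < 1")
    case True
    have "?r \<longlonglongrightarrow> 1" by real_asymp
    then have "eventually (\<lambda>i. norm x < ?r i) sequentially" using True order_tendstoD(1) by blast
    then have "eventually (\<lambda>i. indicator (cball 0 (?r i)) x *\<^sub>R u x = indicator disc x *\<^sub>R u x) sequentially"
      by (rule eventually_mono) (use True in \<open>simp add: indicator_def\<close>)
    then show ?thesis by (rule tendsto_eventually)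
  next
    case False
    have "?r i < norm x" for i using False by (smt (verit) divide_pos_pos of_nat_0_less_iff zero_less_Suc)
    then have "indicator (cball 0 (?r i)) x *\<^sub>R u x = 0" for i
      unfolding mem_cball_0 indicator_def using not_le by (auto simp del: of_nat_Suc)
    moreover have "indicator disc x *\<^sub>R u x = 0" using False by simp
    ultimately show ?thesis by (simp only: tendsto_const)
  qed
qed

lemma locally_integrable_bound:
  fixes u :: "real^2 \<Rightarrow> 'b::euclidean_space" and v :: "real^2 \<Rightarrow> real"
  assumes "u \<in> borel_measurable disc_measure" "locally_integrable v"
    and "AE x in disc_measure. norm (u x) \<le> v x"
  shows "locally_integrable u"
proof (rule locally_integrableI)
  fix r :: real assume r: "0 < r" "r < 1"
  have sub: "cball 0 r \<subseteq> (disc :: (real^2) set)" using r by auto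
  show "integrable lebesgue (\<lambda>x. indicator (cball 0 r) x *\<^sub>R u x)"
  proof (rule Bochner_Integration.integrable_bound[OF locally_integrableD[OF assms(2) r(2)]])
    have "(\<lambda>x. indicator (cball 0 r) x *\<^sub>R (indicator disc x *\<^sub>R u x)) \<in> borel_measurable lebesgue"
      using assms(1) unfolding disc_measurable_iff
      by (rule borel_measurable_scaleR[OF borel_measurable_indicator, rotated]) auto
    also have "(\<lambda>x. indicator (cball 0 r) x *\<^sub>R (indicator disc x *\<^sub>R u x)) = (\<lambda>x. indicator (cball 0 r) x *\<^sub>R u x)"
      using sub by (auto simp: indicator_def fun_eq_iff)
    finally show "(\<lambda>x. indicator (cball 0 r) x *\<^sub>R u x) \<in> borel_measurable lebesgue" .
    show "AE x in lebesgue. norm (indicator (cball 0 r) x *\<^sub>R u x) \<le> norm (indicator (cball 0 r) x *\<^sub>R v x)"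
      using assms(3) unfolding disc_AE
      by eventually_elim (use sub in \<open>auto simp: indicator_def\<close>)
  qed
qed

lemma locally_integrable_const: "locally_integrable (\<lambda>x. c)"
  by (auto simp: locally_integrable_def intro!: absolutely_integrable_on_const lmeasurable_compact)

lemma locally_integrable_add:
  "locally_integrable u \<Longrightarrow> locally_integrable v \<Longrightarrow> locally_integrable (\<lambda>x. u x + v x)"
  by (auto simp: locally_integrable_def intro!: set_integral_add)

lemma locally_integrable_linear:
  fixes h :: "'b::euclidean_space \<Rightarrow> 'c::euclidean_space"
  shows "locally_integrable u \<Longrightarrow> bounded_linear h \<Longrightarrow> locally_integrable (\<lambda>x. h (u x))"
  using absolutely_integrable_linear[where f = u and h = h] by (auto simp: locally_integrable_def o_def)

lemma locally_integrable_norm: "locally_integrable u \<Longrightarrow> locally_integrable (\<lambda>x. norm (u x))"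
  by (auto simp: locally_integrable_def intro: absolutely_integrable_norm[unfolded o_def])

lemma disc_measurable_cong_AE:
  fixes f f' :: "real^2 \<Rightarrow> 'b::euclidean_space"
  assumes "f \<in> borel_measurable disc_measure" "AE x in disc_measure. f x = f' x"
  shows "f' \<in> borel_measurable disc_measure"
proof -
  have "AE x in lebesgue. indicator disc x *\<^sub>R f x = indicator disc x *\<^sub>R f' x"
    using assms(2) unfolding disc_AE by eventually_elim (auto simp: indicator_def)
  then show ?thesis
    using assms(1) unfolding disc_measurable_iff by (rule borel_measurable_AE[rotated])
qed

lemma disc_integrable_cong_AE:
  fixes f f' :: "real^2 \<Rightarrow> 'b::euclidean_space"
  assumes "AE x in disc_measure. f x = f' x"
  shows "integrable disc_measure f \<longleftrightarrow> integrable disc_measure f'"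
proof -
  have "AE x in disc_measure. f' x = f x" using assms by eventually_elim simp
  then show ?thesis
    using assms
    by (auto intro: integrable_cong_AE_imp disc_measurable_cong_AE dest: borel_measurable_integrable)
qed

text \<open>Completeness of Lebesgue measure transfers integrability along almost everywhere
  equality; when it fails, it fails on both sides and both integrals are zero by convention.
  Expressions in the arbitrary representatives \<open>pd\<close> can thus be replaced
  freely.\<close>

lemma disc_integral_cong_AE:
  fixes f f' :: "real^2 \<Rightarrow> 'b::euclidean_space"
  assumes "AE x in disc_measure. f x = f' x"
  shows "(LINT x|disc_measure. f x) = (LINT x|disc_measure. f' x)"
proof (cases "integrable disc_measure f")
  case True
  then show ?thesis
    using disc_integrable_cong_AE[OF assms] assms by (intro integral_cong_AE) auto
next
  case False
  then show ?thesis
    using disc_integrable_cong_AE[OF assms] by (simp add: not_integrable_integral_eq)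
qed

lemma locally_integrable_cong_AE:
  fixes u u' :: "real^2 \<Rightarrow> 'b::euclidean_space"
  assumes "locally_integrable u" "AE x in disc_measure. u x = u' x"
  shows "locally_integrable u'"
proof (rule locally_integrable_bound)
  show "u' \<in> borel_measurable disc_measure"
    using locally_integrable_measurable disc_measurable_cong_AE assms by blast
  show "locally_integrable (\<lambda>x. norm (u x))" by (rule locally_integrable_norm[OF assms(1)])
  show "AE x in disc_measure. norm (u' x) \<le> norm (u x)" using assms(2) by eventually_elim simp
qed

lemma weak_partial_cong_AE:
  fixes u u' v v' :: "real^2 \<Rightarrow> 'b::euclidean_space"
  assumes "weak_partial i u v" and u: "AE x in disc_measure. u x = u' x" and v: "AE x in disc_measure. v x = v' x"
  shows "weak_partial i u' v'"
proof -
  have "(LINT x|disc_measure. \<psi> x *\<^sub>R f x) = (LINT x|disc_measure. \<psi> x *\<^sub>R f' x)"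
    if "AE x in disc_measure. f x = f' x" for f f' :: "real^2 \<Rightarrow> 'b" and \<psi> :: "real^2 \<Rightarrow> real"
    by (rule disc_integral_cong_AE) (use that in eventually_elim, simp)
  from this[OF u] this[OF v] show ?thesis
    using assms(1) locally_integrable_cong_AE[OF _ u] locally_integrable_cong_AE[OF _ v]
    by (simp add: weak_partial_def)
qed

section \<open>Mollification of weak derivatives\<close>

lemma lebesgue_borel_rep:
  fixes f :: "'a::euclidean_space \<Rightarrow> 'b::euclidean_space"
  assumes "integrable lebesgue f"
  obtains g where "integrable lborel g" "AE x in lebesgue. f x = g x"
proof -
  have "\<exists>g'\<in>borel_measurable lborel. (AE x in lborel. f x \<bullet> b = g' x)" for b
    using assms by (intro completion_ex_borel_measurable_real) auto
  then obtain g' where g': "\<And>b. g' b \<in> borel_measurable lborel" "\<And>b. AE x in lborel. f x \<bullet> b = g' b x"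
    by metis
  define g where "g x = (\<Sum>b\<in>Basis. g' b x *\<^sub>R b)" for x
  have "AE x in lborel. \<forall>b\<in>Basis. f x \<bullet> b = g' b x"
    using g'(2) by (intro AE_finite_allI) auto
  then have "AE x in lborel. f x = g x"
    by eventually_elim (simp add: g_def euclidean_eq_iff[where 'a = 'b] inner_sum_left_Basis)
  then have ae: "AE x in lebesgue. f x = g x" by (rule AE_completion)
  have m: "g \<in> borel_measurable lborel"
    unfolding g_def using g'(1) by (intro borel_measurable_sum borel_measurable_scaleR) auto
  then have "integrable lebesgue g"
    using integrable_cong_AE_imp[OF assms measurable_completion[OF m]] ae by simp
  then have "integrable lborel g" using m by (simp add: integrable_completion)
  then show thesis using ae that by blast
qed

lemma weak_partial_locI:
  assumes "weak_partial i u v"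
  shows "locally_integrable u" "locally_integrable v" "u \<in> borel_measurable disc_measure" "v \<in> borel_measurable disc_measure"
  using assms locally_integrable_measurable by (auto simp: weak_partial_def)

text \<open>The weak derivative is tested with \<open>\<phi> y = \<rho> (x - y)\<close>, whose
  derivative in \<open>y\<close> is minus that of the kernel. The condition on
  \<open>norm x + e\<close> keeps the support of this test function in the ball on which
  \<open>G\<close> and \<open>H\<close> represent \<open>u\<close> and \<open>v\<close>.\<close>

lemma mollified_partial:
  fixes u v :: "real^2 \<Rightarrow> 'b::euclidean_space"
  assumes wp: "weak_partial i u v" and m: "mollifier e \<rho>" and r: "r < 1" and x: "norm x + e \<le> r"
    and G: "integrable lborel G" "AE x in lebesgue. indicator (cball 0 r) x *\<^sub>R u x = G x"
    and H: "integrable lborel H" "AE x in lebesgue. indicator (cball 0 r) x *\<^sub>R v x = H x"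
  shows "cpd i (conv \<rho> G) x = conv \<rho> H x"
proof -
  define \<phi> where "\<phi> y = \<rho> (x - y)" for y
  have s: "smooth \<rho>" using m by (simp add: mollifier_def)
  have der: "(\<phi> has_derivative (\<lambda>v. frechet_derivative \<rho> (at (x - y)) (- v))) (at y)" for y
    unfolding \<phi>_def
    by (rule has_derivative_compose[OF _ smooth_has_derivative[OF s]]) (auto intro!: derivative_eq_intros)
  have \<phi>s: "smooth \<phi>"
  proof -
    have "C_k k (\<lambda>y. x + - 1 *\<^sub>R y)" for k
      by (intro C_k_add C_k_const C_k_linear bounded_linear_scaleR_right)
    then have "C_k k \<phi>" for k
      using C_k_compose[of k \<rho> "\<lambda>y. x + - 1 *\<^sub>R y"] s by (simp add: \<phi>_def[abs_def] smooth_def)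
    then show ?thesis by (simp add: smooth_def)
  qed
  have z: "\<phi> y = 0" if "r < norm y" for y
  proof -
    have "e \<le> norm (x - y)" using that x norm_triangle_ineq2[of y x] by (simp add: norm_minus_commute)
    then show ?thesis using m by (simp add: \<phi>_def mollifier_def)
  qed
  have test: "test_function \<phi>" by (rule test_functionI[OF \<phi>s r z])
  have lin: "linear (frechet_derivative \<rho> (at y))" for y
    using smooth_has_derivative[OF s] has_derivative_linear by blast
  have cpd: "cpd i \<phi> y = - frechet_derivative \<rho> (at (x - y)) (axis i 1)" for y
    unfolding cpd_def frechet_derivative_at[OF der, symmetric] by (simp add: linear_neg[OF lin])
  have zD: "cpd i \<phi> y = 0" if "r < norm y" for y
    unfolding cpd_def by (rule supp_derivative[OF z that])
  \<comment> \<open>The weight vanishes outside the ball of radius \<open>r\<close>, so the integral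
    over the disc only sees the truncations and can be computed with their Borel versions.\<close>
  have swap: "(LINT y|disc_measure. \<psi> y *\<^sub>R f y) = (LINT y|lborel. \<psi> y *\<^sub>R F y)"
    if "\<And>y. r < norm y \<Longrightarrow> \<psi> y = (0::real)" "continuous_on UNIV \<psi>"
       "AE x in lebesgue. indicator (cball 0 r) x *\<^sub>R f x = F x" "integrable lborel F"
    for \<psi> and f F :: "real^2 \<Rightarrow> 'b"
  proof -
    have [measurable]: "\<psi> \<in> borel_measurable borel" using that by (intro borel_measurable_continuous_onI)
    have [measurable]: "F \<in> borel_measurable borel" using that by auto
    have *: "AE y in lebesgue. indicator disc y *\<^sub>R (\<psi> y *\<^sub>R f y) = \<psi> y *\<^sub>R F y"
      using that(3)
    proof eventually_elim
      case (elim y)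
      then show ?case using that(1)[of y] r by (cases "r < norm y") (auto simp: indicator_def)
    qed
    have m2: "(\<lambda>y. \<psi> y *\<^sub>R F y) \<in> borel_measurable lborel" by measurable
    have m3: "(\<lambda>y. \<psi> y *\<^sub>R F y) \<in> borel_measurable lebesgue" by (rule measurable_completion[OF m2])
    have "AE y in lebesgue. \<psi> y *\<^sub>R F y = indicator disc y *\<^sub>R (\<psi> y *\<^sub>R f y)" using * by eventually_elim simp
    then have "(\<lambda>y. indicator disc y *\<^sub>R (\<psi> y *\<^sub>R f y)) \<in> borel_measurable lebesgue"
      by (rule borel_measurable_AE[OF m3])
    then have "(LINT y|disc_measure. \<psi> y *\<^sub>R f y) = (LINT y|lebesgue. \<psi> y *\<^sub>R F y)"
      unfolding disc_integral by (rule integral_cong_AE[OF _ m3 *])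
    also have "\<dots> = (LINT y|lborel. \<psi> y *\<^sub>R F y)" by (rule integral_completion[OF m2])
    finally show ?thesis .
  qed
  have "cpd i (conv \<rho> G) x = conv (\<lambda>x. frechet_derivative \<rho> (at x) (axis i 1)) G x"
    unfolding cpd_def
    using frechet_derivative_at[OF conv_has_derivative[OF s mollifier_zero[OF m] G(1)]] by metis
  also have "\<dots> = - (LINT y|lborel. cpd i \<phi> y *\<^sub>R G y)"
    by (simp add: conv_def cpd flip: integral_minus)
  also have "\<dots> = - (LINT y|disc_measure. cpd i \<phi> y *\<^sub>R u y)"
    using swap[of "cpd i \<phi>" u G] zD G smooth_continuous[OF smooth_deriv[OF \<phi>s]] by (simp add: cpd_def)
  also have "\<dots> = (LINT y|disc_measure. \<phi> y *\<^sub>R v y)"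
    using wp test by (simp add: weak_partial_def)
  also have "\<dots> = (LINT y|lborel. \<phi> y *\<^sub>R H y)"
    using swap[of \<phi> v H] z H smooth_continuous[OF \<phi>s] by simp
  finally show ?thesis by (simp add: conv_def \<phi>_def)
qed

text \<open>The set \<open>I\<close> of directions allows one to use a single sequence for both partial derivatives.\<close>

lemma weak_partial_approx:
  fixes u :: "real^2 \<Rightarrow> 'b::euclidean_space"
  assumes wp: "\<And>i. i \<in> I \<Longrightarrow> weak_partial i u (v i)" and u: "locally_integrable u" and r: "0 < r" "r < 1"
  obtains U where "\<And>k::nat. smooth (U k)"
    "(\<lambda>k. \<integral>\<^sup>+x. ennreal (norm (indicator (cball 0 r) x *\<^sub>R (U k x - u x))) \<partial>lebesgue) \<longlonglongrightarrow> 0"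
    "\<And>i. i \<in> I \<Longrightarrow>
       (\<lambda>k. \<integral>\<^sup>+x. ennreal (norm (indicator (cball 0 r) x *\<^sub>R (cpd i (U k) x - v i x))) \<partial>lebesgue) \<longlonglongrightarrow> 0"
    "AE x in disc_measure. norm x \<le> r \<longrightarrow> (\<lambda>k. U k x) \<longlonglongrightarrow> u x"
    "\<And>M k x. 0 \<le> M \<Longrightarrow> (AE x in disc_measure. norm (u x) \<le> M) \<Longrightarrow> norm (U k x) \<le> M"
    "\<And>i M k x. 0 \<le> M \<Longrightarrow> i \<in> I \<Longrightarrow> (AE x in disc_measure. norm (v i x) \<le> M) \<Longrightarrow> norm x \<le> r \<Longrightarrow>
       norm (cpd i (U k) x) \<le> M"
proof -
  \<comment> \<open>The margin \<open>r' - r\<close> bounds the mollification radius: on the ball of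
    radius \<open>r\<close> only values inside radius \<open>r'\<close> are averaged, still away
    from the circle.\<close>
  define r' where "r' = (1 + r) / 2"
  have r': "r < r'" "r' < 1" using r by (auto simp: r'_def)
  obtain G where G: "integrable lborel G" "AE x in lebesgue. indicator (cball 0 r') x *\<^sub>R u x = G x"
    using lebesgue_borel_rep[OF locally_integrableD[OF u r'(2)]] by blast
  have "\<exists>H. integrable lborel H \<and> (i \<in> I \<longrightarrow> (AE x in lebesgue. indicator (cball 0 r') x *\<^sub>R v i x = H x))" for i
  proof (cases "i \<in> I")
    case True
    show ?thesis
      using lebesgue_borel_rep[OF locally_integrableD[OF weak_partial_locI(2)[OF wp[OF True]] r'(2)]] by blast
  qed (auto intro!: exI[of _ "\<lambda>_. 0"])
  then obtain H where H: "\<And>i. integrable lborel (H i)"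
    "\<And>i. i \<in> I \<Longrightarrow> AE x in lebesgue. indicator (cball 0 r') x *\<^sub>R v i x = H i x"
    by metis
  define P where "P k \<rho> \<longleftrightarrow> mollifier (r' - r) \<rho> \<and>
      (\<integral>\<^sup>+x. ennreal (norm (conv \<rho> G x - G x)) \<partial>lborel) \<le> ennreal (1 / Suc k) \<and>
      (\<forall>i. (\<integral>\<^sup>+x. ennreal (norm (conv \<rho> (H i) x - H i x)) \<partial>lborel) \<le> ennreal (1 / Suc k))"
    for k :: nat and \<rho>
  have "\<forall>k. \<exists>\<rho>. P k \<rho>"
  proof
    fix k
    have k: "0 < 1 / real (Suc k)" by simp
    obtain d where d: "d > 0" "\<And>\<rho> s. mollifier s \<rho> \<Longrightarrow> s \<le> d \<Longrightarrow>
        (\<integral>\<^sup>+x. ennreal (norm (conv \<rho> G x - G x)) \<partial>lborel) \<le> ennreal (1 / Suc k)"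
      using conv_L1[OF G(1) k] by blast
    have "\<exists>d>0. \<forall>\<rho> s. mollifier s \<rho> \<longrightarrow> s \<le> d \<longrightarrow>
        (\<integral>\<^sup>+x. ennreal (norm (conv \<rho> (H i) x - H i x)) \<partial>lborel) \<le> ennreal (1 / Suc k)" for i
      using conv_L1[OF H(1) k] by metis
    then obtain d' where d': "\<And>i. d' i > 0" "\<And>i \<rho> s. mollifier s \<rho> \<Longrightarrow> s \<le> d' i \<Longrightarrow>
        (\<integral>\<^sup>+x. ennreal (norm (conv \<rho> (H i) x - H i x)) \<partial>lborel) \<le> ennreal (1 / Suc k)"
      by metis
    \<comment> \<open>There are only two directions, so the minimum over them is positive and one
      kernel is good for \<open>u\<close> and for all its derivatives.\<close>
    define e where "e = min (min d (r' - r)) (Min (range d'))"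
    have "e > 0" using d d' r' by (auto simp: e_def)
    moreover have "e \<le> d" "e \<le> r' - r" "\<And>i. e \<le> d' i" by (auto simp: e_def min.coboundedI2)
    moreover obtain \<rho> :: "real^2 \<Rightarrow> real" where "mollifier e \<rho>" using mollifier_exists[OF \<open>e > 0\<close>] by blast
    ultimately have e: "e \<le> d" "e \<le> r' - r" "\<And>i. e \<le> d' i" "mollifier e \<rho>" by auto
    have "mollifier (r' - r) \<rho>" using e(2,4) by (auto simp: mollifier_def)
    then show "\<exists>\<rho>. P k \<rho>" unfolding P_def using d(2)[OF e(4,1)] d'(2)[OF e(4,3)] by blast
  qed
  then obtain \<rho> where "\<forall>k. P k (\<rho> k)" using choice[of P] by blast
  then have \<rho>: "\<And>k. mollifier (r' - r) (\<rho> k)"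
      "\<And>k. (\<integral>\<^sup>+x. ennreal (norm (conv (\<rho> k) G x - G x)) \<partial>lborel) \<le> ennreal (1 / Suc k)"
      "\<And>k i. (\<integral>\<^sup>+x. ennreal (norm (conv (\<rho> k) (H i) x - H i x)) \<partial>lborel) \<le> ennreal (1 / Suc k)"
    unfolding P_def by blast+
  have lim0: "(\<lambda>k. ennreal (1 / Suc k)) \<longlonglongrightarrow> 0"
    using LIMSEQ_inverse_real_of_nat by (subst ennreal_0[symmetric], intro tendsto_ennrealI) (simp add: inverse_eq_divide)
  have smooth: "smooth (conv (\<rho> k) G)" for k
    by (rule conv_smooth[OF _ mollifier_zero[OF \<rho>(1)] G(1)]) (use \<rho>(1) in \<open>auto simp: mollifier_def\<close>)
  have [measurable]: "G \<in> borel_measurable borel" using borel_measurable_integrable[OF G(1)] by simp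
  have cm[measurable]: "conv (\<rho> k) G \<in> borel_measurable borel" for k
    using smooth_continuous[OF smooth] by (rule borel_measurable_continuous_onI)
  have intd: "integrable lborel (\<lambda>x. conv (\<rho> k) G x - G x)" for k
    using \<rho>(2)[of k] by (auto simp: integrable_iff_bounded intro: le_less_trans)
  have "(\<lambda>k. \<integral>\<^sup>+x. ennreal (norm (conv (\<rho> k) G x - G x)) \<partial>lborel) \<longlonglongrightarrow> 0"
    by (rule tendsto_sandwich[OF _ _ tendsto_const lim0]) (auto intro!: always_eventually \<rho>(2) simp del: of_nat_Suc)
  then have "(\<lambda>k. ennreal (LINT x|lborel. norm (conv (\<rho> k) G x - G x))) \<longlonglongrightarrow> ennreal 0"
    using intd by (simp add: nn_integral_eq_integral)
  then have "(\<lambda>k. LINT x|lborel. norm (conv (\<rho> k) G x - G x)) \<longlonglongrightarrow> 0"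
    by (subst (asm) tendsto_ennreal_iff) (auto intro!: always_eventually)
  \<comment> \<open>L^1 convergence gives pointwise convergence only along a subsequence; the
    sequence returned in the end is this subsequence.\<close>
  then obtain s where s: "strict_mono s" "AE x in lborel. (\<lambda>k. conv (\<rho> (s k)) G x - G x) \<longlonglongrightarrow> 0"
    using tendsto_L1_AE_subseq[where u = "\<lambda>k x. conv (\<rho> k) G x - G x" and M = lborel, OF intd] by blast
  have part: "cpd i (conv (\<rho> k) G) x = conv (\<rho> k) (H i) x" if "i \<in> I" "norm x \<le> r" for i k x
    by (rule mollified_partial[OF wp[OF that(1)] \<rho>(1) r'(2) _ G H[of i]])
       (use that in auto)
  have s_lim: "(\<lambda>k. ennreal (1 / Suc (s k))) \<longlonglongrightarrow> 0"
    using LIMSEQ_subseq_LIMSEQ[OF lim0 s(1)] by (simp add: o_def)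
  have bound: "norm (conv (\<rho> k) F x) \<le> M"
    if "0 \<le> M" "AE x in disc_measure. norm (f x) \<le> M" "integrable lborel F"
      "AE x in lebesgue. indicator (cball 0 r') x *\<^sub>R f x = F x" for f F :: "real^2 \<Rightarrow> 'b" and M k x
  proof -
    have "AE y in lebesgue. norm (F y) \<le> M"
      using that(2,4) unfolding disc_AE
    proof eventually_elim
      case (elim y)
      show ?case
        using elim r' that(1) by (cases "norm y \<le> r'") (auto simp flip: elim(2))
    qed
    then have "AE y in lborel. norm (x - y) < r' - r \<longrightarrow> norm (F y - 0) \<le> M"
      unfolding AE_completion_iff by eventually_elim simp
    then show ?thesis using conv_near_const[OF \<rho>(1) that(3), where x = x and c = 0 and \<delta> = M] by simp
  qed
  have L1: "(\<lambda>k. \<integral>\<^sup>+x. ennreal (norm (indicator (cball 0 r) x *\<^sub>R (W k x - f x))) \<partial>lebesgue) \<longlonglongrightarrow> 0"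
    if W: "\<And>k x. norm x \<le> r \<Longrightarrow> W k x = conv (\<rho> (s k)) F x" and
      F: "AE x in lebesgue. indicator (cball 0 r') x *\<^sub>R f x = F x" and
      b: "\<And>k. (\<integral>\<^sup>+x. ennreal (norm (conv (\<rho> k) F x - F x)) \<partial>lborel) \<le> ennreal (1 / Suc k)"
    for f F :: "real^2 \<Rightarrow> 'b" and W
  proof (rule tendsto_sandwich[OF _ _ tendsto_const s_lim])
    have "(\<integral>\<^sup>+x. ennreal (norm (indicator (cball 0 r) x *\<^sub>R (W k x - f x))) \<partial>lebesgue)
       \<le> (\<integral>\<^sup>+x. ennreal (norm (conv (\<rho> (s k)) F x - F x)) \<partial>lebesgue)" for k
    proof (rule nn_integral_mono_AE)
      show "AE x in lebesgue. ennreal (norm (indicator (cball 0 r) x *\<^sub>R (W k x - f x)))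
          \<le> ennreal (norm (conv (\<rho> (s k)) F x - F x))"
        using F by eventually_elim (use W r' in \<open>auto simp: indicator_def\<close>)
    qed
    then show "eventually (\<lambda>k. (\<integral>\<^sup>+x. ennreal (norm (indicator (cball 0 r) x *\<^sub>R (W k x - f x))) \<partial>lebesgue)
        \<le> ennreal (1 / Suc (s k))) sequentially"
      by (intro always_eventually allI order_trans[OF _ b]) (simp add: nn_integral_completion)
  qed auto
  show thesis
  proof (rule that[of "\<lambda>k. conv (\<rho> (s k)) G"])
    show "AE x in disc_measure. norm x \<le> r \<longrightarrow> (\<lambda>k. conv (\<rho> (s k)) G x) \<longlonglongrightarrow> u x"
      unfolding disc_AE using AE_completion[OF s(2)] G(2)
      by eventually_elim (use r' in \<open>auto simp: indicator_def LIM_zero_iff\<close>)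
    show "(\<lambda>k. \<integral>\<^sup>+x. ennreal (norm (indicator (cball 0 r) x *\<^sub>R (conv (\<rho> (s k)) G x - u x))) \<partial>lebesgue) \<longlonglongrightarrow> 0"
      by (rule L1[OF _ G(2) \<rho>(2)]) auto
    show "(\<lambda>k. \<integral>\<^sup>+x. ennreal (norm (indicator (cball 0 r) x *\<^sub>R (cpd i (conv (\<rho> (s k)) G) x - v i x))) \<partial>lebesgue) \<longlonglongrightarrow> 0"
      if "i \<in> I" for i
      by (rule L1[OF _ H(2)[OF that] \<rho>(3)]) (use part that in auto)
    show "norm (conv (\<rho> (s k)) G x) \<le> M" if "0 \<le> M" "AE x in disc_measure. norm (u x) \<le> M" for M k x
      by (rule bound[OF that G])
    show "norm (cpd i (conv (\<rho> (s k)) G) x) \<le> M"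
      if "0 \<le> M" "i \<in> I" "AE x in disc_measure. norm (v i x) \<le> M" "norm x \<le> r" for i M k x
      using bound[OF that(1,3) H(1) H(2)[OF that(2)]] part that by simp
  qed (rule smooth)
qed

text \<open>Translation invariance makes the integral of every difference quotient zero. The steps
  are at most 1, so the quotients are dominated by the Lipschitz constant on the ball of radius r +
  1, and dominated convergence applies.\<close>

lemma integral_cpd_eq_0:
  fixes f :: "real^2 \<Rightarrow> 'b::euclidean_space"
  assumes f: "C_k (Suc 0) f" and z: "\<And>x. r < norm x \<Longrightarrow> f x = 0"
  shows "(LINT x|lebesgue. cpd i f x) = 0" "integrable lebesgue (cpd i f)"
proof -
  obtain L where L: "L > 0" "\<And>x y. norm (f x - f y) \<le> L * norm (x - y)"
    by (rule C_1_supp_lipschitz[OF f, of r], erule z, rule that)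
  define e :: "real^2" where "e = axis i 1"
  have e: "norm e = 1" by (simp add: e_def)
  define h where "h k = 1 / real (Suc k)" for k
  have h: "0 < h k" "h k \<le> 1" for k by (auto simp: h_def)
  have h0: "h \<longlonglongrightarrow> 0" unfolding h_def by real_asymp
  have cont: "continuous_on UNIV f" using C_k_imp_continuous[OF f] .
  have contD: "continuous_on UNIV (cpd i f)" using C_k_deriv[OF f] by (simp add: cpd_def[abs_def])
  have [measurable]: "f \<in> borel_measurable borel" "cpd i f \<in> borel_measurable borel"
    using cont contD by (auto intro: borel_measurable_continuous_onI)
  have int_supp: "integrable lborel g" if "continuous_on UNIV g" "\<And>x. R < norm x \<Longrightarrow> g x = 0"
    for g :: "real^2 \<Rightarrow> 'b" and R
  proof -
    have "integrable lborel (\<lambda>x. indicator (cball 0 R) x *\<^sub>R g x)"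
      using borel_integrable_compact[OF compact_cball continuous_on_subset[OF that(1)]] by simp
    also have "(\<lambda>x. indicator (cball 0 R) x *\<^sub>R g x) = g"
      using that(2) by (auto simp: fun_eq_iff indicator_def)
    finally show ?thesis .
  qed
  have intf: "integrable lborel f" by (rule int_supp[OF cont z])
  have intD: "integrable lborel (cpd i f)"
    by (rule int_supp[OF contD, of r]) (simp add: cpd_def supp_derivative[OF z])
  then show "integrable lebesgue (cpd i f)" by (simp add: integrable_completion)
  have shift: "integrable lborel (\<lambda>x. f (x + a))" "(LINT x|lborel. f (x + a)) = (LINT x|lborel. f x)" for a
  proof -
    have "(LINT x|lborel. f x) = (LINT x|distr lborel borel ((+) a). f x)" by (simp only: lborel_distr_plus)
    also have "\<dots> = (LINT x|lborel. f (x + a))" by (subst integral_distr) (auto simp: add.commute)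
    finally show "(LINT x|lborel. f (x + a)) = (LINT x|lborel. f x)" by simp
    have "integrable (distr lborel borel ((+) a)) f" using intf by (simp only: lborel_distr_plus)
    then show "integrable lborel (\<lambda>x. f (x + a))" by (subst (asm) integrable_distr_eq) (auto simp: add.commute)
  qed
  define q where "q k x = (1 / h k) *\<^sub>R (f (x + h k *\<^sub>R e) - f x)" for k x
  have q0: "(LINT x|lborel. q k x) = 0" for k
    unfolding q_def using shift intf by (simp add: Bochner_Integration.integral_diff)
  have "(\<lambda>k. LINT x|lborel. q k x) \<longlonglongrightarrow> (LINT x|lborel. cpd i f x)"
  proof (rule integral_dominated_convergence[where w = "\<lambda>x. L * indicator (cball 0 (r + 1)) x"])
    show "integrable lborel (\<lambda>x::real^2. L * indicator (cball 0 (r + 1)) x)"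
      by (intro integrable_mult_right integrable_real_indicator) (use emeasure_bounded_finite[OF bounded_cball, of "0::real^2" "r + 1"] in \<open>auto simp: infinity_ennreal_def\<close>)
    show "AE x in lborel. (\<lambda>k. q k x) \<longlonglongrightarrow> cpd i f x"
    proof (rule AE_I2)
      fix x
      let ?D = "frechet_derivative f (at x)"
      have D: "(f has_derivative ?D) (at x)" by (rule C_1_has_derivative[OF f])
      have "((\<lambda>y. (1 / norm (y - x)) *\<^sub>R (f y - (f x + ?D (y - x)))) \<longlongrightarrow> 0) (at x)"
        using D by (simp add: has_derivative_within divide_inverse)
      moreover have "(\<lambda>k. x + h k *\<^sub>R e) \<longlonglongrightarrow> x + 0 *\<^sub>R e" using h0 by (intro tendsto_intros)
      ultimately have "(\<lambda>k. (1 / norm (x + h k *\<^sub>R e - x)) *\<^sub>R (f (x + h k *\<^sub>R e) - (f x + ?D (x + h k *\<^sub>R e - x)))) \<longlonglongrightarrow> 0"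
        using h e unfolding tendsto_at_iff_sequentially comp_def
        by (elim allE[of _ "\<lambda>k. x + h k *\<^sub>R e"]) (auto simp: less_imp_neq[symmetric])
      also have "(\<lambda>k. (1 / norm (x + h k *\<^sub>R e - x)) *\<^sub>R (f (x + h k *\<^sub>R e) - (f x + ?D (x + h k *\<^sub>R e - x))))
          = (\<lambda>k. q k x - cpd i f x)"
      proof
        fix k
        have "?D (h k *\<^sub>R e) = h k *\<^sub>R cpd i f x"
          using linear_cmul[OF has_derivative_linear[OF D]] by (simp add: cpd_def e_def)
        then show "(1 / norm (x + h k *\<^sub>R e - x)) *\<^sub>R (f (x + h k *\<^sub>R e) - (f x + ?D (x + h k *\<^sub>R e - x)))
           = q k x - cpd i f x"
          using h[of k] e by (simp add: q_def scaleR_diff_right scaleR_add_right)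
      qed
      finally show "(\<lambda>k. q k x) \<longlonglongrightarrow> cpd i f x" by (simp add: LIM_zero_iff)
    qed
    show "AE x in lborel. norm (q k x) \<le> L * indicator (cball 0 (r + 1)) x" for k
    proof (rule AE_I2)
      fix x
      show "norm (q k x) \<le> L * indicator (cball 0 (r + 1)) x"
      proof (cases "norm x \<le> r + 1")
        case True
        have "norm (f (x + h k *\<^sub>R e) - f x) \<le> L * h k" using L(2)[of "x + h k *\<^sub>R e" x] h[of k] e by simp
        then show ?thesis using True h[of k] by (simp add: q_def pos_divide_le_eq)
      next
        case False
        have "norm x \<le> norm (x + h k *\<^sub>R e) + h k"
          using norm_triangle_ineq4[of "x + h k *\<^sub>R e" "h k *\<^sub>R e"] e h[of k] by simp
        then have "f (x + h k *\<^sub>R e) = 0" "f x = 0" using False h[of k] by (auto intro!: z)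
        then show ?thesis using L by (simp add: q_def indicator_def)
      qed
    qed
  qed (auto simp: q_def)
  then have "(LINT x|lborel. cpd i f x) = 0" by (simp add: q0 LIMSEQ_const_iff)
  then show "(LINT x|lebesgue. cpd i f x) = 0" by (simp add: integral_completion)
qed

lemma integrable_supp_scaleR:
  fixes f :: "real^2 \<Rightarrow> 'b::euclidean_space" and \<psi> :: "real^2 \<Rightarrow> real"
  assumes "continuous_on UNIV \<psi>" and z: "\<And>x. r < norm x \<Longrightarrow> \<psi> x = 0" and "r < 1" "locally_integrable f"
  shows "integrable disc_measure (\<lambda>x. \<psi> x *\<^sub>R f x)"
proof -
  obtain B where B: "B > 0" "\<And>x. norm (\<psi> x) \<le> B"
    by (rule supp_bounded[OF assms(1), of r], erule z, rule that)
  have [measurable]: "\<psi> \<in> borel_measurable borel" using assms(1) by (rule borel_measurable_continuous_onI)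
  have [measurable]: "(\<lambda>x. indicator (cball 0 r) x *\<^sub>R f x) \<in> borel_measurable lebesgue"
    using locally_integrableD[OF assms(4,3)] by (rule borel_measurable_integrable)
  have eq: "indicator disc x *\<^sub>R (\<psi> x *\<^sub>R f x) = \<psi> x *\<^sub>R (indicator (cball 0 r) x *\<^sub>R f x)" for x
    using z[of x] assms(3) by (cases "r < norm x") (auto simp: indicator_def)
  have \<psi>m: "\<psi> \<in> borel_measurable lebesgue" by (rule measurable_completion) simp
  show ?thesis
    unfolding disc_integrable eq
  proof (rule Bochner_Integration.integrable_bound)
    show "integrable lebesgue (\<lambda>x. B *\<^sub>R (indicator (cball 0 r) x *\<^sub>R f x))"
      by (intro integrable_scaleR_right locally_integrableD assms)
    show "(\<lambda>x. \<psi> x *\<^sub>R (indicator (cball 0 r) x *\<^sub>R f x)) \<in> borel_measurable lebesgue"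
      by (rule borel_measurable_scaleR[OF \<psi>m]) measurable
    show "AE x in lebesgue. norm (\<psi> x *\<^sub>R (indicator (cball 0 r) x *\<^sub>R f x)) \<le> norm (B *\<^sub>R (indicator (cball 0 r) x *\<^sub>R f x))"
    proof (rule AE_I2)
      fix x
      show "norm (\<psi> x *\<^sub>R (indicator (cball 0 r) x *\<^sub>R f x)) \<le> norm (B *\<^sub>R (indicator (cball 0 r) x *\<^sub>R f x))"
        unfolding norm_scaleR[of "\<psi> x"] norm_scaleR[of B] using B by (intro mult_right_mono) auto
    qed
  qed
qed

lemma test_integrable:
  fixes f :: "real^2 \<Rightarrow> 'b::euclidean_space" and \<phi> :: "real^2 \<Rightarrow> real"
  assumes "test_function \<phi>" "locally_integrable f"
  shows "integrable disc_measure (\<lambda>x. \<phi> x *\<^sub>R f x)" "integrable disc_measure (\<lambda>x. cpd i \<phi> x *\<^sub>R f x)"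
proof -
  obtain r where r: "smooth \<phi>" "0 < r" "r < 1" "\<And>x. r < norm x \<Longrightarrow> \<phi> x = 0"
    using test_functionE[OF assms(1)] by blast
  show "integrable disc_measure (\<lambda>x. \<phi> x *\<^sub>R f x)"
    by (rule integrable_supp_scaleR[OF smooth_continuous[OF r(1)] r(4,3) assms(2)])
  show "integrable disc_measure (\<lambda>x. cpd i \<phi> x *\<^sub>R f x)"
    by (rule integrable_supp_scaleR[OF _ _ r(3) assms(2)])
       (use smooth_continuous[OF smooth_deriv[OF r(1)]] supp_derivative[OF r(4)] in \<open>auto simp: cpd_def[abs_def]\<close>)
qed

text \<open>The difference of two weak derivatives is a weak derivative of 0. The mollifications of
  0 vanish, by their sup bound with M = 0, while their derivatives converge to that difference in
  L^1 on smaller balls.\<close>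

lemma weak_partial_unique:
  fixes u v v' :: "real^2 \<Rightarrow> 'b::euclidean_space"
  assumes "weak_partial i u v" "weak_partial i u v'"
  shows "AE x in disc_measure. v x = v' x"
proof -
  define w where "w x = v x - v' x" for x
  note loc = weak_partial_locI[OF assms(1)] weak_partial_locI[OF assms(2)]
  have lw: "locally_integrable w"
    using locally_integrable_add[OF loc(2) locally_integrable_linear[OF loc(6) bounded_linear_minus[OF bounded_linear_ident]]]
    by (simp add: w_def[abs_def])
  have wp: "weak_partial i (\<lambda>x. 0) w"
    unfolding weak_partial_def
  proof (intro conjI allI impI lw locally_integrable_const)
    fix \<phi> :: "real^2 \<Rightarrow> real" assume \<phi>: "test_function \<phi>"
    show "(LINT x|disc_measure. cpd i \<phi> x *\<^sub>R (0::'b)) = - (LINT x|disc_measure. \<phi> x *\<^sub>R w x)"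
      using assms \<phi> test_integrable(1)[OF \<phi> loc(2)] test_integrable(1)[OF \<phi> loc(6)]
      by (simp add: weak_partial_def w_def scaleR_diff_right Bochner_Integration.integral_diff)
  qed
  have ae: "AE x in disc_measure. norm x \<le> r \<longrightarrow> w x = 0" if r: "0 < r" "r < 1" for r
  proof -
    obtain U where
      L1: "(\<lambda>k::nat. \<integral>\<^sup>+x. ennreal (norm (indicator (cball 0 r) x *\<^sub>R (cpd i (U k) x - w x))) \<partial>lebesgue) \<longlonglongrightarrow> 0"
      and U0: "\<And>M k x. 0 \<le> M \<Longrightarrow> (AE x in disc_measure. norm (0::'b) \<le> M) \<Longrightarrow> norm (U k x) \<le> M"
      by (rule weak_partial_approx[of "{i}" "\<lambda>x. 0::'b" "\<lambda>_. w", OF _ locally_integrable_const r]) (auto intro: wp)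
    have "U k = (\<lambda>_. 0)" for k using U0[of 0 k] by (auto simp: fun_eq_iff)
    then have "cpd i (U k) x = 0" for k x by (simp add: cpd_def)
    then have 0: "(\<integral>\<^sup>+x. ennreal (norm (indicator (cball 0 r) x *\<^sub>R w x)) \<partial>lebesgue) = 0"
      using L1 by (simp add: LIMSEQ_const_iff)
    have "(\<lambda>x. indicator (cball 0 r) x *\<^sub>R w x) \<in> borel_measurable lebesgue"
      using locally_integrableD[OF lw r(2)] by (rule borel_measurable_integrable)
    then have "AE x in lebesgue. indicator (cball 0 r) x *\<^sub>R w x = 0"
      using 0 by (subst (asm) nn_integral_0_iff_AE)
        (auto intro: measurable_compose[OF borel_measurable_norm measurable_ennreal] simp del: norm_scaleR)
    then show ?thesis
      unfolding disc_AE by eventually_elim (auto simp: indicator_def)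
  qed
  have "AE x in disc_measure. norm x \<le> 1 - 1 / (real n + 2) \<longrightarrow> w x = 0" for n
    by (rule ae) (auto simp: field_simps)
  then have "AE x in disc_measure. \<forall>n::nat. norm x \<le> 1 - 1 / (real n + 2) \<longrightarrow> w x = 0"
    unfolding AE_all_countable by blast
  moreover have "AE x in disc_measure. norm x < 1"
    unfolding disc_AE by auto
  ultimately show ?thesis
  proof eventually_elim
    case (elim x)
    have "(\<lambda>n. 1 - 1 / (real n + 2)) \<longlonglongrightarrow> 1" by real_asymp
    then have "eventually (\<lambda>n. norm x < 1 - 1 / (real n + 2)) sequentially"
      using elim(2) order_tendstoD(1) by blast
    then obtain n where "norm x < 1 - 1 / (real n + 2)" by (auto simp: eventually_sequentially)
    then show ?case using elim(1) less_imp_le by (auto simp: w_def)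
  qed
qed

section \<open>Chain and product rules for weak derivatives\<close>

lemma C_1_bounded_derivative:
  fixes g :: "'a::euclidean_space \<Rightarrow> 'b::euclidean_space"
  assumes g: "C_k (Suc 0) g"
  obtains B where "B > 0" "\<And>y v. norm y \<le> M \<Longrightarrow> norm (frechet_derivative g (at y) v) \<le> B * norm v"
    "\<And>y. norm y \<le> M \<Longrightarrow> norm (g y) \<le> B"
proof -
  have bd: "\<exists>B>0. \<forall>y\<in>cball 0 M. norm (f y) \<le> B" if "continuous_on UNIV f" for f :: "'a \<Rightarrow> 'b"
  proof -
    have "compact (f ` cball 0 M)" using continuous_on_subset[OF that] by (intro compact_continuous_image) auto
    then show ?thesis using compact_imp_bounded bounded_pos by (metis image_eqI)
  qed
  have "\<exists>B>0. \<forall>y\<in>cball 0 M. norm (frechet_derivative g (at y) b) \<le> B" for b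
    using C_k_deriv[OF g] by (intro bd) simp
  then obtain B where B: "\<And>b. B b > 0" "\<And>b y. y \<in> cball 0 M \<Longrightarrow> norm (frechet_derivative g (at y) b) \<le> B b"
    by metis
  obtain B' where B': "B' > 0" "\<And>y. y \<in> cball 0 M \<Longrightarrow> norm (g y) \<le> B'"
    using bd[OF C_k_imp_continuous[OF g]] by blast
  define L where "L = (\<Sum>b\<in>(Basis::'a set). B b)"
  have L: "L > 0" unfolding L_def using B(1) by (intro sum_pos) auto
  have "norm (frechet_derivative g (at y) v) \<le> L * norm v" if "norm y \<le> M" for y v
  proof -
    have lin: "linear (frechet_derivative g (at y))"
      using C_1_has_derivative[OF g] has_derivative_linear by blast
    have "frechet_derivative g (at y) v = (\<Sum>b\<in>Basis. (v \<bullet> b) *\<^sub>R frechet_derivative g (at y) b)"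
      by (subst euclidean_representation[of v, symmetric]) (simp only: linear_sum[OF lin] linear_cmul[OF lin] o_def)
    also have "norm \<dots> \<le> (\<Sum>b\<in>Basis. norm v * B b)"
      using that by (intro order_trans[OF norm_sum] sum_mono) (auto intro!: mult_mono B(2) Basis_le_norm)
    finally show ?thesis by (simp add: L_def sum_distrib_right mult.commute sum_distrib_left)
  qed
  then have "norm (frechet_derivative g (at y) v) \<le> (L + B') * norm v" if "norm y \<le> M" for y v
    using mult_right_mono[of L "L + B'" "norm v"] that B'(1) by (auto intro: order_trans)
  moreover have "norm (g y) \<le> L + B'" if "norm y \<le> M" for y
    using B'(2)[of y] that L by auto
  moreover have "0 < L + B'" using L B' by simp
  ultimately show thesis by (intro that[of "L + B'"])
qed

lemma frechet_derivative_expand: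
  fixes g :: "'a::euclidean_space \<Rightarrow> 'b::euclidean_space"
  assumes g: "C_k (Suc 0) g"
  shows "frechet_derivative g (at y) v = (\<Sum>b\<in>Basis. (v \<bullet> b) *\<^sub>R frechet_derivative g (at y) b)"
proof -
  have lin: "linear (frechet_derivative g (at y))"
    using C_1_has_derivative[OF g] has_derivative_linear by blast
  show ?thesis
    by (subst euclidean_representation[of v, symmetric]) (simp only: linear_sum[OF lin] linear_cmul[OF lin] o_def)
qed

lemma measurable_frechet_derivative:
  fixes g :: "'a::euclidean_space \<Rightarrow> 'b::euclidean_space"
  assumes g: "C_k (Suc 0) g" and "u \<in> borel_measurable M" "v \<in> borel_measurable M"
  shows "(\<lambda>x. frechet_derivative g (at (u x)) (v x)) \<in> borel_measurable M"
proof -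
  have "(\<lambda>x. frechet_derivative g (at (u x)) b) \<in> borel_measurable M" for b
    using C_k_deriv[OF g, of b] by (intro borel_measurable_continuous_on[OF _ assms(2)]) simp
  then show ?thesis
    by (subst frechet_derivative_expand[OF g])
       (intro borel_measurable_sum borel_measurable_scaleR borel_measurable_inner assms borel_measurable_const)
qed

lemma locally_integrable_continuous:
  fixes h :: "real^2 \<Rightarrow> 'b::euclidean_space"
  assumes "continuous_on UNIV h"
  shows "locally_integrable h"
proof (rule locally_integrableI)
  fix r :: real
  have "integrable lborel (\<lambda>x. indicator (cball 0 r) x *\<^sub>R h x)"
    using borel_integrable_compact[OF compact_cball continuous_on_subset[OF assms]] by simp
  then show "integrable lebesgue (\<lambda>x. indicator (cball 0 r) x *\<^sub>R h x)"
    by (simp add: integrable_completion borel_measurable_integrable)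
qed

text \<open>The product of \<open>\<phi>\<close> and \<open>f\<close> is C^1 and vanishes near the
  circle, so its derivative integrates to zero. C^1 regularity of \<open>f\<close> is the right
  generality for compositions of a C^1 map with mollifications and for the boundary cutoffs.\<close>

lemma test_integral_by_parts:
  fixes f :: "real^2 \<Rightarrow> 'b::euclidean_space"
  assumes \<phi>: "test_function \<phi>" and f: "C_k (Suc 0) f"
  shows "(LINT x|disc_measure. cpd i \<phi> x *\<^sub>R f x) = - (LINT x|disc_measure. \<phi> x *\<^sub>R cpd i f x)"
proof -
  obtain r where r: "smooth \<phi>" "0 < r" "r < 1" "\<And>x. r < norm x \<Longrightarrow> \<phi> x = 0"
    using test_functionE[OF \<phi>] by blast
  define \<theta> where "\<theta> x = \<phi> x *\<^sub>R f x" for x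
  have \<theta>1: "C_k (Suc 0) \<theta>"
    unfolding \<theta>_def[abs_def] using r(1) f by (intro C_k_bilinear[OF bounded_bilinear_scaleR]) (auto simp: smooth_def)
  have \<theta>z: "\<theta> x = 0" if "r < norm x" for x using r(4)[OF that] by (simp add: \<theta>_def)
  have cpd: "cpd i \<theta> x = cpd i \<phi> x *\<^sub>R f x + \<phi> x *\<^sub>R cpd i f x" for x
  proof -
    have D: "(\<theta> has_derivative (\<lambda>h. \<phi> x *\<^sub>R frechet_derivative f (at x) h + frechet_derivative \<phi> (at x) h *\<^sub>R f x)) (at x)"
      unfolding \<theta>_def[abs_def]
      by (rule has_derivative_scaleR[OF smooth_has_derivative[OF r(1)] C_1_has_derivative[OF f]])
    show ?thesis unfolding cpd_def frechet_derivative_at[OF D, symmetric] by (rule add.commute)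
  qed
  have c: "continuous_on UNIV (cpd i f)" using C_k_deriv[OF f] by (simp add: cpd_def[abs_def])
  note int = test_integrable(2)[OF \<phi> locally_integrable_continuous[OF C_k_imp_continuous[OF f]], of i] 
    test_integrable(1)[OF \<phi> locally_integrable_continuous[OF c]]
  have "indicator disc x *\<^sub>R cpd i \<theta> x = cpd i \<theta> x" for x
    using r(3) supp_derivative[of r \<theta>, OF \<theta>z] by (cases "r < norm x") (auto simp: cpd_def indicator_def)
  then have "0 = (LINT x|disc_measure. cpd i \<theta> x)"
    using integral_cpd_eq_0[OF \<theta>1 \<theta>z] unfolding disc_integral by simp
  also have "\<dots> = (LINT x|disc_measure. cpd i \<phi> x *\<^sub>R f x) + (LINT x|disc_measure. \<phi> x *\<^sub>R cpd i f x)"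
    unfolding cpd by (rule Bochner_Integration.integral_add[OF int])
  finally show ?thesis by (simp add: eq_neg_iff_add_eq_0)
qed

lemma disc_nn_integral_le:
  fixes f g :: "real^2 \<Rightarrow> ennreal"
  assumes "\<And>x. x \<in> disc \<Longrightarrow> f x \<le> g x"
  shows "(\<integral>\<^sup>+x. f x \<partial>disc_measure) \<le> (\<integral>\<^sup>+x. g x \<partial>lebesgue)"
proof -
  have "(\<integral>\<^sup>+x. f x \<partial>disc_measure) = (\<integral>\<^sup>+x. f x * indicator disc x \<partial>lebesgue)"
    by (rule nn_integral_restrict_space) auto
  also have "\<dots> \<le> (\<integral>\<^sup>+x. g x \<partial>lebesgue)"
    using assms by (intro nn_integral_mono) (auto simp: indicator_def)
  finally show ?thesis .
qed

lemma disc_nn_integral_le_AE: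
  fixes f g :: "real^2 \<Rightarrow> ennreal"
  assumes "AE x in disc_measure. f x \<le> g x"
  shows "(\<integral>\<^sup>+x. f x \<partial>disc_measure) \<le> (\<integral>\<^sup>+x. g x \<partial>lebesgue)"
  by (rule order_trans[OF nn_integral_mono_AE[OF assms] disc_nn_integral_le]) auto

text \<open>Passage to the limit in products whose derivative factor \<open>V k\<close> converges
  only in L^1, while the linear coefficient \<open>T k\<close> is bounded and converges pointwise.
  The product is split into \<open>T k\<close> applied to V_k - v, which tends to 0 in L^1, and
  \<open>T k\<close> applied to \<open>v\<close>, which is handled by dominated convergence.\<close>

lemma limit_mollified_linear:
  fixes v :: "real^2 \<Rightarrow> 'b::euclidean_space" and T :: "nat \<Rightarrow> real^2 \<Rightarrow> 'b \<Rightarrow> 'c::euclidean_space"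
  assumes L1: "(\<lambda>k. \<integral>\<^sup>+x. ennreal (norm (indicator (cball 0 r) x *\<^sub>R (V k x - v x))) \<partial>lebesgue) \<longlonglongrightarrow> 0"
    and lin: "\<And>k x. linear (T k x)" and z: "\<And>k x. r < norm x \<Longrightarrow> T k x = (\<lambda>_. 0)"
    and bd: "0 \<le> C" "\<And>k. AE x in disc_measure. \<forall>y. norm (T k x y) \<le> C * norm y"
    and V: "\<And>k. continuous_on UNIV (V k)"
    and int: "\<And>k. integrable disc_measure (\<lambda>x. T k x (V k x))" "\<And>k. integrable disc_measure (\<lambda>x. T k x (v x))"
    and r: "r < 1" and v: "locally_integrable v" and T': "T' \<in> borel_measurable disc_measure"
    and lim: "AE x in disc_measure. (\<lambda>k. T k x (v x)) \<longlonglongrightarrow> T' x"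
  shows "(\<lambda>k. LINT x|disc_measure. T k x (V k x)) \<longlonglongrightarrow> (LINT x|disc_measure. T' x)"
proof -
  have m: "(\<lambda>x. ennreal (norm (indicator (cball 0 r) x *\<^sub>R (V k x - v x)))) \<in> borel_measurable lebesgue" for k
  proof -
    have "V k \<in> borel_measurable lebesgue"
      by (rule measurable_completion) (use borel_measurable_continuous_onI[OF V] in simp)
    then have "(\<lambda>x. indicator (cball 0 r) x *\<^sub>R V k x) \<in> borel_measurable lebesgue"
      by (rule borel_measurable_scaleR[OF borel_measurable_indicator, rotated]) auto
    from borel_measurable_diff[OF this borel_measurable_integrable[OF locally_integrableD[OF v r]]]
    have "(\<lambda>x. indicator (cball 0 r) x *\<^sub>R (V k x - v x)) \<in> borel_measurable lebesgue"
      by (simp only: scaleR_diff_right)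
    then have "(\<lambda>x. norm (indicator (cball 0 r) x *\<^sub>R (V k x - v x))) \<in> borel_measurable lebesgue"
      by (rule measurable_compose[OF _ borel_measurable_norm])
    from measurable_compose[OF this measurable_ennreal] show ?thesis .
  qed
  have "(\<lambda>k. \<integral>\<^sup>+x. ennreal (norm (T k x (V k x) - T k x (v x))) \<partial>disc_measure) \<longlonglongrightarrow> 0"
  proof (rule tendsto_sandwich[OF _ _ tendsto_const])
    have "(\<integral>\<^sup>+x. ennreal (norm (T k x (V k x) - T k x (v x))) \<partial>disc_measure)
        \<le> (\<integral>\<^sup>+x. ennreal C * ennreal (norm (indicator (cball 0 r) x *\<^sub>R (V k x - v x))) \<partial>lebesgue)" for k
    proof (rule disc_nn_integral_le_AE)
      show "AE x in disc_measure. ennreal (norm (T k x (V k x) - T k x (v x)))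
          \<le> ennreal C * ennreal (norm (indicator (cball 0 r) x *\<^sub>R (V k x - v x)))"
        using bd(2)[of k]
      proof eventually_elim
        case (elim x)
        have "norm (T k x (V k x) - T k x (v x)) \<le> C * norm (indicator (cball 0 r) x *\<^sub>R (V k x - v x))"
          using z[of x k] elim[rule_format, of "V k x - v x"]
          by (cases "r < norm x") (auto simp: indicator_def linear_diff[OF lin])
        then show ?case using bd(1) by (simp flip: ennreal_mult)
      qed
    qed
    then show "eventually (\<lambda>k. (\<integral>\<^sup>+x. ennreal (norm (T k x (V k x) - T k x (v x))) \<partial>disc_measure)
       \<le> ennreal C * (\<integral>\<^sup>+x. ennreal (norm (indicator (cball 0 r) x *\<^sub>R (V k x - v x))) \<partial>lebesgue)) sequentially"
      by (intro always_eventually allI) (simp add: nn_integral_cmult[OF m] del: norm_scaleR)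
    show "(\<lambda>k. ennreal C * (\<integral>\<^sup>+x. ennreal (norm (indicator (cball 0 r) x *\<^sub>R (V k x - v x))) \<partial>lebesgue)) \<longlonglongrightarrow> 0"
      using tendsto_mult_ennreal[OF tendsto_const[of "ennreal C"] L1] by simp
  qed auto
  then have "(\<lambda>k. \<integral>\<^sup>+x. ennreal (norm ((T k x (V k x) - T k x (v x)) - 0)) \<partial>disc_measure) \<longlonglongrightarrow> 0"
    by simp
  then have 1: "(\<lambda>k. LINT x|disc_measure. T k x (V k x) - T k x (v x)) \<longlonglongrightarrow> (LINT x|disc_measure. 0)"
    by (rule tendsto_L1_int[rotated 2]) (use int in auto)
  have 2: "(\<lambda>k. LINT x|disc_measure. T k x (v x)) \<longlonglongrightarrow> (LINT x|disc_measure. T' x)"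
  proof (rule integral_dominated_convergence[OF T' _ _ lim])
    show "integrable disc_measure (\<lambda>x. C * norm (indicator (cball 0 r) x *\<^sub>R v x))"
    proof -
      have "integrable lebesgue (\<lambda>x. C * norm (indicator (cball 0 r) x *\<^sub>R v x))"
        using locally_integrableD[OF v r] by (intro integrable_mult_right integrable_norm)
      also have "(\<lambda>x. C * norm (indicator (cball 0 r) x *\<^sub>R v x)) =
          (\<lambda>x. indicator disc x *\<^sub>R (C * norm (indicator (cball 0 r) x *\<^sub>R v x)))"
        using r by (auto simp: fun_eq_iff indicator_def)
      finally show ?thesis by (simp only: disc_integrable)
    qed
    show "AE x in disc_measure. norm (T k x (v x)) \<le> C * norm (indicator (cball 0 r) x *\<^sub>R v x)" for k
      using bd(2)[of k]
    proof eventually_elim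
      case (elim x)
      then show ?case using z[of x k] by (cases "r < norm x") auto
    qed
  qed (use int in auto)
  show ?thesis
    using tendsto_add[OF 1 2] int by (simp add: Bochner_Integration.integral_diff)
qed

lemma disc_measurable_continuous:
  fixes h :: "real^2 \<Rightarrow> 'b::euclidean_space"
  shows "continuous_on UNIV h \<Longrightarrow> h \<in> borel_measurable disc_measure"
  by (intro locally_integrable_measurable locally_integrable_continuous)

lemma test_function_cont:
  fixes \<phi> :: "real^2 \<Rightarrow> real"
  assumes "test_function \<phi>"
  shows "continuous_on UNIV \<phi>" "continuous_on UNIV (cpd i \<phi>)"
  using assms smooth_continuous[OF smooth_deriv, of \<phi>] smooth_continuous[of \<phi>]
  by (auto simp: cpd_def[abs_def] test_function_def)

lemma integrable_disc_continuous_supp: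
  fixes \<psi> :: "real^2 \<Rightarrow> real"
  assumes "continuous_on UNIV \<psi>" "\<And>x. r < norm x \<Longrightarrow> \<psi> x = 0" "r < 1"
  shows "integrable disc_measure \<psi>"
  using integrable_supp_scaleR[OF assms locally_integrable_const[of "1::real"]] by simp

lemma weak_partial_approx_single:
  fixes u v :: "real^2 \<Rightarrow> 'b::euclidean_space"
  assumes wp: "weak_partial i u v" and r: "0 < r" "r < 1"
    and M: "0 \<le> M" "AE x in disc_measure. norm (u x) \<le> M"
  obtains U where "\<And>k::nat. smooth (U k)"
    "(\<lambda>k. \<integral>\<^sup>+x. ennreal (norm (indicator (cball 0 r) x *\<^sub>R (cpd i (U k) x - v x))) \<partial>lebesgue) \<longlonglongrightarrow> 0"
    "AE x in disc_measure. norm x \<le> r \<longrightarrow> (\<lambda>k. U k x) \<longlonglongrightarrow> u x"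
    "\<And>k x. norm (U k x) \<le> M"
proof (rule weak_partial_approx[of "{i}" u "\<lambda>_. v" r])
  fix U :: "nat \<Rightarrow> real^2 \<Rightarrow> 'b"
  assume U: "\<And>k. smooth (U k)"
    "\<And>j. j \<in> {i} \<Longrightarrow>
       (\<lambda>k. \<integral>\<^sup>+x. ennreal (norm (indicator (cball 0 r) x *\<^sub>R (cpd j (U k) x - v x))) \<partial>lebesgue) \<longlonglongrightarrow> 0"
    "AE x in disc_measure. norm x \<le> r \<longrightarrow> (\<lambda>k. U k x) \<longlonglongrightarrow> u x"
    "\<And>M k x. 0 \<le> M \<Longrightarrow> (AE x in disc_measure. norm (u x) \<le> M) \<Longrightarrow> norm (U k x) \<le> M"
  show thesis
    by (rule that[of U, OF U(1) U(2) U(3) U(4)[OF M]]) simp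
qed (use weak_partial_locI[OF wp] wp r in auto)

text \<open>For the mollifications of \<open>u\<close> this is classical integration by parts. They
  obey the same bound as \<open>u\<close>, so \<open>g\<close> and its derivative are bounded on
  their range and both sides of the identity pass to the limit.\<close>

lemma weak_partial_compose:
  fixes u v :: "real^2 \<Rightarrow> 'b::euclidean_space" and g :: "'b \<Rightarrow> 'c::euclidean_space"
  assumes wp: "weak_partial i u v" and M: "AE x in disc_measure. norm (u x) \<le> M"
    and g: "C_k (Suc 0) g"
  shows "weak_partial i (\<lambda>x. g (u x)) (\<lambda>x. frechet_derivative g (at (u x)) (v x))"
proof -
  define M' where "M' = max 0 M"
  have M': "0 \<le> M'" "AE x in disc_measure. norm (u x) \<le> M'"
    using M by (auto simp: M'_def elim!: eventually_mono)
  obtain B where B: "B > 0" "\<And>y v. norm y \<le> M' \<Longrightarrow> norm (frechet_derivative g (at y) v) \<le> B * norm v"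
    "\<And>y. norm y \<le> M' \<Longrightarrow> norm (g y) \<le> B"
    by (rule C_1_bounded_derivative[OF g, of M'], rule that)
  note loc = weak_partial_locI[OF wp]
  have contg: "continuous_on UNIV g" by (rule C_k_imp_continuous[OF g])
  have contD: "continuous_on UNIV (\<lambda>x. frechet_derivative g (at x) b)" for b
    using C_k_deriv[OF g] by simp
  have lin: "linear (frechet_derivative g (at y))" for y
    using C_1_has_derivative[OF g] has_derivative_linear by blast
  have mg: "(\<lambda>x. g (u x)) \<in> borel_measurable disc_measure"
    by (rule borel_measurable_continuous_on[OF contg loc(3)])
  have mD: "(\<lambda>x. frechet_derivative g (at (u x)) (v x)) \<in> borel_measurable disc_measure"
    by (rule measurable_frechet_derivative[OF g loc(3,4)])
  have Bv: "locally_integrable (\<lambda>x. B * norm (v x))"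
    by (rule locally_integrable_linear[OF locally_integrable_norm[OF loc(2)] bounded_linear_mult_right])
  have lg: "locally_integrable (\<lambda>x. g (u x))"
    by (rule locally_integrable_bound[OF mg locally_integrable_const[of B]])
       (use M'(2) in eventually_elim, auto intro: B)
  have lD: "locally_integrable (\<lambda>x. frechet_derivative g (at (u x)) (v x))"
    by (rule locally_integrable_bound[OF mD Bv]) (use M'(2) in eventually_elim, auto intro: B)
  show ?thesis
    unfolding weak_partial_def
  proof (intro conjI allI impI lg lD)
    fix \<phi> :: "real^2 \<Rightarrow> real" assume \<phi>: "test_function \<phi>"
    obtain r where r: "smooth \<phi>" "0 < r" "r < 1" "\<And>x. r < norm x \<Longrightarrow> \<phi> x = 0"
      using test_functionE[OF \<phi>] by blast
    have cpd0: "cpd i \<phi> x = 0" if "r < norm x" for x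
      using supp_derivative[OF r(4) that] by (simp add: cpd_def)
    obtain U where U: "\<And>k::nat. smooth (U k)"
      "(\<lambda>k. \<integral>\<^sup>+x. ennreal (norm (indicator (cball 0 r) x *\<^sub>R (cpd i (U k) x - v x))) \<partial>lebesgue) \<longlonglongrightarrow> 0"
      "AE x in disc_measure. norm x \<le> r \<longrightarrow> (\<lambda>k. U k x) \<longlonglongrightarrow> u x"
      "\<And>k x. norm (U k x) \<le> M'"
      by (rule weak_partial_approx_single[OF wp r(2,3) M'], rule that)
    have Uc: "continuous_on UNIV (U k)" "continuous_on UNIV (cpd i (U k))" for k
      using smooth_continuous[OF U(1)] smooth_continuous[OF smooth_deriv[OF U(1)]]
      by (auto simp: cpd_def[abs_def])
    have gU: "C_k (Suc 0) (\<lambda>x. g (U k x))" for k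
      using U(1)[of k] unfolding smooth_def by (intro C_k_compose[OF g]) auto
    have cpd_gU: "cpd i (\<lambda>x. g (U k x)) x = frechet_derivative g (at (U k x)) (cpd i (U k) x)" for k x
      unfolding cpd_def
      using frechet_derivative_at[OF has_derivative_compose[OF smooth_has_derivative[OF U(1)] C_1_has_derivative[OF g]], symmetric]
      by simp
    have contDU: "continuous_on UNIV (cpd i (\<lambda>x. g (U k x)))" for k
      using C_k_deriv[OF gU] by (simp add: cpd_def[abs_def])
    obtain K where K: "K > 0" "\<And>x. norm (\<phi> x) \<le> K"
      by (rule supp_bounded[OF test_function_cont(1)[OF \<phi>], of r], erule r(4), rule that)
    have "(\<lambda>k. LINT x|disc_measure. cpd i \<phi> x *\<^sub>R g (U k x)) \<longlonglongrightarrow> (LINT x|disc_measure. cpd i \<phi> x *\<^sub>R g (u x))"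
    proof (rule integral_dominated_convergence[where w = "\<lambda>x. norm (cpd i \<phi> x) * B"])
      show "(\<lambda>x. cpd i \<phi> x *\<^sub>R g (u x)) \<in> borel_measurable disc_measure"
        using test_integrable(2)[OF \<phi> lg] by auto
      show "(\<lambda>x. cpd i \<phi> x *\<^sub>R g (U k x)) \<in> borel_measurable disc_measure" for k
        using test_integrable(2)[OF \<phi> locally_integrable_continuous[OF C_k_imp_continuous[OF gU]]] by auto
      show "integrable disc_measure (\<lambda>x. norm (cpd i \<phi> x) * B)"
        by (intro integrable_mult_left integrable_norm integrable_disc_continuous_supp[OF test_function_cont(2)[OF \<phi>] cpd0 r(3)])
      show "AE x in disc_measure. norm (cpd i \<phi> x *\<^sub>R g (U k x)) \<le> norm (cpd i \<phi> x) * B" for k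
        using B(3)[OF U(4)] by (auto intro!: AE_I2 mult_left_mono)
      show "AE x in disc_measure. (\<lambda>k. cpd i \<phi> x *\<^sub>R g (U k x)) \<longlonglongrightarrow> cpd i \<phi> x *\<^sub>R g (u x)"
        using U(3)
      proof eventually_elim
        case (elim x)
        show ?case
        proof (cases "r < norm x")
          case False
          then have "(\<lambda>k. g (U k x)) \<longlonglongrightarrow> g (u x)"
            using elim contg continuous_on_tendsto_compose[OF contg] by auto
          then show ?thesis by (intro tendsto_intros)
        qed (simp add: cpd0)
      qed
    qed
    moreover have "(\<lambda>k. LINT x|disc_measure. \<phi> x *\<^sub>R frechet_derivative g (at (U k x)) (cpd i (U k) x))
        \<longlonglongrightarrow> (LINT x|disc_measure. \<phi> x *\<^sub>R frechet_derivative g (at (u x)) (v x))"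
    proof (rule limit_mollified_linear[OF U(2), where C = "K * B"])
      show "linear (\<lambda>y. \<phi> x *\<^sub>R frechet_derivative g (at (U k x)) y)" for k x
        by (intro linear_compose_scale_right lin)
      show "AE x in disc_measure. \<forall>y. norm (\<phi> x *\<^sub>R frechet_derivative g (at (U k x)) y) \<le> K * B * norm y" for k
        using B(2)[OF U(4)] K B(1) by (auto intro!: AE_I2 mult_mono simp: mult.assoc)
      show "integrable disc_measure (\<lambda>x. \<phi> x *\<^sub>R frechet_derivative g (at (U k x)) (cpd i (U k) x))" for k
        unfolding cpd_gU[symmetric] by (intro test_integrable(1)[OF \<phi>] locally_integrable_continuous contDU)
      show "integrable disc_measure (\<lambda>x. \<phi> x *\<^sub>R frechet_derivative g (at (U k x)) (v x))" for k
        by (rule test_integrable(1)[OF \<phi> locally_integrable_bound[OF _ Bv]])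
          (use B(2)[OF U(4)] in \<open>auto intro: measurable_frechet_derivative[OF g disc_measurable_continuous[OF Uc(1)] loc(4)]\<close>)
      show "(\<lambda>x. \<phi> x *\<^sub>R frechet_derivative g (at (u x)) (v x)) \<in> borel_measurable disc_measure"
        using test_integrable(1)[OF \<phi> lD] by auto
      show "AE x in disc_measure. (\<lambda>k. \<phi> x *\<^sub>R frechet_derivative g (at (U k x)) (v x))
          \<longlonglongrightarrow> \<phi> x *\<^sub>R frechet_derivative g (at (u x)) (v x)"
        using U(3)
      proof eventually_elim
        case (elim x)
        show ?case
        proof (cases "r < norm x")
          case False
          then have "(\<lambda>k. frechet_derivative g (at (U k x)) (v x)) \<longlonglongrightarrow> frechet_derivative g (at (u x)) (v x)"
            using elim continuous_on_tendsto_compose[OF contD[of "v x"]] by auto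
          then show ?thesis by (intro tendsto_intros)
        qed (simp add: r(4))
      qed
    qed (use K B r loc(2) Uc in \<open>auto simp: fun_eq_iff\<close>)
    moreover have "(LINT x|disc_measure. cpd i \<phi> x *\<^sub>R g (U k x))
       = - (LINT x|disc_measure. \<phi> x *\<^sub>R frechet_derivative g (at (U k x)) (cpd i (U k) x))" for k
      using test_integral_by_parts[OF \<phi> gU, of i k] by (simp only: cpd_gU)
    ultimately show "(LINT x|disc_measure. cpd i \<phi> x *\<^sub>R g (u x))
       = - (LINT x|disc_measure. \<phi> x *\<^sub>R frechet_derivative g (at (u x)) (v x))"
      using LIMSEQ_unique[OF _ tendsto_minus] by simp
  qed
qed

text \<open>Proved apart from the chain rule because here \<open>u\<close> may be unbounded: a
  bounded linear map commutes with the integral.\<close>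

lemma weak_partial_linear:
  fixes u v :: "real^2 \<Rightarrow> 'b::euclidean_space" and h :: "'b \<Rightarrow> 'c::euclidean_space"
  assumes wp: "weak_partial i u v" and h: "bounded_linear h"
  shows "weak_partial i (\<lambda>x. h (u x)) (\<lambda>x. h (v x))"
proof -
  note loc = weak_partial_locI[OF wp]
  interpret h: bounded_linear h by (rule h)
  show ?thesis
    unfolding weak_partial_def
  proof (intro conjI allI impI locally_integrable_linear[OF _ h] loc)
    fix \<phi> :: "real^2 \<Rightarrow> real" assume \<phi>: "test_function \<phi>"
    have "(LINT x|disc_measure. cpd i \<phi> x *\<^sub>R h (u x)) = h (LINT x|disc_measure. cpd i \<phi> x *\<^sub>R u x)"
      using integral_bounded_linear[OF h test_integrable(2)[OF \<phi> loc(1)]] by (simp add: h.scaleR)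
    moreover have "(LINT x|disc_measure. \<phi> x *\<^sub>R h (v x)) = h (LINT x|disc_measure. \<phi> x *\<^sub>R v x)"
      using integral_bounded_linear[OF h test_integrable(1)[OF \<phi> loc(2)]] by (simp add: h.scaleR)
    ultimately show "(LINT x|disc_measure. cpd i \<phi> x *\<^sub>R h (u x)) = - (LINT x|disc_measure. \<phi> x *\<^sub>R h (v x))"
      using wp \<phi> by (simp add: weak_partial_def h.neg)
  qed
qed

lemma weak_partial_add:
  assumes "weak_partial i u v" "weak_partial i u' v'"
  shows "weak_partial i (\<lambda>x. u x + u' x) (\<lambda>x. v x + v' x)"
proof -
  note loc = weak_partial_locI[OF assms(1)] and loc' = weak_partial_locI[OF assms(2)]
  show ?thesis
    unfolding weak_partial_def
  proof (intro conjI allI impI locally_integrable_add loc loc')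
    fix \<phi> :: "real^2 \<Rightarrow> real" assume \<phi>: "test_function \<phi>"
    note int = test_integrable(2)[OF \<phi> loc(1), of i] test_integrable(2)[OF \<phi> loc'(1), of i]
       test_integrable(1)[OF \<phi> loc(2)] test_integrable(1)[OF \<phi> loc'(2)]
    show "(LINT x|disc_measure. cpd i \<phi> x *\<^sub>R (u x + u' x)) = - (LINT x|disc_measure. \<phi> x *\<^sub>R (v x + v' x))"
      using assms \<phi> int by (simp add: weak_partial_def scaleR_add_right Bochner_Integration.integral_add)
  qed
qed

lemma weak_partial_scaleR: "weak_partial i u v \<Longrightarrow> weak_partial i (\<lambda>x. c *\<^sub>R u x) (\<lambda>x. c *\<^sub>R v x)"
  by (rule weak_partial_linear[OF _ bounded_linear_scaleR_right])

lemma weak_partial_Pair: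
  fixes u v :: "real^2 \<Rightarrow> 'b::euclidean_space" and u' v' :: "real^2 \<Rightarrow> 'c::euclidean_space"
  assumes "weak_partial i u v" "weak_partial i u' v'"
  shows "weak_partial i (\<lambda>x. (u x, u' x)) (\<lambda>x. (v x, v' x))"
proof -
  have "bounded_linear (\<lambda>y::'b. (y, 0::'c))" "bounded_linear (\<lambda>y::'c. (0::'b, y))"
    by (auto intro!: bounded_linear_Pair bounded_linear_ident bounded_linear_zero)
  from weak_partial_add[OF weak_partial_linear[OF assms(1) this(1)] weak_partial_linear[OF assms(2) this(2)]]
  show ?thesis by simp
qed

text \<open>The chain rule for the pair of the two functions and the smooth map induced by
  \<open>h\<close>; the bounds on both factors bound the pair.\<close>

lemma weak_partial_bilinear:
  fixes u v :: "real^2 \<Rightarrow> 'b::euclidean_space" and u' v' :: "real^2 \<Rightarrow> 'c::euclidean_space"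
    and h :: "'b \<Rightarrow> 'c \<Rightarrow> 'd::euclidean_space"
  assumes h: "bounded_bilinear h" and wp: "weak_partial i u v" "weak_partial i u' v'"
    and M: "AE x in disc_measure. norm (u x) \<le> M" "AE x in disc_measure. norm (u' x) \<le> M'"
  shows "weak_partial i (\<lambda>x. h (u x) (u' x)) (\<lambda>x. h (u x) (v' x) + h (v x) (u' x))"
proof -
  define g where "g p = h (fst p) (snd p)" for p
  have g: "C_k (Suc 0) g"
    unfolding g_def[abs_def]
    by (intro C_k_bilinear[OF h] C_k_linear bounded_linear_fst bounded_linear_snd)
  have D: "(g has_derivative (\<lambda>q. h (fst p) (snd q) + h (fst q) (snd p))) (at p)" for p
    unfolding g_def[abs_def] by (intro bounded_bilinear.FDERIV[OF h] derivative_intros) 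
  have "AE x in disc_measure. norm (u x, u' x) \<le> M + M'"
    using M by eventually_elim (rule order_trans[OF norm_Pair_le], simp)
  from weak_partial_compose[OF weak_partial_Pair[OF wp] this g]
  show ?thesis
    unfolding frechet_derivative_at[OF D, symmetric] by (simp add: g_def)
qed

section \<open>Commutation of derivatives\<close>

text \<open>The second difference is symmetric in the two directions. Two applications of the mean
  value theorem express it by a mixed derivative at a nearby point, in either order; continuity of
  the mixed derivatives lets the step tend to zero.\<close>

lemma cpd_commute:
  fixes f :: "real^2 \<Rightarrow> real"
  assumes "smooth f"
  shows "cpd i (cpd j f) x = cpd j (cpd i f) x"
proof -
  define d where "d i = (axis i 1 :: real^2)" for i :: 2
  have sm: "smooth (cpd i f)" for i using smooth_deriv[OF assms] by (simp add: cpd_def[abs_def])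
  have sm2: "smooth (cpd i (cpd j f))" for i j using smooth_deriv[OF sm] by (simp add: cpd_def[abs_def])
  have line: "((\<lambda>t. g (y + t *\<^sub>R d i)) has_real_derivative cpd i g (y + t *\<^sub>R d i)) (at t)"
    if "smooth g" for g :: "real^2 \<Rightarrow> real" and y i t
  proof -
    have "((\<lambda>t. g (y + t *\<^sub>R d i)) has_derivative (\<lambda>s. frechet_derivative g (at (y + t *\<^sub>R d i)) (s *\<^sub>R d i))) (at t)"
      by (rule has_derivative_compose[OF _ smooth_has_derivative[OF that]]) (auto intro!: derivative_eq_intros)
    moreover have "frechet_derivative g (at z) (s *\<^sub>R d i) = cpd i g z * s" for s z
      using linear_cmul[OF has_derivative_linear[OF smooth_has_derivative[OF that]]]
      by (simp add: cpd_def d_def)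
    ultimately show ?thesis by (simp add: has_field_derivative_def)
  qed
  have mvt: "\<exists>s t. 0 < s \<and> s < h \<and> 0 < t \<and> t < h \<and>
      f (x + h *\<^sub>R d i + h *\<^sub>R d j) - f (x + h *\<^sub>R d i) - f (x + h *\<^sub>R d j) + f x
        = h * h * cpd j (cpd i f) (x + s *\<^sub>R d i + t *\<^sub>R d j)" if h: "h > 0" for h and i j
  proof -
    let ?a = "\<lambda>s. f ((x + h *\<^sub>R d j) + s *\<^sub>R d i) - f (x + s *\<^sub>R d i)"
    have "(?a has_real_derivative (cpd i f ((x + h *\<^sub>R d j) + s *\<^sub>R d i) - cpd i f (x + s *\<^sub>R d i))) (at s)" for s
      by (intro DERIV_diff line assms)
    then obtain s where s: "0 < s" "s < h"
      "?a h - ?a 0 = (h - 0) * (cpd i f ((x + h *\<^sub>R d j) + s *\<^sub>R d i) - cpd i f (x + s *\<^sub>R d i))"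
      using MVT2[of 0 h ?a "\<lambda>s. cpd i f ((x + h *\<^sub>R d j) + s *\<^sub>R d i) - cpd i f (x + s *\<^sub>R d i)"] h by auto
    let ?b = "\<lambda>t. cpd i f ((x + s *\<^sub>R d i) + t *\<^sub>R d j)"
    obtain t where t: "0 < t" "t < h" "?b h - ?b 0 = (h - 0) * cpd j (cpd i f) ((x + s *\<^sub>R d i) + t *\<^sub>R d j)"
      using MVT2[of 0 h ?b "\<lambda>t. cpd j (cpd i f) ((x + s *\<^sub>R d i) + t *\<^sub>R d j)"] line[OF sm] h by auto
    show ?thesis
      by (rule exI[of _ s], rule exI[of _ t]) (use s t in \<open>auto simp: algebra_simps\<close>)
  qed
  define h where "h n = 1 / real (Suc n)" for n
  have h: "h n > 0" for n by (simp add: h_def)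
  have h0: "h \<longlonglongrightarrow> 0" unfolding h_def by real_asymp
  have "\<exists>z z'. norm (z - x) \<le> 2 * h n \<and> norm (z' - x) \<le> 2 * h n \<and> cpd i (cpd j f) z = cpd j (cpd i f) z'" for n
  proof -
    obtain s t where st: "0 < s" "s < h n" "0 < t" "t < h n"
      "f (x + h n *\<^sub>R d i + h n *\<^sub>R d j) - f (x + h n *\<^sub>R d i) - f (x + h n *\<^sub>R d j) + f x
        = h n * h n * cpd j (cpd i f) (x + s *\<^sub>R d i + t *\<^sub>R d j)"
      using mvt[OF h, of n i j] by auto
    obtain s' t' where st': "0 < s'" "s' < h n" "0 < t'" "t' < h n"
      "f (x + h n *\<^sub>R d j + h n *\<^sub>R d i) - f (x + h n *\<^sub>R d j) - f (x + h n *\<^sub>R d i) + f x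
        = h n * h n * cpd i (cpd j f) (x + s' *\<^sub>R d j + t' *\<^sub>R d i)"
      using mvt[OF h, of n j i] by auto
    have eq: "x + h n *\<^sub>R d j + h n *\<^sub>R d i = x + h n *\<^sub>R d i + h n *\<^sub>R d j" by simp
    have "h n * h n * cpd i (cpd j f) (x + s' *\<^sub>R d j + t' *\<^sub>R d i)
       = h n * h n * cpd j (cpd i f) (x + s *\<^sub>R d i + t *\<^sub>R d j)"
      using st(5) st'(5)[unfolded eq] by linarith
    moreover have near: "norm (x + a *\<^sub>R d k + b *\<^sub>R d l - x) \<le> 2 * h n" if "0 < a" "a < h n" "0 < b" "b < h n" for a b k l
      using norm_triangle_ineq[of "a *\<^sub>R d k" "b *\<^sub>R d l"] that by (simp add: d_def)
    ultimately show ?thesis using h[of n] near[OF st(1-4), of i j] near[OF st'(1-4), of j i]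
      by (intro exI[of _ "x + s' *\<^sub>R d j + t' *\<^sub>R d i"] exI[of _ "x + s *\<^sub>R d i + t *\<^sub>R d j"] conjI) auto
  qed
  then obtain z z' where z: "\<And>n. norm (z n - x) \<le> 2 * h n" "\<And>n. norm (z' n - x) \<le> 2 * h n"
    "\<And>n. cpd i (cpd j f) (z n) = cpd j (cpd i f) (z' n)" by metis
  have h2: "(\<lambda>n. 2 * h n) \<longlonglongrightarrow> 0" using h0 by (auto intro!: tendsto_eq_intros)
  have lim: "z \<longlonglongrightarrow> x" "z' \<longlonglongrightarrow> x"
    using Lim_null_comparison[OF _ h2, of "\<lambda>n. z n - x"] Lim_null_comparison[OF _ h2, of "\<lambda>n. z' n - x"] z(1,2)
    by (auto simp: LIM_zero_iff)
  have c: "isCont (cpd i (cpd j f)) x" for i j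
    using smooth_continuous[OF sm2, of UNIV] by (simp add: continuous_on_eq_continuous_at)
  have "(\<lambda>n. cpd j (cpd i f) (z' n)) \<longlonglongrightarrow> cpd j (cpd i f) x" "(\<lambda>n. cpd i (cpd j f) (z n)) \<longlonglongrightarrow> cpd i (cpd j f) x"
    using isCont_tendsto_compose[OF c] lim by auto
  then show ?thesis using LIMSEQ_unique z(3) by simp
qed

lemma test_function_cpd:
  fixes \<phi> :: "real^2 \<Rightarrow> real"
  assumes "test_function \<phi>"
  shows "test_function (cpd i \<phi>)"
proof -
  obtain r where r: "smooth \<phi>" "0 < r" "r < 1" "\<And>x. r < norm x \<Longrightarrow> \<phi> x = 0"
    using test_functionE[OF assms] by blast
  have "cpd i \<phi> x = 0" if "r < norm x" for x
    using supp_derivative[of r \<phi>, OF r(4) that] by (simp add: cpd_def)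
  then show ?thesis
    using smooth_deriv[OF r(1)] by (intro test_functionI[OF _ r(3)]) (auto simp: cpd_def[abs_def])
qed

lemma test_function_mult:
  fixes \<phi> \<psi> :: "real^2 \<Rightarrow> real"
  assumes \<phi>: "test_function \<phi>" and \<psi>: "smooth \<psi>"
  shows "test_function (\<lambda>x. \<phi> x * \<psi> x)" "cpd i (\<lambda>x. \<phi> x * \<psi> x) x = cpd i \<phi> x * \<psi> x + \<phi> x * cpd i \<psi> x"
proof -
  obtain r where r: "smooth \<phi>" "0 < r" "r < 1" "\<And>x. r < norm x \<Longrightarrow> \<phi> x = 0"
    using test_functionE[OF \<phi>] by blast
  show "test_function (\<lambda>x. \<phi> x * \<psi> x)"
    by (rule test_functionI[OF smooth_bilinear[OF bounded_bilinear_mult r(1) \<psi>] r(3)]) (simp add: r(4))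
  have D: "((\<lambda>x. \<phi> x * \<psi> x) has_derivative (\<lambda>h. \<phi> x * frechet_derivative \<psi> (at x) h + frechet_derivative \<phi> (at x) h * \<psi> x)) (at x)"
    by (rule has_derivative_mult[OF smooth_has_derivative[OF r(1)] smooth_has_derivative[OF \<psi>]])
  show "cpd i (\<lambda>x. \<phi> x * \<psi> x) x = cpd i \<phi> x * \<psi> x + \<phi> x * cpd i \<psi> x"
    unfolding cpd_def frechet_derivative_at[OF D, symmetric] by (rule add.commute)
qed

text \<open>A derivative of a test function is again a test function, so both sides are minus the
  integral of \<open>f\<close> against a mixed second derivative of \<open>\<phi>\<close>.\<close>

lemma weak_partial_commute:
  fixes f :: "real^2 \<Rightarrow> 'b::euclidean_space" and \<phi> :: "real^2 \<Rightarrow> real"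
  assumes "weak_partial i f p" "weak_partial j f q" and \<phi>: "test_function \<phi>"
  shows "(LINT x|disc_measure. cpd j \<phi> x *\<^sub>R p x) = (LINT x|disc_measure. cpd i \<phi> x *\<^sub>R q x)"
proof -
  have "smooth \<phi>" using \<phi> by (simp add: test_function_def)
  note c = cpd_commute[OF this, of i j]
  have "- (LINT x|disc_measure. cpd j \<phi> x *\<^sub>R p x) = (LINT x|disc_measure. cpd i (cpd j \<phi>) x *\<^sub>R f x)"
    using assms(1) test_function_cpd[OF \<phi>, of j] by (simp add: weak_partial_def)
  also have "\<dots> = (LINT x|disc_measure. cpd j (cpd i \<phi>) x *\<^sub>R f x)" by (simp only: c)
  also have "\<dots> = - (LINT x|disc_measure. cpd i \<phi> x *\<^sub>R q x)"
    using assms(2) test_function_cpd[OF \<phi>, of i] by (simp add: weak_partial_def)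
  finally show ?thesis by simp
qed

text \<open>Since \<open>\<phi> u\<close> is not smooth, \<open>u\<close> is mollified; the bounds on \<open>p\<close> and \<open>q\<close> make up for the
  convergence of the derivatives of the mollifications in \<open>L\<^sup>1\<close> only.\<close>

lemma weak_partial_commute_product:
  fixes f :: "real^2 \<Rightarrow> 'b::euclidean_space" and \<phi> u :: "real^2 \<Rightarrow> real"
  assumes wp: "weak_partial i f p" "weak_partial j f q" and \<phi>: "test_function \<phi>"
    and u: "\<And>l. weak_partial l u (v l)" and M: "AE x in disc_measure. norm (u x) \<le> M"
    and C: "AE x in disc_measure. norm (p x) \<le> C" "AE x in disc_measure. norm (q x) \<le> C"
  shows "(LINT x|disc_measure. (cpd j \<phi> x * u x + \<phi> x * v j x) *\<^sub>R p x)
       = (LINT x|disc_measure. (cpd i \<phi> x * u x + \<phi> x * v i x) *\<^sub>R q x)"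
proof -
  define C' where "C' = max 0 C"
  have C': "0 \<le> C'" "AE x in disc_measure. norm (p x) \<le> C'" "AE x in disc_measure. norm (q x) \<le> C'"
  proof -
    show "AE x in disc_measure. norm (p x) \<le> C'" using C(1) by eventually_elim (simp add: C'_def)
    show "AE x in disc_measure. norm (q x) \<le> C'" using C(2) by eventually_elim (simp add: C'_def)
  qed (simp add: C'_def)
  have lu: "locally_integrable u" by (rule weak_partial_locI(1)[OF u])
  note lp = weak_partial_locI[OF wp(1)] and lq = weak_partial_locI[OF wp(2)]
  obtain r where r: "smooth \<phi>" "0 < r" "r < 1" "\<And>x. r < norm x \<Longrightarrow> \<phi> x = 0"
    using test_functionE[OF \<phi>] by blast
  have cpd0: "cpd l \<phi> x = 0" if "r < norm x" for x l
    using supp_derivative[of r \<phi>, OF r(4) that] by (simp add: cpd_def)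
  obtain U where U: "\<And>k::nat. smooth (U k)"
    "(\<lambda>k. \<integral>\<^sup>+x. ennreal (norm (indicator (cball 0 r) x *\<^sub>R (U k x - u x))) \<partial>lebesgue) \<longlonglongrightarrow> 0"
    "\<And>l. l \<in> UNIV \<Longrightarrow>
       (\<lambda>k. \<integral>\<^sup>+x. ennreal (norm (indicator (cball 0 r) x *\<^sub>R (cpd l (U k) x - v l x))) \<partial>lebesgue) \<longlonglongrightarrow> 0"
    by (rule weak_partial_approx[of UNIV u v, OF u lu r(2,3)], rule that)
  have Uc: "continuous_on UNIV (U k)" "continuous_on UNIV (cpd l (U k))" for k l
    using smooth_continuous[OF U(1)] smooth_continuous[OF smooth_deriv[OF U(1)]]
    by (auto simp: cpd_def[abs_def])
  have lim1: "(\<lambda>k. LINT x|disc_measure. (\<psi> x * V k x) *\<^sub>R g x) \<longlonglongrightarrow> (LINT x|disc_measure. (\<psi> x * w x) *\<^sub>R g x)"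
    and int1: "\<And>k. integrable disc_measure (\<lambda>x. (\<psi> x * V k x) *\<^sub>R g x)"
    and int2: "integrable disc_measure (\<lambda>x. (\<psi> x * w x) *\<^sub>R g x)"
    if L1: "(\<lambda>k. \<integral>\<^sup>+x. ennreal (norm (indicator (cball 0 r) x *\<^sub>R (V k x - w x))) \<partial>lebesgue) \<longlonglongrightarrow> 0"
      and V: "\<And>k. continuous_on UNIV (V k)" and w: "locally_integrable w"
      and \<psi>: "test_function \<psi>" "\<And>x. r < norm x \<Longrightarrow> \<psi> x = 0"
      and g: "AE x in disc_measure. norm (g x) \<le> C'" "g \<in> borel_measurable disc_measure"
    for V :: "nat \<Rightarrow> real^2 \<Rightarrow> real" and w \<psi> :: "real^2 \<Rightarrow> real" and g :: "real^2 \<Rightarrow> 'b"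
  proof -
    have int: "integrable disc_measure (\<lambda>x. (\<psi> x * a x) *\<^sub>R g x)" if a: "locally_integrable a" for a :: "real^2 \<Rightarrow> real"
    proof -
      have "locally_integrable (\<lambda>x. C' * norm (a x))"
        by (rule locally_integrable_linear[OF locally_integrable_norm[OF a] bounded_linear_mult_right])
      then have "locally_integrable (\<lambda>x. a x *\<^sub>R g x)"
        by (rule locally_integrable_bound[OF borel_measurable_scaleR[OF locally_integrable_measurable[OF a] g(2)]])
           (use g(1) in \<open>eventually_elim, simp add: mult.commute[of C'] mult_left_mono\<close>)
      from test_integrable(1)[OF \<psi>(1) this] show ?thesis by simp
    qed
    show "integrable disc_measure (\<lambda>x. (\<psi> x * V k x) *\<^sub>R g x)" for k
      by (rule int[OF locally_integrable_continuous[OF V]])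
    show "integrable disc_measure (\<lambda>x. (\<psi> x * w x) *\<^sub>R g x)" by (rule int[OF w])
    obtain K where K: "K > 0" "\<And>x. norm (\<psi> x) \<le> K"
      by (rule supp_bounded[OF test_function_cont(1)[OF \<psi>(1)], of r], erule \<psi>(2), rule that)
    show "(\<lambda>k. LINT x|disc_measure. (\<psi> x * V k x) *\<^sub>R g x) \<longlonglongrightarrow> (LINT x|disc_measure. (\<psi> x * w x) *\<^sub>R g x)"
    proof (rule limit_mollified_linear[OF L1, where C = "K * C'"])
      show "linear (\<lambda>y. (\<psi> x * y) *\<^sub>R g x)" for x
        by (auto intro!: linearI simp: algebra_simps)
      show "AE x in disc_measure. \<forall>y. norm ((\<psi> x * y) *\<^sub>R g x) \<le> K * C' * norm y"
        using g(1)
      proof eventually_elim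
        case (elim x)
        show ?case
        proof
          fix y
          have "\<bar>\<psi> x\<bar> * norm (g x) \<le> K * C'" using elim K[of ] C'(1) by (intro mult_mono) auto
          then have "(\<bar>\<psi> x\<bar> * norm (g x)) * \<bar>y\<bar> \<le> (K * C') * \<bar>y\<bar>" by (intro mult_right_mono) auto
          then show "norm ((\<psi> x * y) *\<^sub>R g x) \<le> K * C' * norm y" by (simp add: abs_mult mult_ac)
        qed
      qed
      show "(\<lambda>x. (\<psi> x * w x) *\<^sub>R g x) \<in> borel_measurable disc_measure" using int[OF w] by auto
    qed (use K C' r V w \<psi>(2) int[OF w] int[OF locally_integrable_continuous[OF V]] in \<open>auto simp: fun_eq_iff\<close>)
  qed
  \<comment> \<open>The product rule for \<open>\<phi> x * U k x\<close> gives one term with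
    \<open>U k\<close> and one with its derivative. Both factors converge in L^1, and boundedness of
    \<open>g\<close> suffices for the limit.\<close>
  have lim: "(\<lambda>k. LINT x|disc_measure. cpd l (\<lambda>x. \<phi> x * U k x) x *\<^sub>R g x)
      \<longlonglongrightarrow> (LINT x|disc_measure. (cpd l \<phi> x * u x + \<phi> x * v l x) *\<^sub>R g x)"
    if g: "AE x in disc_measure. norm (g x) \<le> C'" "g \<in> borel_measurable disc_measure" for g :: "real^2 \<Rightarrow> 'b" and l
  proof -
    note A = U(2) Uc(1) lu test_function_cpd[OF \<phi>] cpd0 g
    note B = U(3)[OF UNIV_I, of l] Uc(2) weak_partial_locI(2)[OF u] \<phi> r(4) g
    show ?thesis
      using tendsto_add[OF lim1[OF A, of l] lim1[OF B]] int1[OF A, of l] int2[OF A, of l] int1[OF B] int2[OF B]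
      by (simp add: test_function_mult(2)[OF \<phi> U(1)] scaleR_add_left Bochner_Integration.integral_add)
  qed
  have "(LINT x|disc_measure. cpd j (\<lambda>x. \<phi> x * U k x) x *\<^sub>R p x) = (LINT x|disc_measure. cpd i (\<lambda>x. \<phi> x * U k x) x *\<^sub>R q x)" for k
    by (rule weak_partial_commute[OF wp test_function_mult(1)[OF \<phi> U(1)]])
  then show ?thesis
    using lim[OF C'(2) lp(4), of j] lim[OF C'(3) lq(4), of i] LIMSEQ_unique by simp
qed

text \<open>Mollifications inherit the bound \<open>C\<close> for each of the two partial
  derivatives and are Lipschitz with constant \<open>2 * C\<close> on balls of radius below 1. The
  estimate passes to \<open>u\<close> where they converge, a set of full measure and hence dense,
  and extends by continuity up to the circle.\<close>

lemma weak_partials_lipschitz: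
  fixes u :: "real^2 \<Rightarrow> 'b::euclidean_space"
  assumes cont: "continuous_on (cball 0 1) u" and wp: "\<And>i. weak_partial i u (v i)"
    and C: "0 \<le> C" "\<And>i. AE x in disc_measure. norm (v i x) \<le> C"
  shows "(2 * C)-lipschitz_on (cball 0 1) u"
proof -
  have lip: "(2 * C)-lipschitz_on (cball 0 r) u" if r: "0 < r" "r < 1" for r
  proof -
    obtain U where U: "\<And>k::nat. smooth (U k)"
      "AE x in disc_measure. norm x \<le> r \<longrightarrow> (\<lambda>k. U k x) \<longlonglongrightarrow> u x"
      "\<And>i M k x. 0 \<le> M \<Longrightarrow> i \<in> UNIV \<Longrightarrow> (AE x in disc_measure. norm (v i x) \<le> M) \<Longrightarrow> norm x \<le> r \<Longrightarrow>
       norm (cpd i (U k) x) \<le> M"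
      by (rule weak_partial_approx[of UNIV u v, OF wp weak_partial_locI(1)[OF wp] r], rule that)
    have Ulip: "norm (U k x - U k y) \<le> 2 * C * norm (x - y)" if "x \<in> cball 0 r" "y \<in> cball 0 r" for k x y
    proof (rule differentiable_bound[OF convex_cball _ _ that, where f' = "\<lambda>x. frechet_derivative (U k) (at x)"])
      fix z :: "real^2" assume z: "z \<in> cball 0 r"
      note D = smooth_has_derivative[OF U(1), of k z]
      show "(U k has_derivative frechet_derivative (U k) (at z)) (at z within cball 0 r)"
        by (rule has_derivative_at_withinI[OF D])
      show "onorm (frechet_derivative (U k) (at z)) \<le> 2 * C"
      proof (rule onorm_le)
        fix a :: "real^2"
        have "frechet_derivative (U k) (at z) a = (\<Sum>i\<in>UNIV. (a $ i) *\<^sub>R cpd i (U k) z)"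
        proof -
          have "a = (\<Sum>i\<in>UNIV. (a $ i) *\<^sub>R axis i 1)" using basis_expansion[of a] by (simp add: scalar_mult_eq_scaleR)
          then have "frechet_derivative (U k) (at z) a = frechet_derivative (U k) (at z) (\<Sum>i\<in>UNIV. (a $ i) *\<^sub>R axis i 1)" by simp
          also have "\<dots> = (\<Sum>i\<in>UNIV. (a $ i) *\<^sub>R cpd i (U k) z)"
            unfolding cpd_def
            by (simp only: linear_sum[OF has_derivative_linear[OF D]] linear_cmul[OF has_derivative_linear[OF D]])
          finally show ?thesis .
        qed
        also have "norm \<dots> \<le> (\<Sum>i\<in>(UNIV::2 set). norm a * C)"
          using U(3)[OF C(1) UNIV_I C(2)] z
          by (intro order_trans[OF norm_sum] sum_mono) (auto intro!: mult_mono component_le_norm_cart)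
        finally show "norm (frechet_derivative (U k) (at z) a) \<le> 2 * C * norm a" by (simp add: mult_ac)
      qed
    qed
    define S where "S = {x \<in> ball 0 r. (\<lambda>k. U k x) \<longlonglongrightarrow> u x}"
    have "(2 * C)-lipschitz_on S u"
    proof (rule lipschitz_onI)
      fix x y assume xy: "x \<in> S" "y \<in> S"
      have "(\<lambda>k. norm (U k x - U k y)) \<longlonglongrightarrow> norm (u x - u y)" using xy by (auto simp: S_def intro!: tendsto_intros)
      then show "dist (u x) (u y) \<le> 2 * C * dist x y"
        unfolding dist_norm
        by (rule LIMSEQ_le_const2) (use Ulip xy in \<open>auto simp: S_def\<close>)
    qed (use C in auto)
    moreover have cl: "closure S = cball 0 r"
    proof
      show "closure S \<subseteq> cball 0 r" by (rule closure_minimal) (auto simp: S_def)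
      have "ball 0 r \<subseteq> closure S"
      proof
        fix x :: "real^2" assume x: "x \<in> ball 0 r"
        show "x \<in> closure S"
          unfolding closure_approachable
        proof (intro allI impI)
          fix e :: real assume "e > 0"
          let ?B = "ball x e \<inter> ball 0 r"
          have "open ?B" "x \<in> ?B" using x \<open>e > 0\<close> by auto
          then obtain d where d: "d > 0" "ball x d \<subseteq> ?B" using open_contains_ball by blast
          have "\<not> ball x d \<inter> S = {}"
          proof
            assume e: "ball x d \<inter> S = {}"
            have "AE y in lebesgue. y \<notin> ball x d"
              using U(2) unfolding disc_AE
            proof eventually_elim
              case (elim y)
              show ?case
              proof
                assume y: "y \<in> ball x d"
                then have "norm y < r" using d by auto
                then have "y \<in> S" using elim r by (auto simp: S_def)
                then show False using e y by auto
              qed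
            qed
            then have "AE y in lborel. y \<notin> ball x d" by (simp add: AE_completion_iff)
            then have "emeasure lborel (ball x d) = 0"
              by (subst (asm) AE_iff_measurable[where N = "ball x d"]) auto
            then show False
              using \<open>d > 0\<close> content_ball_pos[of d x] by (simp add: measure_def)
          qed
          then show "\<exists>y\<in>S. dist y x < e" using d by (auto simp: dist_commute)
        qed
      qed
      then show "cball 0 r \<subseteq> closure S" using closure_ball[OF r(1), of "0::real^2"] closure_minimal[OF _ closed_closure] by metis
    qed
    moreover have "continuous_on (closure S) u"
      unfolding cl by (rule continuous_on_subset[OF cont]) (use r in auto)
    ultimately show ?thesis using lipschitz_on_closure by metis
  qed
  have "(2 * C)-lipschitz_on (ball 0 1) u"
  proof (rule lipschitz_onI)
    fix x y :: "real^2" assume xy: "x \<in> ball 0 1" "y \<in> ball 0 1"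
    define r where "r = (1 + max (norm x) (norm y)) / 2"
    have "max (norm x) (norm y) < 1" using xy by simp
    then have r: "0 < r" "r < 1" "norm x \<le> r" "norm y \<le> r"
      unfolding r_def by (auto intro: add_pos_nonneg simp: le_max_iff_disj)
    show "dist (u x) (u y) \<le> 2 * C * dist x y"
      by (rule lipschitz_onD[OF lip[OF r(1,2)]]) (use r in auto)
  qed (use C in auto)
  then show ?thesis
    using lipschitz_on_closure[of "2 * C" "ball 0 1" u] cont by (simp add: closure_ball)
qed

lemma pd_weak_partial:
  assumes "weak_partial i u v"
  shows "weak_partial i u (pd i u)" "AE x in disc_measure. pd i u x = v x"
proof -
  show "weak_partial i u (pd i u)" unfolding pd_def using assms by (rule someI[of "weak_partial i u"])
  then show "AE x in disc_measure. pd i u x = v x" using assms by (rule weak_partial_unique)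
qed

lemma weak_partial_C1:
  assumes f: "C_k (Suc 0) f"
  shows "weak_partial i f (cpd i f)"
  unfolding weak_partial_def
  using C_k_deriv[OF f] C_k_imp_continuous[OF f] test_integral_by_parts[OF _ f]
  by (auto intro!: locally_integrable_continuous simp: cpd_def[abs_def])

section \<open>Approximation by test functions and the pairing\<close>

text \<open>A C^1 cutoff that is rational on the positive half line, so that its estimates are
  polynomial inequalities. It never attains 1, but its distance to 1 and its derivative decay at
  least like 1 / m.\<close>

definition cut :: "real \<Rightarrow> real" where
  "cut m = (max 0 m)\<^sup>2 / (1 + (max 0 m)\<^sup>2)"

definition cut' :: "real \<Rightarrow> real" where
  "cut' m = 2 * max 0 m / (1 + (max 0 m)\<^sup>2)\<^sup>2"

lemma max_0_square_deriv: "((\<lambda>m. (max 0 m)\<^sup>2) has_real_derivative 2 * max 0 m) (at (m::real))"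
proof -
  consider "m > 0" | "m < 0" | "m = 0" by linarith
  then show ?thesis
  proof cases
    case 1
    have "((\<lambda>m. m\<^sup>2) has_real_derivative 2 * max 0 m) (at m)"
      using 1 by (auto intro!: derivative_eq_intros)
    then show ?thesis
      by (rule has_field_derivative_transform_within_open[where S = "{0<..}"]) (use 1 in auto)
  next
    case 2
    have "((\<lambda>m. 0) has_real_derivative 2 * max 0 m) (at m)"
      using 2 by auto
    then show ?thesis
      by (rule has_field_derivative_transform_within_open[where S = "{..<0}"]) (use 2 in auto)
  next
    case 3
    have "((\<lambda>h. (max 0 h)\<^sup>2 / h) \<longlongrightarrow> 0) (at (0::real))"
    proof (rule Lim_null_comparison[where g = "\<lambda>h. \<bar>h\<bar>"])
      show "\<forall>\<^sub>F h in at 0. norm ((max 0 h)\<^sup>2 / h) \<le> \<bar>h\<bar>"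
        by (auto simp: eventually_at_filter max_def power2_eq_square)
    qed (auto intro!: tendsto_eq_intros)
    then show ?thesis using 3 by (simp add: DERIV_def)
  qed
qed

lemma cut_deriv: "(cut has_real_derivative cut' m) (at m)"
proof -
  have "1 + (max 0 m)\<^sup>2 \<noteq> 0" using zero_le_power2[of "max 0 m"] by linarith
  moreover have "((2 * max 0 m) * (1 + (max 0 m)\<^sup>2) - (max 0 m)\<^sup>2 * (0 + 2 * max 0 m)) / ((1 + (max 0 m)\<^sup>2) * (1 + (max 0 m)\<^sup>2)) = cut' m"
    unfolding cut'_def by (simp add: power2_eq_square algebra_simps)
  ultimately show ?thesis
    using DERIV_divide[OF max_0_square_deriv[of m] DERIV_add[OF DERIV_const max_0_square_deriv[of m]], of 1] unfolding cut_def[abs_def] by simp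
qed

lemma cut_C1: "C_k (Suc 0) cut"
proof (rule C_k_SucI[where f' = "\<lambda>m v. v * cut' m"])
  show "(cut has_derivative (\<lambda>v. v * cut' m)) (at m)" for m
    using cut_deriv[of m] by (simp add: has_field_derivative_def mult_commute_abs)
  have "1 + (max 0 m)\<^sup>2 \<noteq> 0" for m :: real using zero_le_power2[of "max 0 m"] by linarith
  then have "continuous_on UNIV cut'"
    unfolding cut'_def[abs_def] by (intro continuous_intros) auto
  then show "C_k 0 (\<lambda>m. v * cut' m)" for v by (auto intro!: continuous_intros)
qed

text \<open>For the boundary cutoff the weight m + 1 in the last two bounds is (k + 1) times 1 -
  |x|^2: they trade the steepness of the cutoff for the distance to the circle.\<close>

lemma cut_bounds: "0 \<le> cut m" "cut m \<le> 1" "m \<le> 0 \<Longrightarrow> cut m = 0" "m \<le> 0 \<Longrightarrow> cut' m = 0" "0 \<le> cut' m"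
    "(m + 1) * cut' m \<le> 4" "(m + 1) * (1 - cut m) \<le> 2"
proof -
  have p: "1 + (max 0 m)\<^sup>2 > 0" using zero_le_power2[of "max 0 m"] by linarith
  show "0 \<le> cut m" "cut m \<le> 1" "m \<le> 0 \<Longrightarrow> cut m = 0" "m \<le> 0 \<Longrightarrow> cut' m = 0" "0 \<le> cut' m"
    using p by (auto simp: cut_def cut'_def field_simps)
  show "(m + 1) * cut' m \<le> 4"
  proof (cases "m \<le> 0")
    case False
    have "(m + 1) * m \<le> 2 * (1 + m\<^sup>2)" using zero_le_power2[of "m - 1/2"]
      by (simp add: power2_eq_square algebra_simps)
    also have "\<dots> \<le> 2 * (1 + m\<^sup>2)\<^sup>2" using False
      by (simp add: power2_eq_square algebra_simps)
    finally show ?thesis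
      using False p by (simp add: cut'_def field_simps)
  qed (simp add: cut'_def)
  show "(m + 1) * (1 - cut m) \<le> 2"
  proof (cases "m \<le> 0")
    case False
    have "m + 1 \<le> 2 * (1 + m\<^sup>2)" using zero_le_power2[of "m - 1/4"]
      by (simp add: power2_eq_square algebra_simps)
    then show ?thesis
      using False p by (simp add: cut_def field_simps)
  qed (simp add: cut_def)
qed

text \<open>The function vanishes where 1 - |x|^2 is at most 1 / (k + 1). The squared norm keeps it
  C^1 at the origin.\<close>

definition bd_cut :: "nat \<Rightarrow> real^2 \<Rightarrow> real" where
  "bd_cut k x = cut (real (Suc k) * (1 - x \<bullet> x) - 1)"

lemma bd_cut_C1: "C_k (Suc 0) (bd_cut k)"
proof -
  have "C_k (Suc 0) (\<lambda>x::real^2. (real (Suc k) - 1) + (- real (Suc k)) * (x \<bullet> x))"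
    by (intro C_k_add C_k_const C_k_bilinear[OF bounded_bilinear_mult] C_k_bilinear[OF bounded_bilinear_inner]
          C_k_linear[OF bounded_linear_ident])
  from C_k_compose[OF cut_C1 this] show ?thesis
    by (simp add: bd_cut_def[abs_def] algebra_simps)
qed

lemma bd_cut_cpd: "cpd i (bd_cut k) x = - 2 * real (Suc k) * (x $ i) * cut' (real (Suc k) * (1 - x \<bullet> x) - 1)"
proof -
  have "((\<lambda>x::real^2. real (Suc k) * (1 - x \<bullet> x) - 1) has_derivative (\<lambda>v. - 2 * real (Suc k) * (x \<bullet> v))) (at x)"
    by (auto intro!: derivative_eq_intros simp: fun_eq_iff inner_commute algebra_simps)
  from has_derivative_compose[OF this cut_deriv[unfolded has_field_derivative_def]]
  have "(bd_cut k has_derivative (\<lambda>v. cut' (real (Suc k) * (1 - x \<bullet> x) - 1) * (- 2 * real (Suc k) * (x \<bullet> v)))) (at x)"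
    by (simp add: bd_cut_def[abs_def])
  from frechet_derivative_at[OF this, symmetric] show ?thesis
    by (simp add: cpd_def inner_axis)
qed

text \<open>The Lipschitz bound and the boundary condition make \<open>f\<close> at most a multiple
  of 1 - |x|^2. The gradient of the cutoff is at most a constant divided by the same quantity, so
  the cut off functions have gradients bounded independently of \<open>k\<close>, as
  \<open>approximates\<close> demands.\<close>

lemma approximates_exists:
  fixes f :: "real^2 \<Rightarrow> real^3"
  assumes cont: "continuous_on (cball 0 1) f" and wp: "\<And>i. weak_partial i f (p i)"
    and C: "0 \<le> C" "\<And>i. AE x in disc_measure. norm (p i x) \<le> C"
    and bd: "\<And>x. norm x = 1 \<Longrightarrow> f x = 0"
  obtains \<phi> where "approximates \<phi> f"
proof -
  define L where "L = 2 * C"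
  have L: "0 \<le> L" using C by (simp add: L_def)
  have lip: "L-lipschitz_on (cball 0 1) f"
    unfolding L_def by (rule weak_partials_lipschitz[OF cont wp C])
  have fL: "norm (f x) \<le> L * (1 - x \<bullet> x)" if x: "norm x \<le> 1" for x
  proof -
    \<comment> \<open>The nearest point of the circle; for the origin any point of the circle
      serves.\<close>
    obtain y :: "real^2" where y: "norm y = 1" "norm (x - y) = 1 - norm x"
    proof (cases "x = 0")
      case True
      then show thesis by (intro that[of "axis 1 1"]) simp_all
    next
      case False
      have "x - (1 / norm x) *\<^sub>R x = (1 - 1 / norm x) *\<^sub>R x" by (simp add: scaleR_diff_left)
      then have "norm (x - (1 / norm x) *\<^sub>R x) = \<bar>(1 - 1 / norm x) * norm x\<bar>" by (simp add: abs_mult)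
      also have "\<dots> = 1 - norm x" using False x by (simp add: field_simps)
      finally show thesis using False by (intro that[of "(1 / norm x) *\<^sub>R x"]) auto
    qed
    have "norm (f x) \<le> L * (1 - norm x)"
      using lipschitz_onD[OF lip, of x y] x y bd by (simp add: dist_norm)
    moreover have "(norm x)\<^sup>2 \<le> norm x" using x by (simp add: power2_eq_square mult_left_le)
    ultimately show ?thesis
      using mult_left_mono[of "1 - norm x" "1 - x \<bullet> x" L] L by (simp add: power2_norm_eq_inner)
  qed
  have fb: "norm (f x) \<le> L" if "norm x \<le> 1" for x
    using fL[OF that] mult_left_mono[of "1 - x \<bullet> x" 1 L] L by simp
  define m where "m k x = real (Suc k) * (1 - x \<bullet> x) - 1" for k and x :: "real^2"
  define W where "W k x = (if norm x < 1 then bd_cut k x *\<^sub>R f x else 0)" for k x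
  define D where "D k i x = (if norm x < 1 then bd_cut k x *\<^sub>R p i x + cpd i (bd_cut k) x *\<^sub>R f x else 0)" for k i x
  \<comment> \<open>The radius where the argument of the cutoff changes sign; the cut off function
    and its derivatives vanish from there on. For k = 0 it is 0.\<close>
  define R where "R k = sqrt (1 - 1 / real (Suc k))" for k
  have R: "0 \<le> R k" "R k < 1" for k by (auto simp: R_def)
  have mR: "m k x \<le> 0" if "R k \<le> norm x" for k x
  proof -
    have "(R k)\<^sup>2 \<le> (norm x)\<^sup>2" using that R[of k] by (intro power_mono)
    then have "1 - 1 / real (Suc k) \<le> x \<bullet> x" by (simp add: R_def power2_norm_eq_inner)
    then have "real (Suc k) * (1 - x \<bullet> x) \<le> real (Suc k) * (1 / real (Suc k))" by (intro mult_left_mono) auto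
    then show ?thesis by (simp add: m_def)
  qed
  have cut_m: "bd_cut k x = cut (m k x)" "cpd i (bd_cut k) x = - 2 * real (Suc k) * (x $ i) * cut' (m k x)" for k i x
    by (simp_all add: bd_cut_def m_def bd_cut_cpd)
  have W0: "W k x = 0" and D0: "D k i x = 0" if "R k \<le> norm x" for k i x
    using mR[OF that] cut_bounds(3,4)[of "m k x"] by (simp_all add: W_def D_def cut_m)
  have Wf: "norm (W k x - f x) \<le> 2 * L / real (Suc k)" if x: "norm x < 1" for k x
  proof -
    have "norm (W k x - f x) = (1 - cut (m k x)) * norm (f x)"
    proof -
      have "W k x - f x = (cut (m k x) - 1) *\<^sub>R f x" using x by (simp add: W_def cut_m scaleR_diff_left)
      then show ?thesis using cut_bounds(2)[of "m k x"] by simp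
    qed
    also have "\<dots> \<le> (1 - cut (m k x)) * (L * (1 - x \<bullet> x))"
      using fL[of x] x cut_bounds(2)[of "m k x"] by (intro mult_left_mono) auto
    also have "\<dots> = L * ((m k x + 1) * (1 - cut (m k x))) / real (Suc k)"
      by (simp add: m_def field_simps)
    also have "\<dots> \<le> L * 2 / real (Suc k)"
      using L cut_bounds(7)[of "m k x"] by (intro divide_right_mono mult_left_mono) auto
    finally show ?thesis by (simp add: mult.commute)
  qed
  \<comment> \<open>The chain rule contributes the factor 2 (k + 1), which times 1 - |x|^2 is 2 (m +
    1); with (m + 1) times the derivative of \<open>cut\<close> at most 4 this makes 8.\<close>
  have cutD: "norm (cpd i (bd_cut k) x *\<^sub>R f x) \<le> 8 * L" if x: "norm x < 1" for k i x
  proof -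
    have "\<bar>x $ i\<bar> \<le> 1" using component_le_norm_cart[of x i] x by simp
    then have "\<bar>cpd i (bd_cut k) x\<bar> \<le> 2 * real (Suc k) * 1 * cut' (m k x)"
      unfolding cut_m abs_mult using cut_bounds(5)[of "m k x"] by (intro mult_mono) auto
    moreover have "norm (f x) \<le> L * (1 - x \<bullet> x)" using fL x by simp
    ultimately have "norm (cpd i (bd_cut k) x *\<^sub>R f x) \<le> (2 * real (Suc k) * 1 * cut' (m k x)) * (L * (1 - x \<bullet> x))"
      unfolding norm_scaleR using cut_bounds(5)[of "m k x"] by (intro mult_mono) auto
    also have "\<dots> = 2 * L * ((m k x + 1) * cut' (m k x))" by (simp add: m_def algebra_simps)
    also have "\<dots> \<le> 2 * L * 4" using L cut_bounds(6)[of "m k x"] by (intro mult_left_mono) auto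
    finally show ?thesis by simp
  qed
  define K where "K = C + 8 * L"
  have K: "0 \<le> K" using C L by (simp add: K_def)
  have DK: "AE x in disc_measure. norm (D k i x) \<le> K" for k i
    using C(2)[of i]
  proof eventually_elim
    case (elim x)
    have "norm (bd_cut k x *\<^sub>R p i x) \<le> 1 * C"
      unfolding norm_scaleR using cut_bounds(1,2)[of "m k x"] elim C by (intro mult_mono) (auto simp: cut_m)
    then have "norm (bd_cut k x *\<^sub>R p i x + cpd i (bd_cut k) x *\<^sub>R f x) \<le> K" if "norm x < 1"
      using norm_triangle_ineq[of "bd_cut k x *\<^sub>R p i x" "cpd i (bd_cut k) x *\<^sub>R f x"] cutD[OF that, of i k]
      by (simp add: K_def)
    then show ?case using K by (simp add: D_def)
  qed
  have Dlim: "AE x in disc_measure. (\<lambda>k. D k i x) \<longlonglongrightarrow> p i x" for i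
    unfolding disc_AE
  proof (rule AE_I2, rule impI)
    fix x :: "real^2" assume "x \<in> disc"
    then have x: "norm x < 1" by simp
    define a where "a = 1 - x \<bullet> x"
    have "(norm x)\<^sup>2 < 1" using x by (simp add: abs_square_less_1)
    then have a: "a > 0" by (simp add: a_def power2_norm_eq_inner)
    have ev: "eventually (\<lambda>k. real (Suc k) * a - 1 > 0) sequentially"
      using a by real_asymp
    have ev1: "eventually (\<lambda>k. cut (m k x) = (real (Suc k) * a - 1)\<^sup>2 / (1 + (real (Suc k) * a - 1)\<^sup>2)) sequentially"
      and ev2: "eventually (\<lambda>k. cpd i (bd_cut k) x = - (2 * (x $ i)) * (real (Suc k) * (2 * (real (Suc k) * a - 1) / (1 + (real (Suc k) * a - 1)\<^sup>2)\<^sup>2))) sequentially"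
      by (rule eventually_mono[OF ev], simp add: cut_def cut'_def m_def cut_m a_def mult_ac del: of_nat_Suc)+
    have "(\<lambda>k. (real (Suc k) * a - 1)\<^sup>2 / (1 + (real (Suc k) * a - 1)\<^sup>2)) \<longlonglongrightarrow> 1"
      using a by real_asymp
    then have l1: "(\<lambda>k. bd_cut k x) \<longlonglongrightarrow> 1" unfolding cut_m using tendsto_cong[OF ev1] by simp
    have "(\<lambda>k. real (Suc k) * (2 * (real (Suc k) * a - 1) / (1 + (real (Suc k) * a - 1)\<^sup>2)\<^sup>2)) \<longlonglongrightarrow> 0"
      using a by real_asymp
    then have "(\<lambda>k. - (2 * (x $ i)) * (real (Suc k) * (2 * (real (Suc k) * a - 1) / (1 + (real (Suc k) * a - 1)\<^sup>2)\<^sup>2))) \<longlonglongrightarrow> 0"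
      by (rule tendsto_mult_right_zero)
    then have l2: "(\<lambda>k. cpd i (bd_cut k) x) \<longlonglongrightarrow> 0" using tendsto_cong[OF ev2] by simp
    have "(\<lambda>k. bd_cut k x *\<^sub>R p i x + cpd i (bd_cut k) x *\<^sub>R f x) \<longlonglongrightarrow> 1 *\<^sub>R p i x + 0 *\<^sub>R f x"
      by (intro tendsto_intros l1 l2)
    then show "(\<lambda>k. D k i x) \<longlonglongrightarrow> p i x" using x by (simp add: D_def)
  qed
  have wpW: "weak_partial i (W k) (D k i)" for i k
  proof -
    have "AE x in disc_measure. norm (bd_cut k x) \<le> 1"
      using cut_bounds(1,2) by (auto simp: cut_m)
    moreover have "AE x in disc_measure. norm (f x) \<le> L" unfolding disc_AE using fb by (auto simp: less_imp_le)
    ultimately have "weak_partial i (\<lambda>x. bd_cut k x *\<^sub>R f x) (\<lambda>x. bd_cut k x *\<^sub>R p i x + cpd i (bd_cut k) x *\<^sub>R f x)"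
      by (rule weak_partial_bilinear[OF bounded_bilinear_scaleR weak_partial_C1[OF bd_cut_C1] wp])
    then show ?thesis
      by (rule weak_partial_cong_AE) (auto simp: disc_AE W_def D_def)
  qed
  have Wc: "continuous_on UNIV (W k)" for k
  proof -
    have "continuous_on (ball 0 1) (W k)"
    proof -
      have "continuous_on (ball 0 1) (\<lambda>x. bd_cut k x *\<^sub>R f x)"
        by (intro continuous_intros C_k_imp_continuous[OF bd_cut_C1] continuous_on_subset[OF cont]) auto
      then show ?thesis by (rule continuous_on_eq) (auto simp: W_def)
    qed
    moreover have "continuous_on (- cball 0 (R k)) (W k)"
      by (rule continuous_on_eq[OF continuous_on_const[of _ 0]]) (auto simp: W0)
    ultimately have "continuous_on (ball 0 1 \<union> - cball 0 (R k)) (W k)"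
      by (intro continuous_on_open_Un) auto
    moreover have "ball 0 1 \<union> - cball 0 (R k) = (UNIV :: (real^2) set)" using R[of k] by auto
    ultimately show ?thesis by simp
  qed
  have Wi: "integrable lborel (W k)" for k
  proof -
    have "integrable lborel (\<lambda>x. indicator (cball 0 1) x *\<^sub>R W k x)"
      using borel_integrable_compact[OF compact_cball continuous_on_subset[OF Wc]] by simp
    also have "(\<lambda>x. indicator (cball 0 1) x *\<^sub>R W k x) = W k"
      by (auto simp: fun_eq_iff indicator_def W_def)
    finally show ?thesis .
  qed
  \<comment> \<open>Three requirements on the mollified cutoffs: uniform closeness, a gradient bound
    free of \<open>k\<close>, and closeness of the gradients in L^1. The last one yields convergence
    almost everywhere along a subsequence.\<close>
  define P where "P k \<phi> \<longleftrightarrow> test_function \<phi> \<and> (\<forall>x\<in>disc. norm (\<phi> x - W k x) \<le> 1 / real (Suc k)) \<and>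
      (\<forall>i x. norm (cpd i \<phi> x) \<le> K) \<and>
      (\<forall>i. (\<integral>\<^sup>+x. ennreal (norm (cpd i \<phi> x - D k i x)) \<partial>disc_measure) \<le> ennreal (1 / real (Suc k)))" for k \<phi>
  have "\<forall>k. \<exists>\<phi>. P k \<phi>"
  proof
    fix k
    define r where "r = (1 + R k) / 2"
    have r: "R k < r" "r < 1" using R[of k] by (auto simp: r_def)
    have indW: "indicator (cball 0 r) x *\<^sub>R W k x = W k x" and indD: "indicator (cball 0 r) x *\<^sub>R D k i x = D k i x" for x i
      using W0[of k x] D0[of k x i] r by (auto simp: indicator_def)
    have "\<forall>i. \<exists>H. integrable lborel H \<and> (AE x in lebesgue. indicator (cball 0 r) x *\<^sub>R D k i x = H x)"
    proof
      fix i
      show "\<exists>H. integrable lborel H \<and> (AE x in lebesgue. indicator (cball 0 r) x *\<^sub>R D k i x = H x)"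
        by (rule lebesgue_borel_rep[OF locally_integrableD[OF weak_partial_locI(2)[OF wpW] r(2)]], rule exI, rule conjI)
    qed
    from choice[OF this] obtain H where
      "\<forall>i. integrable lborel (H i) \<and> (AE x in lebesgue. indicator (cball 0 r) x *\<^sub>R D k i x = H i x)" ..
    then have H: "\<And>i. integrable lborel (H i)" "\<And>i. AE x in lebesgue. indicator (cball 0 r) x *\<^sub>R D k i x = H i x"
      by simp_all
    have k: "0 < 1 / real (Suc k)" by simp
    have "uniformly_continuous_on (cball 0 2) (W k)"
      by (rule compact_uniformly_continuous[OF continuous_on_subset[OF Wc]]) auto
    then obtain d0 where d0: "d0 > 0" "\<And>x y. x \<in> cball 0 2 \<Longrightarrow> y \<in> cball 0 2 \<Longrightarrow> dist y x < d0 \<Longrightarrow> dist (W k y) (W k x) < 1 / real (Suc k)"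
    proof -
      have "\<exists>d>0. \<forall>x\<in>cball 0 2. \<forall>y\<in>cball 0 2. dist y x < d \<longrightarrow> dist (W k y) (W k x) < 1 / real (Suc k)"
        using \<open>uniformly_continuous_on (cball 0 2) (W k)\<close> k by (simp only: uniformly_continuous_on_def)
      then show thesis using that by blast
    qed
    have "\<exists>d>0. \<forall>\<rho> s. mollifier s \<rho> \<longrightarrow> s \<le> d \<longrightarrow>
        (\<integral>\<^sup>+x. ennreal (norm (conv \<rho> (H i) x - H i x)) \<partial>lborel) \<le> ennreal (1 / Suc k)" for i
      by (rule conv_L1[OF H(1) k]) blast
    from choice[OF allI[OF this]] obtain d' where
      "\<forall>i. d' i > 0 \<and> (\<forall>\<rho> s. mollifier s \<rho> \<longrightarrow> s \<le> d' i \<longrightarrow>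
        (\<integral>\<^sup>+x. ennreal (norm (conv \<rho> (H i) x - H i x)) \<partial>lborel) \<le> ennreal (1 / Suc k))" ..
    then have d': "\<And>i. d' i > 0" "\<And>i \<rho> s. mollifier s \<rho> \<Longrightarrow> s \<le> d' i \<Longrightarrow>
        (\<integral>\<^sup>+x. ennreal (norm (conv \<rho> (H i) x - H i x)) \<partial>lborel) \<le> ennreal (1 / Suc k)"
      by blast+
    \<comment> \<open>Half of the gap is used twice: the mollification is supported within radius
      \<open>R k + e\<close>, and a point with \<open>norm x + e\<close> above \<open>r\<close> is
      outside this ball. Hence the derivative is either a convolution with \<open>H\<close> or
      zero.\<close>
    define e where "e = min (min d0 ((r - R k) / 2)) (Min (range d'))"
    have "e \<le> (r - R k) / 2" unfolding e_def by (rule min.coboundedI1, rule min.cobounded2)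
    then have e: "e > 0" "e \<le> d0" "e \<le> (r - R k) / 2" "\<And>i. e \<le> d' i"
      using d0(1) d'(1) r(1) by (simp_all add: e_def min.coboundedI2)
    obtain \<rho> :: "real^2 \<Rightarrow> real" where \<rho>: "mollifier e \<rho>" using mollifier_exists[OF e(1)] by blast
    define \<phi> where "\<phi> = conv \<rho> (W k)"
    have sm: "smooth \<phi>"
      unfolding \<phi>_def by (rule conv_smooth[OF _ mollifier_zero[OF \<rho>] Wi]) (use \<rho> in \<open>auto simp: mollifier_def\<close>)
    have z: "\<phi> x = 0" if "R k + e < norm x" for x
      unfolding \<phi>_def by (rule conv_zero[OF \<rho>, of "R k"]) (use that W0 in auto)
    have "R k + e < 1" using e(3) r by (simp add: field_simps)
    then have test: "test_function \<phi>" by (rule test_functionI[OF sm _ z])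
    have cpd: "cpd i \<phi> x = conv \<rho> (H i) x" if "norm x + e \<le> r" for i x
      unfolding \<phi>_def
      by (rule mollified_partial[OF wpW \<rho> r(2) that Wi _ H]) (simp add: indW)
    have cpd0: "cpd i \<phi> x = 0" if "r < norm x + e" for i x
    proof -
      have "R k + e < norm x" using that e(3) by (simp add: field_simps)
      from supp_derivative[of "R k + e" \<phi>, OF z this] show ?thesis by (simp add: cpd_def)
    qed
    have HK: "AE x in lborel. norm (H i x) \<le> K" for i
    proof -
      have "AE x in lebesgue. norm (H i x) \<le> K"
        using H(2)[of i] DK[of k i] unfolding disc_AE indD
      proof eventually_elim
        case (elim x)
        then show ?case using K D_def[of k i x] by (cases "norm x < 1") auto
      qed
      then show ?thesis by (simp add: AE_completion_iff)
    qed
    have "P k \<phi>"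
      unfolding P_def
    proof (intro conjI allI ballI test)
      fix x :: "real^2" assume x: "x \<in> disc"
      show "norm (\<phi> x - W k x) \<le> 1 / real (Suc k)"
        unfolding \<phi>_def
      proof (rule conv_near_const[OF \<rho> Wi])
        have "norm (W k y - W k x) \<le> 1 / real (Suc k)" if "norm (x - y) < e" for y
        proof -
          have "e \<le> 1" using e(3) r R[of k] by (simp add: field_simps)
          then have "norm y \<le> 2" using that x norm_triangle_ineq2[of y x] by (simp add: norm_minus_commute)
          then show ?thesis
            using d0(2)[of x y] that e(2) x by (simp add: dist_norm norm_minus_commute less_imp_le)
        qed
        then show "AE y in lborel. norm (x - y) < e \<longrightarrow> norm (W k y - W k x) \<le> 1 / real (Suc k)" by simp
      qed
    next
      fix i and x :: "real^2"
      show "norm (cpd i \<phi> x) \<le> K"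
      proof (cases "norm x + e \<le> r")
        case True
        have "AE y in lborel. norm (x - y) < e \<longrightarrow> norm (H i y - 0) \<le> K"
          using HK[of i] by eventually_elim simp
        from conv_near_const[OF \<rho> H(1) this] show ?thesis using cpd[OF True] by simp
      next
        case False
        then show ?thesis using cpd0[of x i] K by simp
      qed
    next
      fix i
      have "(\<integral>\<^sup>+x. ennreal (norm (cpd i \<phi> x - D k i x)) \<partial>disc_measure) \<le> (\<integral>\<^sup>+x. ennreal (norm (conv \<rho> (H i) x - H i x)) \<partial>lebesgue)"
      proof (rule disc_nn_integral_le_AE)
        show "AE x in disc_measure. ennreal (norm (cpd i \<phi> x - D k i x)) \<le> ennreal (norm (conv \<rho> (H i) x - H i x))"
          unfolding disc_AE using H(2)[of i]
        proof eventually_elim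
          case (elim x)
          show ?case
          proof (cases "norm x + e \<le> r")
            case True
            then show ?thesis using elim by (simp add: cpd indD del: scaleR_eq_0_iff)
          next
            case False
            then have "R k \<le> norm x" using e(1,3) by (simp add: field_simps)
            then show ?thesis using False cpd0[of x i] D0[of k x i] by simp
          qed
        qed
      qed
      also have "\<dots> \<le> ennreal (1 / real (Suc k))"
        using d'(2)[OF \<rho> e(4)] by (simp add: nn_integral_completion)
      finally show "(\<integral>\<^sup>+x. ennreal (norm (cpd i \<phi> x - D k i x)) \<partial>disc_measure) \<le> ennreal (1 / real (Suc k))" .
    qed
    then show "\<exists>\<phi>. P k \<phi>" by blast
  qed
  then obtain \<phi> where "\<forall>k. P k (\<phi> k)" using choice[of P] by blast
  then have \<phi>: "\<And>k. test_function (\<phi> k)" "\<And>k x. x \<in> disc \<Longrightarrow> norm (\<phi> k x - W k x) \<le> 1 / real (Suc k)"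
    "\<And>k i x. norm (cpd i (\<phi> k) x) \<le> K"
    "\<And>k i. (\<integral>\<^sup>+x. ennreal (norm (cpd i (\<phi> k) x - D k i x)) \<partial>disc_measure) \<le> ennreal (1 / real (Suc k))"
    unfolding P_def by blast+
  have \<phi>c: "continuous_on UNIV (cpd i (\<phi> k))" for i k
    using smooth_continuous[OF smooth_deriv] \<phi>(1)[of k] by (auto simp: cpd_def[abs_def] test_function_def)
  \<comment> \<open>Both gradient errors are paired into one function, so that a single subsequence
    makes them converge almost everywhere.\<close>
  define u where "u k x = (cpd 1 (\<phi> k) x - D k 1 x, cpd 2 (\<phi> k) x - D k 2 x)" for k x
  have um: "(\<lambda>x. cpd i (\<phi> k) x - D k i x) \<in> borel_measurable disc_measure" for i k
    by (intro borel_measurable_diff disc_measurable_continuous[OF \<phi>c] weak_partial_locI(4)[OF wpW])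
  have ui: "integrable disc_measure (\<lambda>x. cpd i (\<phi> k) x - D k i x)" for i k
    using um \<phi>(4)[of i k] by (auto simp: integrable_iff_bounded intro: le_less_trans)
  have ub: "(LINT x|disc_measure. norm (cpd i (\<phi> k) x - D k i x)) \<le> 1 / real (Suc k)" for i k
    using \<phi>(4)[of i k] nn_integral_eq_integral[OF integrable_norm[OF ui[of i k]]] by (simp del: of_nat_Suc)
  have uint: "integrable disc_measure (u k)" for k
  proof -
    have "bounded_linear (\<lambda>y::real^3. (y, 0::real^3))" "bounded_linear (\<lambda>y::real^3. (0::real^3, y))"
      by (auto intro!: bounded_linear_Pair bounded_linear_ident bounded_linear_zero)
    from Bochner_Integration.integrable_add[OF integrable_bounded_linear[OF this(1) ui[of 1 k]] integrable_bounded_linear[OF this(2) ui[of 2 k]]]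
    show ?thesis by (simp add: u_def[abs_def])
  qed
  have ule: "(LINT x|disc_measure. norm (u k x)) \<le> 2 / real (Suc k)" for k
  proof -
    have "(LINT x|disc_measure. norm (u k x)) \<le> (LINT x|disc_measure. norm (cpd 1 (\<phi> k) x - D k 1 x) + norm (cpd 2 (\<phi> k) x - D k 2 x))"
    proof (rule integral_mono)
      show "integrable disc_measure (\<lambda>x. norm (u k x))" by (rule integrable_norm[OF uint])
      show "norm (u k x) \<le> norm (cpd 1 (\<phi> k) x - D k 1 x) + norm (cpd 2 (\<phi> k) x - D k 2 x)" for x
        unfolding u_def by (rule norm_Pair_le)
    qed (use ui in auto)
    also have "\<dots> \<le> 1 / real (Suc k) + 1 / real (Suc k)"
      using ui ub[of 1 k] ub[of 2 k] by (simp add: Bochner_Integration.integral_add del: of_nat_Suc)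
    finally show ?thesis by simp
  qed
  have "(\<lambda>k. LINT x|disc_measure. norm (u k x)) \<longlonglongrightarrow> 0"
  proof (rule Lim_null_comparison)
    show "(\<lambda>k. 2 / real (Suc k)) \<longlonglongrightarrow> 0" by real_asymp
    show "\<forall>\<^sub>F k in sequentially. norm (LINT x|disc_measure. norm (u k x)) \<le> 2 / real (Suc k)"
      using ule by (intro always_eventually allI) (simp only: real_norm_def, simp)
  qed
  from tendsto_L1_AE_subseq[where u = u and M = disc_measure, OF uint this]
  obtain s where s: "strict_mono s" "AE x in disc_measure. (\<lambda>k. u (s k) x) \<longlonglongrightarrow> 0"
    by (elim exE conjE)
  have "AE x in disc_measure. (\<lambda>k. cpd i (\<phi> (s k)) x) \<longlonglongrightarrow> pd i f x" for i
    using s(2) Dlim[of i] pd_weak_partial(2)[OF wp[of i]]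
  proof eventually_elim
    case (elim x)
    have "(\<lambda>k. fst (u (s k) x)) \<longlonglongrightarrow> 0" "(\<lambda>k. snd (u (s k) x)) \<longlonglongrightarrow> 0"
      using tendsto_fst[OF elim(1)] tendsto_snd[OF elim(1)] by simp_all
    then have "(\<lambda>k. cpd i (\<phi> (s k)) x - D (s k) i x) \<longlonglongrightarrow> 0"
      using exhaust_2[of i] by (auto simp: u_def)
    moreover have "(\<lambda>k. D (s k) i x) \<longlonglongrightarrow> p i x"
      using LIMSEQ_subseq_LIMSEQ[OF elim(2) s(1)] by (simp add: o_def)
    ultimately have "(\<lambda>k. (cpd i (\<phi> (s k)) x - D (s k) i x) + D (s k) i x) \<longlonglongrightarrow> 0 + p i x"
      by (rule tendsto_add)
    then show ?case using elim(3) by simp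
  qed
  moreover have "uniform_limit disc (\<lambda>k. \<phi> (s k)) f sequentially"
  proof (rule uniform_limitI)
    fix \<epsilon> :: real assume "\<epsilon> > 0"
    have "(\<lambda>k. (1 + 2 * L) / real (Suc k)) \<longlonglongrightarrow> 0" by real_asymp
    then have "(\<lambda>k. (1 + 2 * L) / real (Suc (s k))) \<longlonglongrightarrow> 0"
      using LIMSEQ_subseq_LIMSEQ[OF _ s(1)] by (fastforce simp: o_def)
    then have "eventually (\<lambda>k. (1 + 2 * L) / real (Suc (s k)) < \<epsilon>) sequentially"
      using \<open>\<epsilon> > 0\<close> order_tendstoD(2) by blast
    then show "eventually (\<lambda>k. \<forall>x\<in>disc. dist (\<phi> (s k) x) (f x) < \<epsilon>) sequentially"
    proof eventually_elim
      case (elim k)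
      show ?case
      proof
        fix x :: "real^2" assume x: "x \<in> disc"
        have "dist (\<phi> (s k) x) (f x) \<le> norm (\<phi> (s k) x - W (s k) x) + norm (W (s k) x - f x)"
          unfolding dist_norm by norm
        also have "\<dots> \<le> 1 / real (Suc (s k)) + 2 * L / real (Suc (s k))"
          using \<phi>(2)[OF x] Wf[of x "s k"] x by (intro add_mono) auto
        finally show "dist (\<phi> (s k) x) (f x) < \<epsilon>" using elim by (simp add: add_divide_distrib)
      qed
    qed
  qed
  ultimately show thesis
    using \<phi>(1,3) by (intro that[of "\<lambda>k. \<phi> (s k)"]) (auto simp: approximates_def intro!: exI[of _ K])
qed

section \<open>Evaluation of the pairing\<close>

lemma weakly_differentiable_pd:
  assumes "weakly_differentiable u"
  shows "weak_partial i u (pd i u)"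
  using assms pd_weak_partial unfolding weakly_differentiable_def by metis

text \<open>The uniform gradient bound in \<open>approximates\<close> gives a dominating function
  for the integrable field. The limit depends on \<open>f\<close> alone and not on the approximating
  sequence.\<close>

lemma distr_div_limit:
  assumes X: "integrable disc_measure X" and \<phi>: "approximates \<phi> f" and f: "weakly_differentiable f"
  shows "(\<lambda>k. distr_div X (\<phi> k)) \<longlonglongrightarrow> - (LINT x|disc_measure. (\<Sum>i\<in>UNIV. pd i f x \<bullet> X x $ i))"
proof -
  obtain C where C: "\<And>k i x. norm (cpd i (\<phi> k) x) \<le> C" using \<phi> by (auto simp: approximates_def)
  have sm: "smooth (\<phi> k)" for k using \<phi> by (auto simp: approximates_def test_function_def)
  have lim: "AE x in disc_measure. \<forall>i. (\<lambda>k. cpd i (\<phi> k) x) \<longlonglongrightarrow> pd i f x"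
    using \<phi> unfolding AE_all_countable by (simp add: approximates_def)
  have Xi: "integrable disc_measure (\<lambda>x. X x $ i)" for i
    by (rule integrable_bounded_linear[OF bounded_linear_vec_nth X])
  have "(\<lambda>k. LINT x|disc_measure. (\<Sum>i\<in>UNIV. cpd i (\<phi> k) x \<bullet> X x $ i)) \<longlonglongrightarrow>
      (LINT x|disc_measure. (\<Sum>i\<in>UNIV. pd i f x \<bullet> X x $ i))"
  proof (rule integral_dominated_convergence[where w = "\<lambda>x. \<Sum>i\<in>UNIV. C * norm (X x $ i)"])
    show "(\<lambda>x. \<Sum>i\<in>UNIV. pd i f x \<bullet> X x $ i) \<in> borel_measurable disc_measure"
      using weak_partial_locI(4)[OF weakly_differentiable_pd[OF f]] Xi
      by (intro borel_measurable_sum borel_measurable_inner) auto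
    show "(\<lambda>x. \<Sum>i\<in>UNIV. cpd i (\<phi> k) x \<bullet> X x $ i) \<in> borel_measurable disc_measure" for k
    proof (intro borel_measurable_sum borel_measurable_inner)
      show "cpd i (\<phi> k) \<in> borel_measurable disc_measure" for i
        using smooth_continuous[OF smooth_deriv[OF sm]]
        by (intro disc_measurable_continuous) (simp add: cpd_def[abs_def])
    qed (use Xi in auto)
    show "integrable disc_measure (\<lambda>x. \<Sum>i\<in>UNIV. C * norm (X x $ i))"
      using Xi by (intro Bochner_Integration.integrable_sum integrable_mult_right integrable_norm)
    show "AE x in disc_measure. (\<lambda>k. \<Sum>i\<in>UNIV. cpd i (\<phi> k) x \<bullet> X x $ i) \<longlonglongrightarrow> (\<Sum>i\<in>UNIV. pd i f x \<bullet> X x $ i)"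
      using lim by eventually_elim (auto intro!: tendsto_intros)
    show "AE x in disc_measure. norm (\<Sum>i\<in>UNIV. cpd i (\<phi> k) x \<bullet> X x $ i) \<le> (\<Sum>i\<in>UNIV. C * norm (X x $ i))" for k
    proof (rule AE_I2)
      fix x
      show "norm (\<Sum>i\<in>UNIV. cpd i (\<phi> k) x \<bullet> X x $ i) \<le> (\<Sum>i\<in>UNIV. C * norm (X x $ i))"
        using C by (intro order_trans[OF norm_sum] sum_mono)
          (auto intro!: order_trans[OF Cauchy_Schwarz_ineq2] mult_right_mono)
    qed
  qed
  then show ?thesis unfolding distr_div_def by (rule tendsto_minus)
qed

text \<open>The existence of an approximating sequence is what makes the definite description in
  \<open>pairing\<close> denote the limit.\<close>

lemma pairing_distr_div:
  assumes X: "integrable disc_measure X" and f: "weakly_differentiable f" and \<phi>: "approximates \<phi> f"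
  shows "pairing f (distr_div X) = - (LINT x|disc_measure. (\<Sum>i\<in>UNIV. pd i f x \<bullet> X x $ i))"
  unfolding pairing_def
proof (rule the_equality)
  show "\<forall>\<phi>. approximates \<phi> f \<longrightarrow> (\<lambda>k. distr_div X (\<phi> k)) \<longlonglongrightarrow> - (LINT x|disc_measure. (\<Sum>i\<in>UNIV. pd i f x \<bullet> X x $ i))"
    using distr_div_limit[OF X _ f] by blast
  fix l assume "\<forall>\<phi>. approximates \<phi> f \<longrightarrow> (\<lambda>k. distr_div X (\<phi> k)) \<longlonglongrightarrow> l"
  then show "l = - (LINT x|disc_measure. (\<Sum>i\<in>UNIV. pd i f x \<bullet> X x $ i))"
    using distr_div_limit[OF X \<phi> f] \<phi> LIMSEQ_unique by blast
qed

text \<open>Rotating components turns the exterior derivative into a divergence, so one limit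
  theorem serves both pairings.\<close>

lemma distr_d_eq_distr_div: "distr_d \<beta> = distr_div (\<lambda>x. - perp (\<beta> x))"
  by (simp add: fun_eq_iff distr_d_def distr_div_def perp_def sum_2)

section \<open>Bounded functions with square integrable derivatives\<close>

lemma borel_measurable_bilinear:
  fixes h :: "'b::euclidean_space \<Rightarrow> 'c::euclidean_space \<Rightarrow> 'd::euclidean_space"
  assumes "bounded_bilinear h" "f \<in> borel_measurable M" "g \<in> borel_measurable M"
  shows "(\<lambda>x. h (f x) (g x)) \<in> borel_measurable M"
  by (rule borel_measurable_continuous_Pair[OF assms(2,3)])
     (intro bounded_bilinear.continuous_on[OF assms(1)] continuous_intros)

lemma integrable_disc_const: "integrable disc_measure (\<lambda>x. c :: 'b::euclidean_space)"
proof -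
  have "integrable lborel (\<lambda>x::real^2. indicator disc x *\<^sub>R c)"
    by (intro integrable_scaleR_left integrable_real_indicator)
       (use emeasure_bounded_finite[OF bounded_ball, of "0::real^2" 1] in \<open>auto simp: infinity_ennreal_def\<close>)
  then show ?thesis
    unfolding disc_integrable by (simp add: integrable_completion borel_measurable_integrable)
qed

lemma L_two_bound:
  fixes u :: "real^2 \<Rightarrow> 'b::euclidean_space" and v :: "real^2 \<Rightarrow> 'c::euclidean_space"
  assumes "L_two v" "u \<in> borel_measurable disc_measure" "AE x in disc_measure. norm (u x) \<le> norm (v x)"
  shows "L_two u"
  unfolding L_two_def
proof
  have v: "integrable disc_measure (\<lambda>x. (norm (v x))\<^sup>2)" using assms(1) by (simp add: L_two_def)
  show "integrable disc_measure (\<lambda>x. (norm (u x))\<^sup>2)"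
    by (rule Bochner_Integration.integrable_bound[OF v])
       (use assms(2,3) in \<open>auto intro!: borel_measurable_power measurable_compose[OF _ borel_measurable_norm] power_mono elim!: eventually_mono\<close>)
qed (rule assms)

lemma L_two_bounded:
  fixes u :: "real^2 \<Rightarrow> 'b::euclidean_space"
  assumes "u \<in> borel_measurable disc_measure" "AE x in disc_measure. norm (u x) \<le> M"
  shows "L_two u"
proof (rule L_two_bound[OF _ assms(1)])
  show "L_two (\<lambda>x::real^2. \<bar>M\<bar>)" by (simp add: L_two_def integrable_disc_const)
  show "AE x in disc_measure. norm (u x) \<le> norm \<bar>M\<bar>" using assms(2) by eventually_elim simp
qed

lemma L_two_norm: "L_two u \<Longrightarrow> L_two (\<lambda>x. norm (u x))"
  by (auto simp: L_two_def intro: measurable_compose[OF _ borel_measurable_norm])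

lemma L_two_cmult: "L_two (u :: real^2 \<Rightarrow> real) \<Longrightarrow> L_two (\<lambda>x. c * u x)"
  by (auto simp: L_two_def power_mult_distrib abs_mult intro!: borel_measurable_times)

lemma L_two_add:
  fixes u v :: "real^2 \<Rightarrow> 'b::euclidean_space"
  assumes "L_two u" "L_two v"
  shows "L_two (\<lambda>x. u x + v x)"
  unfolding L_two_def
proof
  show m: "(\<lambda>x. u x + v x) \<in> borel_measurable disc_measure"
    using assms by (auto simp: L_two_def)
  show "integrable disc_measure (\<lambda>x. (norm (u x + v x))\<^sup>2)"
  proof (rule Bochner_Integration.integrable_bound)
    show "integrable disc_measure (\<lambda>x. 2 * (norm (u x))\<^sup>2 + 2 * (norm (v x))\<^sup>2)"
      using assms by (auto simp: L_two_def)
    show "AE x in disc_measure. norm ((norm (u x + v x))\<^sup>2) \<le> norm (2 * (norm (u x))\<^sup>2 + 2 * (norm (v x))\<^sup>2)"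
    proof (rule AE_I2)
      fix x
      have "(norm (u x + v x))\<^sup>2 \<le> (norm (u x) + norm (v x))\<^sup>2"
        by (intro power_mono norm_triangle_ineq) auto
      also have "\<dots> \<le> 2 * (norm (u x))\<^sup>2 + 2 * (norm (v x))\<^sup>2"
        using zero_le_power2[of "norm (u x) - norm (v x)"] by (simp add: power2_eq_square algebra_simps)
      finally show "norm ((norm (u x + v x))\<^sup>2) \<le> norm (2 * (norm (u x))\<^sup>2 + 2 * (norm (v x))\<^sup>2)" by simp
    qed
  qed (intro borel_measurable_power measurable_compose[OF m borel_measurable_norm])
qed

lemma L_two_sum:
  "(\<And>i. i \<in> I \<Longrightarrow> L_two (u i)) \<Longrightarrow> L_two (\<lambda>x. \<Sum>i\<in>I. u i x)"
proof (induction I rule: infinite_finite_induct)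
  case empty
  show ?case by (simp add: L_two_def)
next
  case (infinite I)
  then show ?case by (simp add: L_two_def)
qed (auto intro!: L_two_add)

lemma L_two_cong_AE:
  assumes "L_two u" "AE x in disc_measure. u x = v x"
  shows "L_two v"
  by (rule L_two_bound[OF assms(1) disc_measurable_cong_AE])
     (use assms in \<open>auto simp: L_two_def elim!: eventually_mono\<close>)

text \<open>Unlike \<open>W_1_2\<close>, this class is closed under products.\<close>

definition BW :: "(real^2 \<Rightarrow> 'b::euclidean_space) \<Rightarrow> bool" where
  "BW u \<longleftrightarrow> (\<exists>M. AE x in disc_measure. norm (u x) \<le> M) \<and> (\<forall>i. \<exists>v. weak_partial i u v \<and> L_two v)"

lemma BW_bound: "BW u \<Longrightarrow> (\<And>M. 0 \<le> M \<Longrightarrow> AE x in disc_measure. norm (u x) \<le> M \<Longrightarrow> thesis) \<Longrightarrow> thesis"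
proof -
  assume "BW u" and *: "\<And>M. 0 \<le> M \<Longrightarrow> AE x in disc_measure. norm (u x) \<le> M \<Longrightarrow> thesis"
  then obtain M where "AE x in disc_measure. norm (u x) \<le> M" by (auto simp: BW_def)
  then have "AE x in disc_measure. norm (u x) \<le> max 0 M" by eventually_elim simp
  then show thesis by (intro *[of "max 0 M"]) auto
qed

lemma BW_pd:
  assumes "BW u"
  shows "weak_partial i u (pd i u)" "L_two (pd i u)"
proof -
  obtain v where v: "weak_partial i u v" "L_two v" using assms by (auto simp: BW_def)
  show "weak_partial i u (pd i u)" by (rule pd_weak_partial(1)[OF v(1)])
  show "L_two (pd i u)"
    by (rule L_two_cong_AE[OF v(2)]) (use pd_weak_partial(2)[OF v(1)] in \<open>auto elim!: eventually_mono\<close>)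
qed

lemma BW_measurable: "BW u \<Longrightarrow> u \<in> borel_measurable disc_measure"
  using BW_pd(1) weak_partial_locI(3) by blast

lemma BW_pd_measurable: "BW u \<Longrightarrow> pd i u \<in> borel_measurable disc_measure"
  using BW_pd(1) weak_partial_locI(4) by blast

lemma BW_weakly_differentiable: "BW u \<Longrightarrow> weakly_differentiable u"
  using BW_pd(1) by (auto simp: weakly_differentiable_def)

lemma BW_L_two: "BW u \<Longrightarrow> L_two u"
  by (rule BW_bound, assumption, rule L_two_bounded[OF BW_measurable])

lemma BW_W_1_2: "BW u \<Longrightarrow> W_1_2 u"
  unfolding W_1_2_def using BW_pd BW_L_two by blast

lemma BW_cong_AE:
  assumes "BW u" "AE x in disc_measure. u x = u' x"
  shows "BW u'"
proof -
  obtain M where M: "AE x in disc_measure. norm (u x) \<le> M" using assms(1) by (auto simp: BW_def)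
  have "AE x in disc_measure. norm (u' x) \<le> M" using M assms(2) by eventually_elim simp
  moreover have "weak_partial i u' (pd i u)" for i
    by (rule weak_partial_cong_AE[OF BW_pd(1)[OF assms(1)] assms(2)]) simp
  ultimately show ?thesis using BW_pd(2)[OF assms(1)] by (auto simp: BW_def)
qed

lemma pd_cong_AE:
  assumes "weak_partial i u v" "AE x in disc_measure. u x = u' x"
  shows "AE x in disc_measure. pd i u' x = v x"
  using pd_weak_partial(2)[OF weak_partial_cong_AE[OF assms, of v]] by simp

text \<open>In each term of the product rule one factor is bounded and the other square integrable;
  this is why the two properties are carried together.\<close>

lemma BW_bilinear:
  fixes u :: "real^2 \<Rightarrow> 'b::euclidean_space" and v :: "real^2 \<Rightarrow> 'c::euclidean_space"
    and h :: "'b \<Rightarrow> 'c \<Rightarrow> 'd::euclidean_space"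
  assumes h: "bounded_bilinear h" and u: "BW u" and v: "BW v"
  shows "BW (\<lambda>x. h (u x) (v x))"
    "weak_partial i (\<lambda>x. h (u x) (v x)) (\<lambda>x. h (u x) (pd i v x) + h (pd i u x) (v x))"
proof -
  obtain M M' where M: "0 \<le> M" "AE x in disc_measure. norm (u x) \<le> M" "0 \<le> M'" "AE x in disc_measure. norm (v x) \<le> M'"
    using BW_bound[OF u] BW_bound[OF v] by metis
  obtain K where K: "0 < K" "\<And>a b. norm (h a b) \<le> norm a * norm b * K"
    using bounded_bilinear.pos_bounded[OF h] by auto
  show wp: "weak_partial i (\<lambda>x. h (u x) (v x)) (\<lambda>x. h (u x) (pd i v x) + h (pd i u x) (v x))" for i
    by (rule weak_partial_bilinear[OF h BW_pd(1)[OF u] BW_pd(1)[OF v] M(2,4)])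
  have "AE x in disc_measure. norm (h (u x) (v x)) \<le> M * M' * K"
    using M(2,4)
  proof eventually_elim
    case (elim x)
    then have "norm (u x) * norm (v x) * K \<le> M * M' * K" using M K by (intro mult_right_mono mult_mono) auto
    then show ?case using K(2) order_trans by blast
  qed
  moreover have "L_two (\<lambda>x. h (u x) (pd i v x) + h (pd i u x) (v x))" for i
  proof (rule L_two_add)
    show "L_two (\<lambda>x. h (u x) (pd i v x))"
    proof (rule L_two_bound)
      show "L_two (\<lambda>x. (M * K) * norm (pd i v x))" by (intro L_two_cmult L_two_norm BW_pd v)
      show "(\<lambda>x. h (u x) (pd i v x)) \<in> borel_measurable disc_measure"
        by (intro borel_measurable_bilinear[OF h] BW_measurable BW_pd_measurable u v)
      show "AE x in disc_measure. norm (h (u x) (pd i v x)) \<le> norm (M * K * norm (pd i v x))"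
        using M(2)
      proof eventually_elim
        case (elim x)
        have "norm (h (u x) (pd i v x)) \<le> norm (u x) * norm (pd i v x) * K" by (rule K)
        also have "\<dots> \<le> M * norm (pd i v x) * K" using elim K by (intro mult_right_mono) auto
        finally show ?case using M K by (simp add: mult_ac)
      qed
    qed
    show "L_two (\<lambda>x. h (pd i u x) (v x))"
    proof (rule L_two_bound)
      show "L_two (\<lambda>x. (M' * K) * norm (pd i u x))" by (intro L_two_cmult L_two_norm BW_pd u)
      show "(\<lambda>x. h (pd i u x) (v x)) \<in> borel_measurable disc_measure"
        by (intro borel_measurable_bilinear[OF h] BW_measurable BW_pd_measurable u v)
      show "AE x in disc_measure. norm (h (pd i u x) (v x)) \<le> norm (M' * K * norm (pd i u x))"
        using M(4)
      proof eventually_elim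
        case (elim x)
        have "norm (h (pd i u x) (v x)) \<le> norm (pd i u x) * norm (v x) * K" by (rule K)
        also have "\<dots> \<le> norm (pd i u x) * M' * K" using elim K by (intro mult_right_mono mult_left_mono) auto
        finally show ?case using M K by (simp add: mult_ac)
      qed
    qed
  qed
  ultimately show "BW (\<lambda>x. h (u x) (v x))" using wp by (auto simp: BW_def)
qed

text \<open>On the essentially bounded range of \<open>u\<close> the derivative of \<open>g\<close>
  is bounded, so the derivative of the composition is dominated by a multiple of that of
  \<open>u\<close>.\<close>

lemma BW_compose:
  fixes u :: "real^2 \<Rightarrow> 'b::euclidean_space" and g :: "'b \<Rightarrow> 'c::euclidean_space"
  assumes u: "BW u" and g: "C_k (Suc 0) g"
  shows "BW (\<lambda>x. g (u x))"
    "weak_partial i (\<lambda>x. g (u x)) (\<lambda>x. frechet_derivative g (at (u x)) (pd i u x))"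
proof -
  obtain M where M: "0 \<le> M" "AE x in disc_measure. norm (u x) \<le> M" by (rule BW_bound[OF u])
  obtain B where B: "B > 0" "\<And>y v. norm y \<le> M \<Longrightarrow> norm (frechet_derivative g (at y) v) \<le> B * norm v"
    "\<And>y. norm y \<le> M \<Longrightarrow> norm (g y) \<le> B"
    by (rule C_1_bounded_derivative[OF g, of M], rule that)
  show wp: "weak_partial i (\<lambda>x. g (u x)) (\<lambda>x. frechet_derivative g (at (u x)) (pd i u x))" for i
    by (rule weak_partial_compose[OF BW_pd(1)[OF u] M(2) g])
  have "AE x in disc_measure. norm (g (u x)) \<le> B" using M(2) by eventually_elim (rule B)
  moreover have "L_two (\<lambda>x. frechet_derivative g (at (u x)) (pd i u x))" for i
  proof (rule L_two_bound)
    show "L_two (\<lambda>x. B * norm (pd i u x))" by (intro L_two_cmult L_two_norm BW_pd u)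
    show "(\<lambda>x. frechet_derivative g (at (u x)) (pd i u x)) \<in> borel_measurable disc_measure"
      by (rule weak_partial_locI(4)[OF wp])
    show "AE x in disc_measure. norm (frechet_derivative g (at (u x)) (pd i u x)) \<le> norm (B * norm (pd i u x))"
      using M(2) by eventually_elim (use B in \<open>auto simp: abs_mult\<close>)
  qed
  ultimately show "BW (\<lambda>x. g (u x))" using wp by (auto simp: BW_def)
qed

lemma BW_add: "BW u \<Longrightarrow> BW v \<Longrightarrow> BW (\<lambda>x. u x + v x)"
  and BW_add_pd: "BW u \<Longrightarrow> BW v \<Longrightarrow> weak_partial i (\<lambda>x. u x + v x) (\<lambda>x. pd i u x + pd i v x)"
proof -
  assume u: "BW u" and v: "BW v"
  show wp: "weak_partial i (\<lambda>x. u x + v x) (\<lambda>x. pd i u x + pd i v x)" for i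
    by (intro weak_partial_add BW_pd u v)
  obtain M M' where M: "AE x in disc_measure. norm (u x) \<le> M" "AE x in disc_measure. norm (v x) \<le> M'"
    using BW_bound[OF u] BW_bound[OF v] by metis
  have "AE x in disc_measure. norm (u x + v x) \<le> M + M'"
    using M by eventually_elim (rule norm_triangle_mono)
  then show "BW (\<lambda>x. u x + v x)"
    using wp L_two_add[OF BW_pd(2)[OF u] BW_pd(2)[OF v]] by (auto simp: BW_def)
qed

lemma BW_Pair:
  fixes u :: "real^2 \<Rightarrow> 'b::euclidean_space" and v :: "real^2 \<Rightarrow> 'c::euclidean_space"
  assumes u: "BW u" and v: "BW v"
  shows "BW (\<lambda>x. (u x, v x))"
proof -
  have lin: "bounded_linear (\<lambda>y::'b. (y, 0::'c))" "bounded_linear (\<lambda>y::'c. (0::'b, y))"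
    by (auto intro!: bounded_linear_Pair bounded_linear_ident bounded_linear_zero)
  have "BW (\<lambda>x. (u x, 0::'c) + (0::'b, v x))"
    by (intro BW_add BW_compose(1)[OF u, where g = "\<lambda>y. (y, 0)"] BW_compose(1)[OF v, where g = "\<lambda>y. (0, y)"] C_k_linear lin)
  then show ?thesis by simp
qed

lemma BW_const: "BW (\<lambda>x. c)"
proof -
  have "weak_partial i (\<lambda>x. c) (\<lambda>x. 0)" for i
    using weak_partial_C1[OF C_k_const, of i c] by (simp add: cpd_def[abs_def])
  moreover have "L_two (\<lambda>x. 0 :: 'a)" by (simp add: L_two_def)
  ultimately show ?thesis by (auto simp: BW_def intro!: exI[of _ "norm c"])
qed

section \<open>First order expansion in a parameter\<close>

text \<open>The weight \<open>S\<close> will be square integrable. The exponent \<open>j\<close> counts the factors that are only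
  square integrable, so that the remainder is integrable for \<open>j \<le> 2\<close>.\<close>

definition taylor_family ::
  "real \<Rightarrow> (real^2 \<Rightarrow> real) \<Rightarrow> nat \<Rightarrow> (real \<Rightarrow> real^2 \<Rightarrow> 'v::euclidean_space) \<Rightarrow> (real^2 \<Rightarrow> 'v) \<Rightarrow> bool" where
  "taylor_family t0 S j F F' \<longleftrightarrow>
     (\<forall>t. \<bar>t\<bar> \<le> t0 \<longrightarrow> F t \<in> borel_measurable disc_measure) \<and> F' \<in> borel_measurable disc_measure \<and>
     (\<exists>K\<ge>0. AE x in disc_measure. norm (F 0 x) \<le> K * S x ^ j \<and> norm (F' x) \<le> K * S x ^ j \<and>
        (\<forall>t. \<bar>t\<bar> \<le> t0 \<longrightarrow> norm (F t x - F 0 x - t *\<^sub>R F' x) \<le> K * t\<^sup>2 * S x ^ j))"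

locale taylor_weight =
  fixes t0 :: real and S :: "real^2 \<Rightarrow> real"
  assumes t0: "0 < t0" "t0 \<le> 1" and S: "\<And>x. 1 \<le> S x"
begin

text \<open>The remainder estimate also bounds \<open>F t\<close> and its first difference, because
  t^2 is at most |t| and |t| at most 1. The factor 3 collects the value at 0, the linear term and
  the remainder.\<close>

lemma taylor_familyE:
  assumes "taylor_family t0 S j F F'"
  obtains K where "0 \<le> K" "AE x in disc_measure. norm (F 0 x) \<le> K * S x ^ j \<and> norm (F' x) \<le> K * S x ^ j \<and>
      (\<forall>t. \<bar>t\<bar> \<le> t0 \<longrightarrow> norm (F t x - F 0 x - t *\<^sub>R F' x) \<le> K * t\<^sup>2 * S x ^ j
         \<and> norm (F t x) \<le> K * S x ^ j \<and> norm (F t x - F 0 x) \<le> K * \<bar>t\<bar> * S x ^ j)"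
proof -
  obtain K where K: "0 \<le> K" "AE x in disc_measure. norm (F 0 x) \<le> K * S x ^ j \<and> norm (F' x) \<le> K * S x ^ j \<and>
        (\<forall>t. \<bar>t\<bar> \<le> t0 \<longrightarrow> norm (F t x - F 0 x - t *\<^sub>R F' x) \<le> K * t\<^sup>2 * S x ^ j)"
    using assms by (auto simp: taylor_family_def)
  have "AE x in disc_measure. norm (F 0 x) \<le> (3 * K) * S x ^ j \<and> norm (F' x) \<le> (3 * K) * S x ^ j \<and>
      (\<forall>t. \<bar>t\<bar> \<le> t0 \<longrightarrow> norm (F t x - F 0 x - t *\<^sub>R F' x) \<le> (3 * K) * t\<^sup>2 * S x ^ j
         \<and> norm (F t x) \<le> (3 * K) * S x ^ j \<and> norm (F t x - F 0 x) \<le> (3 * K) * \<bar>t\<bar> * S x ^ j)"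
    using K(2)
  proof eventually_elim
    case (elim x)
    define A where "A = K * S x ^ j"
    have A: "0 \<le> A" using K(1) S[of x] by (simp add: A_def)
    have "norm (F t x - F 0 x - t *\<^sub>R F' x) \<le> 3 * A * t\<^sup>2 \<and> norm (F t x) \<le> 3 * A \<and> norm (F t x - F 0 x) \<le> 3 * A * \<bar>t\<bar>"
      if t: "\<bar>t\<bar> \<le> t0" for t
    proof -
      have t1: "\<bar>t\<bar> \<le> 1" using t t0 by simp
      have t2: "t\<^sup>2 \<le> \<bar>t\<bar>" using t1 by (metis abs_ge_zero mult_left_le power2_abs power2_eq_square)
      have 1: "norm (F t x - F 0 x - t *\<^sub>R F' x) \<le> A * t\<^sup>2" using elim t by (simp add: A_def mult_ac)
      have 2: "A * t\<^sup>2 \<le> A * \<bar>t\<bar>" using A t2 by (intro mult_left_mono)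
      have "norm (F' x) \<le> A" using elim by (simp add: A_def)
      then have 3: "norm (t *\<^sub>R F' x) \<le> A * \<bar>t\<bar>" by (simp add: mult.commute[of A] mult_left_mono)
      have 4: "norm (F t x - F 0 x) \<le> 2 * A * \<bar>t\<bar>"
        using 1 2 3 norm_triangle_ineq[of "F t x - F 0 x - t *\<^sub>R F' x" "t *\<^sub>R F' x"] by simp
      have 5: "A * \<bar>t\<bar> \<le> A" using A t1 by (simp add: mult_left_le)
      have 6: "norm (F t x) \<le> 3 * A"
        using 4 5 elim norm_triangle_ineq[of "F t x - F 0 x" "F 0 x"] by (simp add: A_def[symmetric])
      have "0 \<le> A * t\<^sup>2" "0 \<le> A * \<bar>t\<bar>" using A by auto
      then show ?thesis using 1 4 6 by linarith
    qed
    moreover have "norm (F 0 x) \<le> A" "norm (F' x) \<le> A" using elim by (auto simp: A_def)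
    moreover have r: "3 * K * S x ^ j = 3 * A" "3 * K * c * S x ^ j = 3 * A * c" for c by (simp_all add: A_def)
    ultimately show ?case unfolding r using A by auto
  qed
  then show thesis using K(1) that[of "3 * K"] by simp
qed

lemma taylor_measurable: "taylor_family t0 S j F F' \<Longrightarrow> \<bar>t\<bar> \<le> t0 \<Longrightarrow> F t \<in> borel_measurable disc_measure"
  and taylor_measurable': "taylor_family t0 S j F F' \<Longrightarrow> F' \<in> borel_measurable disc_measure"
  by (auto simp: taylor_family_def)

lemma taylor_familyI:
  assumes "\<And>t. \<bar>t\<bar> \<le> t0 \<Longrightarrow> F t \<in> borel_measurable disc_measure" "F' \<in> borel_measurable disc_measure" "0 \<le> K"
    "AE x in disc_measure. norm (F 0 x) \<le> K * S x ^ j \<and> norm (F' x) \<le> K * S x ^ j \<and>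
        (\<forall>t. \<bar>t\<bar> \<le> t0 \<longrightarrow> norm (F t x - F 0 x - t *\<^sub>R F' x) \<le> K * t\<^sup>2 * S x ^ j)"
  shows "taylor_family t0 S j F F'"
  using assms by (auto simp: taylor_family_def)

lemma taylor_const:
  assumes "F \<in> borel_measurable disc_measure" "0 \<le> K" "AE x in disc_measure. norm (F x) \<le> K * S x ^ j"
  shows "taylor_family t0 S j (\<lambda>t. F) (\<lambda>x. 0)"
proof (rule taylor_familyI[OF _ _ assms(2)])
  show "AE x in disc_measure. norm (F x) \<le> K * S x ^ j \<and> norm (0::'a) \<le> K * S x ^ j \<and>
        (\<forall>t. \<bar>t\<bar> \<le> t0 \<longrightarrow> norm (F x - F x - t *\<^sub>R 0) \<le> K * t\<^sup>2 * S x ^ j)"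
    using assms(3)
  proof eventually_elim
    case (elim x)
    have "0 \<le> S x ^ j" using S[of x] by simp
    then show ?case using elim assms(2) by auto
  qed
qed (use assms in auto)

lemma taylor_id: "taylor_family t0 S 0 (\<lambda>t x. t) (\<lambda>x. 1)"
  by (rule taylor_familyI[of _ _ 1]) auto

text \<open>The remainder is a sum of three products: the remainder of \<open>F\<close> with
  \<open>G t\<close>, the linear term of \<open>F\<close> with the first difference of
  \<open>G\<close>, and \<open>F 0\<close> with the remainder of \<open>G\<close>. Each has order
  t^2 and contains one bound for \<open>F\<close> and one for \<open>G\<close>, so the degrees
  add.\<close>

lemma taylor_bilinear:
  assumes h: "bounded_bilinear h" and F: "taylor_family t0 S i F F'" and G: "taylor_family t0 S j G G'"
  shows "taylor_family t0 S (i + j) (\<lambda>t x. h (F t x) (G t x)) (\<lambda>x. h (F 0 x) (G' x) + h (F' x) (G 0 x))"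
proof -
  interpret h: bounded_bilinear h by (rule h)
  obtain B where B: "0 < B" "\<And>a b. norm (h a b) \<le> norm a * norm b * B" using h.pos_bounded by auto
  obtain K where K: "0 \<le> K" "AE x in disc_measure. norm (F 0 x) \<le> K * S x ^ i \<and> norm (F' x) \<le> K * S x ^ i \<and>
      (\<forall>t. \<bar>t\<bar> \<le> t0 \<longrightarrow> norm (F t x - F 0 x - t *\<^sub>R F' x) \<le> K * t\<^sup>2 * S x ^ i
         \<and> norm (F t x) \<le> K * S x ^ i \<and> norm (F t x - F 0 x) \<le> K * \<bar>t\<bar> * S x ^ i)"
    by (rule taylor_familyE[OF F])
  obtain L where L: "0 \<le> L" "AE x in disc_measure. norm (G 0 x) \<le> L * S x ^ j \<and> norm (G' x) \<le> L * S x ^ j \<and>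
      (\<forall>t. \<bar>t\<bar> \<le> t0 \<longrightarrow> norm (G t x - G 0 x - t *\<^sub>R G' x) \<le> L * t\<^sup>2 * S x ^ j
         \<and> norm (G t x) \<le> L * S x ^ j \<and> norm (G t x - G 0 x) \<le> L * \<bar>t\<bar> * S x ^ j)"
    by (rule taylor_familyE[OF G])
  show ?thesis
  proof (rule taylor_familyI[where K = "3 * (K * L * B)"])
    show "(\<lambda>x. h (F t x) (G t x)) \<in> borel_measurable disc_measure" if "\<bar>t\<bar> \<le> t0" for t
      using that by (intro borel_measurable_bilinear[OF h] taylor_measurable[OF F] taylor_measurable[OF G])
    have "\<bar>0\<bar> \<le> t0" using t0 by simp
    then show "(\<lambda>x. h (F 0 x) (G' x) + h (F' x) (G 0 x)) \<in> borel_measurable disc_measure"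
      by (intro borel_measurable_add borel_measurable_bilinear[OF h] taylor_measurable[OF F] taylor_measurable[OF G]
            taylor_measurable'[OF F] taylor_measurable'[OF G])
    show "AE x in disc_measure. norm (h (F 0 x) (G 0 x)) \<le> 3 * (K * L * B) * S x ^ (i + j) \<and>
        norm (h (F 0 x) (G' x) + h (F' x) (G 0 x)) \<le> 3 * (K * L * B) * S x ^ (i + j) \<and>
        (\<forall>t. \<bar>t\<bar> \<le> t0 \<longrightarrow> norm (h (F t x) (G t x) - h (F 0 x) (G 0 x) - t *\<^sub>R (h (F 0 x) (G' x) + h (F' x) (G 0 x)))
           \<le> 3 * (K * L * B) * t\<^sup>2 * S x ^ (i + j))"
      using K(2) L(2)
    proof eventually_elim
      case (elim x)
      define P Q where "P = K * S x ^ i" and "Q = L * S x ^ j"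
      have pos: "0 \<le> P" "0 \<le> Q" using K(1) L(1) S[of x] by (auto simp: P_def Q_def)
      have hb: "norm (h a b) \<le> p * q * B" if "norm a \<le> p" "norm b \<le> q" for a b p q
        using that B(1) norm_ge_zero[of a] order_trans[OF norm_ge_zero that(1)]
        by (intro order_trans[OF B(2)] mult_right_mono mult_mono) auto
      have e: "norm (F 0 x) \<le> P" "norm (F' x) \<le> P" "norm (G 0 x) \<le> Q" "norm (G' x) \<le> Q"
        using elim by (auto simp: P_def Q_def)
      have PQ: "P * Q * B = (K * L * B) * S x ^ (i + j)" by (simp add: P_def Q_def power_add mult_ac)
      have PQ0: "0 \<le> P * Q * B" using pos B by simp
      have 1: "norm (h (F 0 x) (G 0 x)) \<le> 3 * (P * Q * B)" using hb[OF e(1,3)] PQ0 by simp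
      have 2: "norm (h (F 0 x) (G' x) + h (F' x) (G 0 x)) \<le> 3 * (P * Q * B)"
        using hb[OF e(1,4)] hb[OF e(2,3)] norm_triangle_ineq[of "h (F 0 x) (G' x)" "h (F' x) (G 0 x)"] PQ0 by simp
      have 3: "norm (h (F t x) (G t x) - h (F 0 x) (G 0 x) - t *\<^sub>R (h (F 0 x) (G' x) + h (F' x) (G 0 x))) \<le> 3 * (P * Q * B) * t\<^sup>2"
        if t: "\<bar>t\<bar> \<le> t0" for t
      proof -
        have f: "norm (F t x - F 0 x - t *\<^sub>R F' x) \<le> P * t\<^sup>2" "norm (G t x) \<le> Q"
          "norm (G t x - G 0 x) \<le> Q * \<bar>t\<bar>" "norm (G t x - G 0 x - t *\<^sub>R G' x) \<le> Q * t\<^sup>2"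
          using elim t by (auto simp: P_def Q_def mult_ac)
        have tF: "norm (t *\<^sub>R F' x) \<le> \<bar>t\<bar> * P" using e(2) by (simp add: mult_left_mono)
        have "h (F t x) (G t x) - h (F 0 x) (G 0 x) - t *\<^sub>R (h (F 0 x) (G' x) + h (F' x) (G 0 x))
          = h (F t x - F 0 x - t *\<^sub>R F' x) (G t x) + h (t *\<^sub>R F' x) (G t x - G 0 x) + h (F 0 x) (G t x - G 0 x - t *\<^sub>R G' x)"
          by (simp add: h.diff_left h.diff_right h.scaleR_left h.scaleR_right scaleR_add_right scaleR_diff_right)
        also have "norm \<dots> \<le> (P * t\<^sup>2) * Q * B + (\<bar>t\<bar> * P) * (Q * \<bar>t\<bar>) * B + P * (Q * t\<^sup>2) * B"
          by (intro norm_triangle_mono hb f tF e)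
        also have "\<dots> = 3 * (P * Q * B) * t\<^sup>2" by (simp add: power2_eq_square mult_ac)
        finally show ?thesis .
      qed
      from 1 2 3 show ?case unfolding PQ by (simp add: mult_ac)
    qed
  qed (use K L B in auto)
qed

lemma taylor_add:
  assumes F: "taylor_family t0 S j F F'" and G: "taylor_family t0 S j G G'"
  shows "taylor_family t0 S j (\<lambda>t x. F t x + G t x) (\<lambda>x. F' x + G' x)"
proof -
  obtain K where K: "0 \<le> K" "AE x in disc_measure. norm (F 0 x) \<le> K * S x ^ j \<and> norm (F' x) \<le> K * S x ^ j \<and>
      (\<forall>t. \<bar>t\<bar> \<le> t0 \<longrightarrow> norm (F t x - F 0 x - t *\<^sub>R F' x) \<le> K * t\<^sup>2 * S x ^ j)"
    using F by (auto simp: taylor_family_def)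
  obtain L where L: "0 \<le> L" "AE x in disc_measure. norm (G 0 x) \<le> L * S x ^ j \<and> norm (G' x) \<le> L * S x ^ j \<and>
      (\<forall>t. \<bar>t\<bar> \<le> t0 \<longrightarrow> norm (G t x - G 0 x - t *\<^sub>R G' x) \<le> L * t\<^sup>2 * S x ^ j)"
    using G by (auto simp: taylor_family_def)
  show ?thesis
  proof (rule taylor_familyI[where K = "K + L"])
    show "AE x in disc_measure. norm (F 0 x + G 0 x) \<le> (K + L) * S x ^ j \<and> norm (F' x + G' x) \<le> (K + L) * S x ^ j \<and>
      (\<forall>t. \<bar>t\<bar> \<le> t0 \<longrightarrow> norm (F t x + G t x - (F 0 x + G 0 x) - t *\<^sub>R (F' x + G' x)) \<le> (K + L) * t\<^sup>2 * S x ^ j)"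
      using K(2) L(2)
    proof eventually_elim
      case (elim x)
      have "norm (F t x + G t x - (F 0 x + G 0 x) - t *\<^sub>R (F' x + G' x)) \<le> K * t\<^sup>2 * S x ^ j + L * t\<^sup>2 * S x ^ j" if "\<bar>t\<bar> \<le> t0" for t
      proof -
        have "F t x + G t x - (F 0 x + G 0 x) - t *\<^sub>R (F' x + G' x) = (F t x - F 0 x - t *\<^sub>R F' x) + (G t x - G 0 x - t *\<^sub>R G' x)"
          by (simp add: scaleR_add_right)
        moreover have "norm (F t x - F 0 x - t *\<^sub>R F' x) \<le> K * t\<^sup>2 * S x ^ j" "norm (G t x - G 0 x - t *\<^sub>R G' x) \<le> L * t\<^sup>2 * S x ^ j"
          using elim that by auto
        ultimately show ?thesis by (simp only: norm_triangle_mono)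
      qed
      then show ?case using elim by (auto simp: distrib_right intro!: norm_triangle_mono)
    qed
  qed (use K L F G in \<open>auto simp: taylor_family_def intro!: borel_measurable_add\<close>)
qed

lemma taylor_minus:
  assumes F: "taylor_family t0 S j F F'"
  shows "taylor_family t0 S j (\<lambda>t x. - F t x) (\<lambda>x. - F' x)"
proof -
  have "taylor_family t0 S 0 (\<lambda>t x. -1 :: real) (\<lambda>x. 0)" by (rule taylor_const[of _ 1]) auto
  from taylor_bilinear[OF bounded_bilinear_scaleR this F] show ?thesis by simp
qed

lemma taylor_cong_AE:
  assumes F: "taylor_family t0 S j F F'" and "\<And>t. \<bar>t\<bar> \<le> t0 \<Longrightarrow> G t \<in> borel_measurable disc_measure"
    and "AE x in disc_measure. \<forall>t. \<bar>t\<bar> \<le> t0 \<longrightarrow> F t x = G t x" and F': "AE x in disc_measure. F' x = G' x"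
  shows "taylor_family t0 S j G G'"
proof -
  obtain K where K: "0 \<le> K" "AE x in disc_measure. norm (F 0 x) \<le> K * S x ^ j \<and> norm (F' x) \<le> K * S x ^ j \<and>
      (\<forall>t. \<bar>t\<bar> \<le> t0 \<longrightarrow> norm (F t x - F 0 x - t *\<^sub>R F' x) \<le> K * t\<^sup>2 * S x ^ j)"
    using F by (auto simp: taylor_family_def)
  show ?thesis
  proof (rule taylor_familyI[OF assms(2) _ K(1)])
    show "G' \<in> borel_measurable disc_measure" by (rule disc_measurable_cong_AE[OF taylor_measurable'[OF F] F'])
    show "AE x in disc_measure. norm (G 0 x) \<le> K * S x ^ j \<and> norm (G' x) \<le> K * S x ^ j \<and>
      (\<forall>t. \<bar>t\<bar> \<le> t0 \<longrightarrow> norm (G t x - G 0 x - t *\<^sub>R G' x) \<le> K * t\<^sup>2 * S x ^ j)"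
      using K(2) assms(3) F'
    proof eventually_elim
      case (elim x)
      have "F 0 x = G 0 x" using elim(2) t0 by simp
      then show ?case using elim by auto
    qed
  qed
qed

lemma taylor_deriv_cong:
  assumes F: "taylor_family t0 S j F F'" and "AE x in disc_measure. F' x = G' x"
  shows "taylor_family t0 S j F G'"
  by (rule taylor_cong_AE[OF F taylor_measurable[OF F] _ assms(2)]) auto

text \<open>With r = sqrt q the error is exactly (1 - r)^2 (2 + r) / (2 r). For r at least 1/2 the
  quotient is at most 2 (1 + r)^2, and (1 - r)^2 (1 + r)^2 = (q - 1)^2.\<close>

lemma inverse_sqrt_expansion:
  assumes "1/4 \<le> (q::real)"
  shows "\<bar>1 / sqrt q - 1 + (q - 1) / 2\<bar> \<le> 2 * (q - 1)\<^sup>2"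
proof -
  define r where "r = sqrt q"
  have "sqrt (1/4) \<le> r" unfolding r_def using assms by (rule real_sqrt_le_mono)
  then have r: "1/2 \<le> r" by (simp add: real_sqrt_divide)
  have q: "q = r\<^sup>2" using assms by (simp add: r_def)
  have eq: "1 / r - 1 + (r\<^sup>2 - 1) / 2 = (1 - r)\<^sup>2 * ((2 + r) / (2 * r))"
    using r by (simp add: field_simps power2_eq_square)
  have "\<bar>1 / r - 1 + (r\<^sup>2 - 1) / 2\<bar> = (1 - r)\<^sup>2 * ((2 + r) / (2 * r))"
    unfolding eq using r by (simp add: abs_mult)
  also have "\<dots> \<le> (1 - r)\<^sup>2 * (2 * (1 + r)\<^sup>2)"
  proof (rule mult_left_mono)
    have "2 + r \<le> 2 * (1 + r)\<^sup>2" using r by (simp add: power2_eq_square algebra_simps)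
    also have "\<dots> \<le> (2 * (1 + r)\<^sup>2) * (2 * r)" using r by (intro mult_right_le_one_le[THEN order_trans[OF _ order_refl]] | simp)+
    finally show "(2 + r) / (2 * r) \<le> 2 * (1 + r)\<^sup>2" using r by (simp add: divide_le_eq)
  qed simp
  also have "\<dots> = 2 * (r\<^sup>2 - 1)\<^sup>2" by (simp add: power2_eq_square algebra_simps)
  finally show ?thesis unfolding q using r by (simp add: real_sqrt_abs)
qed

text \<open>The bound 1/4 keeps \<open>q\<close> away from the singularity; the normalisation of
  \<open>q\<close> at t = 0 makes -1/2 the coefficient of \<open>q'\<close>.\<close>

lemma taylor_inverse_sqrt:
  assumes q: "taylor_family t0 S 0 q q'" and q0: "AE x in disc_measure. q 0 x = 1"
    and lb: "AE x in disc_measure. \<forall>t. \<bar>t\<bar> \<le> t0 \<longrightarrow> 1/4 \<le> q t x"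
  shows "taylor_family t0 S 0 (\<lambda>t x. 1 / sqrt (q t x)) (\<lambda>x. - q' x / 2)"
proof -
  obtain K where K: "0 \<le> K" "AE x in disc_measure. norm (q 0 x) \<le> K * S x ^ 0 \<and> norm (q' x) \<le> K * S x ^ 0 \<and>
      (\<forall>t. \<bar>t\<bar> \<le> t0 \<longrightarrow> norm (q t x - q 0 x - t *\<^sub>R q' x) \<le> K * t\<^sup>2 * S x ^ 0
         \<and> norm (q t x) \<le> K * S x ^ 0 \<and> norm (q t x - q 0 x) \<le> K * \<bar>t\<bar> * S x ^ 0)"
    by (rule taylor_familyE[OF q])
  show ?thesis
  proof (rule taylor_familyI[where K = "1 + K + 2 * K\<^sup>2"])
    show "(\<lambda>x. 1 / sqrt (q t x)) \<in> borel_measurable disc_measure" if "\<bar>t\<bar> \<le> t0" for t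
      using taylor_measurable[OF q that] by measurable
    show "(\<lambda>x. - q' x / 2) \<in> borel_measurable disc_measure"
      using taylor_measurable'[OF q] by measurable
    show "AE x in disc_measure. norm (1 / sqrt (q 0 x)) \<le> (1 + K + 2 * K\<^sup>2) * S x ^ 0 \<and>
        norm (- q' x / 2) \<le> (1 + K + 2 * K\<^sup>2) * S x ^ 0 \<and>
        (\<forall>t. \<bar>t\<bar> \<le> t0 \<longrightarrow> norm (1 / sqrt (q t x) - 1 / sqrt (q 0 x) - t *\<^sub>R (- q' x / 2)) \<le> (1 + K + 2 * K\<^sup>2) * t\<^sup>2 * S x ^ 0)"
      using K(2) q0 lb
    proof eventually_elim
      case (elim x)
      have k2: "0 \<le> K\<^sup>2" by simp
      have "\<bar>1 / sqrt (q t x) - 1 - t * (- q' x / 2)\<bar> \<le> (1 + K + 2 * K\<^sup>2) * t\<^sup>2" if t: "\<bar>t\<bar> \<le> t0" for t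
      proof -
        have 1: "\<bar>1 / sqrt (q t x) - 1 + (q t x - 1) / 2\<bar> \<le> 2 * (q t x - 1)\<^sup>2"
          using elim(3) t by (intro inverse_sqrt_expansion) auto
        have 2: "\<bar>q t x - 1\<bar> \<le> K * \<bar>t\<bar>" "\<bar>q t x - 1 - t * q' x\<bar> \<le> K * t\<^sup>2"
          using elim(1,2) t by auto
        have "(q t x - 1)\<^sup>2 \<le> (K * \<bar>t\<bar>)\<^sup>2" using power_mono[OF 2(1), of 2] by simp
        then have "2 * (q t x - 1)\<^sup>2 \<le> 2 * K\<^sup>2 * t\<^sup>2" by (simp add: power_mult_distrib)
        with 1 have X: "\<bar>1 / sqrt (q t x) - 1 + (q t x - 1) / 2\<bar> \<le> 2 * K\<^sup>2 * t\<^sup>2" by (rule order_trans)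
        have Y: "\<bar>q t x - 1 - t * q' x\<bar> / 2 \<le> K * t\<^sup>2 / 2" using 2(2) by (rule divide_right_mono) simp
        have eq: "1 / sqrt (q t x) - 1 - t * (- q' x / 2)
          = (1 / sqrt (q t x) - 1 + (q t x - 1) / 2) - (q t x - 1 - t * q' x) / 2" by (simp add: field_simps)
        have "\<bar>1 / sqrt (q t x) - 1 - t * (- q' x / 2)\<bar>
            \<le> \<bar>1 / sqrt (q t x) - 1 + (q t x - 1) / 2\<bar> + \<bar>q t x - 1 - t * q' x\<bar> / 2"
          unfolding eq by (rule order_trans[OF abs_triangle_ineq4]) simp
        also have "\<dots> \<le> 2 * K\<^sup>2 * t\<^sup>2 + K * t\<^sup>2 / 2" by (rule add_mono[OF X Y])
        also have "\<dots> \<le> 2 * K\<^sup>2 * t\<^sup>2 + K * t\<^sup>2 + t\<^sup>2"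
        proof -
          have "0 \<le> K * t\<^sup>2" "0 \<le> t\<^sup>2" using K by auto
          then show ?thesis by simp
        qed
        finally have "\<bar>1 / sqrt (q t x) - 1 - t * (- q' x / 2)\<bar> \<le> 2 * K\<^sup>2 * t\<^sup>2 + K * t\<^sup>2 + t\<^sup>2" .
        then show ?thesis by (simp add: algebra_simps)
      qed
      moreover have "\<bar>q' x\<bar> \<le> K" using elim by simp
      then have "norm (- q' x / 2) \<le> 1 + K + 2 * K\<^sup>2" using K(1) k2 unfolding real_norm_def abs_divide abs_minus_cancel by linarith
      moreover have "norm (1 / sqrt (q 0 x)) \<le> 1 + K + 2 * K\<^sup>2" using elim(2) K(1) k2 by simp
      ultimately show ?case using elim(2) by simp
    qed
  qed (use K in auto)
qed

text \<open>Integrating the remainder leaves at most a constant times t^2, so the difference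
  quotient differs from the integral of \<open>F'\<close> by a multiple of |t|. The degree enters
  only through the integrability of the power of the weight.\<close>

lemma taylor_integral:
  fixes F :: "real \<Rightarrow> real^2 \<Rightarrow> real"
  assumes F: "taylor_family t0 S j F F'" and Sj: "integrable disc_measure (\<lambda>x. S x ^ j)"
  shows "\<And>t. \<bar>t\<bar> \<le> t0 \<Longrightarrow> integrable disc_measure (F t)" "integrable disc_measure F'"
    "((\<lambda>t. LINT x|disc_measure. F t x) has_real_derivative (LINT x|disc_measure. F' x)) (at 0)"
proof -
  obtain K where K: "0 \<le> K" "AE x in disc_measure. norm (F 0 x) \<le> K * S x ^ j \<and> norm (F' x) \<le> K * S x ^ j \<and>
      (\<forall>t. \<bar>t\<bar> \<le> t0 \<longrightarrow> norm (F t x - F 0 x - t *\<^sub>R F' x) \<le> K * t\<^sup>2 * S x ^ j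
         \<and> norm (F t x) \<le> K * S x ^ j \<and> norm (F t x - F 0 x) \<le> K * \<bar>t\<bar> * S x ^ j)"
    by (rule taylor_familyE[OF F])
  have pos: "0 \<le> S x ^ j" for x using S[of x] by simp
  have KS: "integrable disc_measure (\<lambda>x. K * S x ^ j)" using Sj by simp
  show int: "integrable disc_measure (F t)" if t: "\<bar>t\<bar> \<le> t0" for t
    by (rule Bochner_Integration.integrable_bound[OF KS taylor_measurable[OF F t]])
       (use K(2) in eventually_elim, use t K(1) pos in auto)
  show int': "integrable disc_measure F'"
    by (rule Bochner_Integration.integrable_bound[OF KS taylor_measurable'[OF F]])
       (use K(2) in eventually_elim, use K(1) pos in auto)
  define I where "I = (LINT x|disc_measure. K * S x ^ j)"
  have I: "0 \<le> I" unfolding I_def using K(1) pos by (intro integral_nonneg_AE) auto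
  have est: "\<bar>(LINT x|disc_measure. F t x) - (LINT x|disc_measure. F 0 x) - t * (LINT x|disc_measure. F' x)\<bar> \<le> I * t\<^sup>2"
    if t: "\<bar>t\<bar> \<le> t0" for t
  proof -
    have i0: "integrable disc_measure (F 0)" using t0 by (intro int) simp
    have "(LINT x|disc_measure. F t x) - (LINT x|disc_measure. F 0 x) - t * (LINT x|disc_measure. F' x)
      = (LINT x|disc_measure. F t x - F 0 x - t * F' x)"
      using int[OF t] i0 int' by (simp add: Bochner_Integration.integral_diff)
    also have "\<bar>\<dots>\<bar> \<le> (LINT x|disc_measure. (K * S x ^ j) * t\<^sup>2)"
    proof -
      have "norm (LINT x|disc_measure. F t x - F 0 x - t * F' x) \<le> (LINT x|disc_measure. (K * S x ^ j) * t\<^sup>2)"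
      proof (rule order_trans[OF integral_norm_bound integral_mono_AE])
        show "AE x in disc_measure. norm (F t x - F 0 x - t * F' x) \<le> K * S x ^ j * t\<^sup>2"
          using K(2) by eventually_elim (use t in \<open>auto simp: mult_ac\<close>)
      qed (use int[OF t] i0 int' KS in auto)
      then show ?thesis by simp
    qed
    also have "\<dots> = I * t\<^sup>2" by (simp add: I_def)
    finally show ?thesis .
  qed
  show "((\<lambda>t. LINT x|disc_measure. F t x) has_real_derivative (LINT x|disc_measure. F' x)) (at 0)"
    unfolding DERIV_def
  proof (rule LIM_zero_cancel, rule Lim_null_comparison[where g = "\<lambda>t. I * \<bar>t\<bar>"])
    have "\<bar>((LINT x|disc_measure. F (0 + t) x) - (LINT x|disc_measure. F 0 x)) / t - (LINT x|disc_measure. F' x)\<bar> \<le> I * \<bar>t\<bar>"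
      if t: "\<bar>t\<bar> \<le> t0" "t \<noteq> 0" for t
    proof -
      have "((LINT x|disc_measure. F (0 + t) x) - (LINT x|disc_measure. F 0 x)) / t - (LINT x|disc_measure. F' x)
         = ((LINT x|disc_measure. F t x) - (LINT x|disc_measure. F 0 x) - t * (LINT x|disc_measure. F' x)) / t"
        using t by (simp add: field_simps)
      also have "\<bar>\<dots>\<bar> \<le> I * t\<^sup>2 / \<bar>t\<bar>" unfolding abs_divide using est[OF t(1)] by (intro divide_right_mono) auto
      also have "\<dots> = I * \<bar>t\<bar>" using t by (simp add: power2_eq_square field_simps)
      finally show ?thesis .
    qed
    then show "\<forall>\<^sub>F t in at 0. norm (((LINT x|disc_measure. F (0 + t) x) - (LINT x|disc_measure. F 0 x)) / t - (LINT x|disc_measure. F' x)) \<le> I * \<bar>t\<bar>"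
      using t0 by (auto simp: eventually_at dist_norm intro!: exI[of _ t0])
  qed (auto intro!: tendsto_eq_intros)
qed

text \<open>Derivative formulas simplify only almost everywhere, after inserting the values at t =
  0. This form leaves that simplification and the arithmetic of degrees as side conditions.\<close>

lemma taylor_bilinear_degree:
  assumes "bounded_bilinear h" "taylor_family t0 S i F F'" "taylor_family t0 S j G G'" "k = i + j"
    and "AE x in disc_measure. h (F 0 x) (G' x) + h (F' x) (G 0 x) = H x"
  shows "taylor_family t0 S k (\<lambda>t x. h (F t x) (G t x)) H"
  using taylor_deriv_cong[OF taylor_bilinear[OF assms(1-3)] assms(5)] assms(4) by simp

text \<open>The polynomial is in Horner form, so that its expansion follows from sums and from
  products with the family t.\<close>

lemma taylor_quadratic:
  assumes A: "taylor_family t0 S j (\<lambda>t. A) (\<lambda>x. 0)" and B: "taylor_family t0 S j (\<lambda>t. B) (\<lambda>x. 0)"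
    and C: "taylor_family t0 S j (\<lambda>t. C) (\<lambda>x. 0)"
  shows "taylor_family t0 S j (\<lambda>t x. A x + t *\<^sub>R (B x + t *\<^sub>R C x)) B"
proof -
  have 1: "taylor_family t0 S j (\<lambda>t x. t *\<^sub>R C x) C"
    by (rule taylor_bilinear_degree[OF bounded_bilinear_scaleR taylor_id C]) simp_all
  have 2: "taylor_family t0 S j (\<lambda>t x. B x + t *\<^sub>R C x) C"
    using taylor_add[OF B 1] by simp
  have 3: "taylor_family t0 S j (\<lambda>t x. t *\<^sub>R (B x + t *\<^sub>R C x)) B"
    by (rule taylor_bilinear_degree[OF bounded_bilinear_scaleR taylor_id 2]) simp_all
  show ?thesis using taylor_add[OF A 3] by simp
qed

end

section \<open>Linear algebra of frames and metrics\<close>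

lemma matrix_inv_eqI:
  fixes G H :: "real^'n^'n"
  assumes "G ** H = mat 1"
  shows "matrix_inv G = H"
proof -
  have HG: "H ** G = mat 1" using assms matrix_left_right_inverse by blast
  have "G ** matrix_inv G = mat 1 \<and> matrix_inv G ** G = mat 1"
    unfolding matrix_inv_def using assms HG by (intro someI[of "\<lambda>A'. G ** A' = mat 1 \<and> A' ** G = mat 1" H]) simp
  then have "H ** (G ** matrix_inv G) = H" by simp
  then show ?thesis by (simp add: matrix_mul_assoc HG)
qed

text \<open>The determinant of the Gram matrix is the squared length of the cross product by the
  Lagrange identity, and the cofactor formula gives the inverse.\<close>

lemma form_norm_sq_gram:
  fixes A B :: "real^3" and \<alpha> :: "real^2" and G :: "real^2^2"
  assumes G: "G = (\<chi> i j. (if i = 1 then A else B) \<bullet> (if j = 1 then A else B))" and N: "cross3 A B \<noteq> 0"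
  shows "det G = (norm (cross3 A B))\<^sup>2"
    "form_norm_sq G \<alpha> = ((B \<bullet> B) * (\<alpha> $ 1)\<^sup>2 - 2 * (A \<bullet> B) * (\<alpha> $ 1) * (\<alpha> $ 2) + (A \<bullet> A) * (\<alpha> $ 2)\<^sup>2) / (norm (cross3 A B))\<^sup>2"
proof -
  have d: "det G = (A \<bullet> A) * (B \<bullet> B) - (A \<bullet> B)\<^sup>2"
    by (simp add: det_2 G power2_eq_square inner_commute)
  then show det: "det G = (norm (cross3 A B))\<^sup>2"
    by (simp add: norm_cross dot_square_norm)
  define D where "D = det G"
  have D: "D \<noteq> 0" using N det by (simp add: D_def)
  define H :: "real^2^2" where "H = vector [vector [B \<bullet> B / D, - (A \<bullet> B) / D], vector [- (A \<bullet> B) / D, A \<bullet> A / D]]"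
  have D_eq: "(A \<bullet> A) * (B \<bullet> B) = D + (A \<bullet> B) * (A \<bullet> B)" using d by (simp add: D_def power2_eq_square)
  have Gij: "G $ 1 $ 1 = A \<bullet> A" "G $ 1 $ 2 = A \<bullet> B" "G $ 2 $ 1 = A \<bullet> B" "G $ 2 $ 2 = B \<bullet> B"
    by (simp_all add: G inner_commute)
  have "G ** H = mat 1"
    using D D_eq by (simp add: matrix_matrix_mult_def vec_eq_iff forall_2 sum_2 H_def Gij mat_def field_simps)
  then have "matrix_inv G = H" by (rule matrix_inv_eqI)
  then show "form_norm_sq G \<alpha> = ((B \<bullet> B) * (\<alpha> $ 1)\<^sup>2 - 2 * (A \<bullet> B) * (\<alpha> $ 1) * (\<alpha> $ 2) + (A \<bullet> A) * (\<alpha> $ 2)\<^sup>2) / (norm (cross3 A B))\<^sup>2"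
    unfolding det[symmetric] D_def[symmetric]
    using D by (simp add: form_norm_sq_def inner_vec_def sum_2 matrix_vector_mult_def H_def field_simps power2_eq_square)
qed

lemma bounded_bilinear_cross3: "bounded_bilinear cross3"
  unfolding bilinear_conv_bounded_bilinear[symmetric] bilinear_def
  by (auto intro!: linearI simp: cross_add_left cross_add_right cross_mult_left cross_mult_right)

lemma norm_cross3_le: "norm (cross3 a b) \<le> norm a * norm b"
proof (rule power2_le_imp_le)
  show "(norm (cross3 a b))\<^sup>2 \<le> (norm a * norm b)\<^sup>2" by (simp add: norm_cross power_mult_distrib)
qed simp

text \<open>What is left of \<open>v\<close> after removing its components along \<open>a\<close>
  and \<open>b\<close> has zero cross product with \<open>cross3 a b\<close>; by the double cross
  product formula it is a multiple of that unit vector.\<close>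

lemma orthonormal_expansion:
  fixes a b v :: "real^3"
  assumes o: "a \<bullet> a = 1" "b \<bullet> b = 1" "a \<bullet> b = 0"
  shows "v = (v \<bullet> a) *\<^sub>R a + (v \<bullet> b) *\<^sub>R b + (v \<bullet> cross3 a b) *\<^sub>R cross3 a b"
proof -
  define w where "w = v - (v \<bullet> a) *\<^sub>R a - (v \<bullet> b) *\<^sub>R b"
  have w: "w \<bullet> a = 0" "w \<bullet> b = 0" using o by (simp_all add: w_def inner_diff_left inner_commute[of b a])
  have n: "cross3 a b \<bullet> cross3 a b = 1" using o by (simp add: dot_cross inner_commute)
  have "cross3 w (cross3 a b) = 0" by (simp add: Lagrange w)
  then have "cross3 (cross3 a b) (cross3 w (cross3 a b)) = 0" by simp
  then have "w = (cross3 a b \<bullet> w) *\<^sub>R cross3 a b" unfolding Lagrange[of "cross3 a b"] by (simp add: n)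
  moreover have "cross3 a b \<bullet> w = v \<bullet> cross3 a b"
    by (simp add: w_def inner_diff_right dot_cross_self inner_commute)
  ultimately have "w = (v \<bullet> cross3 a b) *\<^sub>R cross3 a b" by simp
  then show ?thesis by (simp add: w_def algebra_simps)
qed

lemma orthonormal_norm_le:
  fixes a b v :: "real^3"
  assumes o: "a \<bullet> a = 1" "b \<bullet> b = 1" "a \<bullet> b = 0"
  shows "norm v \<le> \<bar>v \<bullet> a\<bar> + \<bar>v \<bullet> b\<bar> + \<bar>v \<bullet> cross3 a b\<bar>"
proof -
  have "cross3 a b \<bullet> cross3 a b = 1" using o by (simp add: dot_cross inner_commute)
  then have n: "norm a = 1" "norm b = 1" "norm (cross3 a b) = 1" using o by (simp_all add: norm_eq_1)
  have "norm v = norm ((v \<bullet> a) *\<^sub>R a + (v \<bullet> b) *\<^sub>R b + (v \<bullet> cross3 a b) *\<^sub>R cross3 a b)"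
    using orthonormal_expansion[OF o, of v] by simp
  also have "\<dots> \<le> norm ((v \<bullet> a) *\<^sub>R a) + norm ((v \<bullet> b) *\<^sub>R b) + norm ((v \<bullet> cross3 a b) *\<^sub>R cross3 a b)"
    by (intro norm_triangle_mono order_refl norm_triangle_ineq)
  finally show ?thesis by (simp add: n)
qed

lemma pullback_metric_gram:
  "pullback_metric \<Psi> x = (\<chi> i j. (if i = 1 then pd 1 \<Psi> x else pd 2 \<Psi> x) \<bullet> (if j = 1 then pd 1 \<Psi> x else pd 2 \<Psi> x))"
  by (simp add: pullback_metric_def vec_eq_iff forall_2)

text \<open>Conformal invariance in dimension two: the squared norm of a one-form scales by f^-2 and
  the area element by f^2.\<close>

lemma connection_density_scaled:
  assumes "f > 0" "pd 1 \<Psi> x = f *\<^sub>R u1" "pd 2 \<Psi> x = f *\<^sub>R u2" "cross3 u1 u2 \<noteq> 0"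
  shows "connection_density \<Psi> a b x =
    ((u2 \<bullet> u2) * (dot_d a b x $ 1)\<^sup>2 - 2 * (u1 \<bullet> u2) * (dot_d a b x $ 1) * (dot_d a b x $ 2)
      + (u1 \<bullet> u1) * (dot_d a b x $ 2)\<^sup>2) / norm (cross3 u1 u2)"
proof -
  have N: "cross3 (pd 1 \<Psi> x) (pd 2 \<Psi> x) = f\<^sup>2 *\<^sub>R cross3 u1 u2"
    using assms by (simp add: cross_mult_left cross_mult_right power2_eq_square)
  then have N0: "cross3 (pd 1 \<Psi> x) (pd 2 \<Psi> x) \<noteq> 0" using assms by simp
  note G = form_norm_sq_gram[OF pullback_metric_gram N0]
  have n: "norm (f\<^sup>2 *\<^sub>R cross3 u1 u2) = f\<^sup>2 * norm (cross3 u1 u2)" by simp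
  have "sqrt (det (pullback_metric \<Psi> x)) = f\<^sup>2 * norm (cross3 u1 u2)"
    unfolding G(1) N n by simp
  then show ?thesis
    unfolding connection_density_def G(2) N n
    unfolding assms(2,3) using assms(1,4) by (simp add: field_simps power2_eq_square)
qed

lemma perp_components [simp]: "perp \<beta> $ 1 = - (\<beta> $ 2)" "perp \<beta> $ 2 = \<beta> $ 1"
  by (simp_all add: perp_def)

lemma perp_add: "perp (\<beta> + \<gamma>) = perp \<beta> + perp \<gamma>" and perp_perp: "perp (perp \<beta>) = - \<beta>"
  by (simp_all add: vec_eq_iff[where 'b = 2] forall_2)

lemma perp_bounded_linear: "bounded_linear perp"
  unfolding linear_conv_bounded_linear[symmetric]
  by (rule linearI) (simp_all add: vec_eq_iff[where 'b = 2] forall_2)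

lemma integrable_vec_2:
  fixes X :: "2 \<Rightarrow> real^2 \<Rightarrow> real^3"
  assumes "\<And>i. integrable M (X i)"
  shows "integrable M (\<lambda>x. \<chi> i. X i x)"
proof -
  have L: "bounded_linear (\<lambda>y::real^3. (\<chi> j::2. if j = i then y else 0))" for i
    unfolding linear_conv_bounded_linear[symmetric]
    by (rule linearI) (simp_all add: vec_eq_iff[where 'b = 2])
  have "integrable M (\<lambda>x. (\<chi> j::2. if j = 1 then X 1 x else 0) + (\<chi> j::2. if j = 2 then X 2 x else 0))"
    by (intro Bochner_Integration.integrable_add integrable_bounded_linear[OF L] assms)
  also have "(\<lambda>x. (\<chi> j::2. if j = 1 then X 1 x else 0) + (\<chi> j::2. if j = 2 then X 2 x else 0)) = (\<lambda>x. \<chi> i. X i x)"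
    by (simp add: fun_eq_iff vec_eq_iff[where 'b = 2] forall_2)
  finally show ?thesis .
qed

lemma conformal_metric:
  assumes "0 < f" "pd 1 \<Phi> x = f *\<^sub>R a" "pd 2 \<Phi> x = f *\<^sub>R b"
    "a \<bullet> a = 1" "b \<bullet> b = 1" "a \<bullet> b = 0"
  shows "pullback_metric \<Phi> x = f\<^sup>2 *\<^sub>R mat 1" "matrix_inv (pullback_metric \<Phi> x) = (1 / f\<^sup>2) *\<^sub>R mat 1"
    "sqrt (det (pullback_metric \<Phi> x)) = f\<^sup>2" "form_norm_sq (pullback_metric \<Phi> x) \<alpha> = ((\<alpha> $ 1)\<^sup>2 + (\<alpha> $ 2)\<^sup>2) / f\<^sup>2"
proof -
  show G: "pullback_metric \<Phi> x = f\<^sup>2 *\<^sub>R mat 1"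
    using assms by (simp add: pullback_metric_def vec_eq_iff[where 'b = 2] forall_2 mat_def power2_eq_square inner_commute[of "b" "a"])
  show I: "matrix_inv (pullback_metric \<Phi> x) = (1 / f\<^sup>2) *\<^sub>R mat 1"
    by (rule matrix_inv_eqI) (use assms(1) in \<open>simp add: G matrix_matrix_mult_def vec_eq_iff forall_2 sum_2 mat_def\<close>)
  show "sqrt (det (pullback_metric \<Phi> x)) = f\<^sup>2"
    by (rule real_sqrt_unique) (simp_all add: G det_2 mat_def power2_eq_square)
  show "form_norm_sq (pullback_metric \<Phi> x) \<alpha> = ((\<alpha> $ 1)\<^sup>2 + (\<alpha> $ 2)\<^sup>2) / f\<^sup>2"
    by (simp add: form_norm_sq_def I matrix_vector_mult_def inner_vec_def[of \<alpha>] sum_2 mat_def power2_eq_square add_divide_distrib)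
qed

section \<open>Variation of a conformal immersion\<close>

locale conformal_variation =
  fixes \<Phi> :: "real^2 \<Rightarrow> real^3" and w :: "real^3 \<Rightarrow> real^3"
  assumes conf: "weak_conformal_immersion \<Phi>"
    and fin: "finite_frame_energy \<Phi> (coord_frame 1 \<Phi>) (coord_frame 2 \<Phi>)"
    and smw: "smooth w" and supp: "compact (fun_support w)"
    and bdw: "\<forall>y \<in> \<Phi> ` sphere 0 1. w y = 0"
begin

abbreviation "e i \<equiv> coord_frame i \<Phi>"
abbreviation "n \<equiv> unit_normal \<Phi>"
abbreviation "fc x \<equiv> norm (pd 1 \<Phi> x)"
abbreviation "Dw x \<equiv> frechet_derivative w (at (\<Phi> x))"
abbreviation "wPhi x \<equiv> w (\<Phi> x)"

section \<open>The conformal frame and its regularity\<close>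

lemma immersion: "weak_immersion \<Phi>"
  using conf by (simp add: weak_conformal_immersion_def)

lemma Phi_continuous: "continuous_on (cball 0 1) \<Phi>"
  using immersion by (simp add: weak_immersion_def)

lemma Phi_partial: "weak_partial i \<Phi> (pd i \<Phi>)"
  and Phi_L_inf: "L_inf \<Phi>"
  and pd_Phi_bound: "\<exists>C\<ge>0. AE x in disc_measure. norm (pd i \<Phi> x) \<le> C"
proof -
  have W: "W_1_inf \<Phi>" using immersion by (simp add: weak_immersion_def)
  then show "L_inf \<Phi>" by (simp add: W_1_inf_def)
  obtain v where v: "weak_partial i \<Phi> v" "L_inf v" using W by (auto simp: W_1_inf_def)
  show "weak_partial i \<Phi> (pd i \<Phi>)" by (rule pd_weak_partial(1)[OF v(1)])
  obtain C where C: "AE x in disc_measure. norm (v x) \<le> C" using v(2) by (auto simp: L_inf_def)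
  have "AE x in disc_measure. norm (pd i \<Phi> x) \<le> max 0 C"
    using C pd_weak_partial(2)[OF v(1)] by eventually_elim simp
  then show "\<exists>C\<ge>0. AE x in disc_measure. norm (pd i \<Phi> x) \<le> C" by (intro exI[of _ "max 0 C"]) simp
qed

lemma Phi_BW: "BW \<Phi>"
  unfolding BW_def
proof (intro conjI allI)
  show "\<exists>M. AE x in disc_measure. norm (\<Phi> x) \<le> M" using Phi_L_inf by (auto simp: L_inf_def)
  fix i
  obtain C where "AE x in disc_measure. norm (pd i \<Phi> x) \<le> C" using pd_Phi_bound by blast
  then have "L_two (pd i \<Phi>)" by (rule L_two_bounded[OF weak_partial_locI(4)[OF Phi_partial]])
  then show "\<exists>v. weak_partial i \<Phi> v \<and> L_two v" using Phi_partial by blast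
qed

lemma norm_n_le: "norm (n x) \<le> 1"
  by (simp add: unit_normal_def Let_def)

lemma n_BW: "BW n"
proof -
  have "W_1_2 n" using immersion by (simp add: weak_immersion_def)
  then show ?thesis using norm_n_le by (auto simp: W_1_2_def BW_def intro!: exI[of _ 1])
qed

lemma metric_bounds:
  obtains c where "c > 0" "AE x in disc_measure. \<forall>v. c * (v \<bullet> v) \<le> v \<bullet> (pullback_metric \<Phi> x *v v) \<and>
      v \<bullet> (pullback_metric \<Phi> x *v v) \<le> (1 / c) * (v \<bullet> v)"
proof -
  obtain C where "C > 0" "AE x in disc_measure. \<forall>v. (1 / C) * (v \<bullet> v) \<le> v \<bullet> (pullback_metric \<Phi> x *v v) \<and>
        v \<bullet> (pullback_metric \<Phi> x *v v) \<le> C * (v \<bullet> v)"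
    using immersion by (auto simp: weak_immersion_def)
  then show thesis by (intro that[of "1 / C"]) auto
qed

lemma pullback_metric_quadratic:
  "v \<bullet> (pullback_metric \<Psi> x *v v) = (norm (v $ 1 *\<^sub>R pd 1 \<Psi> x + v $ 2 *\<^sub>R pd 2 \<Psi> x))\<^sup>2"
  by (simp add: pullback_metric_def matrix_vector_mult_def inner_vec_def[of v] sum_2 power2_norm_eq_inner
      inner_add_left inner_add_right inner_commute algebra_simps)

lemma conformal_factor_bounds:
  obtains c where "c > 0" "AE x in disc_measure. c \<le> fc x"
proof -
  obtain c where c: "c > 0" "AE x in disc_measure. \<forall>v. c * (v \<bullet> v) \<le> v \<bullet> (pullback_metric \<Phi> x *v v) \<and>
      v \<bullet> (pullback_metric \<Phi> x *v v) \<le> (1 / c) * (v \<bullet> v)"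
    by (rule metric_bounds)
  have "AE x in disc_measure. sqrt c \<le> fc x"
    using c(2)
  proof eventually_elim
    case (elim x)
    have "axis (1::2) (1::real) $ 1 = 1" "axis (1::2) (1::real) $ 2 = 0" by (simp_all add: axis_def)
    then have "c \<le> (fc x)\<^sup>2"
      using elim[rule_format, of "axis 1 1"] by (simp add: pullback_metric_quadratic inner_axis_axis)
    then show ?case by (intro real_le_lsqrt) auto
  qed
  then show thesis using c(1) by (intro that[of "sqrt c"]) auto
qed

text \<open>The factor \<open>exp (- conformal_factor \<Phi> x)\<close> is the reciprocal of
  \<open>fc x\<close> only where the latter is positive, which the lower metric bound ensures almost
  everywhere. The frame is used through these pointwise relations afterwards.\<close>

lemma frame_AE:
  "AE x in disc_measure. 0 < fc x \<and> exp (- conformal_factor \<Phi> x) = 1 / fc x \<and>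
     exp (- 2 * conformal_factor \<Phi> x) = 1 / (fc x)\<^sup>2 \<and>
     pd 1 \<Phi> x = fc x *\<^sub>R e 1 x \<and> pd 2 \<Phi> x = fc x *\<^sub>R e 2 x \<and>
     e 1 x \<bullet> e 1 x = 1 \<and> e 2 x \<bullet> e 2 x = 1 \<and> e 1 x \<bullet> e 2 x = 0 \<and> n x = cross3 (e 1 x) (e 2 x)"
proof -
  obtain c where c: "c > 0" "AE x in disc_measure. c \<le> fc x" by (rule conformal_factor_bounds)
  have "AE x in disc_measure. norm (pd 1 \<Phi> x) = norm (pd 2 \<Phi> x) \<and> pd 1 \<Phi> x \<bullet> pd 2 \<Phi> x = 0"
    using conf by (simp add: weak_conformal_immersion_def)
  then show ?thesis
    using c(2)
  proof eventually_elim
    case (elim x)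
    have f: "0 < fc x" using elim(2) c(1) by linarith
    have l: "exp (- conformal_factor \<Phi> x) = 1 / fc x"
      using f by (simp add: conformal_factor_def exp_minus inverse_eq_divide)
    have l2: "exp (- 2 * conformal_factor \<Phi> x) = 1 / (fc x)\<^sup>2"
      using l by (simp add: exp_double[symmetric] power2_eq_square flip: exp_add mult_2)
         (metis l mult_2 exp_add minus_add_distrib times_divide_times_eq mult_1)
    have e: "e i x = (1 / fc x) *\<^sub>R pd i \<Phi> x" for i by (simp add: coord_frame_def l)
    have p: "pd i \<Phi> x = fc x *\<^sub>R e i x" for i using f by (simp add: e)
    have q: "pd 1 \<Phi> x \<bullet> pd 1 \<Phi> x = (fc x)\<^sup>2" "pd 2 \<Phi> x \<bullet> pd 2 \<Phi> x = (fc x)\<^sup>2"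
      using elim by (simp_all add: power2_norm_eq_inner[symmetric])
    have o: "e 1 x \<bullet> e 1 x = 1" "e 2 x \<bullet> e 2 x = 1" "e 1 x \<bullet> e 2 x = 0"
      using elim f q by (simp_all add: e power2_eq_square)
    have "cross3 (e 1 x) (e 2 x) \<bullet> cross3 (e 1 x) (e 2 x) = 1" using o by (simp add: dot_cross inner_commute)
    then have n1: "norm (cross3 (e 1 x) (e 2 x)) = 1" by (simp add: norm_eq_1)
    have "cross3 (pd 1 \<Phi> x) (pd 2 \<Phi> x) = (fc x)\<^sup>2 *\<^sub>R cross3 (e 1 x) (e 2 x)"
      by (subst (1 2) p) (simp add: cross_mult_left cross_mult_right power2_eq_square)
    then have "n x = cross3 (e 1 x) (e 2 x)" using n1 f by (simp add: unit_normal_def Let_def)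
    then show ?case using f l l2 p[of 1] p[of 2] o by blast
  qed
qed

lemma frame_orthonormal_AE:
  "AE x in disc_measure. 0 < fc x \<and> e 1 x \<bullet> e 1 x = 1 \<and> e 2 x \<bullet> e 2 x = 1 \<and> e 1 x \<bullet> e 2 x = 0 \<and> e 2 x \<bullet> e 1 x = 0
     \<and> (\<forall>v. v \<bullet> pd 1 \<Phi> x = fc x * (v \<bullet> e 1 x)) \<and> (\<forall>v. v \<bullet> pd 2 \<Phi> x = fc x * (v \<bullet> e 2 x))"
  using frame_AE
proof eventually_elim
  case (elim x)
  then have "\<And>v. v \<bullet> pd 1 \<Phi> x = v \<bullet> (fc x *\<^sub>R e 1 x)" "\<And>v. v \<bullet> pd 2 \<Phi> x = v \<bullet> (fc x *\<^sub>R e 2 x)" by metis+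
  then show ?case using elim unfolding inner_scaleR_right by (simp only: inner_commute[of "e 2 x" "e 1 x"]) blast
qed

lemma frame_partial: "weak_partial i (e j) (pd i (e j))"
  using fin exhaust_2[of j] weakly_differentiable_pd by (auto simp: finite_frame_energy_def)

lemma frame_bound: "AE x in disc_measure. norm (e j x) \<le> 1"
  using frame_AE by eventually_elim (use exhaust_2[of j] in \<open>auto simp: norm_eq_sqrt_inner\<close>)

text \<open>The inner products among \<open>e 1\<close>, \<open>e 2\<close> and \<open>n\<close> are
  constant almost everywhere, so by the product rule and uniqueness their derivatives vanish. What
  remains of the derivatives of the frame is the connection form and the components along
  \<open>n\<close>.\<close>

lemma frame_derivatives_AE:
  "AE x in disc_measure. \<forall>i. e 1 x \<bullet> pd i (e 1) x = 0 \<and> e 2 x \<bullet> pd i (e 2) x = 0 \<and>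
     e 2 x \<bullet> pd i (e 1) x = - (e 1 x \<bullet> pd i (e 2) x) \<and>
     e 1 x \<bullet> pd i n x = - (n x \<bullet> pd i (e 1) x) \<and> e 2 x \<bullet> pd i n x = - (n x \<bullet> pd i (e 2) x)"
proof -
  have const: "AE x in disc_measure. u x \<bullet> pd i v x + pd i u x \<bullet> v x = 0"
    if u: "weak_partial i u (pd i u)" "AE x in disc_measure. norm (u x) \<le> 1"
      and v: "weak_partial i v (pd i v)" "AE x in disc_measure. norm (v x) \<le> 1"
      and c: "AE x in disc_measure. u x \<bullet> v x = c" for u v :: "real^2 \<Rightarrow> real^3" and i c
  proof -
    have "weak_partial i (\<lambda>x. c) (\<lambda>x. u x \<bullet> pd i v x + pd i u x \<bullet> v x)"
      by (rule weak_partial_cong_AE[OF weak_partial_bilinear[OF bounded_bilinear_inner u(1) v(1) u(2) v(2)] c]) simp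
    moreover have "weak_partial i (\<lambda>x. c) (\<lambda>x. 0)"
      using weak_partial_C1[OF C_k_const, of i c] by (simp add: cpd_def[abs_def])
    ultimately show ?thesis by (rule weak_partial_unique)
  qed
  have n1: "AE x in disc_measure. norm (n x) \<le> 1" by (simp add: norm_n_le)
  have "AE x in disc_measure. e 1 x \<bullet> e 1 x = 1" "AE x in disc_measure. e 2 x \<bullet> e 2 x = 1"
    "AE x in disc_measure. e 2 x \<bullet> e 1 x = 0" "AE x in disc_measure. e 1 x \<bullet> n x = 0" "AE x in disc_measure. e 2 x \<bullet> n x = 0"
    using frame_AE by (eventually_elim, simp add: dot_cross_self inner_commute)+
  note C = this
  have "AE x in disc_measure. e 1 x \<bullet> pd i (e 1) x = 0 \<and> e 2 x \<bullet> pd i (e 2) x = 0 \<and>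
     e 2 x \<bullet> pd i (e 1) x = - (e 1 x \<bullet> pd i (e 2) x) \<and>
     e 1 x \<bullet> pd i n x = - (n x \<bullet> pd i (e 1) x) \<and> e 2 x \<bullet> pd i n x = - (n x \<bullet> pd i (e 2) x)" for i
    using const[OF frame_partial[of i 1] frame_bound frame_partial[of i 1] frame_bound C(1)]
      const[OF frame_partial[of i 2] frame_bound frame_partial[of i 2] frame_bound C(2)]
      const[OF frame_partial[of i 2] frame_bound frame_partial[of i 1] frame_bound C(3)]
      const[OF frame_partial[of i 1] frame_bound BW_pd(1)[OF n_BW] n1 C(4)]
      const[OF frame_partial[of i 2] frame_bound BW_pd(1)[OF n_BW] n1 C(5)]
    by eventually_elim (simp add: inner_commute add_eq_0_iff)
  then show ?thesis unfolding AE_all_countable by blast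
qed

text \<open>In conformal coordinates the energy density is the plain sum of squares of the
  connection components, so finite energy means that they are square integrable.\<close>

lemma connection_L_two: "L_two (\<lambda>x. e 1 x \<bullet> pd i (e 2) x)"
proof -
  have int: "integrable disc_measure (connection_density \<Phi> (e 1) (e 2))" using fin by (simp add: finite_frame_energy_def)
  have m: "(\<lambda>x. e 1 x \<bullet> pd i (e 2) x) \<in> borel_measurable disc_measure" for i
    by (intro borel_measurable_inner weak_partial_locI(3)[OF frame_partial] weak_partial_locI(4)[OF frame_partial])
  have "AE x in disc_measure. (norm (e 1 x \<bullet> pd i (e 2) x))\<^sup>2 \<le> connection_density \<Phi> (e 1) (e 2) x"
    using frame_AE
  proof eventually_elim
    case (elim x)
    have "cross3 (e 1 x) (e 2 x) \<bullet> cross3 (e 1 x) (e 2 x) = 1" using elim by (simp add: dot_cross inner_commute)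
    then have n1: "norm (cross3 (e 1 x) (e 2 x)) = 1" by (simp add: norm_eq_1)
    then have nz: "cross3 (e 1 x) (e 2 x) \<noteq> 0" by auto
    have "connection_density \<Phi> (e 1) (e 2) x = (e 1 x \<bullet> pd 1 (e 2) x)\<^sup>2 + (e 1 x \<bullet> pd 2 (e 2) x)\<^sup>2"
      using connection_density_scaled[of "fc x" \<Phi> x "e 1 x" "e 2 x" "e 1" "e 2"] elim nz n1
      by (simp add: dot_d_def)
    then show ?case using exhaust_2[of i] by auto
  qed
  then show ?thesis
    unfolding L_two_def using m
    by (auto intro!: Bochner_Integration.integrable_bound[OF int] elim!: eventually_mono)
qed

text \<open>In the basis \<open>e 1\<close>, \<open>e 2\<close>, \<open>n\<close> a derivative of a
  frame vector has a connection component and a normal component. The latter is, up to sign, a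
  component of the derivative of \<open>n\<close>; both are square integrable.\<close>

lemma frame_BW: "BW (e j)"
proof -
  have "L_two (pd i (e j))" for i
  proof (rule L_two_bound)
    show "L_two (\<lambda>x. norm (e 1 x \<bullet> pd i (e 2) x) + norm (pd i n x))"
      by (intro L_two_add L_two_norm connection_L_two BW_pd n_BW)
    show "pd i (e j) \<in> borel_measurable disc_measure" by (rule weak_partial_locI(4)[OF frame_partial])
    show "AE x in disc_measure. norm (pd i (e j) x) \<le> norm (norm (e 1 x \<bullet> pd i (e 2) x) + norm (pd i n x))"
      using frame_AE frame_derivatives_AE frame_bound[of 1] frame_bound[of 2]
    proof eventually_elim
      case (elim x)
      have cs: "\<bar>n x \<bullet> pd i (e j) x\<bar> \<le> norm (pd i n x)"
      proof -
        have "\<bar>n x \<bullet> pd i (e j) x\<bar> = \<bar>e j x \<bullet> pd i n x\<bar>" using elim(2)[rule_format, of i] exhaust_2[of j] by auto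
        also have "\<dots> \<le> norm (e j x) * norm (pd i n x)" by (rule Cauchy_Schwarz_ineq2)
        also have "\<dots> \<le> 1 * norm (pd i n x)" using elim(3,4) exhaust_2[of j] by (intro mult_right_mono) auto
        finally show ?thesis by simp
      qed
      have "norm (pd i (e j) x) \<le> \<bar>e 1 x \<bullet> pd i (e j) x\<bar> + \<bar>e 2 x \<bullet> pd i (e j) x\<bar> + \<bar>n x \<bullet> pd i (e j) x\<bar>"
        using orthonormal_norm_le[of "e 1 x" "e 2 x" "pd i (e j) x"] elim(1) by (simp add: inner_commute)
      then show ?case using cs elim(2)[rule_format, of i] exhaust_2[of j] by auto
    qed
  qed
  then show ?thesis unfolding BW_def using frame_partial[of _ j] frame_bound[of j] by blast
qed

lemma w_C1: "C_k (Suc 0) w" using smw by (simp add: smooth_def)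

lemma wPhi_BW: "BW wPhi" and wPhi_partial: "weak_partial i wPhi (\<lambda>x. Dw x (pd i \<Phi> x))"
  by (rule BW_compose[OF Phi_BW w_C1])+

lemma Dw_linear: "linear (Dw x)"
  using C_1_has_derivative[OF w_C1] has_derivative_linear by blast

text \<open>Compact support of \<open>w\<close> bounds its derivative globally. A bound of at least
  1 allows M to be estimated by M^2 in the choice of \<open>T\<close>.\<close>

lemma Dw_bound:
  obtains M where "M \<ge> 1" "\<And>x v. norm (Dw x v) \<le> M * norm v"
proof -
  obtain B where B: "\<forall>y\<in>fun_support w. norm y \<le> B"
    using compact_imp_bounded[OF supp] bounded_iff by blast
  have z: "w y = 0" if "B < norm y" for y
    using B that closure_subset[of "{x. w x \<noteq> 0}"] by (fastforce simp: fun_support_def)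
  obtain L where L: "L > 0" "\<And>y v. norm (frechet_derivative w (at y) v) \<le> L * norm v"
    by (rule C_1_supp_lipschitz[OF w_C1, of B], erule z, rule that)
  have "norm (Dw x v) \<le> max 1 L * norm v" for x v
    using L(2)[of "\<Phi> x" v] mult_right_mono[of L "max 1 L" "norm v"] by simp
  moreover have "1 \<le> max 1 L" by simp
  ultimately show thesis using that by blast
qed

section \<open>Coefficients of the perturbed normal\<close>

definition c :: "2 \<Rightarrow> real^2 \<Rightarrow> real^3" where "c i x = Dw x (e i x)"

text \<open>The map sending (y, v) to the derivative of \<open>w\<close> at y in direction v is C^1,
  as its expansion in fixed basis directions shows; this uses two derivatives of \<open>w\<close>.
  It is composed with the pair of \<open>\<Phi>\<close> and the frame vector.\<close>

lemma c_BW: "BW (c j)"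
proof -
  define g where "g p = frechet_derivative w (at (fst p)) (snd p)" for p :: "(real^3) \<times> (real^3)"
  have eq: "g p = (\<Sum>b\<in>Basis. (snd p \<bullet> b) *\<^sub>R frechet_derivative w (at (fst p)) b)" for p
    unfolding g_def by (rule frechet_derivative_expand[OF w_C1])
  have "C_k (Suc 0) (\<lambda>p :: (real^3) \<times> (real^3). (snd p \<bullet> b) *\<^sub>R frechet_derivative w (at (fst p)) b)" for b
  proof (rule C_k_bilinear[OF bounded_bilinear_scaleR])
    show "C_k (Suc 0) (\<lambda>p :: (real^3) \<times> (real^3). snd p \<bullet> b)"
      by (rule C_k_bilinear[OF bounded_bilinear_inner C_k_linear[OF bounded_linear_snd] C_k_const])
    have "C_k (Suc 0) (\<lambda>y. frechet_derivative w (at y) b)" using smooth_deriv[OF smw, of b] by (simp add: smooth_def)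
    from C_k_compose[OF this C_k_linear[OF bounded_linear_fst]]
    show "C_k (Suc 0) (\<lambda>p :: (real^3) \<times> (real^3). frechet_derivative w (at (fst p)) b)" .
  qed
  then have "C_k (Suc 0) g"
    unfolding eq[abs_def] by (rule C_k_sum)
  from BW_compose(1)[OF BW_Pair[OF Phi_BW frame_BW] this] show ?thesis
    by (simp add: g_def c_def[abs_def])
qed

definition b1 :: "real^2 \<Rightarrow> real^3" where "b1 x = cross3 (c 1 x) (e 2 x) + cross3 (e 1 x) (c 2 x)"
definition b2 :: "real^2 \<Rightarrow> real^3" where "b2 x = cross3 (c 1 x) (c 2 x)"

lemma b1_BW: "BW b1"
  unfolding b1_def[abs_def] by (intro BW_add BW_bilinear(1)[OF bounded_bilinear_cross3] c_BW frame_BW)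

lemma b2_BW: "BW b2"
  unfolding b2_def[abs_def] by (intro BW_bilinear(1)[OF bounded_bilinear_cross3] c_BW)

section \<open>The conformal factor and the symmetry of the second fundamental form\<close>

text \<open>The multiplier is vector valued. The scalar identity is applied with each component
  \<open>e k x \<bullet> b\<close>, and the \<open>b\<close> components of the results are summed
  over the basis.\<close>

lemma weak_partial_commute_frame:
  assumes \<phi>: "test_function \<phi>"
  shows "(LINT x|disc_measure. cpd 2 \<phi> x * (e k x \<bullet> pd 1 \<Phi> x) + \<phi> x * (pd 2 (e k) x \<bullet> pd 1 \<Phi> x))
       = (LINT x|disc_measure. cpd 1 \<phi> x * (e k x \<bullet> pd 2 \<Phi> x) + \<phi> x * (pd 1 (e k) x \<bullet> pd 2 \<Phi> x))"
proof -
  obtain C1 C2 where C: "C1 \<ge> 0" "C2 \<ge> 0" "AE x in disc_measure. norm (pd 1 \<Phi> x) \<le> C1" "AE x in disc_measure. norm (pd 2 \<Phi> x) \<le> C2"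
    using pd_Phi_bound by metis
  have Cp: "AE x in disc_measure. norm (pd i \<Phi> x) \<le> C1 + C2" for i
    using C(3,4) by eventually_elim (use C(1,2) exhaust_2[of i] in auto)
  have ip: "weak_partial l (\<lambda>x. e k x \<bullet> b) (\<lambda>x. pd l (e k) x \<bullet> b)" for l b
    by (rule weak_partial_linear[OF frame_partial bounded_linear_inner_left])
  have bd: "AE x in disc_measure. norm (e k x \<bullet> b) \<le> norm b" for b
    using frame_bound[of k]
  proof eventually_elim
    case (elim x)
    have "\<bar>e k x \<bullet> b\<bar> \<le> norm (e k x) * norm b" by (rule Cauchy_Schwarz_ineq2)
    also have "\<dots> \<le> 1 * norm b" using elim by (rule mult_right_mono) simp
    finally show ?case by simp
  qed
  have li: "locally_integrable (\<lambda>x. a x *\<^sub>R pd i \<Phi> x)" if a: "locally_integrable a" for a :: "real^2 \<Rightarrow> real" and i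
  proof (rule locally_integrable_bound)
    show "locally_integrable (\<lambda>x. (C1 + C2) * norm (a x))"
      by (rule locally_integrable_linear[OF locally_integrable_norm[OF a] bounded_linear_mult_right])
    show "(\<lambda>x. a x *\<^sub>R pd i \<Phi> x) \<in> borel_measurable disc_measure"
      by (intro borel_measurable_scaleR locally_integrable_measurable[OF a] weak_partial_locI(4)[OF Phi_partial])
    show "AE x in disc_measure. norm (a x *\<^sub>R pd i \<Phi> x) \<le> (C1 + C2) * norm (a x)"
      using Cp[of i] by eventually_elim (simp add: mult.commute[of "C1 + C2"] mult_left_mono)
  qed
  define I where "I i j b = (LINT x|disc_measure. (cpd j \<phi> x * (e k x \<bullet> b) + \<phi> x * (pd j (e k) x \<bullet> b)) *\<^sub>R pd i \<Phi> x)" for i j b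
  have Iint: "integrable disc_measure (\<lambda>x. (cpd j \<phi> x * (e k x \<bullet> b) + \<phi> x * (pd j (e k) x \<bullet> b)) *\<^sub>R pd i \<Phi> x)" for i j b
    using Bochner_Integration.integrable_add[OF test_integrable(2)[OF \<phi> li[OF weak_partial_locI(1)[OF ip]], of j b i]
        test_integrable(1)[OF \<phi> li[OF weak_partial_locI(2)[OF ip]], of j b i]]
    by (simp add: scaleR_add_left)
  have eq: "I 1 2 b = I 2 1 b" for b
    unfolding I_def by (rule weak_partial_commute_product[OF Phi_partial Phi_partial \<phi> ip bd Cp Cp])
  have exp: "(LINT x|disc_measure. cpd j \<phi> x * (e k x \<bullet> pd i \<Phi> x) + \<phi> x * (pd j (e k) x \<bullet> pd i \<Phi> x)) = (\<Sum>b\<in>Basis. I i j b \<bullet> b)" for i j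
  proof -
    have "(\<Sum>b\<in>Basis. I i j b \<bullet> b) = (\<Sum>b\<in>Basis. LINT x|disc_measure. ((cpd j \<phi> x * (e k x \<bullet> b) + \<phi> x * (pd j (e k) x \<bullet> b)) *\<^sub>R pd i \<Phi> x) \<bullet> b)"
      unfolding I_def by (intro sum.cong refl integral_inner_left[symmetric] Iint)
    also have "\<dots> = (LINT x|disc_measure. (\<Sum>b\<in>Basis. ((cpd j \<phi> x * (e k x \<bullet> b) + \<phi> x * (pd j (e k) x \<bullet> b)) *\<^sub>R pd i \<Phi> x) \<bullet> b))"
      by (rule Bochner_Integration.integral_sum[symmetric]) (intro integrable_inner_left Iint)
    also have "\<dots> = (LINT x|disc_measure. cpd j \<phi> x * (e k x \<bullet> pd i \<Phi> x) + \<phi> x * (pd j (e k) x \<bullet> pd i \<Phi> x))"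
    proof (intro Bochner_Integration.integral_cong refl)
      fix x
      have 1: "e k x \<bullet> pd i \<Phi> x = (\<Sum>b\<in>Basis. (e k x \<bullet> b) * (pd i \<Phi> x \<bullet> b))"
        and 2: "pd j (e k) x \<bullet> pd i \<Phi> x = (\<Sum>b\<in>Basis. (pd j (e k) x \<bullet> b) * (pd i \<Phi> x \<bullet> b))"
        by (rule euclidean_inner)+
      show "(\<Sum>b\<in>Basis. ((cpd j \<phi> x * (e k x \<bullet> b) + \<phi> x * (pd j (e k) x \<bullet> b)) *\<^sub>R pd i \<Phi> x) \<bullet> b)
          = cpd j \<phi> x * (e k x \<bullet> pd i \<Phi> x) + \<phi> x * (pd j (e k) x \<bullet> pd i \<Phi> x)"
        unfolding 1 2 by (simp add: distrib_right sum.distrib sum_distrib_left mult.assoc)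
    qed
    finally show ?thesis by simp
  qed
  show ?thesis unfolding exp using eq by simp
qed

text \<open>For k = 1 orthonormality leaves, in the tested identity, e^lambda against the derivative
  of the test function on one side and e^lambda (e_2 . d_1 e_1) on the other. This is the weak form
  of d_2 lambda = - e_2 . d_1 e_1; k = 2 gives the other direction.\<close>

lemma conformal_factor_partial: "\<exists>g. weak_partial i fc g"
proof -
  obtain C where C: "C \<ge> 0" "AE x in disc_measure. fc x \<le> C" using pd_Phi_bound by blast
  have fm: "fc \<in> borel_measurable disc_measure"
    by (intro measurable_compose[OF weak_partial_locI(4)[OF Phi_partial] borel_measurable_norm])
  have fl: "locally_integrable fc"
    by (rule locally_integrable_norm[OF weak_partial_locI(2)[OF Phi_partial]])
  have gl: "locally_integrable (\<lambda>x. fc x * (e j x \<bullet> pd k (e l) x))" for j k l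
  proof (rule locally_integrable_bound)
    show "locally_integrable (\<lambda>x. C * norm (pd k (e l) x))"
      by (rule locally_integrable_linear[OF locally_integrable_norm[OF weak_partial_locI(2)[OF frame_partial]] bounded_linear_mult_right])
    show "(\<lambda>x. fc x * (e j x \<bullet> pd k (e l) x)) \<in> borel_measurable disc_measure"
      by (intro borel_measurable_times fm borel_measurable_inner weak_partial_locI(3)[OF frame_partial] weak_partial_locI(4)[OF frame_partial])
    show "AE x in disc_measure. norm (fc x * (e j x \<bullet> pd k (e l) x)) \<le> C * norm (pd k (e l) x)"
      using C(2) frame_bound[of j]
    proof eventually_elim
      case (elim x)
      have "\<bar>e j x \<bullet> pd k (e l) x\<bar> \<le> norm (e j x) * norm (pd k (e l) x)" by (rule Cauchy_Schwarz_ineq2)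
      also have "\<dots> \<le> 1 * norm (pd k (e l) x)" using elim(2) by (rule mult_right_mono) simp
      finally show ?case using elim(1) C(1) by (simp add: abs_mult mult_mono)
    qed
  qed
  have "weak_partial 2 fc (\<lambda>x. - (fc x * (e 2 x \<bullet> pd 1 (e 1) x)))"
    unfolding weak_partial_def
  proof (intro conjI allI impI fl)
    show "locally_integrable (\<lambda>x. - (fc x * (e 2 x \<bullet> pd 1 (e 1) x)))"
      by (rule locally_integrable_linear[OF gl bounded_linear_minus[OF bounded_linear_ident]])
    fix \<phi> :: "real^2 \<Rightarrow> real" assume \<phi>: "test_function \<phi>"
    have "(LINT x|disc_measure. cpd 2 \<phi> x *\<^sub>R fc x)
        = (LINT x|disc_measure. cpd 2 \<phi> x * (e 1 x \<bullet> pd 1 \<Phi> x) + \<phi> x * (pd 2 (e 1) x \<bullet> pd 1 \<Phi> x))"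
      by (rule disc_integral_cong_AE) (use frame_orthonormal_AE frame_derivatives_AE in \<open>eventually_elim, simp add: inner_commute[of "pd _ (e _) _"]\<close>)
    also have "\<dots> = (LINT x|disc_measure. cpd 1 \<phi> x * (e 1 x \<bullet> pd 2 \<Phi> x) + \<phi> x * (pd 1 (e 1) x \<bullet> pd 2 \<Phi> x))"
      by (rule weak_partial_commute_frame[OF \<phi>])
    also have "\<dots> = - (LINT x|disc_measure. \<phi> x *\<^sub>R - (fc x * (e 2 x \<bullet> pd 1 (e 1) x)))"
      unfolding integral_minus[symmetric]
      by (rule disc_integral_cong_AE) (use frame_orthonormal_AE in \<open>eventually_elim, simp add: inner_commute[of "pd _ (e _) _"]\<close>)
    finally show "(LINT x|disc_measure. cpd 2 \<phi> x *\<^sub>R fc x) = - (LINT x|disc_measure. \<phi> x *\<^sub>R - (fc x * (e 2 x \<bullet> pd 1 (e 1) x)))" .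
  qed
  moreover have "weak_partial 1 fc (\<lambda>x. - (fc x * (e 1 x \<bullet> pd 2 (e 2) x)))"
    unfolding weak_partial_def
  proof (intro conjI allI impI fl)
    show "locally_integrable (\<lambda>x. - (fc x * (e 1 x \<bullet> pd 2 (e 2) x)))"
      by (rule locally_integrable_linear[OF gl bounded_linear_minus[OF bounded_linear_ident]])
    fix \<phi> :: "real^2 \<Rightarrow> real" assume \<phi>: "test_function \<phi>"
    have "(LINT x|disc_measure. cpd 1 \<phi> x *\<^sub>R fc x)
        = (LINT x|disc_measure. cpd 1 \<phi> x * (e 2 x \<bullet> pd 2 \<Phi> x) + \<phi> x * (pd 1 (e 2) x \<bullet> pd 2 \<Phi> x))"
      by (rule disc_integral_cong_AE) (use frame_orthonormal_AE frame_derivatives_AE in \<open>eventually_elim, simp add: inner_commute[of "pd _ (e _) _"]\<close>)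
    also have "\<dots> = (LINT x|disc_measure. cpd 2 \<phi> x * (e 2 x \<bullet> pd 1 \<Phi> x) + \<phi> x * (pd 2 (e 2) x \<bullet> pd 1 \<Phi> x))"
      by (rule weak_partial_commute_frame[OF \<phi>, symmetric])
    also have "\<dots> = - (LINT x|disc_measure. \<phi> x *\<^sub>R - (fc x * (e 1 x \<bullet> pd 2 (e 2) x)))"
      unfolding integral_minus[symmetric]
      by (rule disc_integral_cong_AE) (use frame_orthonormal_AE in \<open>eventually_elim, simp add: inner_commute[of "pd _ (e _) _"]\<close>)
    finally show "(LINT x|disc_measure. cpd 1 \<phi> x *\<^sub>R fc x) = - (LINT x|disc_measure. \<phi> x *\<^sub>R - (fc x * (e 1 x \<bullet> pd 2 (e 2) x)))" .
  qed
  ultimately show ?thesis using exhaust_2[of i] by auto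
qed

text \<open>The product rule applies to fc e_j, and the derivative of \<open>fc\<close> contributes
  only a tangential term, which \<open>n\<close> annihilates. Commuting second derivatives then give
  the symmetry after division by \<open>fc\<close>.\<close>

lemma second_form_AE:
  "AE x in disc_measure. \<forall>i j. n x \<bullet> pd i (pd j \<Phi>) x = fc x * (n x \<bullet> pd i (e j) x)"
  "AE x in disc_measure. n x \<bullet> pd 1 (e 2) x = n x \<bullet> pd 2 (e 1) x"
  "weak_partial i (pd j \<Phi>) (pd i (pd j \<Phi>))"
proof -
  obtain C where C: "C \<ge> 0" "AE x in disc_measure. fc x \<le> C" using pd_Phi_bound by blast
  have peq: "AE x in disc_measure. fc x *\<^sub>R e j x = pd j \<Phi> x" for j
    using frame_AE by eventually_elim (use exhaust_2[of j] in auto)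
  have *: "\<exists>g. weak_partial i (pd j \<Phi>) (\<lambda>x. fc x *\<^sub>R pd i (e j) x + g x *\<^sub>R e j x)" for i j
  proof -
    obtain g where "weak_partial i fc g" using conformal_factor_partial by blast
    then have "weak_partial i (\<lambda>x. fc x *\<^sub>R e j x) (\<lambda>x. fc x *\<^sub>R pd i (e j) x + g x *\<^sub>R e j x)"
      using C(2) by (intro weak_partial_bilinear[OF bounded_bilinear_scaleR _ frame_partial _ frame_bound]) auto
    then have "weak_partial i (pd j \<Phi>) (\<lambda>x. fc x *\<^sub>R pd i (e j) x + g x *\<^sub>R e j x)"
      by (rule weak_partial_cong_AE[OF _ peq]) simp
    then show ?thesis by blast
  qed
  show wp: "weak_partial i (pd j \<Phi>) (pd i (pd j \<Phi>))" for i j using * pd_weak_partial(1) by blast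
  have h: "AE x in disc_measure. n x \<bullet> pd i (pd j \<Phi>) x = fc x * (n x \<bullet> pd i (e j) x)" for i j
  proof -
    obtain g where g: "weak_partial i (pd j \<Phi>) (\<lambda>x. fc x *\<^sub>R pd i (e j) x + g x *\<^sub>R e j x)" using * by blast
    show ?thesis
      using pd_weak_partial(2)[OF g] frame_AE
    proof eventually_elim
      case (elim x)
      have "n x \<bullet> e j x = 0" using elim(2) exhaust_2[of j] by (auto simp: dot_cross_self)
      then show ?case using elim(1) by (simp add: inner_add_right)
    qed
  qed
  show "AE x in disc_measure. \<forall>i j. n x \<bullet> pd i (pd j \<Phi>) x = fc x * (n x \<bullet> pd i (e j) x)"
    unfolding AE_all_countable using h by blast
  \<comment> \<open>The derivative already found in one order satisfies the defining identity of the
    derivative in the other order, so uniqueness identifies the two.\<close>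
  have "weak_partial 2 (pd 1 \<Phi>) (pd 1 (pd 2 \<Phi>))"
    unfolding weak_partial_def
  proof (intro conjI allI impI weak_partial_locI(1)[OF wp] weak_partial_locI(2)[OF wp])
    fix \<phi> :: "real^2 \<Rightarrow> real" assume \<phi>: "test_function \<phi>"
    have "(LINT x|disc_measure. cpd 2 \<phi> x *\<^sub>R pd 1 \<Phi> x) = (LINT x|disc_measure. cpd 1 \<phi> x *\<^sub>R pd 2 \<Phi> x)"
      by (rule weak_partial_commute[OF Phi_partial Phi_partial \<phi>])
    also have "\<dots> = - (LINT x|disc_measure. \<phi> x *\<^sub>R pd 1 (pd 2 \<Phi>) x)"
      using wp[of 1 2] \<phi> by (simp add: weak_partial_def)
    finally show "(LINT x|disc_measure. cpd 2 \<phi> x *\<^sub>R pd 1 \<Phi> x) = - (LINT x|disc_measure. \<phi> x *\<^sub>R pd 1 (pd 2 \<Phi>) x)" .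
  qed
  from pd_weak_partial(2)[OF this] h[of 1 2] h[of 2 1] frame_AE
  show "AE x in disc_measure. n x \<bullet> pd 1 (e 2) x = n x \<bullet> pd 2 (e 1) x"
  proof eventually_elim
    case (elim x)
    have "fc x * (n x \<bullet> pd 1 (e 2) x) = fc x * (n x \<bullet> pd 2 (e 1) x)"
      using elim(1-3) by simp
    moreover have "fc x \<noteq> 0" using elim(4) by simp
    ultimately show ?case by simp
  qed
qed

section \<open>Expansion of the energy density\<close>

definition Mw :: real where "Mw = (SOME M. 1 \<le> M \<and> (\<forall>x v. norm (Dw x v) \<le> M * norm v))"
text \<open>For |t| at most T the vector t b1 + t^2 b2 has length at most 2 T Mw + T Mw^2, hence at
  most 3 T Mw^2 = 1/2, and \<open>zf\<close> stays away from zero. Moreover T Mw is at most 1/6,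
  small enough to keep the perturbed map an immersion.\<close>

definition T :: real where "T = 1 / (6 * Mw\<^sup>2)"
text \<open>A single L^2 function dominating every derivative that occurs in the expansion.\<close>

definition S :: "real^2 \<Rightarrow> real" where
  "S x = 1 + (\<Sum>i\<in>UNIV. norm (pd i (e 1) x) + norm (pd i (e 2) x) + norm (pd i n x) + norm (pd i b1 x) + norm (pd i b2 x))"

lemma Mw: "1 \<le> Mw" "norm (Dw x v) \<le> Mw * norm v"
proof -
  have "1 \<le> Mw \<and> (\<forall>x v. norm (Dw x v) \<le> Mw * norm v)"
    unfolding Mw_def by (rule someI_ex) (rule Dw_bound, blast)
  then show "1 \<le> Mw" "norm (Dw x v) \<le> Mw * norm v" by auto
qed

lemma T: "0 < T" "T \<le> 1" "T * (2 * Mw) + T * Mw\<^sup>2 \<le> 1/2" "T * Mw \<le> 1/2"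
proof -
  have m0: "Mw \<noteq> 0" using Mw(1) by linarith
  have m: "1 \<le> Mw\<^sup>2" "Mw \<le> Mw\<^sup>2" using Mw(1) mult_mono[of 1 Mw 1 Mw] by (auto simp: power2_eq_square)
  show "0 < T" "T \<le> 1" using m m0 by (auto simp: T_def divide_le_eq)
  have "T * Mw\<^sup>2 = 1/6" using m0 by (simp add: T_def)
  moreover have "T * Mw \<le> T * Mw\<^sup>2" using m \<open>0 < T\<close> by (intro mult_left_mono) auto
  ultimately show "T * (2 * Mw) + T * Mw\<^sup>2 \<le> 1/2" "T * Mw \<le> 1/2" by auto
qed

lemma S_ge: "1 \<le> S x" "norm (pd i (e j) x) \<le> S x" "norm (pd i n x) \<le> S x" "norm (pd i b1 x) \<le> S x" "norm (pd i b2 x) \<le> S x"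
  using exhaust_2[of i] exhaust_2[of j] by (auto simp: S_def sum_2 intro!: add_nonneg_nonneg)

lemma S_L_two: "L_two S"
  unfolding S_def[abs_def]
  by (intro L_two_add L_two_sum L_two_norm BW_pd frame_BW n_BW b1_BW b2_BW BW_L_two BW_const)

lemma S_square_integrable: "integrable disc_measure (\<lambda>x. (S x)\<^sup>2)"
  using S_L_two by (simp add: L_two_def)

interpretation tw: taylor_weight T S
  using T S_ge by unfold_locales auto

text \<open>With \<open>fc = e\<^sup>\<lambda>\<close> and \<open>c\<^sub>i = Dw(e\<^sub>i)\<close>, the derivatives of the perturbed immersion are \<open>fc uf\<^sub>i\<close> and
  their cross product is \<open>fc\<^sup>2 zf\<close>, so that \<open>nu\<close>, \<open>F1\<close> and \<open>F2\<close> are the perturbed normal and frame.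
  The term \<open>al i\<close> is \<open>F1 \<cdot> \<partial>\<^sub>i F2\<close>: as \<open>F2 = e\<^sub>2 - kf nu\<close> and \<open>F1\<close> is orthogonal to \<open>zf\<close>, neither
  derivatives of \<open>kf\<close> nor of \<open>sf\<close> remain. In the energy density \<open>dens\<close> the conformal factor
  cancels.\<close>

definition "zf t x = n x + t *\<^sub>R (b1 x + t *\<^sub>R b2 x)"
definition "qf t x = zf t x \<bullet> zf t x"
definition "sf t x = 1 / sqrt (qf t x)"
definition "nu t x = sf t x *\<^sub>R zf t x"
definition "F1 t x = cross3 (e 2 x) (nu t x)"
definition "kf t x = e 2 x \<bullet> nu t x"
definition "F2 t x = - cross3 (F1 t x) (nu t x)"
definition "dz i t x = pd i n x + t *\<^sub>R (pd i b1 x + t *\<^sub>R pd i b2 x)"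
definition "al i t x = F1 t x \<bullet> pd i (e 2) x + - (kf t x * (sf t x * (F1 t x \<bullet> dz i t x)))"
definition "uf i t x = e i x + t *\<^sub>R (c i x + t *\<^sub>R 0)"
definition "dens t x = sf t x * ((uf 2 t x \<bullet> uf 2 t x) * (al 1 t x * al 1 t x)
    + ((- 2) *\<^sub>R ((uf 1 t x \<bullet> uf 2 t x) * (al 1 t x * al 2 t x)) + (uf 1 t x \<bullet> uf 1 t x) * (al 2 t x * al 2 t x)))"

lemma c_bound: "AE x in disc_measure. \<forall>i. norm (c i x) \<le> Mw"
proof -
  have "AE x in disc_measure. \<forall>i. norm (e i x) \<le> 1" unfolding AE_all_countable using frame_bound by blast
  then show ?thesis
  proof eventually_elim
    case (elim x)
    have "norm (c i x) \<le> Mw * norm (e i x)" for i using Mw(2) by (simp add: c_def)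
    moreover have "Mw * norm (e i x) \<le> Mw * 1" for i using elim Mw(1) by (intro mult_left_mono) auto
    ultimately show ?case using order_trans by fastforce
  qed
qed

lemma base_AE:
  "AE x in disc_measure. 0 < fc x \<and> e 1 x \<bullet> e 1 x = 1 \<and> e 2 x \<bullet> e 2 x = 1 \<and> e 1 x \<bullet> e 2 x = 0 \<and> e 2 x \<bullet> e 1 x = 0 \<and>
    n x = cross3 (e 1 x) (e 2 x) \<and> n x \<bullet> n x = 1 \<and> e 1 x \<bullet> n x = 0 \<and> e 2 x \<bullet> n x = 0 \<and>
    cross3 (e 2 x) (n x) = e 1 x \<and> cross3 (e 1 x) (n x) = - e 2 x \<and>
    norm (b1 x) \<le> 2 * Mw \<and> norm (b2 x) \<le> Mw\<^sup>2"
  using frame_AE frame_orthonormal_AE c_bound frame_bound[of 1] frame_bound[of 2]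
proof eventually_elim
  case (elim x)
  have o: "e 1 x \<bullet> e 1 x = 1" "e 2 x \<bullet> e 2 x = 1" "e 1 x \<bullet> e 2 x = 0" "e 2 x \<bullet> e 1 x = 0" using elim(2) by auto
  have nx: "n x = cross3 (e 1 x) (e 2 x)" using elim(1) by auto
  have nn: "n x \<bullet> n x = 1" unfolding nx using o by (simp add: dot_cross)
  have Mb: "norm (cross3 u v) \<le> a * b" if "norm u \<le> a" "norm v \<le> b" for u v a b
    using that order_trans[OF norm_ge_zero that(1)] by (intro order_trans[OF norm_cross3_le] mult_mono) auto
  have cM: "norm (c i x) \<le> Mw" for i using elim(3) by auto
  have "norm (b1 x) \<le> Mw * 1 + 1 * Mw"
    unfolding b1_def using elim(4,5) by (intro norm_triangle_mono Mb cM)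
  moreover have "norm (b2 x) \<le> Mw * Mw" unfolding b2_def by (intro Mb cM)
  moreover have "cross3 (e 2 x) (n x) = e 1 x" "cross3 (e 1 x) (n x) = - e 2 x"
    unfolding nx Lagrange using o by simp_all
  moreover have "e 1 x \<bullet> n x = 0" "e 2 x \<bullet> n x = 0" unfolding nx by (simp_all add: dot_cross_self)
  ultimately show ?case using o nx nn elim(2) by (simp add: power2_eq_square)
qed

lemma normal_AE:
  "AE x in disc_measure. n x \<bullet> n x = 1 \<and> e 1 x \<bullet> n x = 0 \<and> e 2 x \<bullet> n x = 0 \<and>
    cross3 (e 2 x) (n x) = e 1 x \<and> cross3 (e 1 x) (n x) = - e 2 x \<and>
    norm (b1 x) \<le> 2 * Mw \<and> norm (b2 x) \<le> Mw\<^sup>2"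
  using base_AE by eventually_elim blast

text \<open>\<open>n\<close> is a unit vector and the choice of \<open>T\<close> bounds the other
  terms of \<open>zf\<close> by 1/2; the resulting bound 1/4 for \<open>qf\<close> is the one needed
  for the inverse square root.\<close>

lemma zf_AE:
  "AE x in disc_measure. \<forall>t. \<bar>t\<bar> \<le> T \<longrightarrow> 1/4 \<le> qf t x \<and> sf t x * norm (zf t x) = 1 \<and> nu t x \<bullet> nu t x = 1"
  using normal_AE
proof eventually_elim
  case (elim x)
  show ?case
  proof (intro allI impI)
    fix t assume t: "\<bar>t\<bar> \<le> T"
    have n1: "norm (n x) = 1" using elim by (simp add: norm_eq_1)
    have t2: "\<bar>t\<bar> \<le> 1" using t T by simp
    have "norm (t *\<^sub>R b1 x) \<le> T * (2 * Mw)" unfolding norm_scaleR using t elim by (intro mult_mono) auto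
    moreover have "norm (t *\<^sub>R (t *\<^sub>R b2 x)) \<le> T * (1 * Mw\<^sup>2)"
      unfolding norm_scaleR using t t2 elim T by (intro mult_mono) auto
    moreover have "norm (n x) \<le> norm (zf t x) + (norm (t *\<^sub>R b1 x) + norm (t *\<^sub>R (t *\<^sub>R b2 x)))"
    proof -
      have "n x = zf t x - (t *\<^sub>R b1 x + t *\<^sub>R (t *\<^sub>R b2 x))" by (simp add: zf_def scaleR_add_right)
      then have "norm (n x) \<le> norm (zf t x) + norm (t *\<^sub>R b1 x + t *\<^sub>R (t *\<^sub>R b2 x))"
        using norm_triangle_ineq4 by metis
      then show ?thesis using norm_triangle_ineq[of "t *\<^sub>R b1 x" "t *\<^sub>R (t *\<^sub>R b2 x)"] by linarith
    qed
    ultimately have z: "1/2 \<le> norm (zf t x)" using n1 T(3) by simp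
    then have z0: "zf t x \<noteq> 0" by auto
    have q: "qf t x = (norm (zf t x))\<^sup>2" by (simp add: qf_def power2_norm_eq_inner)
    have "(1/2)\<^sup>2 \<le> (norm (zf t x))\<^sup>2" using z by (intro power_mono) auto
    moreover have s: "sf t x = 1 / norm (zf t x)" by (simp add: sf_def q)
    moreover have "norm (nu t x) = 1" using z0 by (simp add: nu_def s)
    ultimately show "1/4 \<le> qf t x \<and> sf t x * norm (zf t x) = 1 \<and> nu t x \<bullet> nu t x = 1"
      using z0 by (simp add: q norm_eq_1 power2_eq_square)
  qed
qed

lemma at_0_AE:
  "AE x in disc_measure. zf 0 x = n x \<and> qf 0 x = 1 \<and> sf 0 x = 1 \<and> nu 0 x = n x \<and> F1 0 x = e 1 x \<and> kf 0 x = 0 \<and> F2 0 x = e 2 x"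
  using normal_AE
proof eventually_elim
  case (elim x)
  then show ?case by (simp add: zf_def qf_def sf_def nu_def F1_def kf_def F2_def)
qed

text \<open>\<open>b1\<close> is the first variation of the unnormalised normal. Its normal
  component is the tangential divergence of \<open>w\<close>. The multiples of \<open>e 1\<close>
  and \<open>e 2\<close> in the two cross products are exactly those that normalisation
  removes.\<close>

lemma cross_b1_AE:
  "AE x in disc_measure. n x \<bullet> b1 x = c 1 x \<bullet> e 1 x + c 2 x \<bullet> e 2 x \<and> e 2 x \<bullet> b1 x = - (c 2 x \<bullet> n x) \<and>
    cross3 (e 2 x) (b1 x) = (n x \<bullet> b1 x) *\<^sub>R e 1 x + (c 1 x \<bullet> n x) *\<^sub>R n x \<and>
    cross3 (e 1 x) (b1 x) = - ((n x \<bullet> b1 x) *\<^sub>R e 2 x) - (c 2 x \<bullet> n x) *\<^sub>R n x"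
  using base_AE
proof eventually_elim
  case (elim x)
  have o: "e 1 x \<bullet> e 1 x = 1" "e 2 x \<bullet> e 2 x = 1" "e 1 x \<bullet> e 2 x = 0" "e 2 x \<bullet> e 1 x = 0" using elim by auto
  have nx: "cross3 (e 1 x) (e 2 x) = n x" using elim by auto
  have nb: "n x \<bullet> b1 x = c 1 x \<bullet> e 1 x + c 2 x \<bullet> e 2 x"
    unfolding b1_def nx[symmetric] by (simp add: dot_cross inner_add_right o inner_commute)
  have "e 2 x \<bullet> b1 x = e 2 x \<bullet> cross3 (e 1 x) (c 2 x)" unfolding b1_def by (simp add: inner_add_right dot_cross_self)
  also have "\<dots> = - (c 2 x \<bullet> n x)"
    unfolding nx[symmetric] using cross_triple[of "e 1 x" "c 2 x" "e 2 x"] cross_triple[of "e 2 x" "e 1 x" "c 2 x"]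
    by (simp add: inner_commute cross_skew[of "e 2 x" "e 1 x"])
  finally have eb: "e 2 x \<bullet> b1 x = - (c 2 x \<bullet> n x)" .
  have ex: "c i x = (c i x \<bullet> e 1 x) *\<^sub>R e 1 x + (c i x \<bullet> e 2 x) *\<^sub>R e 2 x + (c i x \<bullet> n x) *\<^sub>R n x" for i
    using orthonormal_expansion[OF o(1-3), of "c i x"] by (simp only: nx)
  have "cross3 (e 2 x) (b1 x) = c 1 x - (e 2 x \<bullet> c 1 x) *\<^sub>R e 2 x + (e 2 x \<bullet> c 2 x) *\<^sub>R e 1 x"
    unfolding b1_def by (simp add: cross_add_right Lagrange o)
  also have "\<dots> = (n x \<bullet> b1 x) *\<^sub>R e 1 x + (c 1 x \<bullet> n x) *\<^sub>R n x"
    unfolding nb by (subst ex[of 1]) (simp add: inner_commute scaleR_add_left)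
  finally have c1: "cross3 (e 2 x) (b1 x) = (n x \<bullet> b1 x) *\<^sub>R e 1 x + (c 1 x \<bullet> n x) *\<^sub>R n x" .
  have "cross3 (e 1 x) (b1 x) = - ((e 1 x \<bullet> c 1 x) *\<^sub>R e 2 x) + (e 1 x \<bullet> c 2 x) *\<^sub>R e 1 x - c 2 x"
    unfolding b1_def by (simp add: cross_add_right Lagrange o)
  also have "\<dots> = - ((n x \<bullet> b1 x) *\<^sub>R e 2 x) - (c 2 x \<bullet> n x) *\<^sub>R n x"
    unfolding nb by (subst (2) ex[of 2]) (simp add: inner_commute scaleR_add_left)
  finally show ?case using nb eb c1 by blast
qed

lemma taylor_const_0:
  assumes "BW u" shows "taylor_family T S 0 (\<lambda>t. u) (\<lambda>x. 0)"
proof -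
  obtain M where "0 \<le> M" "AE x in disc_measure. norm (u x) \<le> M" by (rule BW_bound[OF assms])
  then show ?thesis by (intro tw.taylor_const[OF BW_measurable[OF assms], of M]) auto
qed

lemma taylor_const_1:
  assumes "BW u" "\<And>x. norm (pd i u x) \<le> S x" shows "taylor_family T S 1 (\<lambda>t. pd i u) (\<lambda>x. 0)"
  using assms by (intro tw.taylor_const[OF BW_pd_measurable, of _ 1]) auto

lemma taylor_zf: "taylor_family T S 0 zf b1"
  unfolding zf_def[abs_def] by (intro tw.taylor_quadratic taylor_const_0 n_BW b1_BW b2_BW)

lemma taylor_dz: "taylor_family T S 1 (dz i) (pd i b1)"
  unfolding dz_def[abs_def] by (intro tw.taylor_quadratic taylor_const_1 n_BW b1_BW b2_BW S_ge)

text \<open>The zero quadratic coefficient in \<open>uf\<close> gives it the form to which the rule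
  for quadratic families applies.\<close>

lemma taylor_uf: "taylor_family T S 0 (uf i) (c i)"
  unfolding uf_def[abs_def] by (intro tw.taylor_quadratic taylor_const_0 frame_BW c_BW BW_const)

lemma taylor_qf: "taylor_family T S 0 qf (\<lambda>x. 2 * (n x \<bullet> b1 x))"
  unfolding qf_def[abs_def]
  by (rule tw.taylor_bilinear_degree[OF bounded_bilinear_inner taylor_zf taylor_zf])
     (use at_0_AE in \<open>simp, eventually_elim, simp add: inner_commute\<close>)

lemma taylor_sf: "taylor_family T S 0 sf (\<lambda>x. - (n x \<bullet> b1 x))"
proof -
  have q0: "AE x in disc_measure. qf 0 x = 1" using at_0_AE by eventually_elim simp
  have lb: "AE x in disc_measure. \<forall>t. \<bar>t\<bar> \<le> T \<longrightarrow> 1/4 \<le> qf t x" using zf_AE by eventually_elim simp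
  from tw.taylor_inverse_sqrt[OF taylor_qf q0 lb] show ?thesis by (simp add: sf_def[abs_def])
qed

lemma taylor_nu: "taylor_family T S 0 nu (\<lambda>x. b1 x - (n x \<bullet> b1 x) *\<^sub>R n x)"
  unfolding nu_def[abs_def]
  by (rule tw.taylor_bilinear_degree[OF bounded_bilinear_scaleR taylor_sf taylor_zf])
     (use at_0_AE in \<open>simp, eventually_elim, simp\<close>)

text \<open>The tangential term is cancelled by the normalisation of the normal, so to first order
  the frame vector moves in the normal direction only.\<close>

lemma taylor_F1: "taylor_family T S 0 F1 (\<lambda>x. (c 1 x \<bullet> n x) *\<^sub>R n x)"
  unfolding F1_def[abs_def]
  by (rule tw.taylor_bilinear_degree[OF bounded_bilinear_cross3 taylor_const_0[OF frame_BW] taylor_nu])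
     (use normal_AE cross_b1_AE in \<open>simp, eventually_elim, simp add: Cross3.right_diff_distrib cross_mult_right\<close>)

lemma taylor_kf: "taylor_family T S 0 kf (\<lambda>x. - (c 2 x \<bullet> n x))"
  unfolding kf_def[abs_def]
  by (rule tw.taylor_bilinear_degree[OF bounded_bilinear_inner taylor_const_0[OF frame_BW] taylor_nu])
     (use normal_AE cross_b1_AE in \<open>simp, eventually_elim, simp add: inner_diff_right\<close>)

lemma taylor_F2: "taylor_family T S 0 F2 (\<lambda>x. (c 2 x \<bullet> n x) *\<^sub>R n x)"
proof -
  have "taylor_family T S 0 (\<lambda>t x. cross3 (F1 t x) (nu t x)) (\<lambda>x. - ((c 2 x \<bullet> n x) *\<^sub>R n x))"
    by (rule tw.taylor_bilinear_degree[OF bounded_bilinear_cross3 taylor_F1 taylor_nu])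
       (use at_0_AE normal_AE cross_b1_AE in \<open>simp, eventually_elim, simp add: Cross3.right_diff_distrib cross_mult_right cross_mult_left\<close>)
  from tw.taylor_minus[OF this] show ?thesis by (simp add: F2_def[abs_def])
qed

definition "al0 i x = e 1 x \<bullet> pd i (e 2) x"
text \<open>By the relations between frame and normal this is (c_1 . n) h_i2 - (c_2 . n) h_i1 with
  h_ij = n . d_i e_j: the change of the connection form when both frame vectors tilt towards the
  normal.\<close>

definition "al' i x = (c 1 x \<bullet> n x) * (n x \<bullet> pd i (e 2) x) + (c 2 x \<bullet> n x) * (e 1 x \<bullet> pd i n x)"

lemma al_0_AE: "AE x in disc_measure. \<forall>i. al i 0 x = al0 i x"
  using at_0_AE by eventually_elim (simp add: al_def al0_def)

lemma taylor_al: "taylor_family T S 1 (al i) (al' i)"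
proof -
  have 1: "taylor_family T S 1 (\<lambda>t x. F1 t x \<bullet> pd i (e 2) x) (\<lambda>x. (c 1 x \<bullet> n x) * (n x \<bullet> pd i (e 2) x))"
    by (rule tw.taylor_bilinear_degree[OF bounded_bilinear_inner taylor_F1 taylor_const_1[OF frame_BW S_ge(2)]]) simp_all
  have 2: "taylor_family T S 1 (\<lambda>t x. F1 t x \<bullet> dz i t x) (\<lambda>x. F1 0 x \<bullet> pd i b1 x + ((c 1 x \<bullet> n x) *\<^sub>R n x) \<bullet> dz i 0 x)"
    by (rule tw.taylor_bilinear_degree[OF bounded_bilinear_inner taylor_F1 taylor_dz]) simp_all
  have 3: "taylor_family T S 1 (\<lambda>t x. sf t x * (F1 t x \<bullet> dz i t x))
      (\<lambda>x. sf 0 x * (F1 0 x \<bullet> pd i b1 x + ((c 1 x \<bullet> n x) *\<^sub>R n x) \<bullet> dz i 0 x) + - (n x \<bullet> b1 x) * (F1 0 x \<bullet> dz i 0 x))"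
    by (rule tw.taylor_bilinear_degree[OF bounded_bilinear_mult taylor_sf 2]) simp_all
  \<comment> \<open>\<open>kf\<close> vanishes at t = 0, so only its derivative survives, multiplied
    by the value of the other factor; the derivative of \<open>b1\<close> from the previous steps
    drops out here.\<close>
  have 4: "taylor_family T S 1 (\<lambda>t x. kf t x * (sf t x * (F1 t x \<bullet> dz i t x))) (\<lambda>x. - ((c 2 x \<bullet> n x) * (e 1 x \<bullet> pd i n x)))"
    by (rule tw.taylor_bilinear_degree[OF bounded_bilinear_mult taylor_kf 3])
       (use at_0_AE in \<open>simp, eventually_elim, simp add: dz_def\<close>)
  from tw.taylor_add[OF 1 tw.taylor_minus[OF 4]] show ?thesis
    by (simp add: al_def[abs_def] al'_def[abs_def])
qed

text \<open>The first term is the variation of the normalising factor \<open>sf\<close>, the next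
  three come from the metric coefficients, the last from the connection form.\<close>

definition "dens' x = - (c 1 x \<bullet> e 1 x + c 2 x \<bullet> e 2 x) * ((al0 1 x)\<^sup>2 + (al0 2 x)\<^sup>2)
    + 2 * (c 2 x \<bullet> e 2 x) * (al0 1 x)\<^sup>2 - 2 * (c 1 x \<bullet> e 2 x + c 2 x \<bullet> e 1 x) * (al0 1 x * al0 2 x)
    + 2 * (c 1 x \<bullet> e 1 x) * (al0 2 x)\<^sup>2 + 2 * (al0 1 x * al' 1 x + al0 2 x * al' 2 x)"

text \<open>The metric coefficients have degree 0 and each connection component degree 1, so the
  density has degree 2, matching the square integrability of the weight.\<close>

lemma taylor_dens: "taylor_family T S 2 dens dens'"
proof -
  have u0: "uf i 0 x = e i x" for i x by (simp add: uf_def)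
  have m: "taylor_family T S 0 (\<lambda>t x. uf i t x \<bullet> uf j t x) (\<lambda>x. e i x \<bullet> c j x + c i x \<bullet> e j x)" for i j
    by (rule tw.taylor_bilinear_degree[OF bounded_bilinear_inner taylor_uf taylor_uf]) (simp_all add: u0)
  have a: "taylor_family T S 2 (\<lambda>t x. al i t x * al j t x) (\<lambda>x. al0 i x * al' j x + al' i x * al0 j x)" for i j
    by (rule tw.taylor_bilinear_degree[OF bounded_bilinear_mult taylor_al taylor_al])
       (use al_0_AE in \<open>simp, eventually_elim, simp\<close>)
  have ma: "taylor_family T S 2 (\<lambda>t x. (uf i t x \<bullet> uf j t x) * (al k t x * al l t x))
      (\<lambda>x. (e i x \<bullet> e j x) * (al0 k x * al' l x + al' k x * al0 l x) + (e i x \<bullet> c j x + c i x \<bullet> e j x) * (al0 k x * al0 l x))"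
    for i j k l
    by (rule tw.taylor_bilinear_degree[OF bounded_bilinear_mult m a])
       (use al_0_AE in \<open>simp, eventually_elim, simp add: u0\<close>)
  have c2: "taylor_family T S 0 (\<lambda>t x. - 2 :: real) (\<lambda>x. 0)" by (rule taylor_const_0[OF BW_const])
  have mm: "taylor_family T S 2 (\<lambda>t x. (- 2 :: real) *\<^sub>R ((uf 1 t x \<bullet> uf 2 t x) * (al 1 t x * al 2 t x)))
      (\<lambda>x. (- 2) *\<^sub>R ((e 1 x \<bullet> e 2 x) * (al0 1 x * al' 2 x + al' 1 x * al0 2 x) + (e 1 x \<bullet> c 2 x + c 1 x \<bullet> e 2 x) * (al0 1 x * al0 2 x)))"
    by (rule tw.taylor_bilinear_degree[OF bounded_bilinear_scaleR c2 ma[of 1 2 1 2]]) simp_all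
  note sum = tw.taylor_add[OF ma[of 2 2 1 1] tw.taylor_add[OF mm ma[of 1 1 2 2]]]
  show ?thesis
    unfolding dens_def[abs_def]
  proof (rule tw.taylor_bilinear_degree[OF bounded_bilinear_mult taylor_sf sum])
    show "AE x in disc_measure.
       sf 0 x * (((e 2 x \<bullet> e 2 x) * (al0 1 x * al' 1 x + al' 1 x * al0 1 x) + (e 2 x \<bullet> c 2 x + c 2 x \<bullet> e 2 x) * (al0 1 x * al0 1 x))
         + ((- 2) *\<^sub>R ((e 1 x \<bullet> e 2 x) * (al0 1 x * al' 2 x + al' 1 x * al0 2 x) + (e 1 x \<bullet> c 2 x + c 1 x \<bullet> e 2 x) * (al0 1 x * al0 2 x))
           + ((e 1 x \<bullet> e 1 x) * (al0 2 x * al' 2 x + al' 2 x * al0 2 x) + (e 1 x \<bullet> c 1 x + c 1 x \<bullet> e 1 x) * (al0 2 x * al0 2 x))))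
       + - (n x \<bullet> b1 x) * ((uf 2 0 x \<bullet> uf 2 0 x) * (al 1 0 x * al 1 0 x)
         + ((- 2) *\<^sub>R ((uf 1 0 x \<bullet> uf 2 0 x) * (al 1 0 x * al 2 0 x)) + (uf 1 0 x \<bullet> uf 1 0 x) * (al 2 0 x * al 2 0 x)))
       = dens' x"
      using at_0_AE al_0_AE base_AE cross_b1_AE
    proof eventually_elim
      case (elim x)
      have o: "e 1 x \<bullet> e 1 x = 1" "e 2 x \<bullet> e 2 x = 1" "e 1 x \<bullet> e 2 x = 0" using elim(3) by auto
      have s: "sf 0 x = 1" using elim(1) by auto
      have nb: "n x \<bullet> b1 x = c 1 x \<bullet> e 1 x + c 2 x \<bullet> e 2 x" using elim(4) by auto
      have a0: "al 1 0 x = al0 1 x" "al 2 0 x = al0 2 x" using elim(2) by auto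
      show ?case
        unfolding s nb a0 u0 o dens'_def inner_commute[of "e 1 x" "c _ x"] inner_commute[of "e 2 x" "c _ x"]
        by (simp add: power2_eq_square algebra_simps)
    qed
  qed simp
qed

section \<open>Identification with the perturbed immersion and its frame\<close>

lemma perturbed_partial: "weak_partial i (perturbed \<Phi> w t) (\<lambda>x. pd i \<Phi> x + t *\<^sub>R Dw x (pd i \<Phi> x))"
  unfolding perturbed_def[abs_def] by (intro weak_partial_add Phi_partial weak_partial_scaleR wPhi_partial)

lemma pd_wPhi_AE: "AE x in disc_measure. \<forall>i. pd i wPhi x = fc x *\<^sub>R c i x"
proof -
  have "AE x in disc_measure. pd i wPhi x = fc x *\<^sub>R c i x" for i
    using pd_weak_partial(2)[OF wPhi_partial[of i]] frame_AE
  proof eventually_elim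
    case (elim x)
    have p: "pd i \<Phi> x = fc x *\<^sub>R e i x" using elim(2) exhaust_2[of i] by auto
    have "Dw x (pd i \<Phi> x) = Dw x (fc x *\<^sub>R e i x)" using p by (rule arg_cong)
    then show ?case using elim(1) by (simp add: c_def linear_cmul[OF Dw_linear])
  qed
  then show ?thesis unfolding AE_all_countable by blast
qed

lemma pd_perturbed_AE: "AE x in disc_measure. \<forall>i. pd i (perturbed \<Phi> w t) x = fc x *\<^sub>R uf i t x"
proof -
  have "AE x in disc_measure. pd i (perturbed \<Phi> w t) x = fc x *\<^sub>R uf i t x" for i
    using pd_weak_partial(2)[OF perturbed_partial[of i t]] frame_AE
  proof eventually_elim
    case (elim x)
    have p: "pd i \<Phi> x = fc x *\<^sub>R e i x" using elim(2) exhaust_2[of i] by auto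
    have D: "Dw x (pd i \<Phi> x) = fc x *\<^sub>R c i x" unfolding p[THEN arg_cong[where f = "Dw x"]]
      by (simp add: c_def linear_cmul[OF Dw_linear])
    show ?case unfolding elim(1) D uf_def using p by (simp add: scaleR_add_right)
  qed
  then show ?thesis unfolding AE_all_countable by blast
qed

lemma cross_uf_AE: "AE x in disc_measure. \<forall>t. cross3 (uf 1 t x) (uf 2 t x) = zf t x"
  using frame_AE
proof eventually_elim
  case (elim x)
  have nx: "n x = cross3 (e 1 x) (e 2 x)" using elim by auto
  show ?case
    unfolding zf_def uf_def nx b1_def b2_def
    by (simp add: cross_add_left cross_add_right cross_mult_left cross_mult_right scaleR_add_right)
qed

lemma normal_perturbed_AE:
  assumes t: "\<bar>t\<bar> \<le> T"
  shows "AE x in disc_measure. unit_normal (perturbed \<Phi> w t) x = nu t x"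
  using pd_perturbed_AE[of t] cross_uf_AE zf_AE frame_orthonormal_AE
proof eventually_elim
  case (elim x)
  have f: "0 < fc x" using elim(4) by blast
  have N: "cross3 (pd 1 (perturbed \<Phi> w t) x) (pd 2 (perturbed \<Phi> w t) x) = (fc x)\<^sup>2 *\<^sub>R zf t x"
    using elim(1,2) by (simp add: cross_mult_left cross_mult_right power2_eq_square)
  have s: "sf t x * norm (zf t x) = 1" using elim(3) t by auto
  then have "norm (zf t x) \<noteq> 0" by auto
  then have "sf t x = 1 / norm (zf t x)" using s by (simp add: field_simps)
  then show ?case using f by (simp add: unit_normal_def Let_def N nu_def)
qed

lemma perturbed_frame_AE:
  assumes t: "\<bar>t\<bar> \<le> T"
  shows "AE x in disc_measure. perturbed_frame 1 \<Phi> w t x = F1 t x" "AE x in disc_measure. perturbed_frame 2 \<Phi> w t x = F2 t x"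
  using normal_perturbed_AE[OF t]
  by (eventually_elim, simp add: perturbed_frame_def perturbed_frame_1_def perturbed_frame_2_def F1_def F2_def)+

lemma zf_BW: "BW (zf t)"
  unfolding zf_def[abs_def] by (intro BW_add BW_bilinear(1)[OF bounded_bilinear_scaleR] BW_const n_BW b1_BW b2_BW)

lemma pd_zf_AE: "AE x in disc_measure. pd i (zf t) x = dz i t x"
proof -
  have "weak_partial i (zf t) (dz i t)"
    unfolding zf_def[abs_def] dz_def[abs_def]
    by (intro weak_partial_add weak_partial_scaleR BW_pd n_BW b1_BW b2_BW)
  then show ?thesis by (rule pd_weak_partial(2))
qed

text \<open>The function \<open>s \<mapsto> 1 / sqrt s\<close> is modified below \<open>1/4\<close> to become a \<open>C\<^sup>1\<close> function on the line.\<close>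

lemma sf_BW:
  assumes t: "\<bar>t\<bar> \<le> T"
  shows "BW (sf t)"
proof -
  \<comment> \<open>Equal to s for s at least 1/4. Below, the coefficient 2 cancels the linear term
    and leaves 2 s^2 + 1/8, which is positive.\<close>
  define \<eta> where "\<eta> s = s + 2 * (max 0 (1/4 - s))\<^sup>2" for s :: real
  have pos: "\<eta> s > 0" for s
  proof (cases "s \<le> 1/4")
    case True
    have "\<eta> s = 2 * (s\<^sup>2 + 1/16)" using True by (simp add: \<eta>_def power2_eq_square algebra_simps)
    then show ?thesis by (simp add: add_nonneg_pos)
  qed (simp add: \<eta>_def)
  define \<eta>' where "\<eta>' s = 1 - 4 * max 0 (1/4 - s)" for s :: real
  have \<eta>: "(\<eta> has_real_derivative \<eta>' s) (at s)" for s
    unfolding \<eta>_def[abs_def] \<eta>'_def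
    by (rule derivative_eq_intros DERIV_chain'[OF _ max_0_square_deriv] refl)+ simp
  have c: "continuous_on UNIV \<eta>" unfolding \<eta>_def[abs_def] by (intro continuous_intros)
  have "C_k (Suc 0) (\<lambda>s. 1 / sqrt (\<eta> s))"
  proof (rule C_k_SucI[where f' = "\<lambda>s v. v * (- \<eta>' s / (2 * (\<eta> s * sqrt (\<eta> s))))"])
    fix s
    have "((\<lambda>s. 1 / sqrt (\<eta> s)) has_real_derivative - \<eta>' s / (2 * (\<eta> s * sqrt (\<eta> s)))) (at s)"
      using pos[of s] by (auto intro!: derivative_eq_intros \<eta> simp: field_simps)
    then show "((\<lambda>s. 1 / sqrt (\<eta> s)) has_derivative (\<lambda>v. v * (- \<eta>' s / (2 * (\<eta> s * sqrt (\<eta> s)))))) (at s)"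
      by (simp only: has_field_derivative_def mult_commute_abs)
  next
    fix v :: real
    have "\<eta> s * sqrt (\<eta> s) \<noteq> 0" for s using pos[of s] by simp
    then show "C_k 0 (\<lambda>s. v * (- \<eta>' s / (2 * (\<eta> s * sqrt (\<eta> s)))))"
      using c unfolding \<eta>'_def by (auto intro!: continuous_intros)
  qed
  from BW_compose(1)[OF BW_bilinear(1)[OF bounded_bilinear_inner zf_BW zf_BW] this]
  show ?thesis
  proof (rule BW_cong_AE)
    show "AE x in disc_measure. 1 / sqrt (\<eta> (zf t x \<bullet> zf t x)) = sf t x"
      using zf_AE
    proof eventually_elim
      case (elim x)
      then have "1/4 \<le> zf t x \<bullet> zf t x" using t by (auto simp: qf_def)
      then show ?case by (simp add: sf_def \<eta>_def qf_def)
    qed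
  qed
qed

lemma nu_BW: "\<bar>t\<bar> \<le> T \<Longrightarrow> BW (nu t)"
  unfolding nu_def[abs_def] by (intro BW_bilinear(1)[OF bounded_bilinear_scaleR] sf_BW zf_BW)

lemma F_BW: "\<bar>t\<bar> \<le> T \<Longrightarrow> BW (F1 t)" "\<bar>t\<bar> \<le> T \<Longrightarrow> BW (kf t)" "\<bar>t\<bar> \<le> T \<Longrightarrow> BW (F2 t)"
proof -
  assume t: "\<bar>t\<bar> \<le> T"
  show F1: "BW (F1 t)"
    unfolding F1_def[abs_def] by (intro BW_bilinear(1)[OF bounded_bilinear_cross3] frame_BW nu_BW t)
  show "BW (kf t)"
    unfolding kf_def[abs_def] by (intro BW_bilinear(1)[OF bounded_bilinear_inner] frame_BW nu_BW t)
  have "BW (\<lambda>x. cross3 (F1 t x) (nu t x))"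
    by (intro BW_bilinear(1)[OF bounded_bilinear_cross3] F1 nu_BW t)
  from BW_bilinear(1)[OF bounded_bilinear_scaleR BW_const[of "- 1"] this]
  show "BW (F2 t)" by (simp add: F2_def[abs_def])
qed

text \<open>For a unit vector \<open>nu t x\<close> the double cross product defining
  \<open>F2\<close> is \<open>e 2 x\<close> minus its component along \<open>nu t x\<close>. This
  form can be differentiated and paired with \<open>F1\<close>.\<close>

lemma F_pointwise_AE:
  "AE x in disc_measure. \<forall>t. \<bar>t\<bar> \<le> T \<longrightarrow> F2 t x = e 2 x + (- 1) *\<^sub>R (kf t x *\<^sub>R nu t x) \<and> F1 t x \<bullet> F2 t x = 0 \<and> F1 t x \<bullet> zf t x = 0
     \<and> F1 t x \<bullet> nu t x = 0"
  using zf_AE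
proof eventually_elim
  case (elim x)
  show ?case
  proof (intro allI impI conjI)
    fix t assume t: "\<bar>t\<bar> \<le> T"
    have nn: "nu t x \<bullet> nu t x = 1" using elim t by auto
    have "F2 t x = cross3 (nu t x) (cross3 (e 2 x) (nu t x))"
      by (simp add: F2_def F1_def cross_skew[of "nu t x" "cross3 _ _"])
    then show "F2 t x = e 2 x + (- 1) *\<^sub>R (kf t x *\<^sub>R nu t x)"
      by (simp add: Lagrange nn kf_def inner_commute)
    show "F1 t x \<bullet> F2 t x = 0" by (simp add: F2_def dot_cross_self)
    show fn: "F1 t x \<bullet> nu t x = 0" by (simp add: F1_def dot_cross_self)
    have "sf t x \<noteq> 0" using elim t by auto
    then show "F1 t x \<bullet> zf t x = 0" using fn by (simp add: nu_def)
  qed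
qed

text \<open>The second equation comes from differentiating the orthogonality of \<open>F1\<close>
  and \<open>F2\<close>: exchanging the frame vectors changes the sign of the connection
  form.\<close>

lemma pd_F2_AE:
  assumes t: "\<bar>t\<bar> \<le> T"
  shows "AE x in disc_measure. F1 t x \<bullet> pd i (F2 t) x = al i t x \<and> F2 t x \<bullet> pd i (F1 t) x = - al i t x"
proof -
  have "AE x in disc_measure. e 2 x + (- 1) *\<^sub>R (kf t x *\<^sub>R nu t x) = F2 t x"
    using F_pointwise_AE by eventually_elim (use t in simp)
  from pd_cong_AE[OF weak_partial_add[OF frame_partial weak_partial_scaleR[OF BW_bilinear(2)[OF bounded_bilinear_scaleR F_BW(2)[OF t] nu_BW[OF t]]]] this]
  have p2: "AE x in disc_measure. pd i (F2 t) x = pd i (e 2) x + (- 1) *\<^sub>R (kf t x *\<^sub>R pd i (nu t) x + pd i (kf t) x *\<^sub>R nu t x)" .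
  have pn: "AE x in disc_measure. pd i (nu t) x = sf t x *\<^sub>R pd i (zf t) x + pd i (sf t) x *\<^sub>R zf t x"
    by (rule pd_cong_AE[OF BW_bilinear(2)[OF bounded_bilinear_scaleR sf_BW[OF t] zf_BW]]) (simp add: nu_def)
  have "AE x in disc_measure. F1 t x \<bullet> F2 t x = 0"
    using F_pointwise_AE by eventually_elim (use t in blast)
  from weak_partial_cong_AE[OF BW_bilinear(2)[OF bounded_bilinear_inner F_BW(1)[OF t] F_BW(3)[OF t]] this]
  have "weak_partial i (\<lambda>x. 0) (\<lambda>x. F1 t x \<bullet> pd i (F2 t) x + pd i (F1 t) x \<bullet> F2 t x)" by simp
  moreover have "weak_partial i (\<lambda>x. 0 :: real) (\<lambda>x. 0)"
    using weak_partial_C1[OF C_k_const, of i "0::real"] by (simp add: cpd_def[abs_def])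
  ultimately have z: "AE x in disc_measure. F1 t x \<bullet> pd i (F2 t) x + pd i (F1 t) x \<bullet> F2 t x = 0"
    by (rule weak_partial_unique)
  show ?thesis
    using p2 pn z F_pointwise_AE pd_zf_AE[of i t]
  proof eventually_elim
    case (elim x)
    have F: "F1 t x \<bullet> zf t x = 0" "F1 t x \<bullet> nu t x = 0" using elim(4) t by blast+
    have 1: "F1 t x \<bullet> pd i (F2 t) x = al i t x"
      unfolding elim(1,2,5) al_def by (simp add: inner_add_right inner_diff_right F)
    then show ?case using elim(3) by (simp add: inner_commute add_eq_0_iff)
  qed
qed

text \<open>The density is quadratic in the connection form, so the sign by which the two orders of
  the frame differ has no effect.\<close>

lemma connection_AE:
  assumes t: "\<bar>t\<bar> \<le> T"
  shows "AE x in disc_measure. connection_density (perturbed \<Phi> w t) (perturbed_frame 1 \<Phi> w t) (perturbed_frame 2 \<Phi> w t) x = dens t x"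
    "AE x in disc_measure. connection_density (perturbed \<Phi> w t) (perturbed_frame 2 \<Phi> w t) (perturbed_frame 1 \<Phi> w t) x = dens t x"
proof -
  note pf = perturbed_frame_AE[OF t]
  have sym: "AE x in disc_measure. F1 t x = perturbed_frame 1 \<Phi> w t x" "AE x in disc_measure. F2 t x = perturbed_frame 2 \<Phi> w t x"
    by (rule eventually_mono[OF pf(1)], erule sym, rule eventually_mono[OF pf(2)], erule sym)
  have pd: "AE x in disc_measure. pd i (perturbed_frame 1 \<Phi> w t) x = pd i (F1 t) x"
    "AE x in disc_measure. pd i (perturbed_frame 2 \<Phi> w t) x = pd i (F2 t) x" for i
    by (rule pd_cong_AE[OF BW_pd(1)[OF F_BW(1)[OF t]] sym(1)], rule pd_cong_AE[OF BW_pd(1)[OF F_BW(3)[OF t]] sym(2)])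
  have dens: "connection_density (perturbed \<Phi> w t) a b x = dens t x"
    if "0 < fc x" "\<forall>i. pd i (perturbed \<Phi> w t) x = fc x *\<^sub>R uf i t x" "cross3 (uf 1 t x) (uf 2 t x) = zf t x"
      "sf t x * norm (zf t x) = 1" "\<And>i. (dot_d a b x $ i)\<^sup>2 = (al i t x)\<^sup>2"
      "dot_d a b x $ 1 * dot_d a b x $ 2 = al 1 t x * al 2 t x" for a b x
  proof -
    have z0: "norm (zf t x) \<noteq> 0" using that(4) by auto
    then have s: "sf t x = 1 / norm (zf t x)" using that(4) by (simp add: field_simps)
    have "connection_density (perturbed \<Phi> w t) a b x =
      ((uf 2 t x \<bullet> uf 2 t x) * (dot_d a b x $ 1)\<^sup>2 - 2 * (uf 1 t x \<bullet> uf 2 t x) * (dot_d a b x $ 1 * dot_d a b x $ 2)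
        + (uf 1 t x \<bullet> uf 1 t x) * (dot_d a b x $ 2)\<^sup>2) / norm (zf t x)"
      using connection_density_scaled[of "fc x" "perturbed \<Phi> w t" x "uf 1 t x" "uf 2 t x" a b] that z0
      by (simp add: mult.assoc)
    then show ?thesis
      unfolding that(5,6) dens_def s by (simp add: power2_eq_square add_divide_distrib diff_divide_distrib mult.assoc)
  qed
  show "AE x in disc_measure. connection_density (perturbed \<Phi> w t) (perturbed_frame 1 \<Phi> w t) (perturbed_frame 2 \<Phi> w t) x = dens t x"
    using pf pd(2)[of 1] pd(2)[of 2] pd_F2_AE[OF t, of 1] pd_F2_AE[OF t, of 2] pd_perturbed_AE[of t] cross_uf_AE zf_AE frame_orthonormal_AE
  proof eventually_elim
    case (elim x)
    have d: "dot_d (perturbed_frame 1 \<Phi> w t) (perturbed_frame 2 \<Phi> w t) x $ i = al i t x" for i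
      using elim(1-6) exhaust_2[of i] by (auto simp: dot_d_def)
    show ?case by (rule dens) (use elim t d in auto)
  qed
  show "AE x in disc_measure. connection_density (perturbed \<Phi> w t) (perturbed_frame 2 \<Phi> w t) (perturbed_frame 1 \<Phi> w t) x = dens t x"
    using pf pd(1)[of 1] pd(1)[of 2] pd_F2_AE[OF t, of 1] pd_F2_AE[OF t, of 2] pd_perturbed_AE[of t] cross_uf_AE zf_AE frame_orthonormal_AE
  proof eventually_elim
    case (elim x)
    have d: "dot_d (perturbed_frame 2 \<Phi> w t) (perturbed_frame 1 \<Phi> w t) x $ i = - al i t x" for i
      using elim(1-6) exhaust_2[of i] by (auto simp: dot_d_def)
    show ?case by (rule dens) (use elim t d in auto)
  qed
qed

section \<open>The field of the first variation\<close>

definition "om i x = e 2 x \<bullet> pd i (e 1) x"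
definition "hh i j x = n x \<bullet> pd i (e j) x"
text \<open>\<open>fc\<close> times the variation field, written in the orthonormal frame. The
  second fundamental form is \<open>fc\<close> times \<open>hh\<close>, so no conformal factor is
  left in \<open>X\<close>.\<close>

definition "X (i::2) x = (if i = 1
   then (om 1 x * hh 2 1 x + om 2 x * hh 2 2 x) *\<^sub>R n x + om 1 x *\<^sub>R (om 1 x *\<^sub>R e 1 x + om 2 x *\<^sub>R e 2 x)
     - (1/2 * ((om 1 x)\<^sup>2 + (om 2 x)\<^sup>2)) *\<^sub>R e 1 x
   else - ((om 1 x * hh 1 1 x + om 2 x * hh 1 2 x) *\<^sub>R n x) + om 2 x *\<^sub>R (om 1 x *\<^sub>R e 1 x + om 2 x *\<^sub>R e 2 x)
     - (1/2 * ((om 1 x)\<^sup>2 + (om 2 x)\<^sup>2)) *\<^sub>R e 2 x)"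

text \<open>For a conformal metric the factor sqrt (det G) cancels the inverse metric on one-forms,
  so the Hodge star is the rotation \<open>perp\<close>. As \<open>perp\<close> squares to minus the
  identity, rotating the star of the stress term once more gives back that term.\<close>

lemma variation_field_AE:
  "AE x in disc_measure. variation_field \<Phi> x = (\<chi> i. (1 / fc x) *\<^sub>R X i x) \<and> - perp (variation_form \<Phi> x) = variation_field \<Phi> x"
  using frame_AE second_form_AE(1)
proof eventually_elim
  case (elim x)
  obtain f where f: "f = fc x" by blast
  have f0: "0 < f" and l2: "exp (- 2 * conformal_factor \<Phi> x) = 1 / f\<^sup>2"
    and p: "pd 1 \<Phi> x = f *\<^sub>R e 1 x" "pd 2 \<Phi> x = f *\<^sub>R e 2 x"
    and o: "e 1 x \<bullet> e 1 x = 1" "e 2 x \<bullet> e 2 x = 1" "e 1 x \<bullet> e 2 x = 0"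
    unfolding f using elim(1) by blast+
  have h: "n x \<bullet> pd i (pd j \<Phi>) x = f * hh i j x" for i j
    using elim(2) by (simp add: f hh_def)
  note M = conformal_metric[OF f0 p o]
  define \<omega> where "\<omega> = dot_d (e 2) (e 1) x"
  have \<omega>: "\<omega> $ i = om i x" for i by (simp add: \<omega>_def dot_d_def om_def)
  have \<beta>: "contract_second_form \<Phi> x \<omega> $ j = ((om 1 x * hh j 1 x + om 2 x * hh j 2 x) / f) *\<^sub>R n x" for j
    unfolding contract_second_form_def l2 second_form_def h using f0
    by (simp add: sum_2 \<omega> scaleR_add_left[symmetric] power2_eq_square add_divide_distrib[symmetric] distrib_left[symmetric] mult.left_commute)
  have ig: "inner_grad \<Phi> x \<omega> = (1 / f) *\<^sub>R (om 1 x *\<^sub>R e 1 x + om 2 x *\<^sub>R e 2 x)"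
    unfolding inner_grad_def l2 using f0 by (simp add: sum_2 \<omega> p scaleR_add_right power2_eq_square)
  define Q where "Q = (om 1 x)\<^sup>2 + (om 2 x)\<^sup>2"
  have fn: "form_norm_sq (pullback_metric \<Phi> x) \<omega> = Q / f\<^sup>2" unfolding M(4) \<omega> Q_def ..
  define \<tau> where "\<tau> = (\<chi> j. \<omega> $ j *\<^sub>R inner_grad \<Phi> x \<omega>) - (1/2 * form_norm_sq (pullback_metric \<Phi> x) \<omega>) *\<^sub>R grad \<Phi> x"
  have vf: "variation_field \<Phi> x = - perp (contract_second_form \<Phi> x \<omega>) + \<tau>"
    unfolding variation_field_def Let_def \<tau>_def \<omega>_def by simp
  have \<tau>1: "\<tau> $ 1 = (1 / f) *\<^sub>R (om 1 x *\<^sub>R (om 1 x *\<^sub>R e 1 x + om 2 x *\<^sub>R e 2 x) - (1/2 * Q) *\<^sub>R e 1 x)"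
    and \<tau>2: "\<tau> $ 2 = (1 / f) *\<^sub>R (om 2 x *\<^sub>R (om 1 x *\<^sub>R e 1 x + om 2 x *\<^sub>R e 2 x) - (1/2 * Q) *\<^sub>R e 2 x)"
    unfolding \<tau>_def fn using f0
    by (simp_all add: ig \<omega> grad_def p scaleR_diff_right power2_eq_square mult.commute)
  have "variation_field \<Phi> x $ i = (1 / f) *\<^sub>R X i x" for i
  proof -
    have "variation_field \<Phi> x $ 1 = (1 / f) *\<^sub>R X 1 x"
      unfolding vf by (simp add: \<beta> \<tau>1 X_def Q_def scaleR_add_right scaleR_diff_right)
    moreover have "variation_field \<Phi> x $ 2 = (1 / f) *\<^sub>R X 2 x"
      unfolding vf by (simp add: \<beta> \<tau>2 X_def Q_def scaleR_add_right scaleR_diff_right)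
    ultimately show ?thesis using exhaust_2[of i] by auto
  qed
  then have 1: "variation_field \<Phi> x = (\<chi> i. (1 / fc x) *\<^sub>R X i x)" by (simp add: vec_eq_iff[where 'b = 2] f)
  have ct: "contract_d \<Phi> x (stress_tensor (pullback_metric \<Phi> x) \<omega>) = \<tau>"
  proof -
    have T: "stress_tensor (pullback_metric \<Phi> x) \<omega> $ j $ i = om j x * om i x - 1/2 * Q * (if i = j then 1 else 0)" for i j
      unfolding stress_tensor_def fn using f0 by (simp add: \<omega> M(1) mat_def)
    have "contract_d \<Phi> x (stress_tensor (pullback_metric \<Phi> x) \<omega>) $ 1 = \<tau> $ 1"
      unfolding contract_d_def l2 \<tau>1 using f0
      by (simp add: sum_2 T p scaleR_add_right scaleR_diff_left scaleR_diff_right power2_eq_square mult.commute)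
    moreover have "contract_d \<Phi> x (stress_tensor (pullback_metric \<Phi> x) \<omega>) $ 2 = \<tau> $ 2"
      unfolding contract_d_def l2 \<tau>2 using f0
      by (simp add: sum_2 T p scaleR_add_right scaleR_diff_left scaleR_diff_right power2_eq_square mult.commute)
    ultimately show ?thesis by (simp add: vec_eq_iff[where 'b = 2] forall_2)
  qed
  have hs: "hodge_star (pullback_metric \<Phi> x) \<tau> = perp \<tau>"
  proof -
    have "(\<chi> i. \<Sum>k\<in>UNIV. matrix_inv (pullback_metric \<Phi> x) $ i $ k *\<^sub>R \<tau> $ k) = (1 / f\<^sup>2) *\<^sub>R \<tau>"
      unfolding M(2) by (simp add: vec_eq_iff[where 'b = 2] forall_2 sum_2 mat_def)
    then show ?thesis
      unfolding hodge_star_def M(3) using f0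
      by (simp add: linear_cmul[OF bounded_linear.linear[OF perp_bounded_linear]])
  qed
  have "variation_form \<Phi> x = contract_second_form \<Phi> x \<omega> + perp \<tau>"
    unfolding variation_form_def Let_def \<omega>_def[symmetric] ct hs ..
  then have "- perp (variation_form \<Phi> x) = variation_field \<Phi> x" by (simp add: perp_add perp_perp vf)
  then show ?case using 1 by blast
qed

text \<open>The field is quadratic in the quantities \<open>om\<close> and \<open>hh\<close>, both
  dominated by \<open>S\<close>; the division by \<open>fc\<close> is controlled by its lower
  bound.\<close>

lemma variation_field_integrable: "L_one (variation_field \<Phi>)" "L_one (variation_form \<Phi>)"
proof -
  obtain m where m: "m > 0" "AE x in disc_measure. m \<le> fc x" by (rule conformal_factor_bounds)
  have fm: "fc \<in> borel_measurable disc_measure"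
    by (intro measurable_compose[OF weak_partial_locI(4)[OF Phi_partial] borel_measurable_norm])
  have omm: "om i \<in> borel_measurable disc_measure" for i
    unfolding om_def[abs_def] by (intro borel_measurable_inner BW_measurable BW_pd_measurable frame_BW)
  have hm: "hh i j \<in> borel_measurable disc_measure" for i j
    unfolding hh_def[abs_def] by (intro borel_measurable_inner BW_measurable BW_pd_measurable frame_BW n_BW)
  have Xm: "X i \<in> borel_measurable disc_measure" for i
    unfolding X_def[abs_def]
    by (cases "i = 1") (simp_all, (intro borel_measurable_add borel_measurable_diff borel_measurable_uminus borel_measurable_scaleR
        borel_measurable_times borel_measurable_divide borel_measurable_power borel_measurable_const omm hm BW_measurable n_BW frame_BW)+)
  have "integrable disc_measure (\<lambda>x. (1 / fc x) *\<^sub>R X i x)" for i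
  proof (rule Bochner_Integration.integrable_bound)
    show "integrable disc_measure (\<lambda>x. (5 / m) * (S x)\<^sup>2)" using S_square_integrable by simp
    show "(\<lambda>x. (1 / fc x) *\<^sub>R X i x) \<in> borel_measurable disc_measure"
      using fm Xm by (intro borel_measurable_scaleR borel_measurable_divide borel_measurable_const)
    show "AE x in disc_measure. norm ((1 / fc x) *\<^sub>R X i x) \<le> norm ((5 / m) * (S x)\<^sup>2)"
      using m(2) frame_bound[of 1] frame_bound[of 2]
    proof eventually_elim
      case (elim x)
      have S0: "0 \<le> S x" using S_ge(1)[of x] by linarith
      have ip: "\<bar>a \<bullet> b\<bar> \<le> S x" if "norm a \<le> 1" "norm b \<le> S x" for a b :: "real^3"
        using order_trans[OF Cauchy_Schwarz_ineq2 mult_mono[OF that]] by simp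
      have o: "\<bar>om i x\<bar> \<le> S x" for i unfolding om_def by (rule ip[OF elim(3) S_ge(2)])
      have h: "\<bar>hh i j x\<bar> \<le> S x" for i j unfolding hh_def by (rule ip[OF norm_n_le S_ge(2)])
      have sq: "\<bar>a * b\<bar> \<le> (S x)\<^sup>2" if "\<bar>a\<bar> \<le> S x" "\<bar>b\<bar> \<le> S x" for a b
        unfolding abs_mult power2_eq_square using that by (intro mult_mono) auto
      have sv: "norm (a *\<^sub>R v) \<le> b" if "\<bar>a\<bar> \<le> b" "norm v \<le> 1" for a b and v :: "real^3"
      proof -
        have "\<bar>a\<bar> * norm v \<le> b * 1" using that by (intro mult_mono) auto
        then show ?thesis by simp
      qed
      have ot: "\<bar>om 1 x * hh j 1 x + om 2 x * hh j 2 x\<bar> \<le> 2 * (S x)\<^sup>2" for j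
        using sq[OF o[of 1] h[of j 1]] sq[OF o[of 2] h[of j 2]] by linarith
      have q: "\<bar>1/2 * ((om 1 x)\<^sup>2 + (om 2 x)\<^sup>2)\<bar> \<le> (S x)\<^sup>2"
        using sq[OF o[of 1] o[of 1]] sq[OF o[of 2] o[of 2]] by (simp add: power2_eq_square)
      have oo: "norm (om j x *\<^sub>R (om 1 x *\<^sub>R e 1 x + om 2 x *\<^sub>R e 2 x)) \<le> (S x)\<^sup>2 + (S x)\<^sup>2" for j
        unfolding scaleR_add_right scaleR_scaleR
        by (intro norm_triangle_mono sv sq o elim)
      \<comment> \<open>5 = 2 + 2 + 1: the normal term, the product of connection components, and
        the trace term.\<close>
      have "norm (X i x) \<le> 5 * (S x)\<^sup>2"
      proof -
        have "norm (A + B - C) \<le> 5 * (S x)\<^sup>2" if "norm A \<le> 2 * (S x)\<^sup>2" "norm B \<le> (S x)\<^sup>2 + (S x)\<^sup>2" "norm C \<le> (S x)\<^sup>2" for A B C :: "real^3"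
          using norm_triangle_ineq4[of "A + B" C] norm_triangle_ineq[of A B] that by linarith
        note tri = this
        have neq: "(2::2) \<noteq> 1" by simp
        have "norm (X 1 x) \<le> 5 * (S x)\<^sup>2"
          unfolding X_def if_P[OF refl] by (rule tri[OF sv[OF ot norm_n_le] oo sv[OF q elim(2)]])
        moreover have "norm (X 2 x) \<le> 5 * (S x)\<^sup>2"
          unfolding X_def if_not_P[OF neq]
          by (rule tri[OF _ oo sv[OF q elim(3)]], unfold norm_minus_cancel, rule sv[OF ot norm_n_le])
        ultimately show ?thesis using exhaust_2[of i] by metis
      qed
      moreover have "1 / fc x \<le> 1 / m" using elim(1) m(1) by (intro frac_le) auto
      ultimately have "(1 / fc x) * norm (X i x) \<le> (1 / m) * (5 * (S x)\<^sup>2)"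
        using m(1) by (intro mult_mono) auto
      then show ?case using m(1) by simp
    qed
  qed
  then have "integrable disc_measure (\<lambda>x. \<chi> i. (1 / fc x) *\<^sub>R X i x)" by (rule integrable_vec_2)
  moreover have "AE x in disc_measure. (\<chi> i. (1 / fc x) *\<^sub>R X i x) = variation_field \<Phi> x"
    using variation_field_AE by eventually_elim simp
  ultimately have int: "integrable disc_measure (variation_field \<Phi>)" by (simp only: disc_integrable_cong_AE)
  then show "L_one (variation_field \<Phi>)" by (simp add: L_one_def)
  have "integrable disc_measure (\<lambda>x. perp (variation_field \<Phi> x))" by (rule integrable_bounded_linear[OF perp_bounded_linear int])
  moreover have "AE x in disc_measure. perp (variation_field \<Phi> x) = variation_form \<Phi> x"
    using variation_field_AE
  proof eventually_elim
    case (elim x)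
    then have "perp (variation_field \<Phi> x) = perp (- perp (variation_form \<Phi> x))" by simp
    also have "\<dots> = variation_form \<Phi> x" by (simp add: bounded_linear.linear[OF perp_bounded_linear, THEN linear_neg] perp_perp)
    finally show ?case .
  qed
  ultimately show "L_one (variation_form \<Phi>)" unfolding L_one_def by (simp only: disc_integrable_cong_AE)
qed

text \<open>The conformal factors in the derivative of \<open>wPhi\<close> and in the field cancel,
  and the tangential terms agree directly. In the normal terms \<open>al'\<close> contracts the
  connection form with one index of \<open>hh\<close> and the field with the other, so the symmetry
  of the second fundamental form enters.\<close>

lemma first_variation_AE:
  "AE x in disc_measure. dens' x = - 2 * (\<Sum>i\<in>UNIV. pd i wPhi x \<bullet> variation_field \<Phi> x $ i)"
  using variation_field_AE pd_wPhi_AE frame_derivatives_AE second_form_AE(2) frame_orthonormal_AE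
proof eventually_elim
  case (elim x)
  have f: "fc x \<noteq> 0" using elim(5) by auto
  have a0: "al0 i x = - om i x" for i using elim(3)[rule_format, of i] by (simp add: al0_def om_def)
  have a': "al' i x = (c 1 x \<bullet> n x) * hh i 2 x - (c 2 x \<bullet> n x) * hh i 1 x" for i
    using elim(3)[rule_format, of i] by (simp add: al'_def hh_def)
  have hs: "hh 1 2 x = hh 2 1 x" using elim(4) by (simp add: hh_def)
  have v: "variation_field \<Phi> x $ i = (1 / fc x) *\<^sub>R X i x" for i using elim(1) by simp
  have w: "pd i wPhi x = fc x *\<^sub>R c i x" for i using elim(2) by simp
  have "pd i wPhi x \<bullet> variation_field \<Phi> x $ i = c i x \<bullet> X i x" for i
    unfolding v w using f by simp
  then have "(\<Sum>i\<in>UNIV. pd i wPhi x \<bullet> variation_field \<Phi> x $ i) = c 1 x \<bullet> X 1 x + c 2 x \<bullet> X 2 x" by (simp add: sum_2)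
  moreover have "dens' x = - 2 * (c 1 x \<bullet> X 1 x + c 2 x \<bullet> X 2 x)"
    unfolding dens'_def a0 a' X_def hs
    by (simp add: inner_add_right inner_diff_right inner_minus_right power2_eq_square algebra_simps)
  ultimately show ?case by simp
qed

section \<open>Admissibility of the perturbation and the derivative of the energy\<close>

text \<open>As |t| Mw is at most 1/2, adding t Dw(V) to V changes its length by a factor between 1/2
  and 2, and the metric bounds persist with constants worse by a factor 4. The perturbed normal is
  \<open>nu t\<close> almost everywhere.\<close>

lemma perturbed_immersion:
  assumes t: "\<bar>t\<bar> \<le> T"
  shows "weak_immersion (perturbed \<Phi> w t)"
  unfolding weak_immersion_def
proof (intro conjI)
  show "continuous_on (cball 0 1) (perturbed \<Phi> w t)"
    unfolding perturbed_def[abs_def]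
    by (intro continuous_intros Phi_continuous continuous_on_compose2[OF smooth_continuous[OF smw, of UNIV] Phi_continuous]) auto
  have BWp: "BW (perturbed \<Phi> w t)"
    unfolding perturbed_def[abs_def]
    by (intro BW_add Phi_BW BW_bilinear(1)[OF bounded_bilinear_scaleR BW_const] wPhi_BW)
  have tM: "\<bar>t\<bar> * Mw \<le> 1/2" using mult_right_mono[OF t, of Mw] Mw(1) T(4) by linarith
  have pt: "norm (t *\<^sub>R Dw x v) \<le> 1/2 * norm v" for x v
  proof -
    have "\<bar>t\<bar> * norm (Dw x v) \<le> \<bar>t\<bar> * (Mw * norm v)" by (intro mult_left_mono Mw) simp
    also have "\<dots> \<le> 1/2 * norm v" using mult_right_mono[OF tM, of "norm v"] by (simp add: mult.assoc)
    finally show ?thesis by simp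
  qed
  show "W_1_inf (perturbed \<Phi> w t)"
    unfolding W_1_inf_def
  proof (intro conjI allI)
    show "L_inf (perturbed \<Phi> w t)" using BWp BW_measurable by (auto simp: L_inf_def BW_def)
    fix i
    obtain C where C: "0 \<le> C" "AE x in disc_measure. norm (pd i \<Phi> x) \<le> C" using pd_Phi_bound by blast
    have "AE x in disc_measure. norm (pd i \<Phi> x + t *\<^sub>R Dw x (pd i \<Phi> x)) \<le> C + C"
      using C(2)
    proof eventually_elim
      case (elim x)
      have "1/2 * norm (pd i \<Phi> x) \<le> C" using elim C(1) by linarith
      then show ?case using pt[of x "pd i \<Phi> x"] elim by (intro norm_triangle_mono) linarith+
    qed
    then show "\<exists>v. weak_partial i (perturbed \<Phi> w t) v \<and> L_inf v"
      using perturbed_partial[of i t] weak_partial_locI(4)[OF perturbed_partial[of i t]] unfolding L_inf_def by blast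
  qed
  obtain m where m: "m > 0" "AE x in disc_measure. \<forall>v. m * (v \<bullet> v) \<le> v \<bullet> (pullback_metric \<Phi> x *v v) \<and>
      v \<bullet> (pullback_metric \<Phi> x *v v) \<le> (1 / m) * (v \<bullet> v)"
    by (rule metric_bounds)
  have "AE x in disc_measure. \<forall>v. (1 / (4 / m)) * (v \<bullet> v) \<le> v \<bullet> (pullback_metric (perturbed \<Phi> w t) x *v v) \<and>
        v \<bullet> (pullback_metric (perturbed \<Phi> w t) x *v v) \<le> (4 / m) * (v \<bullet> v)"
    using m(2) pd_weak_partial(2)[OF perturbed_partial[of 1 t]] pd_weak_partial(2)[OF perturbed_partial[of 2 t]]
  proof eventually_elim
    case (elim x)
    show ?case
    proof
      fix v :: "real^2"
      define V where "V = v $ 1 *\<^sub>R pd 1 \<Phi> x + v $ 2 *\<^sub>R pd 2 \<Phi> x"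
      have "v $ 1 *\<^sub>R pd 1 (perturbed \<Phi> w t) x + v $ 2 *\<^sub>R pd 2 (perturbed \<Phi> w t) x = V + t *\<^sub>R Dw x V"
        unfolding elim(2,3) V_def
        by (simp add: linear_add[OF Dw_linear] linear_cmul[OF Dw_linear] scaleR_add_right algebra_simps)
      then have q: "v \<bullet> (pullback_metric (perturbed \<Phi> w t) x *v v) = (norm (V + t *\<^sub>R Dw x V))\<^sup>2"
        by (simp add: pullback_metric_quadratic)
      have b: "m * (v \<bullet> v) \<le> (norm V)\<^sup>2" "(norm V)\<^sup>2 \<le> (1 / m) * (v \<bullet> v)"
        using elim(1) unfolding pullback_metric_quadratic V_def by auto
      have n1: "norm (V + t *\<^sub>R Dw x V) \<le> 2 * norm V"
        using pt[of x V] norm_triangle_ineq[of V "t *\<^sub>R Dw x V"] norm_ge_zero[of V] by linarith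
      have n2: "1/2 * norm V \<le> norm (V + t *\<^sub>R Dw x V)"
        using pt[of x V] norm_triangle_ineq4[of "V + t *\<^sub>R Dw x V" "t *\<^sub>R Dw x V"] by simp
      have "(norm (V + t *\<^sub>R Dw x V))\<^sup>2 \<le> (2 * norm V)\<^sup>2" using n1 by (rule power_mono) simp
      then have u: "(norm (V + t *\<^sub>R Dw x V))\<^sup>2 \<le> 4 * (norm V)\<^sup>2" by (simp add: power_mult_distrib)
      have "(1/2 * norm V)\<^sup>2 \<le> (norm (V + t *\<^sub>R Dw x V))\<^sup>2" using n2 by (rule power_mono) simp
      then have l: "1/4 * (norm V)\<^sup>2 \<le> (norm (V + t *\<^sub>R Dw x V))\<^sup>2" by (simp add: power_divide)
      show "(1 / (4 / m)) * (v \<bullet> v) \<le> v \<bullet> (pullback_metric (perturbed \<Phi> w t) x *v v) \<and>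
        v \<bullet> (pullback_metric (perturbed \<Phi> w t) x *v v) \<le> (4 / m) * (v \<bullet> v)"
        unfolding q using u l b by simp
    qed
  qed
  then show "\<exists>C>0. AE x in disc_measure. \<forall>v. (1 / C) * (v \<bullet> v) \<le> v \<bullet> (pullback_metric (perturbed \<Phi> w t) x *v v) \<and>
        v \<bullet> (pullback_metric (perturbed \<Phi> w t) x *v v) \<le> C * (v \<bullet> v)"
    using m(1) by (intro exI[of _ "4 / m"]) simp
  have "AE x in disc_measure. nu t x = unit_normal (perturbed \<Phi> w t) x"
    using normal_perturbed_AE[OF t] by eventually_elim simp
  then show "W_1_2 (unit_normal (perturbed \<Phi> w t))" by (rule BW_W_1_2[OF BW_cong_AE[OF nu_BW[OF t]]])
qed

lemma perturbed_energy:
  assumes t: "\<bar>t\<bar> \<le> T"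
  shows "finite_frame_energy (perturbed \<Phi> w t) (perturbed_frame 1 \<Phi> w t) (perturbed_frame 2 \<Phi> w t)"
    "finite_frame_energy (perturbed \<Phi> w t) (perturbed_frame 2 \<Phi> w t) (perturbed_frame 1 \<Phi> w t)"
    "tangential_frame_energy (perturbed \<Phi> w t) (perturbed_frame 1 \<Phi> w t) (perturbed_frame 2 \<Phi> w t)
      = 1/2 * (LINT x|disc_measure. dens t x)"
    "connection_energy (perturbed \<Phi> w t) (perturbed_frame 2 \<Phi> w t) (perturbed_frame 1 \<Phi> w t)
      = 1/2 * (LINT x|disc_measure. dens t x)"
proof -
  have "AE x in disc_measure. F1 t x = perturbed_frame 1 \<Phi> w t x" "AE x in disc_measure. F2 t x = perturbed_frame 2 \<Phi> w t x"
    by (rule eventually_mono[OF perturbed_frame_AE(1)[OF t]], erule sym,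
        rule eventually_mono[OF perturbed_frame_AE(2)[OF t]], erule sym)
  then have wd: "weakly_differentiable (perturbed_frame 1 \<Phi> w t)" "weakly_differentiable (perturbed_frame 2 \<Phi> w t)"
    using BW_weakly_differentiable BW_cong_AE F_BW[OF t] by blast+
  have i: "integrable disc_measure (dens t)"
    using tw.taylor_integral(1)[OF taylor_dens S_square_integrable t] .
  show "finite_frame_energy (perturbed \<Phi> w t) (perturbed_frame 1 \<Phi> w t) (perturbed_frame 2 \<Phi> w t)"
    "finite_frame_energy (perturbed \<Phi> w t) (perturbed_frame 2 \<Phi> w t) (perturbed_frame 1 \<Phi> w t)"
    unfolding finite_frame_energy_def
    using wd i disc_integrable_cong_AE[OF connection_AE(1)[OF t]] disc_integrable_cong_AE[OF connection_AE(2)[OF t]] by auto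
  show "tangential_frame_energy (perturbed \<Phi> w t) (perturbed_frame 1 \<Phi> w t) (perturbed_frame 2 \<Phi> w t)
      = 1/2 * (LINT x|disc_measure. dens t x)"
    "connection_energy (perturbed \<Phi> w t) (perturbed_frame 2 \<Phi> w t) (perturbed_frame 1 \<Phi> w t)
      = 1/2 * (LINT x|disc_measure. dens t x)"
    unfolding tangential_frame_energy_def connection_energy_def
    using disc_integral_cong_AE[OF connection_AE(1)[OF t]] disc_integral_cong_AE[OF connection_AE(2)[OF t]] by simp_all
qed

text \<open>In degree zero the remainder is at most K t^2 uniformly in x, hence at most \<epsilon>
  |t| once |t| is below \<epsilon> / (K + 1). The summand 1 covers the case K = 0.\<close>

lemma frame_expansion:
  assumes "\<epsilon> > 0"
  shows "\<forall>\<^sub>F t in nhds 0. AE x in disc_measure.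
            norm (perturbed_frame i \<Phi> w t x
                  - (coord_frame i \<Phi> x
                     + (t * exp (- conformal_factor \<Phi> x)
                          * (pd i (\<lambda>x. w (\<Phi> x)) x \<bullet> unit_normal \<Phi> x)) *\<^sub>R unit_normal \<Phi> x))
              \<le> \<epsilon> * \<bar>t\<bar>"
proof -
  define F where "F = (if i = 1 then F1 else F2)"
  have "taylor_family T S 0 F (\<lambda>x. (c i x \<bullet> n x) *\<^sub>R n x)"
    using exhaust_2[of i] taylor_F1 taylor_F2 by (auto simp: F_def)
  then obtain K where K: "0 \<le> K" "AE x in disc_measure. norm (F 0 x) \<le> K * S x ^ 0 \<and> norm ((c i x \<bullet> n x) *\<^sub>R n x) \<le> K * S x ^ 0 \<and>
        (\<forall>t. \<bar>t\<bar> \<le> T \<longrightarrow> norm (F t x - F 0 x - t *\<^sub>R ((c i x \<bullet> n x) *\<^sub>R n x)) \<le> K * t\<^sup>2 * S x ^ 0)"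
    unfolding taylor_family_def by blast
  define d where "d = min T (\<epsilon> / (K + 1))"
  have d: "0 < d" using T(1) assms K(1) by (auto simp: d_def)
  have "AE x in disc_measure. norm (perturbed_frame i \<Phi> w t x - (e i x + (t * exp (- conformal_factor \<Phi> x)
      * (pd i wPhi x \<bullet> n x)) *\<^sub>R n x)) \<le> \<epsilon> * \<bar>t\<bar>" if td: "dist t 0 < d" for t
  proof -
    have t: "\<bar>t\<bar> \<le> T" "\<bar>t\<bar> \<le> \<epsilon> / (K + 1)" using td by (auto simp: d_def dist_norm)
    have Ft: "AE x in disc_measure. perturbed_frame i \<Phi> w t x = F t x"
      using exhaust_2[of i] perturbed_frame_AE[OF t(1)] by (auto simp: F_def)
    show ?thesis
      using Ft K(2) pd_wPhi_AE frame_AE at_0_AE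
    proof eventually_elim
      case (elim x)
      have f: "0 < fc x" "exp (- conformal_factor \<Phi> x) = 1 / fc x" using elim(4) by blast+
      have F0: "F 0 x = e i x" using elim(5) exhaust_2[of i] by (auto simp: F_def)
      have pw: "pd i wPhi x = fc x *\<^sub>R c i x" using elim(3) by blast
      have "exp (- conformal_factor \<Phi> x) * (pd i wPhi x \<bullet> n x) = c i x \<bullet> n x"
        unfolding f(2) pw using f(1) by simp
      then have co: "t * exp (- conformal_factor \<Phi> x) * (pd i wPhi x \<bullet> n x) = t * (c i x \<bullet> n x)" by (simp only: mult.assoc)
      have "norm (F t x - F 0 x - t *\<^sub>R ((c i x \<bullet> n x) *\<^sub>R n x)) \<le> K * t\<^sup>2" using elim(2) t(1) by simp
      also have "\<dots> = (K * \<bar>t\<bar>) * \<bar>t\<bar>" by (simp add: power2_eq_square)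
      also have "\<dots> \<le> \<epsilon> * \<bar>t\<bar>"
      proof (rule mult_right_mono)
        have "K * \<bar>t\<bar> \<le> (K + 1) * \<bar>t\<bar>" by (simp add: mult_right_mono)
        also have "\<dots> \<le> (K + 1) * (\<epsilon> / (K + 1))" using t(2) K(1) by (intro mult_left_mono) auto
        also have "\<dots> = \<epsilon>" using K(1) by simp
        finally show "K * \<bar>t\<bar> \<le> \<epsilon>" .
      qed simp
      finally show ?case unfolding elim(1) co F0 by (simp add: diff_diff_eq)
    qed
  qed
  then show ?thesis using d unfolding eventually_nhds_metric by blast
qed

lemma wPhi_approximates: obtains \<phi> where "approximates \<phi> wPhi"
proof -
  obtain C where C: "\<And>i. 0 \<le> C i" "\<And>i. AE x in disc_measure. norm (pd i \<Phi> x) \<le> C i" using pd_Phi_bound by metis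
  have b: "AE x in disc_measure. norm (Dw x (pd i \<Phi> x)) \<le> Mw * (C 1 + C 2)" for i
    using C(2)[of i]
  proof eventually_elim
    case (elim x)
    have "norm (pd i \<Phi> x) \<le> C 1 + C 2" using elim C(1)[of 1] C(1)[of 2] exhaust_2[of i] by auto
    then have "Mw * norm (pd i \<Phi> x) \<le> Mw * (C 1 + C 2)" using Mw(1) by (intro mult_left_mono) auto
    then show ?case using Mw(2) order_trans by blast
  qed
  have z: "wPhi x = 0" if "norm x = 1" for x using bdw that by simp
  have c: "continuous_on (cball 0 1) wPhi"
    by (intro continuous_on_compose2[OF smooth_continuous[OF smw, of UNIV] Phi_continuous]) auto
  have "0 \<le> Mw * (C 1 + C 2)" using Mw(1) C(1)[of 1] C(1)[of 2] by simp
  from approximates_exists[OF c wPhi_partial this b z] show thesis using that by blast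
qed

text \<open>The density derivative is -2 times the integrand of the limit in the pairing, whence the
  factor 1/2, the same as in the energy. The form is reduced to the field by rotating
  components.\<close>

lemma pairing_variation:
  "pairing wPhi (distr_div (variation_field \<Phi>)) = 1/2 * (LINT x|disc_measure. dens' x)"
  "pairing wPhi (distr_d (variation_form \<Phi>)) = 1/2 * (LINT x|disc_measure. dens' x)"
proof -
  obtain \<phi> where \<phi>: "approximates \<phi> wPhi" by (rule wPhi_approximates)
  have wd: "weakly_differentiable wPhi" by (rule BW_weakly_differentiable[OF wPhi_BW])
  have int: "integrable disc_measure (variation_field \<Phi>)" using variation_field_integrable(1) by (simp add: L_one_def)
  have "(LINT x|disc_measure. dens' x) = (LINT x|disc_measure. - 2 * (\<Sum>i\<in>UNIV. pd i wPhi x \<bullet> variation_field \<Phi> x $ i))"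
    by (rule disc_integral_cong_AE[OF first_variation_AE])
  then show 1: "pairing wPhi (distr_div (variation_field \<Phi>)) = 1/2 * (LINT x|disc_measure. dens' x)"
    unfolding pairing_distr_div[OF int wd \<phi>] by simp
  have "AE x in disc_measure. - perp (variation_form \<Phi> x) = variation_field \<Phi> x"
    using variation_field_AE by eventually_elim simp
  then have "distr_div (\<lambda>x. - perp (variation_form \<Phi> x)) = distr_div (variation_field \<Phi>)"
    unfolding distr_div_def fun_eq_iff
    by (intro allI arg_cong[where f = uminus] disc_integral_cong_AE) (erule eventually_mono, simp only:)
  then show "pairing wPhi (distr_d (variation_form \<Phi>)) = 1/2 * (LINT x|disc_measure. dens' x)"
    using 1 by (simp only: distr_d_eq_distr_div)
qed

text \<open>The representation by \<open>dens\<close> is available for |t| at most \<open>T\<close>,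
  which suffices for a derivative at 0. The hypothesis is phrased for an arbitrary \<open>E\<close>,
  so that both orders of the frame are covered.\<close>

lemma energy_derivative:
  assumes "\<And>t. \<bar>t\<bar> \<le> T \<Longrightarrow> E t = 1/2 * (LINT x|disc_measure. dens t x)"
  shows "(E has_real_derivative pairing wPhi (distr_d (variation_form \<Phi>))) (at 0)"
proof -
  have "((\<lambda>t. 1/2 * (LINT x|disc_measure. dens t x)) has_real_derivative 1/2 * (LINT x|disc_measure. dens' x)) (at 0)"
    by (rule DERIV_cmult[OF tw.taylor_integral(3)[OF taylor_dens S_square_integrable]])
  then show ?thesis
    unfolding pairing_variation(2)
    by (rule has_field_derivative_transform_within_open[where S = "{- T<..<T}"]) (use T(1) assms in auto)
qed

end

theorem proposition3:
  fixes \<Phi> :: "real^2 \<Rightarrow> real^3" and w :: "real^3 \<Rightarrow> real^3"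
  assumes "weak_conformal_immersion \<Phi>"
    and "finite_frame_energy \<Phi> (coord_frame 1 \<Phi>) (coord_frame 2 \<Phi>)"
    and "smooth w" and "compact (fun_support w)"
    and "\<forall>y \<in> \<Phi> ` sphere 0 1. w y = 0"
  shows "(\<forall>\<^sub>F t in nhds 0.
            weak_immersion (perturbed \<Phi> w t) \<and>
            finite_frame_energy (perturbed \<Phi> w t)
              (perturbed_frame 1 \<Phi> w t) (perturbed_frame 2 \<Phi> w t) \<and>
            finite_frame_energy (perturbed \<Phi> w t)
              (perturbed_frame 2 \<Phi> w t) (perturbed_frame 1 \<Phi> w t))
       \<and> (\<forall>i. \<forall>\<epsilon>>0. \<forall>\<^sub>F t in nhds 0. AE x in disc_measure.
            norm (perturbed_frame i \<Phi> w t x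
                  - (coord_frame i \<Phi> x
                     + (t * exp (- conformal_factor \<Phi> x)
                          * (pd i (\<lambda>x. w (\<Phi> x)) x \<bullet> unit_normal \<Phi> x)) *\<^sub>R unit_normal \<Phi> x))
              \<le> \<epsilon> * \<bar>t\<bar>)
       \<and> L_one (variation_form \<Phi>) \<and> L_one (variation_field \<Phi>)
       \<and> ((\<lambda>t. tangential_frame_energy (perturbed \<Phi> w t)
                 (perturbed_frame 1 \<Phi> w t) (perturbed_frame 2 \<Phi> w t))
            has_real_derivative pairing (\<lambda>x. w (\<Phi> x)) (distr_d (variation_form \<Phi>))) (at 0)
       \<and> ((\<lambda>t. connection_energy (perturbed \<Phi> w t)
                 (perturbed_frame 2 \<Phi> w t) (perturbed_frame 1 \<Phi> w t))
            has_real_derivative pairing (\<lambda>x. w (\<Phi> x)) (distr_d (variation_form \<Phi>))) (at 0)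
       \<and> pairing (\<lambda>x. w (\<Phi> x)) (distr_d (variation_form \<Phi>))
           = pairing (\<lambda>x. w (\<Phi> x)) (distr_div (variation_field \<Phi>))"
proof -
  interpret conformal_variation \<Phi> w using assms by unfold_locales
  have "\<forall>\<^sub>F t in nhds 0. \<bar>t\<bar> \<le> T"
    unfolding eventually_nhds_metric using T(1) by (intro exI[of _ T]) (simp add: dist_norm)
  then have "\<forall>\<^sub>F t in nhds 0.
            weak_immersion (perturbed \<Phi> w t) \<and>
            finite_frame_energy (perturbed \<Phi> w t)
              (perturbed_frame 1 \<Phi> w t) (perturbed_frame 2 \<Phi> w t) \<and>
            finite_frame_energy (perturbed \<Phi> w t)
              (perturbed_frame 2 \<Phi> w t) (perturbed_frame 1 \<Phi> w t)"
    by (rule eventually_mono) (intro conjI perturbed_immersion perturbed_energy)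
  moreover note frame_expansion variation_field_integrable energy_derivative[OF perturbed_energy(3)]
    energy_derivative[OF perturbed_energy(4)]
  moreover have "pairing wPhi (distr_d (variation_form \<Phi>)) = pairing wPhi (distr_div (variation_field \<Phi>))"
    by (simp only: pairing_variation)
  ultimately show ?thesis by blast
qed

end
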